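(* Let $f:\mathbb{B}^n\to\mathbb{B}^N$ be a rational proper map. Then $\Gamma_f$ is non-compact if and only if $f$ is totally geodesic with respect to the Poincar\'e metric. Otherwise, $\Gamma_f$ lies in a maximal compact subgroup of $\mathrm{Aut}(\mathbb{B}^n)$, that is, in a conjugate of $\mathbf{U}(n)$ by an element of $\mathrm{Aut}(\mathbb{B}^n)$.
   Context: $\mathbb{B}^n$ is the open unit ball of $\mathbb{C}^n$, $\mathrm{Aut}(\mathbb{B}^n)$ is its group of holomorphic automorphisms (a Lie group, the quotient of $\mathbf{SU}(n,1)$ by its center), and $\mathbf{U}(n)\leqslant\mathrm{Aut}(\mathbb{B}^n)$ is the unitary group. The Poincar\'e metric on a unit ball is the (up to scaling unique) automorphism-invariant K\"ahler (Bergman) metric. A rational proper map $f:\mathbb{B}^n\to\mathbb{B}^N$ is a proper holomorphic map whose components are rational functions. The Hermitian invariant group of $f$ is $$\Gamma_f=\{\gamma\in\mathrm{Aut}(\mathbb{B}^n):\ \text{there is } \psi\in\mathrm{Aut}(\mathbb{B}^N)\text{ with } f\circ\gamma=\psi\circ f\}.$$ *)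

theory Defs
  imports "HOL-Analysis.Analysis" "HOL-Algebra.Bij" "HOL-Algebra.Coset"
begin

section \<open>Holomorphic and rational maps in several variables\<close>

abbreviation unit_ball :: "(complex ^ 'n) set"
  where "unit_ball \<equiv> ball 0 1"

text \<open>
  A map is holomorphic on an open set iff it has a complex-linear (Frechet) derivative at every
  point; a real-linear map is complex-linear iff it is homogeneous over the complex numbers.
\<close>

definition holomorphic_map_on :: "(complex ^ 'n \<Rightarrow> complex ^ 'm) \<Rightarrow> (complex ^ 'n) set \<Rightarrow> bool"
  where "holomorphic_map_on f S \<longleftrightarrow>
    (\<forall>z\<in>S. \<exists>D. (f has_derivative D) (at z within S) \<and> (\<forall>c v. D (c *s v) = c *s D v))"

definition poly_function :: "(complex ^ 'n \<Rightarrow> complex) \<Rightarrow> bool"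
  where "poly_function p \<longleftrightarrow>
    (\<exists>(S :: ('n \<Rightarrow> nat) set) a. finite S \<and> p = (\<lambda>z. \<Sum>\<alpha>\<in>S. a \<alpha> * (\<Prod>i\<in>UNIV. (z $ i) ^ \<alpha> i)))"

text \<open>
  The quotient need not be in lowest terms, so the denominator may vanish somewhere on \<open>S\<close>; it is
  only required not to be the zero polynomial.
\<close>

definition rational_function_on :: "(complex ^ 'n \<Rightarrow> complex) \<Rightarrow> (complex ^ 'n) set \<Rightarrow> bool"
  where "rational_function_on g S \<longleftrightarrow>
    (\<exists>p q. poly_function p \<and> poly_function q \<and> q \<noteq> (\<lambda>z. 0) \<and>
           (\<forall>z\<in>S. q z \<noteq> 0 \<longrightarrow> g z = p z / q z))"

definition rational_proper_map :: "(complex ^ 'n \<Rightarrow> complex ^ 'm) \<Rightarrow> bool"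
  where "rational_proper_map f \<longleftrightarrow>
    f ` unit_ball \<subseteq> unit_ball \<and>
    holomorphic_map_on f unit_ball \<and>
    proper_map (top_of_set unit_ball) (top_of_set unit_ball) f \<and>
    (\<forall>j. rational_function_on (\<lambda>z. f z $ j) unit_ball)"


section \<open>The automorphism group of the ball\<close>

text \<open>
  As in \<open>BijGroup\<close>, automorphisms are extensional functions (\<open>undefined\<close> outside the ball), so
  that maps agreeing on the ball are equal.
\<close>

definition ball_aut :: "(complex ^ 'n \<Rightarrow> complex ^ 'n) set"
  where "ball_aut = {\<gamma> \<in> Bij unit_ball.
    holomorphic_map_on \<gamma> unit_ball \<and> holomorphic_map_on (inv_into unit_ball \<gamma>) unit_ball}"

definition ball_aut_group :: "(complex ^ 'n \<Rightarrow> complex ^ 'n) monoid"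
  where "ball_aut_group = (BijGroup unit_ball)\<lparr>carrier := ball_aut\<rparr>"

text \<open>
  The compact-open topology, which underlies the Lie group structure of the group of holomorphic
  automorphisms and agrees with the quotient topology from \<open>SU(n,1)\<close>.
\<close>

definition ball_aut_topology :: "(complex ^ 'n \<Rightarrow> complex ^ 'n) topology"
  where "ball_aut_topology = topology_generated_by
    {{\<gamma> \<in> ball_aut. \<gamma> ` K \<subseteq> U} | K U. compact K \<and> K \<subseteq> unit_ball \<and> open U}"

definition unitary_matrix :: "complex ^ 'n ^ 'n \<Rightarrow> bool"
  where "unitary_matrix A \<longleftrightarrow> A ** (\<chi> i j. cnj (A $ j $ i)) = mat 1"

definition unitary_group :: "(complex ^ 'n \<Rightarrow> complex ^ 'n) set"
  where "unitary_group = {restrict (\<lambda>z. A *v z) unit_ball | A. unitary_matrix A}"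

definition maximal_compact_subgroup :: "(complex ^ 'n \<Rightarrow> complex ^ 'n) set \<Rightarrow> bool"
  where "maximal_compact_subgroup K \<longleftrightarrow>
    subgroup K ball_aut_group \<and> compactin ball_aut_topology K \<and>
    (\<forall>L. subgroup L ball_aut_group \<and> compactin ball_aut_topology L \<and> K \<subseteq> L \<longrightarrow> L = K)"

definition hermitian_invariant_group ::
    "(complex ^ 'n \<Rightarrow> complex ^ 'm) \<Rightarrow> (complex ^ 'n \<Rightarrow> complex ^ 'n) set"
  where "hermitian_invariant_group f =
    {\<gamma> \<in> ball_aut. \<exists>\<psi>\<in>ball_aut. \<forall>z\<in>unit_ball. f (\<gamma> z) = \<psi> (f z)}"


section \<open>Geodesics and totally geodesic maps\<close>

text \<open>
  A Riemannian metric \<open>g\<close> on an open subset of a Euclidean space is written \<open>g z v w\<close> for the inner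
  product of the tangent vectors \<open>v\<close> and \<open>w\<close> at \<open>z\<close>.  With constant vector fields \<open>u\<close>, \<open>v\<close>, \<open>w\<close>,
  which commute, the Koszul formula for the Levi-Civita connection says that the inner product of
  the covariant derivative of \<open>v\<close> along \<open>u\<close> with \<open>w\<close> is the following expression (the Christoffel
  symbol of the first kind).
\<close>

definition christoffel ::
    "('a::euclidean_space \<Rightarrow> 'a \<Rightarrow> 'a \<Rightarrow> real) \<Rightarrow> 'a \<Rightarrow> 'a \<Rightarrow> 'a \<Rightarrow> 'a \<Rightarrow> real"
  where "christoffel g z u v w =
    (frechet_derivative (\<lambda>y. g y v w) (at z) u +
     frechet_derivative (\<lambda>y. g y u w) (at z) v -
     frechet_derivative (\<lambda>y. g y u v) (at z) w) / 2"

text \<open>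
  The last line says that the covariant acceleration of \<open>c\<close> is orthogonal to every vector \<open>w\<close>,
  that is, zero.  Geodesics are thus affinely parametrised, and constant curves are included.
\<close>

definition geodesic_in ::
    "'a set \<Rightarrow> ('a::euclidean_space \<Rightarrow> 'a \<Rightarrow> 'a \<Rightarrow> real) \<Rightarrow> real set \<Rightarrow> (real \<Rightarrow> 'a) \<Rightarrow> bool"
  where "geodesic_in S g I c \<longleftrightarrow>
    c ` I \<subseteq> S \<and>
    (\<exists>c' c''. \<forall>t\<in>I.
       (c has_vector_derivative c' t) (at t) \<and>
       (c' has_vector_derivative c'' t) (at t) \<and>
       (\<forall>w. g (c t) (c'' t) w + christoffel g (c t) (c' t) (c' t) w = 0))"

definition totally_geodesic_map ::
    "'a set \<Rightarrow> ('a::euclidean_space \<Rightarrow> 'a \<Rightarrow> 'a \<Rightarrow> real) \<Rightarrow>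
     'b set \<Rightarrow> ('b::euclidean_space \<Rightarrow> 'b \<Rightarrow> 'b \<Rightarrow> real) \<Rightarrow> ('a \<Rightarrow> 'b) \<Rightarrow> bool"
  where "totally_geodesic_map S g T h f \<longleftrightarrow>
    (\<forall>I c. open I \<and> is_interval I \<and> geodesic_in S g I c \<longrightarrow> geodesic_in T h I (f \<circ> c))"

definition herm_prod :: "complex ^ 'n \<Rightarrow> complex ^ 'n \<Rightarrow> complex"
  where "herm_prod v w = (\<Sum>i\<in>UNIV. v $ i * cnj (w $ i))"

text \<open>
  The Kaehler metric with potential \<open>- ln (1 - \<bar>z\<bar>\<^sup>2)\<close>.  Its scaling does not matter here, since
  proportional metrics have the same geodesics.
\<close>

definition poincare_metric :: "complex ^ 'n \<Rightarrow> complex ^ 'n \<Rightarrow> complex ^ 'n \<Rightarrow> real"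
  where "poincare_metric z v w =
    Re (herm_prod v w / of_real (1 - (norm z)\<^sup>2) +
        herm_prod v z * herm_prod z w / of_real ((1 - (norm z)\<^sup>2)\<^sup>2))"


section \<open>The automorphisms form a topological space and a group\<close>

lemma topspace_ball_aut_topology: "topspace ball_aut_topology = ball_aut"
proof -
  have "ball_aut = {\<gamma> \<in> ball_aut. \<gamma> ` {} \<subseteq> (UNIV :: (complex ^ 'n) set)}"
    by auto
  then have "(ball_aut :: (complex ^ 'n \<Rightarrow> complex ^ 'n) set) \<in>
      {{\<gamma> \<in> ball_aut. \<gamma> ` K \<subseteq> U} | K U. compact K \<and> K \<subseteq> unit_ball \<and> open U}"
    by (intro CollectI exI[of _ "{}"] exI[of _ UNIV]) auto
  then show ?thesis
    unfolding ball_aut_topology_def topology_generated_by_topspace by blast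
qed

lemma holomorphic_map_on_cong:
  assumes "\<And>z. z \<in> S \<Longrightarrow> f z = g z"
  shows "holomorphic_map_on f S \<longleftrightarrow> holomorphic_map_on g S"
  unfolding holomorphic_map_on_def
  using assms by (metis has_derivative_transform)

lemma holomorphic_map_on_compose:
  assumes "holomorphic_map_on f S" "holomorphic_map_on g T" "f ` S \<subseteq> T"
  shows "holomorphic_map_on (\<lambda>z. g (f z)) S"
  unfolding holomorphic_map_on_def
proof
  fix z assume z: "z \<in> S"
  obtain D where D: "(f has_derivative D) (at z within S)" "\<And>c v. D (c *s v) = c *s D v"
    using assms(1) z unfolding holomorphic_map_on_def by blast
  obtain E where E: "(g has_derivative E) (at (f z) within T)" "\<And>c v. E (c *s v) = c *s E v"
    using assms(2,3) z unfolding holomorphic_map_on_def by blast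
  have "((\<lambda>z. g (f z)) has_derivative (\<lambda>x. E (D x))) (at z within S)"
    by (rule has_derivative_in_compose[OF D(1) has_derivative_subset[OF E(1) assms(3)]])
  then show "\<exists>D. ((\<lambda>z. g (f z)) has_derivative D) (at z within S) \<and>
      (\<forall>c v. D (c *s v) = c *s D v)"
    using D(2) E(2) by (intro exI[of _ "\<lambda>x. E (D x)"]) auto
qed

lemma holomorphic_map_on_ident: "holomorphic_map_on (\<lambda>z. z) S"
  unfolding holomorphic_map_on_def by (auto intro!: exI[of _ "\<lambda>x. x"])

lemma subgroup_ball_aut: "subgroup ball_aut (BijGroup (unit_ball :: (complex ^ 'n) set))"
proof -
  let ?B = "unit_ball :: (complex ^ 'n) set"
  let ?G = "BijGroup ?B"
  interpret group ?G by (rule group_BijGroup)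
  have carr: "carrier ?G = Bij ?B" by (simp add: BijGroup_def)
  have bij: "bij_betw f ?B ?B" if "f \<in> Bij ?B" for f
    using that by (simp add: Bij_def)
  show ?thesis
  proof (rule subgroupI)
    show "ball_aut \<subseteq> carrier ?G"
      by (auto simp: carr ball_aut_def)
    have inv_id: "inv_into ?B (\<lambda>z\<in>?B. z) z = z" if "z \<in> ?B" for z
      using that bij_betw_inv_into_left[OF bij[OF id_Bij] that] by simp
    have "(\<lambda>z\<in>?B. z) \<in> ball_aut"
      unfolding ball_aut_def
      using id_Bij[of ?B] holomorphic_map_on_ident[of ?B]
        holomorphic_map_on_cong[of ?B "\<lambda>z\<in>?B. z" "\<lambda>z. z"]
        holomorphic_map_on_cong[of ?B "inv_into ?B (\<lambda>z\<in>?B. z)" "\<lambda>z. z"] inv_id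
      by auto
    then show "(ball_aut :: (complex ^ 'n \<Rightarrow> complex ^ 'n) set) \<noteq> {}" by blast
  next
    fix f :: "complex ^ 'n \<Rightarrow> complex ^ 'n"
    assume f: "f \<in> ball_aut"
    then have fB: "f \<in> Bij ?B" by (simp add: ball_aut_def)
    let ?g = "\<lambda>z\<in>?B. inv_into ?B f z"
    have g: "inv\<^bsub>?G\<^esub> f = ?g" by (rule inv_BijGroup[OF fB])
    have gB: "?g \<in> Bij ?B" by (rule restrict_inv_into_Bij[OF fB])
    have "inv_into ?B ?g z = f z" if z: "z \<in> ?B" for z
    proof -
      have fz: "f z \<in> ?B" using bij[OF fB] z by (auto simp: bij_betw_def)
      then have "?g (f z) = z"
        using bij_betw_inv_into_left[OF bij[OF fB] z] by simp
      then show ?thesis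
        using bij_betw_inv_into_left[OF bij[OF gB] fz] by simp
    qed
    then show "inv\<^bsub>?G\<^esub> f \<in> ball_aut"
      unfolding g using f gB
        holomorphic_map_on_cong[of ?B ?g "inv_into ?B f"]
        holomorphic_map_on_cong[of ?B "inv_into ?B ?g" f]
      by (auto simp: ball_aut_def)
  next
    fix f g :: "complex ^ 'n \<Rightarrow> complex ^ 'n"
    assume f: "f \<in> ball_aut" and g: "g \<in> ball_aut"
    then have fB: "f \<in> Bij ?B" and gB: "g \<in> Bij ?B" by (simp_all add: ball_aut_def)
    have eq: "f \<otimes>\<^bsub>?G\<^esub> g = compose ?B f g"
      using fB gB by (simp add: BijGroup_def)
    have cB: "compose ?B f g \<in> Bij ?B" by (rule compose_Bij[OF fB gB])
    have h1: "holomorphic_map_on (\<lambda>z. f (g z)) ?B"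
      by (rule holomorphic_map_on_compose[where T = ?B])
        (use f g bij[OF gB] in \<open>auto simp: ball_aut_def bij_betw_def\<close>)
    have h2: "holomorphic_map_on (\<lambda>z. inv_into ?B g (inv_into ?B f z)) ?B"
      by (rule holomorphic_map_on_compose[where T = ?B])
        (use f g bij_betw_inv_into[OF bij[OF fB]] in \<open>auto simp: ball_aut_def bij_betw_def\<close>)
    have "inv_into ?B (compose ?B f g) z = inv_into ?B g (inv_into ?B f z)" if z: "z \<in> ?B" for z
    proof -
      let ?w = "inv_into ?B g (inv_into ?B f z)"
      have a: "inv_into ?B f z \<in> ?B" by (rule Bij_inv_into_mem[OF fB z])
      have b: "?w \<in> ?B" by (rule Bij_inv_into_mem[OF gB a])
      have "compose ?B f g ?w = z"
        using b bij_betw_inv_into_right[OF bij[OF gB] a] bij_betw_inv_into_right[OF bij[OF fB] z]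
        by (simp add: compose_def)
      then show ?thesis
        using bij_betw_inv_into_left[OF bij[OF cB] b] by simp
    qed
    then show "f \<otimes>\<^bsub>?G\<^esub> g \<in> ball_aut"
      unfolding eq using cB h1 h2
        holomorphic_map_on_cong[of ?B "compose ?B f g" "\<lambda>z. f (g z)"]
        holomorphic_map_on_cong[of ?B "inv_into ?B (compose ?B f g)"
          "\<lambda>z. inv_into ?B g (inv_into ?B f z)"]
      by (auto simp: ball_aut_def compose_def)
  qed
qed

lemma group_ball_aut_group: "group ball_aut_group"
  unfolding ball_aut_group_def
  by (rule subgroup.subgroup_is_group[OF subgroup_ball_aut group_BijGroup])

end

theory Submission
  imports Defs "HOL-Complex_Analysis.Complex_Analysis"
begin

text \<open>
  Composing \<open>f\<close> with the involution of the target ball that exchanges \<open>0\<close> and \<open>f 0\<close> gives a map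
  \<open>g = recentre f\<close> with \<open>g 0 = 0\<close>.  Non-compactness of the invariant group and total geodesy of \<open>f\<close>
  are both shown to be equivalent to the condition that \<open>\<bar>g z\<bar> = \<bar>z\<bar>\<close> on the ball, which by
  the Schwarz lemma means that \<open>g\<close> is the restriction of a linear isometry.

  A linear isometry respects geodesics, and it intertwines the involution centred at any point \<open>a\<close>
  with the one centred at \<open>g a\<close>.  So the invariant group then moves \<open>0\<close> to every point of the ball,
  while the elements of a compact set of automorphisms move \<open>0\<close> only inside a smaller ball.

  Suppose \<open>f\<close> is totally geodesic.  Along a real diameter in the direction \<open>v\<close> the geodesic equation
  determines the third derivative of \<open>g\<close> at \<open>0\<close> from the first.  This is a real condition on a
  holomorphic map: comparing the directions \<open>v\<close> and \<open>\<i> v\<close> forces the derivative of \<open>g\<close> in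
  direction \<open>v\<close> to have norm 0 or 1.  A geodesic with zero velocity is constant, which contradicts
  properness, so the norm is 1, and the Schwarz lemma gives \<open>\<bar>g z\<bar> = \<bar>z\<bar>\<close>.

  Suppose the invariant group is not compact.  Then it contains automorphisms
  \<open>\<gamma> k = mob (a k) \<circ> A k\<close>, with \<open>A k\<close> unitary and \<open>a k\<close> converging to a point \<open>p\<close> of the sphere, and
  \<open>g \<circ> \<gamma> k = mob (g (a k)) \<circ> V k \<circ> g\<close> with \<open>V k\<close> unitary.  Let \<open>R z\<close> be the quotient of \<open>1 - \<bar>g z\<bar>\<^sup>2\<close>
  by \<open>1 - \<bar>z\<bar>\<^sup>2\<close>.  Since \<open>1 - \<bar>mob a z\<bar>\<^sup>2\<close> is \<open>1 - \<bar>z\<bar>\<^sup>2\<close> times an explicit factor, \<open>R (\<gamma> k z)\<close> equals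
  \<open>R (a k) R z\<close> times the squared modulus of a quotient of two functions holomorphic in \<open>z\<close>.  By the
  theorem \<open>boundary_regularity\<close>, the only place where rationality is used, \<open>R\<close> has a limit at \<open>p\<close>; it is
  at least 1 by the Schwarz lemma.  Both \<open>a k\<close> and \<open>\<gamma> k z\<close> tend to \<open>p\<close>, so this limit cancels and \<open>R\<close>
  itself is the squared modulus of such a quotient.  As \<open>R \<ge> 1\<close> with equality at \<open>0\<close>, the maximum
  modulus principle, applied to the inverse quotient, yields \<open>R = 1\<close>.

  For \<open>boundary_regularity\<close> write \<open>f = P / Q\<close> with polynomials.  On the sphere \<open>\<bar>P\<bar> = \<bar>Q\<bar>\<close>, and this
  polarises to \<open>\<langle>P z, P w\<rangle> = Q z cnj (Q w)\<close> whenever \<open>\<langle>z, w\<rangle> = 1\<close>.  The denominator may vanish at \<open>p\<close>,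
  but on a line \<open>p + t v\<close> with \<open>v\<close> close to a suitable direction \<open>e\<close> a power of \<open>t\<close> cancels and \<open>f\<close>
  becomes a power series in \<open>t\<close> with vector coefficients \<open>\<phi> k v\<close>.  The polarised identity expresses the
  Hermitian products of the coefficients for two directions through the product of the directions
  alone.  By positivity of the Hermitian product, \<open>\<phi> k (e + s y)\<close> is then a polynomial in \<open>s\<close> of
  degree at most \<open>k\<close>.  Hence \<open>t\<close> and \<open>t s\<close> can serve as the variables of a power series, and \<open>f\<close>
  extends holomorphically across \<open>p\<close> on every slice parallel to \<open>e\<close>, with bounds independent of the
  slice.  Comparing a point of the ball with the point of the sphere that it reaches in direction \<open>e\<close>
  gives the limit of the quotient.

  Finally, if the invariant group is compact, it fixes the circumcentre of its orbit of \<open>0\<close> for the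
  invariant distance.  The stabiliser of a point is conjugate to the stabiliser of \<open>0\<close>, which is the
  unitary group.  It is a maximal compact subgroup: a compact group containing it also fixes a point,
  and the point reflection at \<open>p\<close> fixes no point other than \<open>p\<close>.
\<close>

no_notation fps_nth (infixl \<open>$\<close> 75)

section \<open>The Hermitian product and the involutions of the ball\<close>

lemma herm_prod_add_left: "herm_prod (u + v) w = herm_prod u w + herm_prod v w"
  by (simp add: herm_prod_def sum.distrib ring_distribs)

lemma herm_prod_add_right: "herm_prod u (v + w) = herm_prod u v + herm_prod u w"
  by (simp add: herm_prod_def sum.distrib ring_distribs)

lemma herm_prod_diff_left: "herm_prod (u - v) w = herm_prod u w - herm_prod v w"
  by (simp add: herm_prod_def sum_subtractf ring_distribs)

lemma herm_prod_diff_right: "herm_prod u (v - w) = herm_prod u v - herm_prod u w"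
  by (simp add: herm_prod_def sum_subtractf ring_distribs)

lemma herm_prod_minus_left: "herm_prod (- v) w = - herm_prod v w"
  by (simp add: herm_prod_def sum_negf)

lemma herm_prod_minus_right: "herm_prod v (- w) = - herm_prod v w"
  by (simp add: herm_prod_def sum_negf)

lemma herm_prod_cmult_left: "herm_prod (c *s v) w = c * herm_prod v w"
  by (simp add: herm_prod_def sum_distrib_left mult_ac)

lemma herm_prod_cmult_right: "herm_prod v (c *s w) = cnj c * herm_prod v w"
  by (simp add: herm_prod_def sum_distrib_left mult_ac)

lemma scaleR_vec_eq: "r *\<^sub>R (v :: complex ^ 'n) = of_real r *s v"
  unfolding vec_eq_iff vector_scaleR_component vector_smult_component
  by (simp add: scaleR_conv_of_real)

lemma herm_prod_scaleR_left: "herm_prod (r *\<^sub>R v) w = of_real r * herm_prod v w"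
  by (simp add: scaleR_vec_eq herm_prod_cmult_left)

lemma herm_prod_scaleR_right: "herm_prod v (r *\<^sub>R w) = of_real r * herm_prod v w"
  by (simp add: scaleR_vec_eq herm_prod_cmult_right)

lemma herm_prod_zero_left [simp]: "herm_prod 0 w = 0"
  by (simp add: herm_prod_def)

lemma herm_prod_zero_right [simp]: "herm_prod v 0 = 0"
  by (simp add: herm_prod_def)

lemma herm_prod_sum_left: "herm_prod (sum f I) w = (\<Sum>i\<in>I. herm_prod (f i) w)"
  by (induction I rule: infinite_finite_induct) (simp_all add: herm_prod_add_left)

lemma herm_prod_sum_right: "herm_prod v (sum f I) = (\<Sum>i\<in>I. herm_prod v (f i))"
  by (induction I rule: infinite_finite_induct) (simp_all add: herm_prod_add_right)

lemmas herm_prod_simps = herm_prod_add_left herm_prod_add_right herm_prod_diff_left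
  herm_prod_diff_right herm_prod_minus_left herm_prod_minus_right herm_prod_cmult_left
  herm_prod_cmult_right herm_prod_scaleR_left herm_prod_scaleR_right

lemma cnj_herm_prod: "cnj (herm_prod v w) = herm_prod w v"
  by (simp add: herm_prod_def mult.commute)

lemma herm_prod_self: "herm_prod v v = of_real ((norm v)\<^sup>2)"
proof -
  have "(norm v)\<^sup>2 = (\<Sum>i\<in>UNIV. (cmod (v $ i))\<^sup>2)"
    by (simp add: norm_vec_def L2_set_def sum_nonneg)
  then show ?thesis
    by (simp add: herm_prod_def complex_norm_square [symmetric])
qed

lemma Re_herm_prod: "Re (herm_prod v w) = inner v w"
  by (simp add: herm_prod_def inner_vec_def inner_complex_def)

lemma herm_prod_eq_0_iff: "herm_prod v v = 0 \<longleftrightarrow> v = 0"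
  by (simp add: herm_prod_self)

lemma norm_cmult_vec: "norm (c *s (v :: complex ^ 'n)) = cmod c * norm v"
  unfolding norm_vec_def L2_set_def
  by (simp add: norm_mult power_mult_distrib sum_distrib_left [symmetric] real_sqrt_mult)

lemma herm_prod_Cauchy_Schwarz: "cmod (herm_prod v w) \<le> norm v * norm w"
proof -
  obtain c where c: "cmod c = 1" "c * herm_prod v w = of_real (cmod (herm_prod v w))"
  proof (cases "herm_prod v w = 0")
    case True
    then show ?thesis by (intro that[of 1]) auto
  next
    case False
    then show ?thesis
      by (intro that[of "of_real (cmod (herm_prod v w)) / herm_prod v w"])
        (auto simp: norm_divide)
  qed
  have "cmod (herm_prod v w) = Re (herm_prod (c *s v) w)"
    by (simp add: herm_prod_simps c)
  also have "\<dots> \<le> norm (c *s v) * norm w"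
    unfolding Re_herm_prod by (rule norm_cauchy_schwarz)
  finally show ?thesis
    by (simp add: norm_cmult_vec c)
qed

lemma bounded_bilinear_herm_prod: "bounded_bilinear herm_prod"
proof
  show "\<exists>K. \<forall>v w. norm (herm_prod v w) \<le> norm v * norm w * K"
    by (intro exI[of _ 1]) (simp add: herm_prod_Cauchy_Schwarz)
qed (simp_all add: herm_prod_add_left herm_prod_add_right herm_prod_scaleR_left
      herm_prod_scaleR_right scaleR_conv_of_real [where 'a = complex])

lemma bounded_linear_cmult_vec: "bounded_linear (\<lambda>v :: complex ^ 'n. c *s v)"
proof
  show "\<exists>K. \<forall>v :: complex ^ 'n. norm (c *s v) \<le> norm v * K"
    by (intro exI[of _ "cmod c"]) (simp add: norm_cmult_vec)
qed (simp_all add: vec_eq_iff ring_distribs)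

lemma bounded_bilinear_cmult_vec: "bounded_bilinear (\<lambda>c (v :: complex ^ 'n). c *s v)"
proof
  show "\<exists>K. \<forall>c (v :: complex ^ 'n). norm (c *s v) \<le> norm c * norm v * K"
    by (intro exI[of _ 1]) (simp add: norm_cmult_vec)
qed (simp_all add: vec_eq_iff ring_distribs)

lemmas tendsto_herm_prod [tendsto_intros] = bounded_bilinear.tendsto[OF bounded_bilinear_herm_prod]
lemmas tendsto_cmult_vec [tendsto_intros] = bounded_bilinear.tendsto[OF bounded_bilinear_cmult_vec]
lemmas continuous_on_herm_prod [continuous_intros] =
  bounded_bilinear.continuous_on[OF bounded_bilinear_herm_prod]
lemmas continuous_on_cmult_vec [continuous_intros] =
  bounded_bilinear.continuous_on[OF bounded_bilinear_cmult_vec]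
lemmas has_derivative_herm_prod = bounded_bilinear.FDERIV[OF bounded_bilinear_herm_prod]
lemmas has_derivative_cmult_vec = bounded_bilinear.FDERIV[OF bounded_bilinear_cmult_vec]
lemmas has_vector_derivative_herm_prod =
  bounded_bilinear.has_vector_derivative[OF bounded_bilinear_herm_prod]
lemmas has_vector_derivative_cmult_vec =
  bounded_bilinear.has_vector_derivative[OF bounded_bilinear_cmult_vec]

lemma one_minus_herm_prod_nonzero:
  assumes "norm z < 1" "norm w \<le> 1"
  shows "1 - herm_prod z w \<noteq> 0"
proof
  assume "1 - herm_prod z w = 0"
  then have "herm_prod z w = 1" by simp
  then have "1 \<le> norm z * norm w"
    using herm_prod_Cauchy_Schwarz[of z w] by simp
  moreover have "norm z * norm w \<le> norm z * 1"
    using assms by (intro mult_left_mono) auto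
  ultimately show False using assms by linarith
qed

text \<open>
  The equality case of the Cauchy-Schwarz inequality: the first hypothesis turns \<open>\<bar>v - u\<bar>\<^sup>2\<close> into
  \<open>\<bar>v\<bar>\<^sup>2 - \<bar>u\<bar>\<^sup>2\<close>.
\<close>
lemma herm_prod_eq_norm_imp_eq:
  assumes "herm_prod v u = of_real ((norm u)\<^sup>2)" "norm v \<le> norm u"
  shows "v = u"
proof -
  have "inner v u = (norm u)\<^sup>2"
    using assms(1) by (simp add: Re_herm_prod [symmetric])
  then have "(norm (v - u))\<^sup>2 = (norm v)\<^sup>2 - (norm u)\<^sup>2"
    by (simp add: power2_norm_eq_inner inner_diff_left inner_diff_right inner_commute)
  moreover have "(norm v)\<^sup>2 \<le> (norm u)\<^sup>2"
    using assms(2) by (simp add: power_mono)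
  ultimately have "(norm (v - u))\<^sup>2 \<le> 0" by simp
  then show ?thesis by simp
qed

text \<open>
  The involutive automorphism of the ball that exchanges \<open>0\<close> and \<open>a\<close>.  The usual formula involves
  the orthogonal projection of \<open>z\<close> to the line spanned by \<open>a\<close>; with \<open>s = sqrt (1 - \<bar>a\<bar>\<^sup>2)\<close> the factor
  \<open>(1 - s) / \<bar>a\<bar>\<^sup>2\<close> occurring there is written as \<open>1 / (1 + s)\<close>, which also makes sense for \<open>a = 0\<close>.
  For \<open>\<bar>a\<bar> = 1\<close> the formula degenerates to the constant map \<open>a\<close>.
\<close>
definition mob :: "complex ^ 'n \<Rightarrow> complex ^ 'n \<Rightarrow> complex ^ 'n"
  where "mob a z = (1 / (1 - herm_prod z a)) *s
    (a - of_real (sqrt (1 - (norm a)\<^sup>2)) *s z -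
      (herm_prod z a / of_real (1 + sqrt (1 - (norm a)\<^sup>2))) *s a)"

lemma one_minus_norm_square_pos:
  fixes a :: "'a :: real_normed_vector"
  assumes "norm a < 1"
  shows "0 < 1 - (norm a)\<^sup>2"
  using assms by (simp add: power_less_one_iff)

text \<open>
  The transformation rule on which all later computations rest.  It reflects that the involution is
  induced by a linear map of \<open>\<complex>\<^sup>n\<^sup>+\<^sup>1\<close> preserving the Hermitian form of signature \<open>(n, 1)\<close>.
\<close>
lemma one_minus_herm_prod_mob:
  assumes a: "norm a < 1" and z: "1 - herm_prod z a \<noteq> 0" and w: "1 - herm_prod w a \<noteq> 0"
  shows "1 - herm_prod (mob a z) (mob a w) =
    of_real (1 - (norm a)\<^sup>2) * (1 - herm_prod z w) /
      ((1 - herm_prod z a) * (1 - herm_prod a w))"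
proof -
  define s where "s = complex_of_real (sqrt (1 - (norm a)\<^sup>2))"
  define \<alpha> where "\<alpha> = herm_prod z a"
  define \<beta> where "\<beta> = herm_prod a w"
  have s2: "s * s = 1 - of_real ((norm a)\<^sup>2)"
    using one_minus_norm_square_pos[OF a]
    by (simp add: s_def of_real_mult [symmetric] del: of_real_mult)
  have aa: "herm_prod a a = 1 - s * s" by (simp add: s2 herm_prod_self)
  have s1: "1 + s \<noteq> 0"
  proof -
    have "Re (1 + s) > 0"
      using one_minus_norm_square_pos[OF a] by (simp add: s_def add_pos_nonneg)
    then show ?thesis by force
  qed
  have wa: "cnj (herm_prod w a) = \<beta>" by (simp add: \<beta>_def cnj_herm_prod)
  have \<beta>1: "1 - \<beta> \<noteq> 0"
    using w wa by (metis complex_cnj_cancel_iff complex_cnj_diff complex_cnj_one complex_cnj_zero)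
  have \<alpha>1: "1 - \<alpha> \<noteq> 0" using z by (simp add: \<alpha>_def)
  have cs: "cnj s = s" by (simp add: s_def)
  define q where "q = inverse (1 + s)"
  have q: "q * (1 + s) = 1" using s1 by (simp add: q_def)
  have mob: "mob a v = (1 / (1 - herm_prod v a)) *s (a - s *s v - (herm_prod v a * q) *s a)" for v
    by (simp add: mob_def s_def q_def divide_inverse)
  have cq: "cnj q = q" by (simp add: q_def cs)
  have "herm_prod (mob a z) (mob a w) = (1 / (1 - \<alpha>)) * (1 / (1 - \<beta>)) *
     ((1 - s * s) - s * \<beta> - (\<beta> * q) * (1 - s * s)
      - s * (\<alpha> - s * herm_prod z w - (\<beta> * q) * \<alpha>)
      - (\<alpha> * q) * ((1 - s * s) - s * \<beta> - (\<beta> * q) * (1 - s * s)))"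
  proof -
    let ?N = "\<lambda>v. a - s *s v - (herm_prod v a * q) *s a"
    have "herm_prod (?N z) (?N w) = (1 - s * s) - s * \<beta> - (\<beta> * q) * (1 - s * s)
      - s * (\<alpha> - s * herm_prod z w - (\<beta> * q) * \<alpha>)
      - (\<alpha> * q) * ((1 - s * s) - s * \<beta> - (\<beta> * q) * (1 - s * s))"
      by (simp add: herm_prod_simps wa cs cq aa \<alpha>_def [symmetric] \<beta>_def [symmetric])
         (simp add: algebra_simps)
    then show ?thesis
      unfolding mob herm_prod_cmult_left herm_prod_cmult_right
      by (simp add: wa \<alpha>_def [symmetric])
  qed
  also have "(1 - s * s) - s * \<beta> - (\<beta> * q) * (1 - s * s)
      - s * (\<alpha> - s * herm_prod z w - (\<beta> * q) * \<alpha>)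
      - (\<alpha> * q) * ((1 - s * s) - s * \<beta> - (\<beta> * q) * (1 - s * s)) =
      1 - \<alpha> - \<beta> + \<alpha> * \<beta> - s * s * (1 - herm_prod z w)"
    using q by algebra
  also have "1 - \<alpha> - \<beta> + \<alpha> * \<beta> = (1 - \<alpha>) * (1 - \<beta>)"
    by algebra
  finally have "herm_prod (mob a z) (mob a w) =
      ((1 - \<alpha>) * (1 - \<beta>) - s * s * (1 - herm_prod z w)) / ((1 - \<alpha>) * (1 - \<beta>))"
    by simp
  then have "1 - herm_prod (mob a z) (mob a w) = s * s * (1 - herm_prod z w) / ((1 - \<alpha>) * (1 - \<beta>))"
    using \<alpha>1 \<beta>1 by (simp add: diff_divide_distrib)
  then show ?thesis
    by (simp add: s2 \<alpha>_def \<beta>_def)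
qed

lemma one_minus_norm_mob:
  assumes a: "norm a < 1" and z: "1 - herm_prod z a \<noteq> 0"
  shows "1 - (norm (mob a z))\<^sup>2 = (1 - (norm a)\<^sup>2) * (1 - (norm z)\<^sup>2) / (cmod (1 - herm_prod z a))\<^sup>2"
proof -
  have e: "(1 - herm_prod z a) * (1 - herm_prod a z) = of_real ((cmod (1 - herm_prod z a))\<^sup>2)"
    unfolding complex_norm_square by (simp add: cnj_herm_prod)
  have "complex_of_real (1 - (norm (mob a z))\<^sup>2) =
    of_real ((1 - (norm a)\<^sup>2) * (1 - (norm z)\<^sup>2) / (cmod (1 - herm_prod z a))\<^sup>2)"
    using one_minus_herm_prod_mob[OF a z z] unfolding e
    by (simp add: herm_prod_self)
  then show ?thesis by (simp only: of_real_eq_iff)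
qed

lemma mob_in_ball:
  assumes a: "norm a < 1" and z: "norm z < 1"
  shows "norm (mob a z) < 1"
proof -
  have nz: "1 - herm_prod z a \<noteq> 0" using one_minus_herm_prod_nonzero[of z a] a z by simp
  have "0 < 1 - (norm (mob a z))\<^sup>2"
    unfolding one_minus_norm_mob[OF a nz]
    using one_minus_norm_square_pos[OF a] one_minus_norm_square_pos[OF z] nz
    by (intro divide_pos_pos mult_pos_pos) auto
  then show ?thesis
    by (simp add: power_less_one_iff)
qed

lemma mob_0: "mob a 0 = a"
  by (simp add: mob_def)

lemma mob_self:
  assumes a: "norm a < 1"
  shows "mob a a = 0"
proof -
  define s where "s = complex_of_real (sqrt (1 - (norm a)\<^sup>2))"
  have s2: "s * s = 1 - of_real ((norm a)\<^sup>2)"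
    using one_minus_norm_square_pos[OF a]
    by (simp add: s_def of_real_mult [symmetric] del: of_real_mult)
  have aa: "herm_prod a a = 1 - s * s" by (simp add: s2 herm_prod_self)
  have s1: "1 + s \<noteq> 0"
  proof -
    have "Re (1 + s) > 0"
      using one_minus_norm_square_pos[OF a] by (simp add: s_def add_pos_nonneg)
    then show ?thesis by force
  qed
  have "1 - s - (1 - s * s) / (1 + s) = 0" using s1 by (simp add: field_simps)
  moreover have "a - s *s a - ((1 - s * s) / (1 + s)) *s a = (1 - s - (1 - s * s) / (1 + s)) *s a"
    by (simp add: vec_eq_iff algebra_simps)
  ultimately show ?thesis
    unfolding mob_def s_def [symmetric] of_real_add of_real_1 aa by simp
qed

lemma mob_mob:
  assumes a: "norm a < 1" and z: "norm z < 1"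
  shows "mob a (mob a z) = z"
proof -
  have nz: "1 - herm_prod z a \<noteq> 0" using one_minus_herm_prod_nonzero[of z a] a z by simp
  have na: "1 - herm_prod a a \<noteq> 0" using one_minus_herm_prod_nonzero[of a a] a by simp
  let ?d = "1 - herm_prod z a"
  define s where "s = complex_of_real (sqrt (1 - (norm a)\<^sup>2))"
  have s2: "s * s = 1 - of_real ((norm a)\<^sup>2)"
    using one_minus_norm_square_pos[OF a]
    by (simp add: s_def of_real_mult [symmetric] del: of_real_mult)
  have aa: "herm_prod a a = 1 - s * s" by (simp add: s2 herm_prod_self)
  have s1: "1 + s \<noteq> 0"
  proof -
    have "Re (1 + s) > 0"
      using one_minus_norm_square_pos[OF a] by (simp add: s_def add_pos_nonneg)
    then show ?thesis by force
  qed
  have s0: "s \<noteq> 0"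
    using one_minus_norm_square_pos[OF a] by (simp add: s_def)
  have g: "1 - herm_prod (mob a z) a = s * s / ?d"
    using one_minus_herm_prod_mob[OF a nz, of 0] by (simp add: mob_0 s2)
  then have h: "herm_prod (mob a z) a = 1 - s * s / ?d"
    by (simp add: algebra_simps)
  have "mob a (mob a z) = (?d / (s * s)) *s
      (a - s *s mob a z - ((1 - s * s / ?d) / (1 + s)) *s a)"
    by (subst mob_def) (simp add: g h s_def [symmetric])
  also have "\<dots> = z"
  proof -
    have mz: "mob a z = (1 / ?d) *s (a - s *s z - (herm_prod z a / (1 + s)) *s a)"
      by (simp add: mob_def s_def)
    have "(?d / (s * s)) * (x - s * ((1 / ?d) * (x - s * y - (herm_prod z a / (1 + s)) * x)) 
        - ((1 - s * s / ?d) / (1 + s)) * x) = y" for x y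
    proof -
      define \<alpha> where "\<alpha> = herm_prod z a"
      have d: "1 - \<alpha> \<noteq> 0" using nz by (simp add: \<alpha>_def)
      have "x - s * ((1 / (1 - \<alpha>)) * (x - s * y - (\<alpha> / (1 + s)) * x)) - ((1 - s * s / (1 - \<alpha>)) / (1 + s)) * x
        = s * s * y / (1 - \<alpha>)"
      proof -
        define q where "q = inverse (1 + s)"
        define e where "e = inverse (1 - \<alpha>)"
        have "q * (1 + s) = 1" "e * (1 - \<alpha>) = 1" using s1 d by (simp_all add: q_def e_def)
        then have "x - s * ((1 * e) * (x - s * y - (\<alpha> * q) * x)) - ((1 - s * s * e) * q) * x
            = s * s * y * e"
          by algebra
        then show ?thesis by (simp add: q_def e_def divide_inverse)
      qed
      then show ?thesis
        unfolding \<alpha>_def [symmetric] using d s0 by simp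
    qed
    then show ?thesis
      unfolding vec_eq_iff mz
      by (simp only: vector_smult_component vector_minus_component simp_thms)
  qed
  finally show ?thesis .
qed

section \<open>The Schwarz lemma on the ball\<close>

lemma holomorphic_map_on_ball_derivative:
  assumes "holomorphic_map_on f unit_ball" "norm z < 1"
  obtains D where "(f has_derivative D) (at z)" "\<And>c v. D (c *s v) = c *s D v"
proof -
  have "z \<in> unit_ball" using assms(2) by simp
  then obtain D where D: "(f has_derivative D) (at z within unit_ball)"
    "\<And>c v. D (c *s v) = c *s D v"
    using assms(1) unfolding holomorphic_map_on_def by blast
  with \<open>z \<in> unit_ball\<close> show ?thesis
    by (intro that[of D]) (auto simp: at_within_open[OF _ open_ball])
qed

lemma holomorphic_map_onI:
  assumes "\<And>z. z \<in> S \<Longrightarrow> (f has_derivative D z) (at z)"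
    and "\<And>z c v. z \<in> S \<Longrightarrow> D z (c *s v) = c *s D z v"
  shows "holomorphic_map_on f S"
  unfolding holomorphic_map_on_def
  using assms has_derivative_at_withinI by blast

lemma continuous_on_holomorphic_map:
  assumes "holomorphic_map_on f S" shows "continuous_on S f"
  using assms unfolding holomorphic_map_on_def
  by (meson continuous_on_eq_continuous_within has_derivative_continuous)

lemma has_field_derivative_slice:
  fixes f :: "complex ^ 'n \<Rightarrow> complex ^ 'm"
  assumes "(f has_derivative D) (at (a + \<zeta> *s v))" "\<And>c v. D (c *s v) = c *s D v"
  shows "((\<lambda>\<zeta>. f (a + \<zeta> *s v) $ j) has_field_derivative D v $ j) (at \<zeta>)"
proof -
  have "((\<lambda>\<zeta>. \<zeta> *s v) has_derivative (\<lambda>h. h *s v)) (at \<zeta>)"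
    by (rule bounded_linear_imp_has_derivative
        [OF bounded_bilinear.bounded_linear_left[OF bounded_bilinear_cmult_vec]])
  then have "((\<lambda>\<zeta>. a + \<zeta> *s v) has_derivative (\<lambda>h. h *s v)) (at \<zeta>)"
    using has_derivative_add[OF has_derivative_const[of a "at \<zeta>"]] by fastforce
  then have "((\<lambda>\<zeta>. f (a + \<zeta> *s v)) has_derivative (\<lambda>h. D (h *s v))) (at \<zeta>)"
    by (rule has_derivative_compose[where g = f and g' = D]) (rule assms(1))
  then have d: "((\<lambda>\<zeta>. f (a + \<zeta> *s v) $ j) has_derivative (\<lambda>h. D (h *s v) $ j)) (at \<zeta>)"
    by (rule bounded_linear.has_derivative[OF bounded_linear_vec_nth])
  have eq: "(\<lambda>h. D (h *s v) $ j) = (*) (D v $ j)"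
    by (rule ext) (simp only: assms(2) vector_smult_component mult.commute)
  show ?thesis
    using d unfolding has_field_derivative_def eq .
qed

lemma holomorphic_on_slice:
  assumes "holomorphic_map_on f unit_ball" "\<And>\<zeta>. \<zeta> \<in> T \<Longrightarrow> norm (a + \<zeta> *s v) < 1"
  shows "(\<lambda>\<zeta>. f (a + \<zeta> *s v) $ j) holomorphic_on T"
  unfolding holomorphic_on_def field_differentiable_def
proof
  fix \<zeta> assume "\<zeta> \<in> T"
  then obtain D where D: "(f has_derivative D) (at (a + \<zeta> *s v))" "\<And>c v. D (c *s v) = c *s D v"
    using holomorphic_map_on_ball_derivative[OF assms(1) assms(2)] by blast
  show "\<exists>f'. ((\<lambda>\<zeta>. f (a + \<zeta> *s v) $ j) has_field_derivative f') (at \<zeta> within T)"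
    using has_field_derivative_at_within[OF has_field_derivative_slice[OF D]] by blast
qed

lemma holomorphic_on_herm_prod_slice:
  assumes "holomorphic_map_on f unit_ball" "\<And>\<zeta>. \<zeta> \<in> T \<Longrightarrow> norm (a + \<zeta> *s v) < 1"
  shows "(\<lambda>\<zeta>. herm_prod (f (a + \<zeta> *s v)) u) holomorphic_on T"
  unfolding herm_prod_def
  by (intro holomorphic_intros holomorphic_on_slice[OF assms])

lemma holomorphic_on_herm_prod_disc:
  fixes f :: "complex ^ 'n \<Rightarrow> complex ^ 'm"
  assumes "holomorphic_map_on f unit_ball" "norm v \<le> 1"
  shows "(\<lambda>\<zeta>. herm_prod (f (\<zeta> *s v)) u) holomorphic_on ball 0 1"
proof -
  have "norm (0 + \<zeta> *s v) < 1" if "\<zeta> \<in> ball 0 1" for \<zeta>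
    using mult_left_le[OF assms(2) norm_ge_zero[of \<zeta>]] that by (simp add: norm_cmult_vec)
  with holomorphic_on_herm_prod_slice[OF assms(1), where T = "ball 0 1" and a = 0 and v = v and u = u]
  show ?thesis by simp
qed

lemma herm_prod_disc_bound:
  fixes f :: "complex ^ 'n \<Rightarrow> complex ^ 'm"
  assumes "\<And>z. norm z < 1 \<Longrightarrow> norm (f z) < 1" "norm v = 1" "norm u = 1" "norm \<zeta> < 1"
  shows "norm (herm_prod (f (\<zeta> *s v)) u) < 1"
  using herm_prod_Cauchy_Schwarz[of "f (\<zeta> *s v)" u] assms(1)[of "\<zeta> *s v"] assms(2-)
  by (simp add: norm_cmult_vec)

text \<open>
  The one-variable Schwarz lemma on the disc through \<open>z\<close>, applied to the component of \<open>f\<close> in the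
  direction of \<open>f z\<close>.
\<close>
lemma schwarz_ball:
  fixes f :: "complex ^ 'n \<Rightarrow> complex ^ 'm"
  assumes f: "holomorphic_map_on f unit_ball" and b: "\<And>z. norm z < 1 \<Longrightarrow> norm (f z) < 1"
    and "f 0 = 0" and z: "norm z < 1"
  shows "norm (f z) \<le> norm z"
proof (cases "z = 0 \<or> f z = 0")
  case True
  then show ?thesis using \<open>f 0 = 0\<close> by auto
next
  case False
  define v where "v = of_real (1 / norm z) *s z"
  define u where "u = of_real (1 / norm (f z)) *s f z"
  have nv: "norm v = 1" and nu: "norm u = 1"
    using False by (simp_all add: v_def u_def norm_cmult_vec norm_divide)
  have zv: "of_real (norm z) *s v = z" using False by (simp add: v_def)
  define k where "k = (\<lambda>\<zeta>. herm_prod (f (\<zeta> *s v)) u)"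
  have "norm (k (of_real (norm z))) \<le> norm (complex_of_real (norm z))"
  proof (rule Schwarz_Lemma(1))
    show "k holomorphic_on ball 0 1"
      unfolding k_def using nv by (intro holomorphic_on_herm_prod_disc f) simp
    show "k 0 = 0" by (simp add: k_def \<open>f 0 = 0\<close>)
    show "norm (k \<zeta>) < 1" if "norm \<zeta> < 1" for \<zeta>
      unfolding k_def using b nv nu that by (rule herm_prod_disc_bound)
    show "norm (complex_of_real (norm z)) < 1" using z by simp
  qed
  moreover have "k (of_real (norm z)) = of_real (norm (f z))"
    using False unfolding k_def zv
    by (simp add: u_def herm_prod_simps herm_prod_self power2_eq_square)
  ultimately show ?thesis by simp
qed

text \<open>
  Equality in the Schwarz lemma makes the component in the direction of \<open>f z\<close> linear on the disc
  through \<open>z\<close>; it then already exhausts the norm of \<open>f\<close>, so the other components vanish.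
\<close>
lemma holomorphic_norm_preserving_imp_homogeneous:
  fixes f :: "complex ^ 'n \<Rightarrow> complex ^ 'm"
  assumes f: "holomorphic_map_on f unit_ball" and n: "\<And>z. norm z < 1 \<Longrightarrow> norm (f z) = norm z"
    and z: "norm z < 1" and \<eta>: "norm \<eta> \<le> 1"
  shows "f (\<eta> *s z) = \<eta> *s f z"
proof (cases "z = 0")
  case True
  then show ?thesis using n[of 0] by auto
next
  case False
  have f0: "f 0 = 0" using n[of 0] by simp
  have b: "norm (f w) < 1" if "norm w < 1" for w using n that by simp
  define v where "v = of_real (1 / norm z) *s z"
  define u where "u = of_real (1 / norm z) *s f z"
  have nv: "norm v = 1" and nu: "norm u = 1"
    using False n[OF z] by (simp_all add: v_def u_def norm_cmult_vec norm_divide)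
  have zv: "of_real (norm z) *s v = z" and fu: "of_real (norm z) *s u = f z"
    using False by (simp_all add: v_def u_def)
  define k where "k = (\<lambda>\<zeta>. herm_prod (f (\<zeta> *s v)) u)"
  have k: "k holomorphic_on ball 0 1" "k 0 = 0" "\<And>\<zeta>. norm \<zeta> < 1 \<Longrightarrow> norm (k \<zeta>) < 1"
    unfolding k_def using nv nu b f0
    by (auto intro!: holomorphic_on_herm_prod_disc f herm_prod_disc_bound)
  have kz: "k (of_real (norm z)) = of_real (norm z)"
    using False n[OF z] unfolding k_def zv
    by (simp add: u_def herm_prod_simps herm_prod_self power2_eq_square)
  have nz: "norm (complex_of_real (norm z)) < 1" using z by simp
  have "\<exists>\<alpha>. (\<forall>\<zeta>. norm \<zeta> < 1 \<longrightarrow> k \<zeta> = \<alpha> * \<zeta>) \<and> norm \<alpha> = 1"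
    by (rule Schwarz_Lemma(3)[OF k nz]) (use kz z False in \<open>auto intro!: exI[of _ "complex_of_real (norm z)"]\<close>)
  then obtain \<alpha> where \<alpha>: "\<And>\<zeta>. norm \<zeta> < 1 \<Longrightarrow> k \<zeta> = \<alpha> * \<zeta>" by blast
  have "\<alpha> = 1" using \<alpha>[OF nz] kz False by simp
  have fl: "f (\<zeta> *s v) = \<zeta> *s u" if "norm \<zeta> < 1" for \<zeta>
  proof (rule herm_prod_eq_norm_imp_eq)
    show "herm_prod (f (\<zeta> *s v)) (\<zeta> *s u) = of_real ((norm (\<zeta> *s u))\<^sup>2)"
      using \<alpha>[OF that] nu \<open>\<alpha> = 1\<close> complex_norm_square[of \<zeta>]
      by (simp add: herm_prod_simps k_def norm_cmult_vec mult.commute)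
    show "norm (f (\<zeta> *s v)) \<le> norm (\<zeta> *s u)"
      using n[of "\<zeta> *s v"] that nv nu by (simp add: norm_cmult_vec)
  qed
  have "f (\<eta> *s z) = f ((\<eta> * of_real (norm z)) *s v)"
    by (subst zv [symmetric]) (simp only: vector_smult_assoc)
  also have "\<dots> = (\<eta> * of_real (norm z)) *s u"
    using z \<eta> mult_left_le_one_le[of "norm z" "norm \<eta>"] by (intro fl) (simp add: norm_mult)
  also have "\<dots> = \<eta> *s f z"
    by (subst fu [symmetric]) (simp only: vector_smult_assoc)
  finally show ?thesis .
qed

lemma Im_herm_prod: "Im (herm_prod v w) = inner v (\<i> *s w)"
  by (simp add: Re_herm_prod [symmetric] herm_prod_simps)

text \<open>
  Polarisation recovers the real part; the imaginary part follows by complex homogeneity.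
\<close>
lemma herm_prod_preserved:
  fixes D :: "complex ^ 'n \<Rightarrow> complex ^ 'm"
  assumes "\<And>u v. D (u + v) = D u + D v" "\<And>c v. D (c *s v) = c *s D v"
    and n: "\<And>v. norm (D v) = norm v"
  shows "herm_prod (D v) (D w) = herm_prod v w"
proof -
  have i: "inner (D v) (D w) = inner v w" for v w
  proof -
    have "(norm (D v + D w))\<^sup>2 = (norm (v + w))\<^sup>2"
      using n[of "v + w"] assms(1) by simp
    then have "inner (D v) (D v) + inner (D w) (D w) + 2 * inner (D v) (D w)
        = inner v v + inner w w + 2 * inner v w"
      by (simp add: power2_norm_eq_inner inner_add_left inner_add_right inner_commute)
    moreover have "inner (D v) (D v) = inner v v" "inner (D w) (D w) = inner w w"
      using n[of v] n[of w] by (simp_all flip: power2_norm_eq_inner)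
    ultimately show ?thesis by simp
  qed
  show ?thesis
  proof (rule complex_eqI)
    show "Re (herm_prod (D v) (D w)) = Re (herm_prod v w)"
      by (simp add: Re_herm_prod i)
    show "Im (herm_prod (D v) (D w)) = Im (herm_prod v w)"
      using i[of v "\<i> *s w"] by (simp only: Im_herm_prod assms(2))
  qed
qed

text \<open>
  A homogeneous map that is differentiable at \<open>0\<close> is its own derivative there.
\<close>
lemma holomorphic_norm_preserving_imp_linear:
  fixes f :: "complex ^ 'n \<Rightarrow> complex ^ 'm"
  assumes f: "holomorphic_map_on f unit_ball" and n: "\<And>z. norm z < 1 \<Longrightarrow> norm (f z) = norm z"
  obtains D where "\<And>u v. D (u + v) = D u + D v" "\<And>c v. D (c *s v) = c *s D v"
    "\<And>v w. herm_prod (D v) (D w) = herm_prod v w" "\<And>z. norm z < 1 \<Longrightarrow> f z = D z"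
proof -
  obtain D where D: "(f has_derivative D) (at 0)" "\<And>c v. D (c *s v) = c *s D v"
    by (rule holomorphic_map_on_ball_derivative[OF f, of 0]) auto
  have eq: "f z = D z" if z: "norm z < 1" for z
  proof -
    have l: "((\<lambda>r :: real. r *\<^sub>R z) has_vector_derivative z) (at 0)"
      by (auto intro!: derivative_eq_intros)
    have "((\<lambda>r. f (r *\<^sub>R z)) has_vector_derivative D z) (at 0)"
      using vector_derivative_diff_chain_within[OF l, of f D] D(1)
      by (simp add: o_def has_derivative_at_withinI)
    moreover have "((\<lambda>r. r *\<^sub>R f z) has_vector_derivative f z) (at (0 :: real))"
      by (auto intro!: derivative_eq_intros)
    then have "((\<lambda>r. f (r *\<^sub>R z)) has_vector_derivative f z) (at 0)"
    proof (rule has_vector_derivative_transform_within_open)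
      show "open (ball (0 :: real) 1)" "(0 :: real) \<in> ball 0 1" by auto
      show "r *\<^sub>R f z = f (r *\<^sub>R z)" if "r \<in> ball 0 1" for r
        using holomorphic_norm_preserving_imp_homogeneous[OF f n z, of "of_real r"] that
        by (simp add: scaleR_vec_eq)
    qed
    ultimately show ?thesis
      using vector_derivative_unique_at by blast
  qed
  have add: "D (u + v) = D u + D v" for u v
    using has_derivative_linear[OF D(1)] by (rule linear_add)
  have nD: "norm (D v) = norm v" for v
  proof -
    let ?c = "1 / (1 + norm v)"
    have "norm (?c *\<^sub>R v) < 1" by (simp add: add_pos_nonneg)
    then have "norm (D (?c *\<^sub>R v)) = norm (?c *\<^sub>R v)"
      using eq n by simp
    moreover have "D (?c *\<^sub>R v) = ?c *\<^sub>R D v"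
      by (simp only: scaleR_vec_eq D(2))
    ultimately have "?c * norm (D v) = ?c * norm v" by simp
    then show ?thesis by (simp add: add_nonneg_eq_0_iff)
  qed
  show ?thesis
    by (rule that[OF add D(2) herm_prod_preserved[OF add D(2) nD] eq])
qed

definition ctranspose :: "complex ^ 'n ^ 'm \<Rightarrow> complex ^ 'm ^ 'n"
  where "ctranspose A = (\<chi> i j. cnj (A $ j $ i))"

lemma unitary_matrix_iff: "unitary_matrix A \<longleftrightarrow> ctranspose A ** A = mat 1"
  unfolding unitary_matrix_def ctranspose_def [symmetric] by (rule matrix_left_right_inverse)

lemma herm_prod_matrix_left: "herm_prod (A *v z) w = herm_prod z (ctranspose A *v w)"
proof -
  have "herm_prod (A *v z) w = (\<Sum>i\<in>UNIV. \<Sum>j\<in>UNIV. A $ i $ j * z $ j * cnj (w $ i))"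
    by (simp add: herm_prod_def matrix_vector_mult_def sum_distrib_right)
  also have "\<dots> = (\<Sum>j\<in>UNIV. \<Sum>i\<in>UNIV. A $ i $ j * z $ j * cnj (w $ i))"
    by (rule sum.swap)
  also have "\<dots> = herm_prod z (ctranspose A *v w)"
    by (simp add: herm_prod_def matrix_vector_mult_def ctranspose_def sum_distrib_left mult_ac)
  finally show ?thesis .
qed

lemma unitary_herm_prod:
  assumes "unitary_matrix A" shows "herm_prod (A *v z) (A *v w) = herm_prod z w"
  using assms unfolding unitary_matrix_iff herm_prod_matrix_left
  by (simp add: matrix_vector_mul_assoc)

lemma unitary_norm:
  assumes "unitary_matrix A" shows "norm (A *v z) = norm z"
proof -
  have "complex_of_real ((norm (A *v z))\<^sup>2) = of_real ((norm z)\<^sup>2)"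
    unfolding herm_prod_self [symmetric] by (rule unitary_herm_prod[OF assms])
  then have "(norm (A *v z))\<^sup>2 = (norm z)\<^sup>2" by (simp only: of_real_eq_iff)
  then show ?thesis by (simp add: power2_eq_iff_nonneg)
qed

lemma unitary_ctranspose:
  assumes "unitary_matrix A"
  shows "unitary_matrix (ctranspose A)" "A *v (ctranspose A *v z) = z" "ctranspose A *v (A *v z) = z"
proof -
  have "ctranspose (ctranspose A) = A" by (simp add: ctranspose_def vec_eq_iff)
  then show "unitary_matrix (ctranspose A)"
    using assms unfolding unitary_matrix_iff[of "ctranspose A"]
    by (simp add: unitary_matrix_def ctranspose_def [symmetric])
  show "A *v (ctranspose A *v z) = z"
    using assms by (simp add: matrix_vector_mul_assoc unitary_matrix_def ctranspose_def [symmetric])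
  show "ctranspose A *v (A *v z) = z"
    using assms by (simp add: matrix_vector_mul_assoc unitary_matrix_iff)
qed

lemma isometry_unitary_matrix:
  fixes D :: "complex ^ 'n \<Rightarrow> complex ^ 'n"
  assumes "\<And>u v. D (u + v) = D u + D v" "\<And>c v. D (c *s v) = c *s D v"
    and h: "\<And>v w. herm_prod (D v) (D w) = herm_prod v w"
  obtains A where "unitary_matrix A" "\<And>v. D v = A *v v"
proof -
  have "Vector_Spaces.linear (*s) (*s) D"
    using assms by (simp add: Vector_Spaces.linear_iff vec.vector_space_axioms)
  then have A: "matrix D *v v = D v" for v by (rule matrix_works)
  have "(ctranspose (matrix D) ** matrix D) $ i $ j = (if i = j then 1 else 0)" for i j
  proof -
    have "(ctranspose (matrix D) ** matrix D) $ i $ j = herm_prod (D (axis j 1)) (D (axis i 1))"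
      by (simp add: matrix_matrix_mult_def ctranspose_def matrix_def herm_prod_def mult.commute)
    also have "\<dots> = (if i = j then 1 else 0)"
    proof -
      have e: "(if k = j then 1 else 0) * cnj (if k = i then 1 else (0::complex))
          = (if k = j then (if i = j then 1 else 0) else 0)" for k by auto
      show ?thesis unfolding h unfolding herm_prod_def axis_def by (simp add: e)
    qed
    finally show ?thesis .
  qed
  then have "ctranspose (matrix D) ** matrix D = mat 1"
    by (simp add: vec_eq_iff mat_def)
  then show ?thesis
    by (intro that[of "matrix D"]) (simp_all add: unitary_matrix_iff A)
qed

lemma holomorphic_matrix_vector_mult: "holomorphic_map_on (\<lambda>z. A *v z) S"
proof (rule holomorphic_map_onI)
  have "bounded_linear (\<lambda>z. A *v z)"
    by (intro linear_conv_bounded_linear[THEN iffD1] linearI)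
      (simp_all add: vec.add scaleR_vec_eq vec.scale)
  then show "((\<lambda>z. A *v z) has_derivative (\<lambda>v. A *v v)) (at z)" for z
    by (rule bounded_linear_imp_has_derivative)
qed (simp add: vec.scale)

lemma holomorphic_mob:
  fixes a :: "complex ^ 'a"
  assumes a: "norm a < 1"
  shows "holomorphic_map_on (mob a) unit_ball"
proof -
  define s where "s = complex_of_real (sqrt (1 - (norm a)\<^sup>2))"
  define N where "N = (\<lambda>z :: complex ^ 'a. a - s *s z - (herm_prod z a / (1 + s)) *s a)"
  define N' where "N' = (\<lambda>v. - (s *s v) - (herm_prod v a / (1 + s)) *s a)"
  have m: "mob a = (\<lambda>z. (1 / (1 - herm_prod z a)) *s N z)"
    by (simp add: fun_eq_iff mob_def N_def s_def)
  have dh: "((\<lambda>z. herm_prod z a) has_derivative (\<lambda>v. herm_prod v a)) (at z)" for z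
    by (rule bounded_linear_imp_has_derivative
        [OF bounded_bilinear.bounded_linear_left[OF bounded_bilinear_herm_prod]])
  have dN: "(N has_derivative N') (at z)" for z
  proof -
    have 1: "((\<lambda>z. s *s z) has_derivative (\<lambda>v. s *s v)) (at z)"
      by (rule bounded_linear_imp_has_derivative[OF bounded_linear_cmult_vec])
    have "((\<lambda>z. herm_prod z a / (1 + s)) has_derivative (\<lambda>v. herm_prod v a / (1 + s))) (at z)"
      by (rule bounded_linear.has_derivative[OF bounded_linear_divide dh])
    then have 2: "((\<lambda>z. (herm_prod z a / (1 + s)) *s a) has_derivative
        (\<lambda>v. (herm_prod v a / (1 + s)) *s a)) (at z)"
      by (rule bounded_linear.has_derivative
          [OF bounded_bilinear.bounded_linear_left[OF bounded_bilinear_cmult_vec]])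
    show ?thesis
      unfolding N_def N'_def
      using has_derivative_diff[OF has_derivative_diff[OF has_derivative_const[of a] 1] 2] by simp
  qed
  show ?thesis
  proof (rule holomorphic_map_onI)
    fix z :: "complex ^ 'a" assume "z \<in> unit_ball"
    then have nz: "1 - herm_prod z a \<noteq> 0"
      using one_minus_herm_prod_nonzero[of z a] a by simp
    have "((\<lambda>z. 1 / (1 - herm_prod z a)) has_derivative
        (\<lambda>v. herm_prod v a / (1 - herm_prod z a)\<^sup>2)) (at z)"
      using nz by (auto intro!: derivative_eq_intros dh simp: power2_eq_square)
    from has_derivative_cmult_vec[OF this dN]
    show "(mob a has_derivative (\<lambda>v. (1 / (1 - herm_prod z a)) *s N' v +
       (herm_prod v a / (1 - herm_prod z a)\<^sup>2) *s N z)) (at z)"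
      unfolding m .
  next
    fix z :: "complex ^ 'a" and c v
    have "N' (c *s v) = c *s N' v"
      by (simp add: N'_def herm_prod_simps vec_eq_iff algebra_simps)
    then show "(1 / (1 - herm_prod z a)) *s N' (c *s v) +
       (herm_prod (c *s v) a / (1 - herm_prod z a)\<^sup>2) *s N z =
       c *s ((1 / (1 - herm_prod z a)) *s N' v + (herm_prod v a / (1 - herm_prod z a)\<^sup>2) *s N z)"
      by (simp add: herm_prod_simps vec_eq_iff algebra_simps)
  qed
qed

section \<open>Automorphisms of the ball\<close>

lemma ball_aut_bij: "\<gamma> \<in> ball_aut \<Longrightarrow> bij_betw \<gamma> unit_ball unit_ball"
  by (simp add: ball_aut_def Bij_def)

lemma ball_aut_norm: "\<gamma> \<in> ball_aut \<Longrightarrow> norm z < 1 \<Longrightarrow> norm (\<gamma> z) < 1"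
  using ball_aut_bij[of \<gamma>] by (auto simp: bij_betw_def dist_norm)

lemma ball_aut_holomorphic: "\<gamma> \<in> ball_aut \<Longrightarrow> holomorphic_map_on \<gamma> unit_ball"
  by (simp add: ball_aut_def)

lemma ball_aut_eqI:
  assumes "\<gamma> \<in> ball_aut" "\<delta> \<in> ball_aut" "\<And>z. norm z < 1 \<Longrightarrow> \<gamma> z = \<delta> z"
  shows "\<gamma> = \<delta>"
  using assms by (intro extensionalityI[of \<gamma> unit_ball]) (auto simp: ball_aut_def Bij_def)

lemma ball_autI:
  fixes f g :: "complex ^ 'n \<Rightarrow> complex ^ 'n"
  assumes "holomorphic_map_on f unit_ball" "holomorphic_map_on g unit_ball"
    and "\<And>z. norm z < 1 \<Longrightarrow> norm (f z) < 1" "\<And>z. norm z < 1 \<Longrightarrow> norm (g z) < 1"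
    and "\<And>z. norm z < 1 \<Longrightarrow> g (f z) = z" "\<And>z. norm z < 1 \<Longrightarrow> f (g z) = z"
  shows "restrict f unit_ball \<in> ball_aut"
proof -
  let ?B = "unit_ball :: (complex ^ 'n) set"
  have b: "bij_betw (restrict f ?B) ?B ?B"
    by (rule bij_betw_byWitness[where f' = g]) (use assms in auto)
  have "inv_into ?B (restrict f ?B) z = g z" if "z \<in> ?B" for z
    using assms that by (intro inv_into_f_eq bij_betw_imp_inj_on[OF b]) auto
  then show ?thesis
    using b assms(1,2) holomorphic_map_on_cong[of ?B "restrict f ?B" f]
      holomorphic_map_on_cong[of ?B "inv_into ?B (restrict f ?B)" g]
    by (simp add: ball_aut_def Bij_def)
qed

lemma carrier_ball_aut_group: "carrier ball_aut_group = ball_aut"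
  by (simp add: ball_aut_group_def)

lemma mult_ball_aut_group:
  assumes "\<gamma> \<in> ball_aut" "\<delta> \<in> ball_aut"
  shows "\<gamma> \<otimes>\<^bsub>ball_aut_group\<^esub> \<delta> = compose unit_ball \<gamma> \<delta>"
  using assms by (simp add: ball_aut_group_def BijGroup_def ball_aut_def)

lemma mult_ball_aut_apply:
  assumes "\<gamma> \<in> ball_aut" "\<delta> \<in> ball_aut" "norm z < 1"
  shows "(\<gamma> \<otimes>\<^bsub>ball_aut_group\<^esub> \<delta>) z = \<gamma> (\<delta> z)"
  using assms by (simp add: mult_ball_aut_group compose_def)

lemma one_ball_aut_apply: "norm z < 1 \<Longrightarrow> \<one>\<^bsub>ball_aut_group\<^esub> z = z"
  by (simp add: ball_aut_group_def BijGroup_def)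

lemma inv_ball_aut:
  assumes "\<gamma> \<in> ball_aut"
  shows "inv\<^bsub>ball_aut_group\<^esub> \<gamma> \<in> ball_aut"
    and "norm z < 1 \<Longrightarrow> (inv\<^bsub>ball_aut_group\<^esub> \<gamma>) (\<gamma> z) = z"
    and "norm z < 1 \<Longrightarrow> \<gamma> ((inv\<^bsub>ball_aut_group\<^esub> \<gamma>) z) = z"
proof -
  interpret group ball_aut_group by (rule group_ball_aut_group)
  show i: "inv\<^bsub>ball_aut_group\<^esub> \<gamma> \<in> ball_aut"
    using inv_closed[of \<gamma>] assms by (simp add: carrier_ball_aut_group)
  assume z: "norm z < 1"
  show "(inv\<^bsub>ball_aut_group\<^esub> \<gamma>) (\<gamma> z) = z"
    using l_inv[of \<gamma>] assms mult_ball_aut_apply[OF i assms z] one_ball_aut_apply[OF z]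
    by (simp add: carrier_ball_aut_group)
  show "\<gamma> ((inv\<^bsub>ball_aut_group\<^esub> \<gamma>) z) = z"
    using r_inv[of \<gamma>] assms mult_ball_aut_apply[OF assms i z] one_ball_aut_apply[OF z]
    by (simp add: carrier_ball_aut_group)
qed

lemma mult_ball_aut_closed:
  assumes "\<gamma> \<in> ball_aut" "\<delta> \<in> ball_aut"
  shows "\<gamma> \<otimes>\<^bsub>ball_aut_group\<^esub> \<delta> \<in> ball_aut"
proof -
  interpret group ball_aut_group by (rule group_ball_aut_group)
  show ?thesis using m_closed[of \<gamma> \<delta>] assms by (simp add: carrier_ball_aut_group)
qed

text \<open>
  These maps are all the automorphisms (\<open>ball_aut_decomp\<close>), so pairs of a point and a unitary matrix
  serve as coordinates on the automorphism group.
\<close>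
definition mobu :: "complex ^ 'n \<Rightarrow> complex ^ 'n ^ 'n \<Rightarrow> complex ^ 'n \<Rightarrow> complex ^ 'n"
  where "mobu a A = restrict (\<lambda>z. mob a (A *v z)) unit_ball"

lemma mobu_apply: "norm z < 1 \<Longrightarrow> mobu a A z = mob a (A *v z)"
  by (simp add: mobu_def)

lemma mobu_in_ball_aut:
  assumes a: "norm a < 1" and A: "unitary_matrix A"
  shows "mobu a A \<in> ball_aut"
  unfolding mobu_def
proof (rule ball_autI[where g = "\<lambda>z. ctranspose A *v mob a z"])
  have bA: "(\<lambda>z. A *v z) ` unit_ball \<subseteq> unit_ball" and ba: "mob a ` unit_ball \<subseteq> unit_ball"
    using unitary_norm[OF A] mob_in_ball[OF a] by auto
  show "holomorphic_map_on (\<lambda>z. mob a (A *v z)) unit_ball"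
    by (rule holomorphic_map_on_compose[OF holomorphic_matrix_vector_mult holomorphic_mob[OF a] bA])
  show "holomorphic_map_on (\<lambda>z. ctranspose A *v mob a z) unit_ball"
    by (rule holomorphic_map_on_compose[OF holomorphic_mob[OF a] holomorphic_matrix_vector_mult ba])
qed (simp_all add: mob_in_ball mob_mob a unitary_norm A unitary_ctranspose)

lemma mob_in_ball_aut:
  assumes "norm a < 1" shows "restrict (mob a) unit_ball \<in> ball_aut"
  by (rule ball_autI[where g = "mob a"]) (simp_all add: holomorphic_mob mob_in_ball mob_mob assms)

text \<open>
  Cartan's theorem: the Schwarz lemma for the automorphism and for its inverse shows that norms are
  preserved.
\<close>
lemma ball_aut_fix_zero:
  fixes \<gamma> :: "complex ^ 'n \<Rightarrow> complex ^ 'n"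
  assumes \<gamma>: "\<gamma> \<in> ball_aut" and "\<gamma> 0 = 0"
  obtains A where "unitary_matrix A" "\<gamma> = restrict (\<lambda>z. A *v z) unit_ball"
proof -
  let ?\<delta> = "inv\<^bsub>ball_aut_group\<^esub> \<gamma>"
  have d0: "?\<delta> 0 = 0" using inv_ball_aut(2)[OF \<gamma>, of 0] \<open>\<gamma> 0 = 0\<close> by simp
  have le: "norm (\<theta> z) \<le> norm z" if "\<theta> \<in> ball_aut" "\<theta> 0 = 0" "norm z < 1"
    for \<theta> :: "complex ^ 'n \<Rightarrow> complex ^ 'n" and z
    using schwarz_ball[OF ball_aut_holomorphic[OF that(1)] ball_aut_norm[OF that(1)] that(2,3)] .
  have n: "norm (\<gamma> z) = norm z" if z: "norm z < 1" for z
    using le[OF \<gamma> \<open>\<gamma> 0 = 0\<close> z] le[OF inv_ball_aut(1)[OF \<gamma>] d0 ball_aut_norm[OF \<gamma> z]]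
      inv_ball_aut(2)[OF \<gamma> z] by simp
  obtain D where D: "\<And>u v. D (u + v) = D u + D v" "\<And>c v. D (c *s v) = c *s D v"
    "\<And>v w. herm_prod (D v) (D w) = herm_prod v w" "\<And>z. norm z < 1 \<Longrightarrow> \<gamma> z = D z"
    by (rule holomorphic_norm_preserving_imp_linear[OF ball_aut_holomorphic[OF \<gamma>] n]) auto
  obtain A where A: "unitary_matrix A" "\<And>v. D v = A *v v"
    by (rule isometry_unitary_matrix[OF D(1-3)]) auto
  have "\<gamma> \<in> extensional unit_ball" using \<gamma> by (simp add: ball_aut_def Bij_def)
  then have "\<gamma> = restrict (\<lambda>z. A *v z) unit_ball"
    by (rule extensionalityI[OF _ restrict_extensional]) (simp add: D(4) A(2))
  with A(1) show ?thesis by (rule that)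
qed

text \<open>
  Composition with the involution centred at \<open>\<gamma> 0\<close> yields an automorphism fixing \<open>0\<close>.
\<close>
lemma ball_aut_decomp:
  fixes \<gamma> :: "complex ^ 'n \<Rightarrow> complex ^ 'n"
  assumes \<gamma>: "\<gamma> \<in> ball_aut"
  obtains A where "unitary_matrix A" "\<gamma> = mobu (\<gamma> 0) A"
proof -
  let ?a = "\<gamma> 0" and ?m = "restrict (mob (\<gamma> 0)) unit_ball"
  have a: "norm ?a < 1" using ball_aut_norm[OF \<gamma>, of 0] by simp
  have m: "?m \<in> ball_aut" by (rule mob_in_ball_aut[OF a])
  let ?\<theta> = "?m \<otimes>\<^bsub>ball_aut_group\<^esub> \<gamma>"
  have \<theta>: "?\<theta> \<in> ball_aut" by (rule mult_ball_aut_closed[OF m \<gamma>])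
  have ap: "?\<theta> z = mob ?a (\<gamma> z)" if "norm z < 1" for z
    using that by (simp add: mult_ball_aut_apply[OF m \<gamma>] ball_aut_norm[OF \<gamma>])
  have "?\<theta> 0 = 0" by (simp add: ap mob_self[OF a])
  then obtain A where A: "unitary_matrix A" "?\<theta> = restrict (\<lambda>z. A *v z) unit_ball"
    by (rule ball_aut_fix_zero[OF \<theta>])
  have "\<gamma> = mobu ?a A"
  proof (rule ball_aut_eqI[OF \<gamma> mobu_in_ball_aut[OF a A(1)]])
    fix z :: "complex ^ 'n" assume z: "norm z < 1"
    have "A *v z = mob ?a (\<gamma> z)" using ap[OF z] z by (simp add: A(2))
    then show "\<gamma> z = mobu ?a A z"
      using z by (simp add: mobu_apply mob_mob[OF a] ball_aut_norm[OF \<gamma>])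
  qed
  with A(1) show ?thesis by (rule that)
qed

text \<open>
  The limit parameter may lie on the sphere, which is the case needed for unbounded orbits.
\<close>
lemma tendsto_mob:
  assumes a: "(a \<longlongrightarrow> a0) F" and z: "(z \<longlongrightarrow> z0) F"
    and "norm a0 \<le> 1" "1 - herm_prod z0 a0 \<noteq> 0"
  shows "((\<lambda>x. mob (a x) (z x)) \<longlongrightarrow> mob a0 z0) F"
proof -
  have "0 \<le> 1 - (norm a0)\<^sup>2" using assms(3) by (simp add: power_le_one)
  then have "1 + sqrt (1 - (norm a0)\<^sup>2) \<noteq> 0" using real_sqrt_ge_zero[of "1 - (norm a0)\<^sup>2"] by linarith
  then have "complex_of_real (1 + sqrt (1 - (norm a0)\<^sup>2)) \<noteq> 0" by (simp only: of_real_eq_0_iff not_False_eq_True)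
  then show ?thesis
    unfolding mob_def using assms by (intro tendsto_intros) auto
qed

lemma continuous_on_mob:
  assumes "continuous_on S a" "continuous_on S z"
    and "\<And>x. x \<in> S \<Longrightarrow> norm (a x) < 1" "\<And>x. x \<in> S \<Longrightarrow> norm (z x) < 1"
  shows "continuous_on S (\<lambda>x. mob (a x) (z x))"
  unfolding continuous_on_def
proof
  fix x assume x: "x \<in> S"
  show "((\<lambda>x. mob (a x) (z x)) \<longlongrightarrow> mob (a x) (z x)) (at x within S)"
    using assms x one_minus_herm_prod_nonzero[of "z x" "a x"]
    by (intro tendsto_mob) (auto simp: continuous_on_def less_imp_le)
qed

lemma tendsto_matrix_vector_mult [tendsto_intros]:
  fixes A :: "'x \<Rightarrow> complex ^ 'n ^ 'm"
  assumes "(A \<longlongrightarrow> A0) F" "(z \<longlongrightarrow> z0) F"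
  shows "((\<lambda>x. A x *v z x) \<longlongrightarrow> A0 *v z0) F"
  unfolding matrix_vector_mult_def using assms by (intro tendsto_intros)

lemma continuous_on_matrix_vector_mult [continuous_intros]:
  fixes A :: "'x :: topological_space \<Rightarrow> complex ^ 'n ^ 'm"
  assumes "continuous_on S A" "continuous_on S z"
  shows "continuous_on S (\<lambda>x. A x *v z x)"
  using assms unfolding continuous_on_def by (auto intro!: tendsto_intros)

text \<open>
  Unitarity says that the rows are orthonormal, a closed condition bounding every row.
\<close>
lemma compact_unitary: "compact {A :: complex ^ 'n ^ 'n. unitary_matrix A}"
proof -
  have e: "(A ** (\<chi> i j. cnj (A $ j $ i))) $ i $ j = herm_prod (A $ i) (A $ j)"
    for A :: "complex ^ 'n ^ 'n" and i j
    by (simp add: matrix_matrix_mult_def herm_prod_def)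
  have u: "unitary_matrix A \<longleftrightarrow> (\<forall>i j. herm_prod (A $ i) (A $ j) = (if i = j then 1 else 0))"
    for A :: "complex ^ 'n ^ 'n"
    unfolding unitary_matrix_def vec_eq_iff e by (simp add: mat_def)
  have "norm A \<le> real CARD('n)" if A: "unitary_matrix A" for A :: "complex ^ 'n ^ 'n"
  proof -
    have "norm (A $ i) = 1" for i
    proof -
      have "complex_of_real ((norm (A $ i))\<^sup>2) = of_real 1"
        unfolding herm_prod_self [symmetric] using A u by simp
      then have "(norm (A $ i))\<^sup>2 = 1" by (simp only: of_real_eq_iff)
      then show ?thesis by (simp add: power2_eq_1_iff) (smt (verit) norm_ge_zero)
    qed
    then show ?thesis
      using L2_set_le_sum[of UNIV "\<lambda>i. norm (A $ i)"] by (simp add: norm_vec_def)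
  qed
  then have "bounded {A :: complex ^ 'n ^ 'n. unitary_matrix A}"
    by (intro boundedI) auto
  moreover have "closed {A :: complex ^ 'n ^ 'n. unitary_matrix A}"
    unfolding u by (intro closed_Collect_all closed_Collect_eq continuous_intros)
  ultimately show ?thesis by (simp add: compact_eq_bounded_closed)
qed

text \<open>
  The tube lemma for the compact set \<open>K\<close>: the pairs for which some point of \<open>K\<close> is moved outside of \<open>U\<close>
  form the projection of a relatively closed set along \<open>K\<close>.
\<close>
lemma continuous_map_mobu:
  "continuous_map (top_of_set {x. norm (fst x) < 1 \<and> unitary_matrix (snd x)}) ball_aut_topology
    (\<lambda>x. mobu (fst x) (snd x :: complex ^ 'n ^ 'n))"
  unfolding ball_aut_topology_def
proof (rule continuous_on_generated_topo)
  let ?X = "{x. norm (fst x) < 1 \<and> unitary_matrix (snd x :: complex ^ 'n ^ 'n)}"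
  show "(\<lambda>x. mobu (fst x) (snd x)) ` topspace (top_of_set ?X) \<subseteq>
     \<Union> {{\<gamma> \<in> ball_aut. \<gamma> ` K \<subseteq> U} | K U. compact K \<and> K \<subseteq> unit_ball \<and> open U}"
    unfolding topspace_ball_aut_topology
      [unfolded ball_aut_topology_def topology_generated_by_topspace]
    by (intro image_subsetI mobu_in_ball_aut) simp_all
  fix W :: "(complex ^ 'n \<Rightarrow> complex ^ 'n) set"
  assume "W \<in> {{\<gamma> \<in> ball_aut. \<gamma> ` K \<subseteq> U} | K U. compact K \<and> K \<subseteq> unit_ball \<and> open U}"
  then obtain K U where W: "W = {\<gamma> \<in> ball_aut. \<gamma> ` K \<subseteq> U}"
    and K: "compact K" "K \<subseteq> unit_ball" and U: "open U" by blast
  define G where "G = (\<lambda>y :: (complex ^ 'n) \<times> (complex ^ 'n) \<times> (complex ^ 'n ^ 'n).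
    mob (fst (snd y)) (snd (snd y) *v fst y))"
  have "continuous_on (K \<times> ?X) G"
    unfolding G_def using K(2) by (intro continuous_on_mob continuous_intros) (auto simp: unitary_norm)
  then have "closedin (top_of_set (K \<times> ?X)) (K \<times> ?X \<inter> G -` (- U))"
    using U by (intro continuous_closedin_preimage) (auto simp: closed_Compl)
  then have "closedin (top_of_set ?X) {y. \<exists>x. x \<in> K \<and> (x, y) \<in> K \<times> ?X \<inter> G -` (- U)}"
    by (rule closedin_compact_projection[OF K(1)])
  then have "openin (top_of_set ?X) (?X - {y. \<exists>x. x \<in> K \<and> (x, y) \<in> K \<times> ?X \<inter> G -` (- U)})"
    by (rule openin_diff [rotated]) simp
  moreover have "?X - {y. \<exists>x. x \<in> K \<and> (x, y) \<in> K \<times> ?X \<inter> G -` (- U)} =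
      (\<lambda>x. mobu (fst x) (snd x)) -` W \<inter> topspace (top_of_set ?X)"
  proof -
    have "mobu (fst x) (snd x) \<in> W \<longleftrightarrow> (\<forall>z\<in>K. G (z, x) \<in> U)" if x: "x \<in> ?X" for x
    proof -
      have "mobu (fst x) (snd x) \<in> ball_aut" using x by (intro mobu_in_ball_aut) auto
      moreover have "mobu (fst x) (snd x) z = G (z, x)" if "z \<in> K" for z
        using that K(2) by (auto simp: G_def intro!: mobu_apply)
      ultimately show ?thesis unfolding W by (simp add: image_subset_iff)
    qed
    then show ?thesis by auto
  qed
  ultimately show "openin (top_of_set ?X) ((\<lambda>x. mobu (fst x) (snd x)) -` W \<inter> topspace (top_of_set ?X))"
    by simp
qed

lemma compactin_mobu_image:
  assumes "compact X" "X \<subseteq> {x. norm (fst x) < 1 \<and> unitary_matrix (snd x)}"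
  shows "compactin ball_aut_topology ((\<lambda>x. mobu (fst x) (snd x)) ` X)"
  by (rule image_compactin[OF _ continuous_map_mobu])
    (use assms in \<open>auto simp: compactin_subtopology\<close>)

lemma compact_subset_ball_bound:
  fixes K :: "'a :: real_normed_vector set"
  assumes "compact K" "\<And>z. z \<in> K \<Longrightarrow> norm z < 1"
  obtains r where "0 \<le> r" "r < 1" "\<And>z. z \<in> K \<Longrightarrow> norm z \<le> r"
proof (cases "K = {}")
  case True then show ?thesis by (intro that[of 0]) auto
next
  case False
  obtain z where "z \<in> K" "\<And>w. w \<in> K \<Longrightarrow> norm w \<le> norm z"
    using continuous_attains_sup[OF assms(1) False, of norm] by (auto intro: continuous_intros)
  then show ?thesis using assms(2) by (intro that[of "norm z"]) auto
qed

text \<open>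
  Evaluation at \<open>0\<close> is continuous, being tested by the compact set \<open>{0}\<close>.
\<close>
lemma compactin_ball_aut_bounded:
  fixes L :: "(complex ^ 'n \<Rightarrow> complex ^ 'n) set"
  assumes "compactin ball_aut_topology L"
  obtains r where "0 \<le> r" "r < 1" "\<And>\<gamma>. \<gamma> \<in> L \<Longrightarrow> norm (\<gamma> 0) \<le> r"
proof -
  have "continuous_map ball_aut_topology euclidean (\<lambda>\<gamma> :: complex ^ 'n \<Rightarrow> complex ^ 'n. \<gamma> 0)"
    unfolding continuous_map_alt topspace_ball_aut_topology
  proof (intro conjI allI impI)
    fix U :: "(complex ^ 'n) set" assume "openin euclidean U"
    then have "{\<gamma> \<in> ball_aut. \<gamma> ` {0} \<subseteq> U} \<in>
       {{\<gamma> \<in> ball_aut. \<gamma> ` K \<subseteq> U} | K U. compact K \<and> K \<subseteq> unit_ball \<and> open U}"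
      by (intro CollectI exI[of _ "{0}"] exI[of _ U]) auto
    then have "openin ball_aut_topology {\<gamma> \<in> ball_aut. \<gamma> ` {0} \<subseteq> U}"
      unfolding ball_aut_topology_def by (rule topology_generated_by_Basis)
    moreover have "{\<gamma> \<in> ball_aut. \<gamma> ` {0} \<subseteq> U} = (\<lambda>\<gamma>. \<gamma> 0) -` U \<inter> ball_aut" by auto
    ultimately show "openin ball_aut_topology ((\<lambda>\<gamma>. \<gamma> 0) -` U \<inter> ball_aut)" by simp
  qed auto
  from image_compactin[OF assms this] have "compact ((\<lambda>\<gamma>. \<gamma> 0) ` L)" by simp
  moreover have "L \<subseteq> ball_aut"
    using compactin_subset_topspace[OF assms] by (simp add: topspace_ball_aut_topology)
  then have "norm z < 1" if "z \<in> (\<lambda>\<gamma>. \<gamma> 0) ` L" for z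
    using that ball_aut_norm[of _ 0] by auto
  ultimately show ?thesis
    by (rule compact_subset_ball_bound) (use that in auto)
qed

section \<open>Compact groups of automorphisms\<close>

text \<open>
  The hyperbolic cosine of the distance of two points in the Poincare metric.  Its invariance and its
  convexity can be checked on this expression, without any reference to lengths of curves.
\<close>
definition cosh_dist :: "complex ^ 'n \<Rightarrow> complex ^ 'n \<Rightarrow> real"
  where "cosh_dist z w = cmod (1 - herm_prod z w) /
    (sqrt (1 - (norm z)\<^sup>2) * sqrt (1 - (norm w)\<^sup>2))"

lemma cosh_dist_mob:
  assumes a: "norm a < 1" and z: "norm z < 1" and w: "norm w < 1"
  shows "cosh_dist (mob a z) (mob a w) = cosh_dist z w"
proof -
  have nz: "1 - herm_prod z a \<noteq> 0" and nw: "1 - herm_prod w a \<noteq> 0"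
    using one_minus_herm_prod_nonzero[of z a] one_minus_herm_prod_nonzero[of w a] assms by simp_all
  have c: "cmod (1 - herm_prod a w) = cmod (1 - herm_prod w a)"
    using complex_mod_cnj[of "1 - herm_prod w a"] by (simp add: cnj_herm_prod)
  have p: "0 < 1 - (norm a)\<^sup>2" by (rule one_minus_norm_square_pos[OF a])
  define S where "S = sqrt (1 - (norm a)\<^sup>2)"
  have S: "S > 0" "1 - (norm a)\<^sup>2 = S * S" using p by (simp_all add: S_def)
  have e1: "cmod (1 - herm_prod (mob a z) (mob a w)) =
      S * S * cmod (1 - herm_prod z w) / (cmod (1 - herm_prod z a) * cmod (1 - herm_prod w a))"
    unfolding one_minus_herm_prod_mob[OF a nz nw] S(2) using S(1)
    by (simp add: norm_divide norm_mult c)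
  have e2: "sqrt (1 - (norm (mob a z))\<^sup>2) = S * sqrt (1 - (norm z)\<^sup>2) / cmod (1 - herm_prod z a)"
    unfolding one_minus_norm_mob[OF a nz] by (simp add: real_sqrt_mult real_sqrt_divide S_def)
  have e3: "sqrt (1 - (norm (mob a w))\<^sup>2) = S * sqrt (1 - (norm w)\<^sup>2) / cmod (1 - herm_prod w a)"
    unfolding one_minus_norm_mob[OF a nw] by (simp add: real_sqrt_mult real_sqrt_divide S_def)
  have "cmod (1 - herm_prod z a) > 0" "cmod (1 - herm_prod w a) > 0"
    using nz nw by simp_all
  then show ?thesis
    unfolding cosh_dist_def e1 e2 e3 using S(1) by simp
qed

lemma cosh_dist_ball_aut:
  fixes \<gamma> :: "complex ^ 'n \<Rightarrow> complex ^ 'n"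
  assumes \<gamma>: "\<gamma> \<in> ball_aut" and z: "norm z < 1" and w: "norm w < 1"
  shows "cosh_dist (\<gamma> z) (\<gamma> w) = cosh_dist z w"
proof -
  obtain A where A: "unitary_matrix A" "\<gamma> = mobu (\<gamma> 0) A" by (rule ball_aut_decomp[OF \<gamma>])
  have a: "norm (\<gamma> 0) < 1" using ball_aut_norm[OF \<gamma>, of 0] by simp
  have "\<gamma> z = mob (\<gamma> 0) (A *v z)" "\<gamma> w = mob (\<gamma> 0) (A *v w)"
    using A(2) mobu_apply[OF z] mobu_apply[OF w] by metis+
  then have "cosh_dist (\<gamma> z) (\<gamma> w) = cosh_dist (A *v z) (A *v w)"
    using cosh_dist_mob[OF a, of "A *v z" "A *v w"] z w by (simp add: unitary_norm[OF A(1)])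
  then show ?thesis
    by (simp add: cosh_dist_def unitary_norm[OF A(1)] unitary_herm_prod[OF A(1)])
qed

lemma cosh_dist_zero_right: "cosh_dist z 0 = 1 / sqrt (1 - (norm z)\<^sup>2)"
  by (simp add: cosh_dist_def)

lemma cosh_dist_nonneg: "norm z < 1 \<Longrightarrow> norm w < 1 \<Longrightarrow> 0 \<le> cosh_dist z w"
  using one_minus_norm_square_pos[of z] one_minus_norm_square_pos[of w]
  by (auto simp: cosh_dist_def)

text \<open>
  By invariance one of the two points may be moved to \<open>0\<close>.
\<close>
lemma one_less_cosh_dist:
  assumes z: "norm z < 1" and w: "norm w < 1" and "z \<noteq> w"
  shows "1 < cosh_dist z w"
proof -
  have "mob z w \<noteq> 0"
  proof
    assume "mob z w = 0"
    then have "w = z" using mob_mob[OF z w] by (simp add: mob_0)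
    then show False using \<open>z \<noteq> w\<close> by simp
  qed
  then have "0 < (norm (mob z w))\<^sup>2" by simp
  moreover have "0 < 1 - (norm (mob z w))\<^sup>2"
    by (rule one_minus_norm_square_pos[OF mob_in_ball[OF z w]])
  ultimately have "sqrt (1 - (norm (mob z w))\<^sup>2) < 1" "0 < sqrt (1 - (norm (mob z w))\<^sup>2)"
    by simp_all
  then have "1 < cosh_dist (mob z w) 0" by (simp add: cosh_dist_zero_right)
  also have "\<dots> = cosh_dist w z"
    using cosh_dist_mob[OF z w z] by (simp add: mob_self[OF z])
  also have "\<dots> = cosh_dist z w"
    using complex_mod_cnj[of "1 - herm_prod w z"] by (simp add: cosh_dist_def cnj_herm_prod mult.commute)
  finally show ?thesis .
qed

text \<open>
  In the linear model the points are represented by the vectors \<open>(z, 1)\<close> and \<open>(w, 1)\<close> for the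
  Hermitian form of signature \<open>(n, 1)\<close>.  The factors \<open>\<alpha>\<close> and \<open>\<beta>\<close> normalise these vectors and adjust
  their phases so that their product is real; the midpoint is represented by the sum of the two.
\<close>
lemma midpoint_exists:
  fixes z w :: "complex ^ 'n"
  assumes z: "norm z < 1" and w: "norm w < 1"
  obtains m where "norm m < 1"
    "\<And>k. norm k < 1 \<Longrightarrow>
       cosh_dist m k \<le> (cosh_dist z k + cosh_dist w k) / sqrt (2 + 2 * cosh_dist z w)"
proof -
  define d where "d = cosh_dist z w"
  define p where "p = sqrt (1 - (norm z)\<^sup>2)"
  define q where "q = sqrt (1 - (norm w)\<^sup>2)"
  have p: "p > 0" "p\<^sup>2 = 1 - (norm z)\<^sup>2" and q: "q > 0" "q\<^sup>2 = 1 - (norm w)\<^sup>2"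
    using one_minus_norm_square_pos[OF z] one_minus_norm_square_pos[OF w]
    by (simp_all add: p_def q_def)
  have d0: "d \<ge> 0" unfolding d_def by (rule cosh_dist_nonneg[OF z w])
  have nz: "1 - herm_prod z w \<noteq> 0" using one_minus_herm_prod_nonzero[of z w] z w by simp
  define \<alpha> where "\<alpha> = complex_of_real (1 / p)"
  define \<beta> where "\<beta> = sgn (1 - herm_prod z w) / of_real q"
  have na: "cmod \<alpha> = 1 / p" and nb: "cmod \<beta> = 1 / q"
    using p q nz by (simp_all add: \<alpha>_def \<beta>_def norm_divide norm_sgn)
  have aa: "\<alpha> * cnj \<alpha> = of_real (1 / p\<^sup>2)" and bb: "\<beta> * cnj \<beta> = of_real (1 / q\<^sup>2)"
    unfolding complex_norm_square [symmetric] na nb by (simp_all add: power_divide)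
  have ab: "\<alpha> * cnj \<beta> * (1 - herm_prod z w) = of_real d"
  proof -
    have "cnj (sgn c) * c = of_real (cmod c)" if "c \<noteq> 0" for c
    proof -
      have "c * cnj c = of_real (cmod c) * of_real (cmod c)"
        using complex_norm_square[of c] by (simp add: power2_eq_square)
      then show ?thesis using that by (simp add: sgn_eq mult.commute)
    qed
    note this[OF nz]
    then have "\<alpha> * cnj \<beta> * (1 - herm_prod z w) = of_real (1 / p) * (of_real (cmod (1 - herm_prod z w)) / of_real q)"
      by (simp add: \<alpha>_def \<beta>_def)
    then show ?thesis by (simp add: d_def cosh_dist_def p_def q_def)
  qed
  have ba: "\<beta> * cnj \<alpha> * (1 - herm_prod w z) = of_real d"
    using arg_cong[OF ab, of cnj] by (simp add: cnj_herm_prod mult_ac)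
  define M where "M = \<alpha> *s z + \<beta> *s w"
  have MM: "(\<alpha> + \<beta>) * cnj (\<alpha> + \<beta>) - herm_prod M M = of_real (2 + 2 * d)"
  proof -
    have "(\<alpha> + \<beta>) * cnj (\<alpha> + \<beta>) - herm_prod M M = \<alpha> * cnj \<alpha> * (1 - herm_prod z z)
       + \<beta> * cnj \<beta> * (1 - herm_prod w w) + \<alpha> * cnj \<beta> * (1 - herm_prod z w)
       + \<beta> * cnj \<alpha> * (1 - herm_prod w z)"
      by (simp add: M_def herm_prod_simps algebra_simps)
    also have "\<dots> = of_real (1 / p\<^sup>2 * p\<^sup>2 + 1 / q\<^sup>2 * q\<^sup>2 + d + d)"
    proof -
      have "1 - herm_prod z z = of_real (p\<^sup>2)" "1 - herm_prod w w = of_real (q\<^sup>2)"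
        by (simp_all add: herm_prod_self p(2) q(2))
      then show ?thesis unfolding aa bb ab ba by (simp only: of_real_add of_real_mult)
    qed
    also have "1 / p\<^sup>2 * p\<^sup>2 + 1 / q\<^sup>2 * q\<^sup>2 + d + d = 2 + 2 * d" using p(1) q(1) by simp
    finally show ?thesis .
  qed
  have MM': "(cmod (\<alpha> + \<beta>))\<^sup>2 - (norm M)\<^sup>2 = 2 + 2 * d"
  proof -
    have "complex_of_real ((cmod (\<alpha> + \<beta>))\<^sup>2 - (norm M)\<^sup>2) = of_real (2 + 2 * d)"
      unfolding MM [symmetric] herm_prod_self of_real_diff complex_norm_square ..
    then show ?thesis by (simp only: of_real_eq_iff)
  qed
  then have "(cmod (\<alpha> + \<beta>))\<^sup>2 > 0" using d0 zero_le_power2[of "norm M"] by linarith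
  then have s: "\<alpha> + \<beta> \<noteq> 0" "cmod (\<alpha> + \<beta>) > 0" by auto
  define m where "m = (1 / (\<alpha> + \<beta>)) *s M"
  have m2: "1 - (norm m)\<^sup>2 = (2 + 2 * d) / (cmod (\<alpha> + \<beta>))\<^sup>2"
  proof -
    have "(norm m)\<^sup>2 = (norm M)\<^sup>2 / (cmod (\<alpha> + \<beta>))\<^sup>2"
      by (simp add: m_def norm_cmult_vec norm_divide power_divide)
    moreover have "(cmod (\<alpha> + \<beta>))\<^sup>2 \<noteq> 0" using s by simp
    ultimately show ?thesis unfolding MM' [symmetric] by (simp add: diff_divide_distrib)
  qed
  then have "1 - (norm m)\<^sup>2 > 0" using s d0 by simp
  then have m1: "norm m < 1" by (simp add: power_less_one_iff)
  show ?thesis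
  proof (rule that[OF m1])
    fix k :: "complex ^ 'n" assume k: "norm k < 1"
    define e where "e = sqrt (1 - (norm k)\<^sup>2)"
    have e: "e > 0" using one_minus_norm_square_pos[OF k] by (simp add: e_def)
    have "(\<alpha> + \<beta>) * (1 - herm_prod m k) = \<alpha> * (1 - herm_prod z k) + \<beta> * (1 - herm_prod w k)"
    proof -
      have "(\<alpha> + \<beta>) * herm_prod m k = herm_prod M k"
        unfolding m_def herm_prod_cmult_left using s by simp
      then show ?thesis by (simp add: M_def herm_prod_simps algebra_simps)
    qed
    then have "cmod (\<alpha> + \<beta>) * cmod (1 - herm_prod m k) =
        cmod (\<alpha> * (1 - herm_prod z k) + \<beta> * (1 - herm_prod w k))"
      by (metis norm_mult)
    also have "\<dots> \<le> cmod (1 - herm_prod z k) / p + cmod (1 - herm_prod w k) / q"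
      using norm_triangle_ineq[of "\<alpha> * (1 - herm_prod z k)" "\<beta> * (1 - herm_prod w k)"]
      by (simp add: norm_mult na nb)
    finally have le: "cmod (\<alpha> + \<beta>) * cmod (1 - herm_prod m k) \<le>
        cmod (1 - herm_prod z k) / p + cmod (1 - herm_prod w k) / q" .
    have "sqrt (1 - (norm m)\<^sup>2) = sqrt (2 + 2 * d) / cmod (\<alpha> + \<beta>)"
      unfolding m2 using s by (simp add: real_sqrt_divide)
    then have "cosh_dist m k = cmod (\<alpha> + \<beta>) * cmod (1 - herm_prod m k) / (sqrt (2 + 2 * d) * e)"
      by (simp add: cosh_dist_def e_def)
    also have "\<dots> \<le> (cmod (1 - herm_prod z k) / p + cmod (1 - herm_prod w k) / q) / (sqrt (2 + 2 * d) * e)"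
      using le e d0 by (intro divide_right_mono) auto
    also have "\<dots> = (cosh_dist z k + cosh_dist w k) / sqrt (2 + 2 * d)"
      using e p q by (simp add: cosh_dist_def p_def [symmetric] q_def [symmetric] e_def [symmetric]
          add_divide_distrib mult_ac)
    finally show "cosh_dist m k \<le> (cosh_dist z k + cosh_dist w k) / sqrt (2 + 2 * cosh_dist z w)"
      unfolding d_def .
  qed
qed

text \<open>
  Existence is by compactness.  For uniqueness, the midpoint of two different centres would have
  a strictly smaller radius, because \<open>sqrt (2 + 2 * cosh_dist z w) > 2\<close>.
\<close>
lemma circumcentre_exists:
  fixes S :: "(complex ^ 'n) set"
  assumes S: "0 \<in> S" "\<And>k. k \<in> S \<Longrightarrow> norm k \<le> r" and r: "r < 1"
  obtains z c where "norm z < 1" "\<And>k. k \<in> S \<Longrightarrow> cosh_dist z k \<le> c"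
    "\<And>w. norm w < 1 \<Longrightarrow> (\<And>k. k \<in> S \<Longrightarrow> cosh_dist w k \<le> c) \<Longrightarrow> w = z"
proof -
  have k1: "norm k < 1" if "k \<in> S" for k using S(2)[OF that] r by simp
  define R where "R = {c. \<exists>z. norm z < 1 \<and> (\<forall>k\<in>S. cosh_dist z k \<le> c)}"
  have R0: "0 \<le> c" if "c \<in> R" for c
    using that S(1) cosh_dist_nonneg[of _ 0] by (force simp: R_def)
  have "R \<noteq> {}"
  proof -
    have "cosh_dist 0 k \<le> 1 / sqrt (1 - r\<^sup>2)" if "k \<in> S" for k
    proof -
      have "(norm k)\<^sup>2 \<le> r\<^sup>2" using S(2)[OF that] by (simp add: power_mono)
      moreover have "0 < 1 - r\<^sup>2"
        using r S(2)[OF S(1)] by (simp add: power_less_one_iff)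
      ultimately show ?thesis
        by (simp add: cosh_dist_def frac_le)
    qed
    then have "1 / sqrt (1 - r\<^sup>2) \<in> R" by (auto simp: R_def intro!: exI[of _ 0])
    then show ?thesis by auto
  qed
  define c where "c = Inf R"
  have bdd: "bdd_below R" using R0 by (auto intro!: bdd_belowI)
  have "\<exists>z. norm z < 1 \<and> (\<forall>k\<in>S. cosh_dist z k \<le> c + inverse (real (Suc i)))" for i
  proof -
    have "Inf R < c + inverse (real (Suc i))" unfolding c_def by simp
    then obtain x where "x \<in> R" "x < c + inverse (real (Suc i))"
      using cInf_lessD[OF \<open>R \<noteq> {}\<close>] by blast
    then show ?thesis unfolding R_def by force
  qed
  then obtain z where z: "\<And>i. norm (z i) < 1"
    "\<And>i k. k \<in> S \<Longrightarrow> cosh_dist (z i) k \<le> c + inverse (real (Suc i))" by metis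
  have c0: "c \<ge> 0" unfolding c_def using \<open>R \<noteq> {}\<close> R0 by (rule cInf_greatest)
  \<comment> \<open>As \<open>0 \<in> S\<close>, almost optimal centres have bounded distance from \<open>0\<close> and stay away from the sphere.\<close>
  define \<rho> where "\<rho> = 1 - 1 / (c + 1)\<^sup>2"
  have zb: "(norm (z i))\<^sup>2 \<le> \<rho>" for i
  proof -
    have p: "0 < 1 - (norm (z i))\<^sup>2" by (rule one_minus_norm_square_pos[OF z(1)])
    have "inverse (real (Suc i)) \<le> 1" by (simp add: inverse_le_1_iff)
    then have "1 / sqrt (1 - (norm (z i))\<^sup>2) \<le> c + 1"
      using z(2)[OF S(1), of i] unfolding cosh_dist_zero_right by linarith
    then have "1 / (c + 1) \<le> sqrt (1 - (norm (z i))\<^sup>2)"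
      using p c0 by (simp add: field_simps)
    then have "(1 / (c + 1))\<^sup>2 \<le> (sqrt (1 - (norm (z i))\<^sup>2))\<^sup>2"
      using c0 by (intro power_mono) auto
    then show ?thesis using p by (simp add: \<rho>_def power_divide)
  qed
  have "\<rho> < 1" using c0 by (simp add: \<rho>_def)
  have "\<rho> \<ge> 0" using zb[of 0] zero_le_power2 order_trans by blast
  have "z i \<in> cball 0 (sqrt \<rho>)" for i
    using zb[of i] by (simp add: real_le_rsqrt)
  then obtain l \<sigma> where l: "l \<in> cball 0 (sqrt \<rho>)" "strict_mono \<sigma>" "(z \<circ> \<sigma>) \<longlonglongrightarrow> l"
    using compact_cball[of "0 :: complex ^ 'n" "sqrt \<rho>"] unfolding compact_def by blast
  have l1: "norm l < 1"
    using l(1) \<open>\<rho> < 1\<close> \<open>\<rho> \<ge> 0\<close> real_sqrt_lt_1_iff[of \<rho>] by (simp add: le_less_trans)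
  have lc: "cosh_dist l k \<le> c" if "k \<in> S" for k
  proof (rule LIMSEQ_le)
    have "sqrt (1 - (norm l)\<^sup>2) * sqrt (1 - (norm k)\<^sup>2) \<noteq> 0"
      using one_minus_norm_square_pos[OF l1] one_minus_norm_square_pos[OF k1[OF that]] by simp
    then show "(\<lambda>i. cosh_dist (z (\<sigma> i)) k) \<longlonglongrightarrow> cosh_dist l k"
      unfolding cosh_dist_def using l(3) by (intro tendsto_intros) (auto simp: o_def)
    have "(\<lambda>i. inverse (real (Suc (\<sigma> i)))) \<longlonglongrightarrow> 0"
      using LIMSEQ_subseq_LIMSEQ[OF LIMSEQ_inverse_real_of_nat l(2)] by (simp add: o_def)
    then show "(\<lambda>i. c + inverse (real (Suc (\<sigma> i)))) \<longlonglongrightarrow> c"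
      using tendsto_add[OF tendsto_const[of c]] by fastforce
    show "\<exists>N. \<forall>n\<ge>N. cosh_dist (z (\<sigma> n)) k \<le> c + inverse (real (Suc (\<sigma> n)))"
      using z(2)[OF that] by blast
  qed
  have "w = l" if w: "norm w < 1" "\<And>k. k \<in> S \<Longrightarrow> cosh_dist w k \<le> c" for w
  proof (rule ccontr)
    assume "w \<noteq> l"
    let ?d = "cosh_dist l w"
    have d: "1 < ?d" using one_less_cosh_dist[OF l1 w(1)] \<open>w \<noteq> l\<close> by auto
    obtain m where m: "norm m < 1" "\<And>k. norm k < 1 \<Longrightarrow>
       cosh_dist m k \<le> (cosh_dist l k + cosh_dist w k) / sqrt (2 + 2 * ?d)"
      using midpoint_exists[OF l1 w(1)] by blast
    have "cosh_dist m k \<le> 2 * c / sqrt (2 + 2 * ?d)" if "k \<in> S" for k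
    proof -
      have "(cosh_dist l k + cosh_dist w k) / sqrt (2 + 2 * ?d) \<le> 2 * c / sqrt (2 + 2 * ?d)"
        using lc[OF that] w(2)[OF that] d by (intro divide_right_mono) auto
      then show ?thesis using m(2)[OF k1[OF that]] by simp
    qed
    then have "2 * c / sqrt (2 + 2 * ?d) \<in> R" using m(1) by (auto simp: R_def)
    then have "c \<le> 2 * c / sqrt (2 + 2 * ?d)" unfolding c_def by (rule cInf_lower[OF _ bdd])
    moreover have "sqrt (2 + 2 * ?d) > 2"
      using d by (intro real_less_rsqrt) simp
    moreover have "c > 0"
      using lc[OF S(1)] one_minus_norm_square_pos[OF l1]
      by (smt (verit) cosh_dist_zero_right divide_pos_pos real_sqrt_gt_zero)
    moreover from calculation have "0 < sqrt (2 + 2 * ?d)" by linarith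
    ultimately have "c * sqrt (2 + 2 * ?d) \<le> 2 * c" "2 * c < c * sqrt (2 + 2 * ?d)"
      using mult_strict_left_mono[of 2 "sqrt (2 + 2 * ?d)" c] by (simp_all add: pos_le_divide_eq)
    then show False by linarith
  qed
  then show ?thesis using that[OF l1 lc] by blast
qed

text \<open>
  Every element of the group permutes the orbit of \<open>0\<close> isometrically, so it fixes the unique
  circumcentre of the orbit.
\<close>
lemma compact_subgroup_fixes_point:
  fixes L :: "(complex ^ 'n \<Rightarrow> complex ^ 'n) set"
  assumes L: "subgroup L ball_aut_group" and c: "compactin ball_aut_topology L"
  obtains p where "norm p < 1" "\<And>\<gamma>. \<gamma> \<in> L \<Longrightarrow> \<gamma> p = p"
proof -
  interpret subgroup L ball_aut_group by (rule L)
  have sub: "\<gamma> \<in> ball_aut" if "\<gamma> \<in> L" for \<gamma> using subset that by (auto simp: carrier_ball_aut_group)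
  obtain r where r: "r < 1" "\<And>\<gamma>. \<gamma> \<in> L \<Longrightarrow> norm (\<gamma> 0) \<le> r"
    by (rule compactin_ball_aut_bounded[OF c]) auto
  let ?S = "(\<lambda>\<gamma>. \<gamma> 0) ` L"
  have S0: "0 \<in> ?S"
    by (rule image_eqI[OF _ one_closed]) (simp add: one_ball_aut_apply)
  have Sr: "norm k \<le> r" if "k \<in> ?S" for k using that r(2) by auto
  show ?thesis
  proof (rule circumcentre_exists[OF S0 Sr r(1)])
    fix z :: "complex ^ 'n" and b
    assume z: "norm z < 1" "\<And>k. k \<in> ?S \<Longrightarrow> cosh_dist z k \<le> b"
      "\<And>w. norm w < 1 \<Longrightarrow> (\<And>k. k \<in> ?S \<Longrightarrow> cosh_dist w k \<le> b) \<Longrightarrow> w = z"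
    show ?thesis
    proof (rule that[OF z(1)])
      fix \<gamma> assume \<gamma>: "\<gamma> \<in> L"
      let ?i = "inv\<^bsub>ball_aut_group\<^esub> \<gamma>"
      show "\<gamma> z = z"
      proof (rule z(3))
        show "norm (\<gamma> z) < 1" by (rule ball_aut_norm[OF sub[OF \<gamma>] z(1)])
        fix k assume "k \<in> ?S"
        then obtain \<delta> where \<delta>: "\<delta> \<in> L" "k = \<delta> 0" by blast
        have k1: "norm k < 1" using ball_aut_norm[OF sub[OF \<delta>(1)], of 0] \<delta>(2) by simp
        have "?i \<otimes>\<^bsub>ball_aut_group\<^esub> \<delta> \<in> L" using \<gamma> \<delta>(1) by (simp add: m_closed m_inv_closed)
        moreover have "(?i \<otimes>\<^bsub>ball_aut_group\<^esub> \<delta>) 0 = ?i k"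
          using mult_ball_aut_apply[OF inv_ball_aut(1)[OF sub[OF \<gamma>]] sub[OF \<delta>(1)], of 0] \<delta>(2) by simp
        ultimately have "?i k \<in> ?S" by (metis image_eqI)
        then have "cosh_dist z (?i k) \<le> b" by (rule z(2))
        moreover have "cosh_dist (\<gamma> z) (\<gamma> (?i k)) = cosh_dist z (?i k)"
          by (rule cosh_dist_ball_aut[OF sub[OF \<gamma>] z(1) ball_aut_norm[OF inv_ball_aut(1)[OF sub[OF \<gamma>]] k1]])
        ultimately show "cosh_dist (\<gamma> z) k \<le> b" by (simp add: inv_ball_aut(3)[OF sub[OF \<gamma>] k1])
      qed
    qed
  qed
qed

definition ball_stabilizer :: "complex ^ 'n \<Rightarrow> (complex ^ 'n \<Rightarrow> complex ^ 'n) set"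
  where "ball_stabilizer p = {\<gamma> \<in> ball_aut. \<gamma> p = p}"

lemma subgroup_ball_stabilizer:
  assumes p: "norm p < 1"
  shows "subgroup (ball_stabilizer p) ball_aut_group"
proof -
  interpret group ball_aut_group by (rule group_ball_aut_group)
  show ?thesis
  proof (rule subgroupI)
    show "ball_stabilizer p \<subseteq> carrier ball_aut_group"
      by (auto simp: ball_stabilizer_def carrier_ball_aut_group)
    have "\<one>\<^bsub>ball_aut_group\<^esub> \<in> ball_stabilizer p"
      using one_closed by (simp add: ball_stabilizer_def carrier_ball_aut_group one_ball_aut_apply[OF p])
    then show "ball_stabilizer p \<noteq> {}" by auto
    show "inv\<^bsub>ball_aut_group\<^esub> \<gamma> \<in> ball_stabilizer p" if "\<gamma> \<in> ball_stabilizer p" for \<gamma>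
      using that inv_ball_aut(1,2)[of \<gamma>] p by (auto simp: ball_stabilizer_def) metis
    show "\<gamma> \<otimes>\<^bsub>ball_aut_group\<^esub> \<delta> \<in> ball_stabilizer p"
      if "\<gamma> \<in> ball_stabilizer p" "\<delta> \<in> ball_stabilizer p" for \<gamma> \<delta>
      using that p by (auto simp: ball_stabilizer_def mult_ball_aut_closed mult_ball_aut_apply)
  qed
qed

text \<open>
  The orbit of \<open>0\<close> stays away from the sphere because an automorphism fixing \<open>p\<close> preserves the
  distance to \<open>p\<close>; the remaining conditions on the coordinates are closed.
\<close>
lemma compactin_ball_stabilizer:
  fixes p :: "complex ^ 'n"
  assumes p: "norm p < 1"
  shows "compactin ball_aut_topology (ball_stabilizer p)"
proof -
  \<comment> \<open>From \<open>\<bar>1 - \<langle>p, \<gamma> 0\<rangle>\<bar> = sqrt (1 - \<bar>\<gamma> 0\<bar>\<^sup>2)\<close>, where the left-hand side is at least \<open>1 - \<bar>p\<bar>\<close>.\<close>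
  define s where "s = sqrt (1 - (1 - norm p)\<^sup>2)"
  have s1: "s < 1" using p by (simp add: s_def)
  define Y where "Y = cball (0 :: complex ^ 'n) s \<times> {A :: complex ^ 'n ^ 'n. unitary_matrix A}"
  define X where "X = {x \<in> Y. mob (fst x) (snd x *v p) = p}"
  have Y: "norm (fst x) < 1" "unitary_matrix (snd x)" if "x \<in> Y" for x
    using that s1 by (auto simp: Y_def)
  have "compact Y" unfolding Y_def by (intro compact_Times compact_cball compact_unitary)
  moreover have "continuous_on Y (\<lambda>x. mob (fst x) (snd x *v p))"
    using Y p by (intro continuous_on_mob continuous_intros) (auto simp: unitary_norm)
  then have "closedin (top_of_set Y) X"
    unfolding X_def by (intro continuous_closedin_preimage_constant)
  ultimately have "compact X" by (rule closedin_compact)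
  then have "compactin ball_aut_topology ((\<lambda>x. mobu (fst x) (snd x)) ` X)"
    by (rule compactin_mobu_image) (use Y in \<open>auto simp: X_def\<close>)
  moreover have "(\<lambda>x. mobu (fst x) (snd x)) ` X = ball_stabilizer p"
  proof
    show "(\<lambda>x. mobu (fst x) (snd x)) ` X \<subseteq> ball_stabilizer p"
      using Y p by (auto simp: ball_stabilizer_def X_def mobu_in_ball_aut mobu_apply)
    show "ball_stabilizer p \<subseteq> (\<lambda>x. mobu (fst x) (snd x)) ` X"
    proof
      fix \<gamma> assume "\<gamma> \<in> ball_stabilizer p"
      then have \<gamma>: "\<gamma> \<in> ball_aut" "\<gamma> p = p" by (auto simp: ball_stabilizer_def)
      obtain A where A: "unitary_matrix A" "\<gamma> = mobu (\<gamma> 0) A" by (rule ball_aut_decomp[OF \<gamma>(1)])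
      have g0: "norm (\<gamma> 0) < 1" using ball_aut_norm[OF \<gamma>(1), of 0] by simp
      have pp: "0 < 1 - (norm p)\<^sup>2" and gp: "0 < 1 - (norm (\<gamma> 0))\<^sup>2"
        using one_minus_norm_square_pos p g0 by blast+
      have "cosh_dist p (\<gamma> 0) = cosh_dist p 0"
        using cosh_dist_ball_aut[OF \<gamma>(1) p, of 0] \<gamma>(2) by simp
      then have "cmod (1 - herm_prod p (\<gamma> 0)) = sqrt (1 - (norm (\<gamma> 0))\<^sup>2)"
        using pp gp by (simp add: cosh_dist_def field_simps)
      moreover have "1 - norm p \<le> cmod (1 - herm_prod p (\<gamma> 0))"
      proof -
        have "norm p * norm (\<gamma> 0) \<le> norm p" using g0 by (simp add: mult_left_le)
        then have "cmod (herm_prod p (\<gamma> 0)) \<le> norm p"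
          using herm_prod_Cauchy_Schwarz[of p "\<gamma> 0"] by linarith
        then show ?thesis using norm_triangle_ineq2[of 1 "herm_prod p (\<gamma> 0)"] by simp
      qed
      ultimately have "(1 - norm p)\<^sup>2 \<le> (sqrt (1 - (norm (\<gamma> 0))\<^sup>2))\<^sup>2"
        using p by (intro power_mono) auto
      then have "(norm (\<gamma> 0))\<^sup>2 \<le> 1 - (1 - norm p)\<^sup>2" using gp by simp
      then have "norm (\<gamma> 0) \<le> s" unfolding s_def by (rule real_le_rsqrt)
      moreover have "mob (\<gamma> 0) (A *v p) = p"
        unfolding mobu_apply[OF p, symmetric] A(2) [symmetric] by (rule \<gamma>(2))
      ultimately have "(\<gamma> 0, A) \<in> X"
        using A(1) by (simp add: X_def Y_def)
      then show "\<gamma> \<in> (\<lambda>x. mobu (fst x) (snd x)) ` X"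
        by (intro image_eqI[of _ _ "(\<gamma> 0, A)"]) (simp_all add: A(2) [symmetric])
    qed
  qed
  ultimately show ?thesis by simp
qed

lemma unitary_group_eq: "unitary_group = ball_stabilizer 0"
proof
  show "unitary_group \<subseteq> (ball_stabilizer 0 :: (complex ^ 'n \<Rightarrow> complex ^ 'n) set)"
  proof
    fix \<gamma> :: "complex ^ 'n \<Rightarrow> complex ^ 'n" assume "\<gamma> \<in> unitary_group"
    then obtain A where A: "unitary_matrix A" "\<gamma> = restrict (\<lambda>z. A *v z) unit_ball"
      by (auto simp: unitary_group_def)
    have "restrict (\<lambda>z. A *v z) unit_ball \<in> ball_aut"
      by (rule ball_autI[where g = "\<lambda>z. ctranspose A *v z"])
        (simp_all add: holomorphic_matrix_vector_mult unitary_norm A unitary_ctranspose)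
    then show "\<gamma> \<in> ball_stabilizer 0" using A by (simp add: ball_stabilizer_def)
  qed
  show "(ball_stabilizer 0 :: (complex ^ 'n \<Rightarrow> complex ^ 'n) set) \<subseteq> unitary_group"
    by (auto simp: ball_stabilizer_def unitary_group_def elim: ball_aut_fix_zero)
qed

lemma ball_stabilizer_conjugate:
  assumes p: "norm p < 1"
  obtains \<phi> where "\<phi> \<in> carrier ball_aut_group"
    "ball_stabilizer p = (\<phi> <#\<^bsub>ball_aut_group\<^esub> unitary_group) #>\<^bsub>ball_aut_group\<^esub> (inv\<^bsub>ball_aut_group\<^esub> \<phi>)"
proof -
  interpret group ball_aut_group by (rule group_ball_aut_group)
  define \<phi> where "\<phi> = restrict (mob p) unit_ball"
  have \<phi>: "\<phi> \<in> ball_aut" unfolding \<phi>_def by (rule mob_in_ball_aut[OF p])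
  have \<phi>0: "\<phi> 0 = p" and \<phi>p: "(inv\<^bsub>ball_aut_group\<^esub> \<phi>) p = 0"
    using inv_ball_aut(2)[OF \<phi>, of 0] by (simp_all add: \<phi>_def mob_0)
  let ?i = "inv\<^bsub>ball_aut_group\<^esub> \<phi>"
  note i = inv_ball_aut(1)[OF \<phi>]
  have eq: "(\<phi> <#\<^bsub>ball_aut_group\<^esub> unitary_group) #>\<^bsub>ball_aut_group\<^esub> ?i =
      {\<phi> \<otimes>\<^bsub>ball_aut_group\<^esub> \<gamma> \<otimes>\<^bsub>ball_aut_group\<^esub> ?i | \<gamma>. \<gamma> \<in> ball_stabilizer 0}"
    unfolding unitary_group_eq by (auto simp: l_coset_def r_coset_def)
  have "\<phi> \<otimes>\<^bsub>ball_aut_group\<^esub> \<gamma> \<otimes>\<^bsub>ball_aut_group\<^esub> ?i \<in> ball_stabilizer p" if "\<gamma> \<in> ball_stabilizer 0" for \<gamma>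
  proof -
    have g: "\<gamma> \<in> ball_aut" "\<gamma> 0 = 0" using that by (auto simp: ball_stabilizer_def)
    show ?thesis
      using g \<phi> i p by (simp add: ball_stabilizer_def mult_ball_aut_closed mult_ball_aut_apply \<phi>p \<phi>0)
  qed
  moreover have "\<exists>\<gamma>. \<delta> = \<phi> \<otimes>\<^bsub>ball_aut_group\<^esub> \<gamma> \<otimes>\<^bsub>ball_aut_group\<^esub> ?i \<and> \<gamma> \<in> ball_stabilizer 0"
    if "\<delta> \<in> ball_stabilizer p" for \<delta>
  proof (intro exI conjI)
    have d: "\<delta> \<in> ball_aut" "\<delta> p = p" using that by (auto simp: ball_stabilizer_def)
    let ?\<gamma> = "?i \<otimes>\<^bsub>ball_aut_group\<^esub> \<delta> \<otimes>\<^bsub>ball_aut_group\<^esub> \<phi>"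
    have "norm (\<phi> 0) < 1" by (simp add: \<phi>0 p)
    then show "?\<gamma> \<in> ball_stabilizer 0"
      using d \<phi> i p by (simp add: ball_stabilizer_def mult_ball_aut_closed mult_ball_aut_apply \<phi>p \<phi>0)
    have "\<delta> \<in> carrier ball_aut_group" "\<phi> \<in> carrier ball_aut_group" "?i \<in> carrier ball_aut_group"
      using d \<phi> i by (simp_all add: carrier_ball_aut_group)
    then show "\<delta> = \<phi> \<otimes>\<^bsub>ball_aut_group\<^esub> ?\<gamma> \<otimes>\<^bsub>ball_aut_group\<^esub> ?i"
      by (simp add: m_assoc) (simp add: m_assoc [symmetric])
  qed
  ultimately have "ball_stabilizer p = (\<phi> <#\<^bsub>ball_aut_group\<^esub> unitary_group) #>\<^bsub>ball_aut_group\<^esub> ?i"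
    unfolding eq by auto
  then show ?thesis
    using that[of \<phi>] \<phi> by (simp add: carrier_ball_aut_group)
qed

text \<open>
  A compact subgroup containing the stabiliser fixes some point \<open>q\<close>.  The stabiliser contains the
  point reflection at \<open>p\<close>, whose only fixed point is \<open>p\<close>, so \<open>q = p\<close>.
\<close>
lemma maximal_compact_ball_stabilizer:
  fixes p :: "complex ^ 'n"
  assumes p: "norm p < 1"
  shows "maximal_compact_subgroup (ball_stabilizer p)"
  unfolding maximal_compact_subgroup_def
proof (intro conjI allI impI subgroup_ball_stabilizer compactin_ball_stabilizer p)
  fix L :: "(complex ^ 'n \<Rightarrow> complex ^ 'n) set"
  assume L: "subgroup L ball_aut_group \<and> compactin ball_aut_topology L \<and> ball_stabilizer p \<subseteq> L"
  then have "subgroup L ball_aut_group" "compactin ball_aut_topology L" by auto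
  then obtain q where q: "norm q < 1" "\<And>\<gamma>. \<gamma> \<in> L \<Longrightarrow> \<gamma> q = q"
    by (rule compact_subgroup_fixes_point) auto
  \<comment> \<open>The point reflection at \<open>p\<close>.\<close>
  define \<gamma> where "\<gamma> = restrict (\<lambda>z. mob p (- mob p z)) unit_ball"
  have "\<gamma> \<in> ball_aut"
    unfolding \<gamma>_def
  proof (rule ball_autI)
    have n: "holomorphic_map_on (\<lambda>z :: complex ^ 'n. - z) unit_ball"
      by (rule holomorphic_map_onI[where D = "\<lambda>_ v. - v"]) (auto intro!: derivative_eq_intros)
    have m: "mob p ` unit_ball \<subseteq> unit_ball" using mob_in_ball[OF p] by auto
    have m': "(\<lambda>z. - mob p z) ` unit_ball \<subseteq> unit_ball" using mob_in_ball[OF p] by auto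
    show "holomorphic_map_on (\<lambda>z. mob p (- mob p z)) unit_ball"
      "holomorphic_map_on (\<lambda>z. mob p (- mob p z)) unit_ball"
      by (rule holomorphic_map_on_compose[OF holomorphic_map_on_compose[OF holomorphic_mob[OF p] n m]
            holomorphic_mob[OF p] m'])+
  qed (simp_all add: mob_in_ball mob_mob p)
  then have "\<gamma> \<in> ball_stabilizer p"
    using p by (simp add: ball_stabilizer_def \<gamma>_def mob_self mob_0)
  then have "\<gamma> q = q" using L q(2) by blast
  then have "mob p (- mob p q) = q" using q(1) by (simp add: \<gamma>_def)
  then have "- mob p q = mob p q"
    using mob_mob[OF p, of "- mob p q"] mob_in_ball[OF p q(1)] by simp
  then have "mob p q = 0" by (simp add: vec_eq_iff)
  then have "q = p" using mob_mob[OF p q(1)] by (simp add: mob_0)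
  have "L \<subseteq> ball_aut"
    using L subgroup.subset[of L ball_aut_group] by (simp add: carrier_ball_aut_group)
  then have "L \<subseteq> ball_stabilizer p" using q(2) \<open>q = p\<close> by (auto simp: ball_stabilizer_def)
  then show "L = ball_stabilizer p" using L by auto
qed

section \<open>Geodesics of the ball\<close>

lemma one_minus_herm_prod_self: "1 - herm_prod z z = of_real (1 - (norm z)\<^sup>2)"
  by (simp add: herm_prod_self)

text \<open>
  Replacing the norm by the Hermitian product makes the denominators smooth expressions to which
  the product and quotient rules apply.
\<close>
lemma poincare_metric_alt:
  "poincare_metric z v w =
     Re (herm_prod v w / (1 - herm_prod z z) + herm_prod v z * herm_prod z w / (1 - herm_prod z z)\<^sup>2)"
  by (simp add: poincare_metric_def herm_prod_self)

lemma poincare_metric_derivative: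
  assumes z: "norm z < 1"
  shows "frechet_derivative (\<lambda>y. poincare_metric y v w) (at z) d =
    Re (herm_prod v w * (herm_prod z d + herm_prod d z) / (1 - herm_prod z z)\<^sup>2 +
        (herm_prod v d * herm_prod z w + herm_prod v z * herm_prod d w) / (1 - herm_prod z z)\<^sup>2 +
        2 * herm_prod v z * herm_prod z w * (herm_prod z d + herm_prod d z) / (1 - herm_prod z z)^3)"
proof -
  have nz: "1 - herm_prod z z \<noteq> 0" using one_minus_herm_prod_nonzero[of z z] z by simp
  have 1: "((\<lambda>y. herm_prod v y) has_derivative (\<lambda>d. herm_prod v d)) (at z)"
    by (rule bounded_linear_imp_has_derivative
        [OF bounded_bilinear.bounded_linear_right[OF bounded_bilinear_herm_prod]])
  have 2: "((\<lambda>y. herm_prod y w) has_derivative (\<lambda>d. herm_prod d w)) (at z)"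
    by (rule bounded_linear_imp_has_derivative
        [OF bounded_bilinear.bounded_linear_left[OF bounded_bilinear_herm_prod]])
  have 3: "((\<lambda>y. 1 - herm_prod y y) has_derivative (\<lambda>d. - (herm_prod z d + herm_prod d z))) (at z)"
    using has_derivative_diff[OF has_derivative_const
        has_derivative_herm_prod[OF has_derivative_ident has_derivative_ident], of 1 z] by simp
  have 4: "((\<lambda>y. inverse (1 - herm_prod y y)) has_derivative
      (\<lambda>d. (herm_prod z d + herm_prod d z) / (1 - herm_prod z z)\<^sup>2)) (at z)"
    using Deriv.has_derivative_inverse[OF nz 3]
    by (simp add: power2_eq_square divide_inverse mult_ac del: minus_add_distrib)
  have 5: "((\<lambda>y. herm_prod v w * inverse (1 - herm_prod y y)) has_derivative
      (\<lambda>d. herm_prod v w * ((herm_prod z d + herm_prod d z) / (1 - herm_prod z z)\<^sup>2))) (at z)"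
    by (rule has_derivative_mult_right[OF 4])
  have 6: "((\<lambda>y. (herm_prod v y * herm_prod y w) * (inverse (1 - herm_prod y y) * inverse (1 - herm_prod y y)))
     has_derivative (\<lambda>d. (herm_prod v z * herm_prod z w) *
       (inverse (1 - herm_prod z z) * ((herm_prod z d + herm_prod d z) / (1 - herm_prod z z)\<^sup>2) +
        ((herm_prod z d + herm_prod d z) / (1 - herm_prod z z)\<^sup>2) * inverse (1 - herm_prod z z)) +
       (herm_prod v z * herm_prod d w + herm_prod v d * herm_prod z w) *
       (inverse (1 - herm_prod z z) * inverse (1 - herm_prod z z)))) (at z)"
    by (rule has_derivative_mult[OF has_derivative_mult[OF 1 2] has_derivative_mult[OF 4 4]])
  have 7: "((\<lambda>y. poincare_metric y v w) has_derivative (\<lambda>d. Re (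
       herm_prod v w * ((herm_prod z d + herm_prod d z) / (1 - herm_prod z z)\<^sup>2) +
       ((herm_prod v z * herm_prod z w) *
       (inverse (1 - herm_prod z z) * ((herm_prod z d + herm_prod d z) / (1 - herm_prod z z)\<^sup>2) +
        ((herm_prod z d + herm_prod d z) / (1 - herm_prod z z)\<^sup>2) * inverse (1 - herm_prod z z)) +
       (herm_prod v z * herm_prod d w + herm_prod v d * herm_prod z w) *
       (inverse (1 - herm_prod z z) * inverse (1 - herm_prod z z)))))) (at z)"
    using bounded_linear.has_derivative[OF bounded_linear_Re has_derivative_add[OF 5 6]]
    by (simp add: poincare_metric_alt divide_inverse power2_eq_square)
  have "frechet_derivative (\<lambda>y. poincare_metric y v w) (at z) d = Re (
       herm_prod v w * ((herm_prod z d + herm_prod d z) / (1 - herm_prod z z)\<^sup>2) +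
       ((herm_prod v z * herm_prod z w) *
       (inverse (1 - herm_prod z z) * ((herm_prod z d + herm_prod d z) / (1 - herm_prod z z)\<^sup>2) +
        ((herm_prod z d + herm_prod d z) / (1 - herm_prod z z)\<^sup>2) * inverse (1 - herm_prod z z)) +
       (herm_prod v z * herm_prod d w + herm_prod v d * herm_prod z w) *
       (inverse (1 - herm_prod z z) * inverse (1 - herm_prod z z))))"
    by (rule fun_cong[OF frechet_derivative_at[OF 7, symmetric]])
  moreover have "X * (P / R\<^sup>2) + ((Y * Z) * (inverse R * (P / R\<^sup>2) + (P / R\<^sup>2) * inverse R) +
      (Y * D + V * Z) * (inverse R * inverse R)) =
      X * P / R\<^sup>2 + (V * Z + Y * D) / R\<^sup>2 + 2 * Y * Z * P / R^3" for X P Y Z D V R :: complex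
    by (simp add: divide_inverse power2_eq_square power3_eq_cube algebra_simps)
  ultimately show ?thesis by (simp only:)
qed

text \<open>
  The three derivatives in the Christoffel symbol combine to a metric product with \<open>w\<close>, so the
  acceleration term in the geodesic equation can be read off.
\<close>
lemma christoffel_poincare_metric:
  assumes z: "norm z < 1"
  shows "christoffel poincare_metric z u u w =
    poincare_metric z ((2 * herm_prod u z / of_real (1 - (norm z)\<^sup>2)) *s u) w"
proof -
  define R where "R = 1 - herm_prod z z"
  define F where "F = herm_prod u u * herm_prod z w / R\<^sup>2 + herm_prod u w * herm_prod z u / R\<^sup>2
     + 2 * herm_prod u z * herm_prod z u * herm_prod z w / R^3"
  have nz: "R \<noteq> 0" using one_minus_herm_prod_nonzero[of z z] z by (simp add: R_def)
  have R': "of_real (1 - (norm z)\<^sup>2) = R" by (simp add: R_def herm_prod_self)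
  have cR: "cnj R = R" by (simp add: R_def cnj_herm_prod)
  have "herm_prod u u * (herm_prod z w + herm_prod w z) / R\<^sup>2 +
        (herm_prod u w * herm_prod z u + herm_prod u z * herm_prod w u) / R\<^sup>2 +
        2 * herm_prod u z * herm_prod z u * (herm_prod z w + herm_prod w z) / R^3 = F + cnj F"
    by (simp add: F_def cR cnj_herm_prod add_divide_distrib algebra_simps)
  then have 3: "frechet_derivative (\<lambda>y. poincare_metric y u u) (at z) w = 2 * Re F"
    unfolding poincare_metric_derivative[OF z] R_def [symmetric] by simp
  have "christoffel poincare_metric z u u w =
    Re (herm_prod u w * (herm_prod z u + herm_prod u z) / R\<^sup>2 +
        (herm_prod u u * herm_prod z w + herm_prod u z * herm_prod u w) / R\<^sup>2 +
        2 * herm_prod u z * herm_prod z w * (herm_prod z u + herm_prod u z) / R^3) - Re F"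
    unfolding christoffel_def 3 unfolding poincare_metric_derivative[OF z] R_def by simp
  also have "\<dots> = Re (herm_prod u w * (herm_prod z u + herm_prod u z) / R\<^sup>2 +
        (herm_prod u u * herm_prod z w + herm_prod u z * herm_prod u w) / R\<^sup>2 +
        2 * herm_prod u z * herm_prod z w * (herm_prod z u + herm_prod u z) / R^3 - F)"
    by simp
  also have "herm_prod u w * (herm_prod z u + herm_prod u z) / R\<^sup>2 +
        (herm_prod u u * herm_prod z w + herm_prod u z * herm_prod u w) / R\<^sup>2 +
        2 * herm_prod u z * herm_prod z w * (herm_prod z u + herm_prod u z) / R^3 - F =
      2 * herm_prod u z * herm_prod u w / R\<^sup>2 + 2 * herm_prod u z * herm_prod u z * herm_prod z w / R^3"
    by (simp add: F_def add_divide_distrib algebra_simps)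
  also have "\<dots> = (2 * herm_prod u z / R) * herm_prod u w / R +
      (2 * herm_prod u z / R) * herm_prod u z * herm_prod z w / R\<^sup>2"
    using nz by (simp add: power2_eq_square power3_eq_cube)
  also have "Re \<dots> = poincare_metric z ((2 * herm_prod u z / of_real (1 - (norm z)\<^sup>2)) *s u) w"
    unfolding poincare_metric_alt R' R_def [symmetric] by (simp add: herm_prod_simps mult.assoc)
  finally show ?thesis .
qed

lemma poincare_metric_add_left:
  "poincare_metric z (u + v) w = poincare_metric z u w + poincare_metric z v w"
  by (simp add: poincare_metric_alt herm_prod_simps add_divide_distrib distrib_right)

lemma poincare_metric_nondegenerate:
  assumes z: "norm z < 1" and v: "\<And>w. poincare_metric z v w = 0"
  shows "v = 0"
proof -
  have "herm_prod v z * herm_prod z v = of_real ((cmod (herm_prod v z))\<^sup>2)"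
    unfolding complex_norm_square by (simp add: cnj_herm_prod)
  then have "poincare_metric z v v = (norm v)\<^sup>2 / (1 - (norm z)\<^sup>2) +
      (cmod (herm_prod v z))\<^sup>2 / (1 - (norm z)\<^sup>2)\<^sup>2"
    unfolding poincare_metric_def herm_prod_self
    by (simp only: of_real_divide [symmetric] of_real_power [symmetric] of_real_add [symmetric] Re_complex_of_real)
  moreover have "0 \<le> (cmod (herm_prod v z))\<^sup>2 / (1 - (norm z)\<^sup>2)\<^sup>2" by simp
  moreover have "0 < (norm v)\<^sup>2 / (1 - (norm z)\<^sup>2)" if "v \<noteq> 0"
    using one_minus_norm_square_pos[OF z] that by simp
  ultimately show ?thesis using v[of v] by (cases "v = 0") linarith+
qed

text \<open>
  The geodesic equation for a position \<open>z\<close>, velocity \<open>v\<close> and acceleration \<open>a\<close>, solved for the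
  acceleration.
\<close>
definition ball_geodesic_eq :: "complex ^ 'n \<Rightarrow> complex ^ 'n \<Rightarrow> complex ^ 'n \<Rightarrow> bool"
  where "ball_geodesic_eq z v a \<longleftrightarrow> a = (- 2 * herm_prod v z / (1 - herm_prod z z)) *s v"

lemma geodesic_in_poincare_iff:
  "geodesic_in unit_ball poincare_metric I c \<longleftrightarrow>
    c ` I \<subseteq> unit_ball \<and>
    (\<exists>c' c''. \<forall>t\<in>I. (c has_vector_derivative c' t) (at t) \<and>
       (c' has_vector_derivative c'' t) (at t) \<and> ball_geodesic_eq (c t) (c' t) (c'' t))"
proof -
  have "(\<forall>w. poincare_metric z a w + christoffel poincare_metric z v v w = 0) \<longleftrightarrow> ball_geodesic_eq z v a"
    if z: "norm z < 1" for z v a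
  proof -
    let ?l = "2 * herm_prod v z / of_real (1 - (norm z)\<^sup>2)"
    have "(\<forall>w. poincare_metric z a w + christoffel poincare_metric z v v w = 0) \<longleftrightarrow>
       (\<forall>w. poincare_metric z (a + ?l *s v) w = 0)"
      by (simp add: christoffel_poincare_metric[OF z] poincare_metric_add_left)
    also have "\<dots> \<longleftrightarrow> a + ?l *s v = 0"
      using poincare_metric_nondegenerate[OF z, of "a + ?l *s v"] by (auto simp: poincare_metric_def)
    also have "\<dots> \<longleftrightarrow> ball_geodesic_eq z v a"
      unfolding ball_geodesic_eq_def one_minus_herm_prod_self
      by (simp add: eq_neg_iff_add_eq_0 vector_sneg_minus1 [symmetric] vec_eq_iff)
    finally show ?thesis .
  qed
  moreover have "norm (c t) < 1" if "c ` I \<subseteq> unit_ball" "t \<in> I" for t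
    using that by auto
  ultimately show ?thesis
    unfolding geodesic_in_def by (metis (no_types, lifting))
qed

lemma has_vector_derivative_herm_prod_const_right:
  assumes "(f has_vector_derivative f') F"
  shows "((\<lambda>t. herm_prod (f t) w) has_vector_derivative herm_prod f' w) F"
  by (rule bounded_linear.has_vector_derivative
      [OF bounded_bilinear.bounded_linear_left[OF bounded_bilinear_herm_prod] assms])

text \<open>
  The involution is a fractional linear map \<open>N / d\<close>, so the acceleration of the image is again a
  multiple of its velocity.  The factor is identified by differentiating the transformation rule for
  \<open>1 - \<langle>mob a z, mob a w\<rangle>\<close> along the curve with \<open>w\<close> kept fixed.
\<close>
lemma geodesic_mob:
  fixes c :: "real \<Rightarrow> complex ^ 'n"
  assumes a: "norm a < 1" and I: "open I" and c: "geodesic_in unit_ball poincare_metric I c"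
  shows "geodesic_in unit_ball poincare_metric I (\<lambda>t. mob a (c t))"
proof -
  obtain c' c'' where cB: "c ` I \<subseteq> unit_ball"
    and c1: "\<And>t. t \<in> I \<Longrightarrow> (c has_vector_derivative c' t) (at t)"
    and c2: "\<And>t. t \<in> I \<Longrightarrow> (c' has_vector_derivative c'' t) (at t)"
    and eq: "\<And>t. t \<in> I \<Longrightarrow> ball_geodesic_eq (c t) (c' t) (c'' t)"
    using c unfolding geodesic_in_poincare_iff by blast
  have cn: "norm (c t) < 1" if "t \<in> I" for t using cB that by auto
  define s where "s = complex_of_real (sqrt (1 - (norm a)\<^sup>2))"
  define L where "L = (\<lambda>v :: complex ^ 'n. - (s *s v) - (herm_prod v a / (1 + s)) *s a)"
  have Lc: "L (x *s v) = x *s L v" for x v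
    by (simp add: L_def herm_prod_simps vec_eq_iff algebra_simps)
  have bL: "bounded_linear L"
  proof (rule linear_conv_bounded_linear[THEN iffD1], rule linearI)
    show "L (u + v) = L u + L v" for u v
      by (simp add: L_def herm_prod_simps vec_eq_iff algebra_simps add_divide_distrib)
    show "L (r *\<^sub>R v) = r *\<^sub>R L v" for r v by (simp only: scaleR_vec_eq Lc)
  qed
  define d where "d = (\<lambda>t. 1 - herm_prod (c t) a)"
  define d' where "d' = (\<lambda>t. - herm_prod (c' t) a)"
  define N where "N = (\<lambda>t. a + L (c t))"
  define \<mu> where "\<mu> = (\<lambda>t. - 2 * herm_prod (c' t) (c t) / (1 - herm_prod (c t) (c t)))"
  define m1 where "m1 = (\<lambda>t. (1 / d t) *s L (c' t) - (d' t / (d t)\<^sup>2) *s N t)"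
  define m2 where "m2 = (\<lambda>t. (\<mu> t - 2 * d' t / d t) *s m1 t)"
  have m: "mob a (c t) = (1 / d t) *s N t" for t
    by (simp add: mob_def d_def N_def L_def s_def algebra_simps)
  have dn: "d t \<noteq> 0" if "t \<in> I" for t
    using one_minus_herm_prod_nonzero[of "c t" a] cn[OF that] a by (simp add: d_def)
  have c''eq: "c'' t = \<mu> t *s c' t" if "t \<in> I" for t
    using eq[OF that] by (simp add: ball_geodesic_eq_def \<mu>_def)
  have dd: "(d has_vector_derivative d' t) (at t)" if "t \<in> I" for t
    unfolding d_def d'_def
    using has_vector_derivative_diff[OF has_vector_derivative_const
        has_vector_derivative_herm_prod_const_right[OF c1[OF that]], of 1 a] by simp
  have dd': "(d' has_vector_derivative \<mu> t * d' t) (at t)" if "t \<in> I" for t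
    unfolding d'_def
    using has_vector_derivative_minus[OF has_vector_derivative_herm_prod_const_right[OF c2[OF that]], of a]
    by (simp add: c''eq[OF that] herm_prod_simps)
  have dN: "(N has_vector_derivative L (c' t)) (at t)" if "t \<in> I" for t
    unfolding N_def
    using has_vector_derivative_add[OF has_vector_derivative_const
        bounded_linear.has_vector_derivative[OF bL c1[OF that]], of a] by simp
  have dLc': "((\<lambda>t. L (c' t)) has_vector_derivative \<mu> t *s L (c' t)) (at t)" if "t \<in> I" for t
    using bounded_linear.has_vector_derivative[OF bL c2[OF that]] by (simp add: c''eq[OF that] Lc)
  have di: "((\<lambda>t. 1 / d t) has_vector_derivative - (d' t / (d t)\<^sup>2)) (at t)" if "t \<in> I" for t
    using field_vector_diff_chain_at[OF dd[OF that] DERIV_inverse[OF dn[OF that]]]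
    by (simp add: o_def divide_inverse power2_eq_square mult_ac)
  have di2: "((\<lambda>t. d' t / (d t)\<^sup>2) has_vector_derivative \<mu> t * d' t / (d t)\<^sup>2 - 2 * (d' t)\<^sup>2 / (d t)^3) (at t)"
    if t: "t \<in> I" for t
  proof -
    have "((\<lambda>t. d' t * ((1 / d t) * (1 / d t))) has_vector_derivative
       d' t * ((1 / d t) * (- (d' t / (d t)\<^sup>2)) + (- (d' t / (d t)\<^sup>2)) * (1 / d t)) +
       \<mu> t * d' t * ((1 / d t) * (1 / d t))) (at t)"
      by (rule has_vector_derivative_mult[OF dd'[OF t] has_vector_derivative_mult[OF di[OF t] di[OF t]]])
    then show ?thesis
      using dn[OF t] by (simp add: power2_eq_square power3_eq_cube algebra_simps)
  qed
  have h1: "((\<lambda>t. mob a (c t)) has_vector_derivative m1 t) (at t)" if t: "t \<in> I" for t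
    unfolding m m1_def
    using has_vector_derivative_cmult_vec[OF di[OF t] dN[OF t]] by (simp add: vec_eq_iff)
  have h2: "(m1 has_vector_derivative m2 t) (at t)" if t: "t \<in> I" for t
  proof -
    have "(m1 has_vector_derivative
       ((1 / d t) *s (\<mu> t *s L (c' t)) + (- (d' t / (d t)\<^sup>2)) *s L (c' t)) -
       ((d' t / (d t)\<^sup>2) *s L (c' t) + (\<mu> t * d' t / (d t)\<^sup>2 - 2 * (d' t)\<^sup>2 / (d t)^3) *s N t)) (at t)"
      unfolding m1_def
      by (rule has_vector_derivative_diff[OF has_vector_derivative_cmult_vec[OF di[OF t] dLc'[OF t]]
            has_vector_derivative_cmult_vec[OF di2[OF t] dN[OF t]]])
    moreover have "((1 / d t) *s (\<mu> t *s L (c' t)) + (- (d' t / (d t)\<^sup>2)) *s L (c' t)) -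
       ((d' t / (d t)\<^sup>2) *s L (c' t) + (\<mu> t * d' t / (d t)\<^sup>2 - 2 * (d' t)\<^sup>2 / (d t)^3) *s N t) = m2 t"
      unfolding m2_def m1_def vec_eq_iff
      using dn[OF t] by (simp add: field_simps power2_eq_square power3_eq_cube)
    ultimately show ?thesis by simp
  qed
  have key: "- 2 * herm_prod (m1 t) (mob a (c t)) / (1 - herm_prod (mob a (c t)) (mob a (c t))) =
      \<mu> t - 2 * d' t / d t" if t: "t \<in> I" for t
  proof -
    define z where "z = c t"
    define w where "w = mob a z"
    define k where "k = complex_of_real (1 - (norm a)\<^sup>2)"
    define e where "e = 1 - herm_prod a z"
    have zn: "norm z < 1" using cn[OF t] by (simp add: z_def)
    have k0: "k \<noteq> 0" using one_minus_norm_square_pos[OF a] unfolding k_def of_real_eq_0_iff by linarith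
    have e0: "e \<noteq> 0" using one_minus_herm_prod_nonzero[of a z] zn a by (simp add: e_def)
    have R0: "1 - herm_prod z z \<noteq> 0" using one_minus_herm_prod_nonzero[of z z] zn by simp
    have W0: "1 - herm_prod w w \<noteq> 0"
      using one_minus_herm_prod_nonzero[of w w] mob_in_ball[OF a zn] by (simp add: w_def)
    \<comment> \<open>The transformation rule with the second argument frozen at time \<open>t\<close>, in order to be differentiated.\<close>
    have id: "(1 - herm_prod (mob a (c \<tau>)) w) * d \<tau> * e = k * (1 - herm_prod (c \<tau>) z)" if "\<tau> \<in> I" for \<tau>
      using one_minus_herm_prod_mob[OF a dn[OF that, unfolded d_def] dn[OF t, unfolded d_def]]
        dn[OF that] e0 unfolding w_def z_def k_def [symmetric]
      by (simp add: d_def e_def z_def)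
    have "((\<lambda>\<tau>. (1 - herm_prod (mob a (c \<tau>)) w) * d \<tau> * e) has_vector_derivative
        ((1 - herm_prod (mob a (c t)) w) * d' t + (0 - herm_prod (m1 t) w) * d t) * e) (at t)"
      by (intro has_vector_derivative_mult_left has_vector_derivative_mult has_vector_derivative_diff
          has_vector_derivative_const has_vector_derivative_herm_prod_const_right h1 dd t)
    moreover have "((\<lambda>\<tau>. k * (1 - herm_prod (c \<tau>) z)) has_vector_derivative
        k * (0 - herm_prod (c' t) z)) (at t)"
      by (intro has_vector_derivative_mult_right has_vector_derivative_diff
          has_vector_derivative_const has_vector_derivative_herm_prod_const_right c1 t)
    then have "((\<lambda>\<tau>. (1 - herm_prod (mob a (c \<tau>)) w) * d \<tau> * e) has_vector_derivative
        k * (0 - herm_prod (c' t) z)) (at t)"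
      by (rule has_vector_derivative_transform_within_open[OF _ I t]) (simp add: id)
    ultimately have "((1 - herm_prod w w) * d' t - herm_prod (m1 t) w * d t) * e =
        - (k * herm_prod (c' t) z)"
      using vector_derivative_unique_at by (fastforce simp: w_def z_def)
    moreover have "(1 - herm_prod w w) * d t * e = k * (1 - herm_prod z z)"
      using id[OF t] by (simp add: w_def z_def)
    ultimately have "k * (herm_prod (m1 t) w * (d t * (1 - herm_prod z z))) =
        k * ((d' t * (1 - herm_prod z z) + d t * herm_prod (c' t) z) * (1 - herm_prod w w))"
      by algebra
    then have "herm_prod (m1 t) w * (d t * (1 - herm_prod z z)) =
        (d' t * (1 - herm_prod z z) + d t * herm_prod (c' t) z) * (1 - herm_prod w w)"
      using k0 by simp
    then have "herm_prod (m1 t) w / (1 - herm_prod w w) =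
        (d' t * (1 - herm_prod z z) + d t * herm_prod (c' t) z) / (d t * (1 - herm_prod z z))"
      using R0 W0 dn[OF t] by (subst frac_eq_eq) auto
    also have "\<dots> = d' t / d t + herm_prod (c' t) z / (1 - herm_prod z z)"
      using R0 dn[OF t] by (simp add: add_divide_distrib)
    finally have q: "herm_prod (m1 t) w / (1 - herm_prod w w) =
        d' t / d t + herm_prod (c' t) z / (1 - herm_prod z z)" .
    have "- 2 * herm_prod (m1 t) w / (1 - herm_prod w w) = - 2 * (herm_prod (m1 t) w / (1 - herm_prod w w))"
      by simp
    also have "\<dots> = \<mu> t - 2 * d' t / d t"
      unfolding q \<mu>_def z_def by (simp add: algebra_simps)
    finally show ?thesis unfolding w_def z_def .
  qed
  show ?thesis
    unfolding geodesic_in_poincare_iff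
  proof (intro conjI exI ballI)
    show "(\<lambda>t. mob a (c t)) ` I \<subseteq> unit_ball"
      using cn mob_in_ball[OF a] by auto
    fix t assume t: "t \<in> I"
    show "((\<lambda>t. mob a (c t)) has_vector_derivative m1 t) (at t)" by (rule h1[OF t])
    show "(m1 has_vector_derivative m2 t) (at t)" by (rule h2[OF t])
    show "ball_geodesic_eq (mob a (c t)) (m1 t) (m2 t)"
      unfolding ball_geodesic_eq_def key[OF t] m2_def ..
  qed
qed

lemma geodesic_linear_isometry:
  fixes D :: "complex ^ 'n \<Rightarrow> complex ^ 'm"
  assumes D: "\<And>u v. D (u + v) = D u + D v" "\<And>c v. D (c *s v) = c *s D v"
    and h: "\<And>v w. herm_prod (D v) (D w) = herm_prod v w"
    and c: "geodesic_in unit_ball poincare_metric I c"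
  shows "geodesic_in unit_ball poincare_metric I (\<lambda>t. D (c t))"
proof -
  have bD: "bounded_linear D"
    by (rule linear_conv_bounded_linear[THEN iffD1], rule linearI) (simp_all add: D scaleR_vec_eq)
  have n: "norm (D v) = norm v" for v
  proof -
    have "(norm (D v))\<^sup>2 = (norm v)\<^sup>2"
      using h[of v v] unfolding herm_prod_self of_real_eq_iff .
    then show ?thesis by (simp add: power2_eq_iff_nonneg)
  qed
  obtain c' c'' where cB: "c ` I \<subseteq> unit_ball"
    and c: "\<And>t. t \<in> I \<Longrightarrow> (c has_vector_derivative c' t) (at t)"
     "\<And>t. t \<in> I \<Longrightarrow> (c' has_vector_derivative c'' t) (at t)"
     "\<And>t. t \<in> I \<Longrightarrow> ball_geodesic_eq (c t) (c' t) (c'' t)"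
    using c unfolding geodesic_in_poincare_iff by blast
  show ?thesis
    unfolding geodesic_in_poincare_iff
  proof (intro conjI exI ballI)
    show "(\<lambda>t. D (c t)) ` I \<subseteq> unit_ball" using cB by (auto simp: n)
    fix t assume t: "t \<in> I"
    show "((\<lambda>t. D (c t)) has_vector_derivative D (c' t)) (at t)"
      by (rule bounded_linear.has_vector_derivative[OF bD c(1)[OF t]])
    show "((\<lambda>t. D (c' t)) has_vector_derivative D (c'' t)) (at t)"
      by (rule bounded_linear.has_vector_derivative[OF bD c(2)[OF t]])
    show "ball_geodesic_eq (D (c t)) (D (c' t)) (D (c'' t))"
      unfolding ball_geodesic_eq_def h
      by (subst c(3)[OF t, unfolded ball_geodesic_eq_def]) (rule D(2))
  qed
qed

lemma totally_geodesic_mob_compose: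
  assumes a: "norm a < 1"
    and f: "totally_geodesic_map unit_ball poincare_metric unit_ball poincare_metric f"
  shows "totally_geodesic_map unit_ball poincare_metric unit_ball poincare_metric (\<lambda>z. mob a (f z))"
  using f geodesic_mob[OF a] unfolding totally_geodesic_map_def o_def by blast

section \<open>Totally geodesic holomorphic maps\<close>

lemma abs_tanh_real_less_1: "\<bar>tanh t\<bar> < (1 :: real)"
  using tanh_real_lt_1[of t] tanh_real_gt_neg1[of t] by (simp add: abs_less_iff)

lemma tanh_surj:
  assumes "\<bar>x\<bar> < (1 :: real)"
  shows "tanh (ln (sqrt ((1 + x) / (1 - x)))) = x"
proof -
  have "(1 + x) / (1 - x) > 0" using assms by (auto simp: abs_less_iff)
  moreover have "((1 + x) / (1 - x) - 1) / ((1 + x) / (1 - x) + 1) = x"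
    using assms by (simp add: field_simps abs_less_iff)
  ultimately show ?thesis by (simp add: tanh_ln_real)
qed

lemma geodesic_tanh:
  assumes v: "norm v = 1"
  shows "geodesic_in unit_ball poincare_metric UNIV (\<lambda>t. tanh t *\<^sub>R v)"
  unfolding geodesic_in_poincare_iff
proof (intro conjI exI ballI)
  show "range (\<lambda>t. tanh t *\<^sub>R v) \<subseteq> unit_ball"
    using v abs_tanh_real_less_1 by auto
  fix t :: real
  have 1: "(tanh has_real_derivative (1 - (tanh t)\<^sup>2)) (at t)" for t :: real
    by (auto intro!: derivative_eq_intros)
  show "((\<lambda>t. tanh t *\<^sub>R v) has_vector_derivative (1 - (tanh t)\<^sup>2) *\<^sub>R v) (at t)"
    by (rule bounded_linear.has_vector_derivative[OF bounded_linear_scaleR_left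
          1[unfolded has_real_derivative_iff_has_vector_derivative]])
  have "((\<lambda>t. 1 - (tanh t)\<^sup>2) has_real_derivative (- 2 * tanh t * (1 - (tanh t)\<^sup>2))) (at t)"
    by (auto intro!: derivative_eq_intros)
  then show "((\<lambda>t. (1 - (tanh t)\<^sup>2) *\<^sub>R v) has_vector_derivative
      (- 2 * tanh t * (1 - (tanh t)\<^sup>2)) *\<^sub>R v) (at t)"
    unfolding has_real_derivative_iff_has_vector_derivative
    by (rule bounded_linear.has_vector_derivative[OF bounded_linear_scaleR_left])
  have t1: "1 - (tanh t)\<^sup>2 \<noteq> 0"
    using one_minus_norm_square_pos[of "tanh t"] abs_tanh_real_less_1[of t] by simp
  define x where "x = tanh t"
  have 2: "1 - herm_prod (x *\<^sub>R v) (x *\<^sub>R v) = of_real (1 - x\<^sup>2)"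
    by (simp only: one_minus_herm_prod_self norm_scaleR v power_mult_distrib power2_abs
        power_one mult_1_right real_norm_def)
  have 3: "herm_prod ((1 - x\<^sup>2) *\<^sub>R v) (x *\<^sub>R v) = of_real ((1 - x\<^sup>2) * x)"
    by (simp add: herm_prod_simps herm_prod_self v mult_ac)
  have "- 2 * herm_prod ((1 - x\<^sup>2) *\<^sub>R v) (x *\<^sub>R v) / (1 - herm_prod (x *\<^sub>R v) (x *\<^sub>R v)) =
      of_real (- 2 * ((1 - x\<^sup>2) * x) / (1 - x\<^sup>2))"
    unfolding 2 3 by (simp only: of_real_divide of_real_mult of_real_minus of_real_numeral)
  also have "- 2 * ((1 - x\<^sup>2) * x) / (1 - x\<^sup>2) = - 2 * x" using t1 by (simp add: x_def)
  finally have "(- 2 * herm_prod ((1 - x\<^sup>2) *\<^sub>R v) (x *\<^sub>R v) / (1 - herm_prod (x *\<^sub>R v) (x *\<^sub>R v))) *s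
      ((1 - x\<^sup>2) *\<^sub>R v) = (- 2 * x) *\<^sub>R ((1 - x\<^sup>2) *\<^sub>R v)"
    unfolding scaleR_vec_eq by simp
  then show "ball_geodesic_eq (tanh t *\<^sub>R v) ((1 - (tanh t)\<^sup>2) *\<^sub>R v)
      ((- 2 * tanh t * (1 - (tanh t)\<^sup>2)) *\<^sub>R v)"
    unfolding ball_geodesic_eq_def x_def by (simp only: scaleR_scaleR)
qed

text \<open>
  The function \<open>E\<close> below is constant along every geodesic, which replaces an appeal to uniqueness for
  ordinary differential equations.
\<close>
lemma geodesic_constant_if_velocity_zero:
  assumes c: "geodesic_in unit_ball poincare_metric UNIV c"
    and v: "(c has_vector_derivative 0) (at 0)"
  shows "c t = c 0"
proof -
  obtain c' c'' where cB: "range c \<subseteq> unit_ball"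
    and c: "\<And>t. (c has_vector_derivative c' t) (at t)"
     "\<And>t. (c' has_vector_derivative c'' t) (at t)"
     "\<And>t. ball_geodesic_eq (c t) (c' t) (c'' t)"
    using c unfolding geodesic_in_poincare_iff by blast
  have c0: "c' 0 = 0" using vector_derivative_unique_at[OF c(1) v] .
  define R where "R = (\<lambda>t. 1 - herm_prod (c t) (c t))"
  have R0: "R t \<noteq> 0" for t
  proof -
    have "norm (c t) < 1" using cB by (auto simp: image_subset_iff)
    then show ?thesis using one_minus_herm_prod_nonzero[of "c t" "c t"] by (simp add: R_def)
  qed
  have cR: "cnj (R t) = R t" for t by (simp add: R_def cnj_herm_prod)
  define R' where "R' = (\<lambda>t. - (herm_prod (c t) (c' t) + herm_prod (c' t) (c t)))"
  have dR: "(R has_vector_derivative R' t) (at t)" for t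
    unfolding R_def R'_def
    using has_vector_derivative_diff[OF has_vector_derivative_const
        has_vector_derivative_herm_prod[OF c(1) c(1)], of 1 t] by simp
  have dRi: "((\<lambda>t. inverse (R t)) has_vector_derivative - (R' t / (R t)\<^sup>2)) (at t)" for t
    using field_vector_diff_chain_at[OF dR DERIV_inverse[OF R0], of t]
    by (simp add: o_def divide_inverse power2_eq_square mult_ac)
  \<comment> \<open>The squared Euclidean speed divided by \<open>(1 - \<bar>c\<bar>\<^sup>2)\<^sup>2\<close>.\<close>
  define E where "E = (\<lambda>t. herm_prod (c' t) (c' t) * (inverse (R t) * inverse (R t)))"
  have "(E has_vector_derivative
      herm_prod (c' t) (c' t) * (inverse (R t) * (- (R' t / (R t)\<^sup>2)) + (- (R' t / (R t)\<^sup>2)) * inverse (R t)) +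
      (herm_prod (c' t) (c'' t) + herm_prod (c'' t) (c' t)) * (inverse (R t) * inverse (R t))) (at t)" for t
    unfolding E_def
    by (rule has_vector_derivative_mult[OF has_vector_derivative_herm_prod[OF c(2) c(2)]
          has_vector_derivative_mult[OF dRi dRi]])
  moreover have "herm_prod (c' t) (c' t) * (inverse (R t) * (- (R' t / (R t)\<^sup>2)) + (- (R' t / (R t)\<^sup>2)) * inverse (R t)) +
      (herm_prod (c' t) (c'' t) + herm_prod (c'' t) (c' t)) * (inverse (R t) * inverse (R t)) = 0" for t
  proof -
    have "c'' t = (- 2 * herm_prod (c' t) (c t) / R t) *s c' t"
      using c(3)[of t] by (simp add: ball_geodesic_eq_def R_def)
    then have "herm_prod (c'' t) (c' t) = (- 2 * herm_prod (c' t) (c t) / R t) * herm_prod (c' t) (c' t)"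
      "herm_prod (c' t) (c'' t) = (- 2 * herm_prod (c t) (c' t) / R t) * herm_prod (c' t) (c' t)"
      by (simp_all add: herm_prod_simps cnj_herm_prod cR)
    then show ?thesis
      using R0[of t] by (simp add: R'_def divide_inverse power2_eq_square algebra_simps)
  qed
  ultimately have "(E has_vector_derivative 0) (at t)" for t by metis
  then obtain k where "\<And>t. E t = k"
    using has_vector_derivative_zero_constant[of UNIV E] by (auto simp: has_vector_derivative_at_within)
  moreover have "E 0 = 0" by (simp add: E_def c0)
  ultimately have "E t = 0" for t by metis
  then have "c' t = 0" for t using R0 by (simp add: E_def herm_prod_eq_0_iff)
  then have "(c has_vector_derivative 0) (at t within UNIV)" for t
    using c(1)[of t] by simp
  then obtain k where "\<And>t. t \<in> UNIV \<Longrightarrow> c t = k"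
    by (rule has_vector_derivative_zero_constant[OF convex_UNIV]) blast
  from this[of t] this[of 0] show ?thesis by simp
qed

lemma has_vector_derivative_vec_nth:
  "(f has_vector_derivative f') F \<Longrightarrow> ((\<lambda>t. f t $ j) has_vector_derivative f' $ j) F"
  by (rule bounded_linear.has_vector_derivative[OF bounded_linear_vec_nth])

text \<open>
  The geodesic equation for the image of the diameter in direction \<open>v\<close>, reparametrised by the position
  \<open>x = tanh t\<close> on the diameter.
\<close>
lemma totally_geodesic_radial_eq:
  fixes g :: "complex ^ 'n \<Rightarrow> complex ^ 'm"
  assumes g: "holomorphic_map_on g unit_ball"
    and tg: "totally_geodesic_map unit_ball poincare_metric unit_ball poincare_metric g"
    and v: "norm v = 1" and x: "\<bar>x\<bar> < 1"
  shows "deriv (deriv (\<lambda>\<zeta>. g (\<zeta> *s v) $ j)) (of_real x) =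
    (2 * of_real x / (1 - (of_real x)\<^sup>2) -
     2 * herm_prod (\<chi> i. deriv (\<lambda>\<zeta>. g (\<zeta> *s v) $ i) (of_real x)) (g (of_real x *s v)) /
       (1 - herm_prod (g (of_real x *s v)) (g (of_real x *s v)))) *
    deriv (\<lambda>\<zeta>. g (\<zeta> *s v) $ j) (of_real x)"
proof -
  define G where "G = (\<lambda>j \<zeta>. g (\<zeta> *s v) $ j)"
  have hol: "G j holomorphic_on ball 0 1" for j
  proof -
    have "norm (0 + \<zeta> *s v) < 1" if "\<zeta> \<in> ball 0 1" for \<zeta>
      using that v by (simp add: norm_cmult_vec)
    from holomorphic_on_slice[OF g this, of "ball 0 1" j] show ?thesis by (simp add: G_def)
  qed
  have d1: "(G j has_field_derivative deriv (G j) z) (at z)" if "norm z < 1" for j z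
    by (rule holomorphic_derivI[OF hol open_ball]) (use that in simp)
  have d2: "(deriv (G j) has_field_derivative deriv (deriv (G j)) z) (at z)" if "norm z < 1" for j z
    by (rule holomorphic_derivI[OF holomorphic_deriv[OF hol open_ball] open_ball]) (use that in simp)
  define \<tau> where "\<tau> = (\<lambda>t :: real. complex_of_real (tanh t))"
  have \<tau>1: "norm (\<tau> t) < 1" for t using abs_tanh_real_less_1[of t] by (simp add: \<tau>_def)
  have d\<tau>: "(\<tau> has_vector_derivative (1 - (\<tau> t)\<^sup>2)) (at t)" for t
  proof -
    have "(tanh has_real_derivative (1 - (tanh t)\<^sup>2)) (at t)"
      by (auto intro!: derivative_eq_intros)
    from bounded_linear.has_vector_derivative[OF bounded_linear_of_real
        this[unfolded has_real_derivative_iff_has_vector_derivative]]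
    show ?thesis by (simp add: \<tau>_def)
  qed
  define h where "h = (\<lambda>t. g (tanh t *\<^sub>R v))"
  have hG: "h t $ j = G j (\<tau> t)" for t j
    by (simp add: h_def G_def \<tau>_def scaleR_vec_eq)
  have "geodesic_in unit_ball poincare_metric UNIV h"
    using tg[unfolded totally_geodesic_map_def, rule_format, of UNIV "\<lambda>t. tanh t *\<^sub>R v"]
      geodesic_tanh[OF v] by (simp add: o_def h_def)
  then obtain h' h'' where hB: "range h \<subseteq> unit_ball"
    and h: "\<And>t. (h has_vector_derivative h' t) (at t)"
     "\<And>t. (h' has_vector_derivative h'' t) (at t)"
     "\<And>t. ball_geodesic_eq (h t) (h' t) (h'' t)"
    unfolding geodesic_in_poincare_iff by blast
  have h'j: "h' t $ j = (1 - (\<tau> t)\<^sup>2) * deriv (G j) (\<tau> t)" for t j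
  proof (rule vector_derivative_unique_at)
    show "((\<lambda>t. h t $ j) has_vector_derivative h' t $ j) (at t)"
      by (rule has_vector_derivative_vec_nth[OF h(1)])
    show "((\<lambda>t. h t $ j) has_vector_derivative (1 - (\<tau> t)\<^sup>2) * deriv (G j) (\<tau> t)) (at t)"
      unfolding hG using field_vector_diff_chain_at[OF d\<tau> d1[OF \<tau>1]] by (simp add: o_def)
  qed
  have h''j: "h'' t $ j = (1 - (\<tau> t)\<^sup>2)\<^sup>2 * deriv (deriv (G j)) (\<tau> t)
      - 2 * \<tau> t * (1 - (\<tau> t)\<^sup>2) * deriv (G j) (\<tau> t)" for t j
  proof (rule vector_derivative_unique_at)
    show "((\<lambda>t. h' t $ j) has_vector_derivative h'' t $ j) (at t)"
      by (rule has_vector_derivative_vec_nth[OF h(2)])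
    have a: "((\<lambda>t. 1 - \<tau> t * \<tau> t) has_vector_derivative 0 - (\<tau> t * (1 - (\<tau> t)\<^sup>2) + (1 - (\<tau> t)\<^sup>2) * \<tau> t)) (at t)"
      by (intro has_vector_derivative_diff has_vector_derivative_const has_vector_derivative_mult d\<tau>)
    have b: "((\<lambda>t. deriv (G j) (\<tau> t)) has_vector_derivative (1 - (\<tau> t)\<^sup>2) * deriv (deriv (G j)) (\<tau> t)) (at t)"
      using field_vector_diff_chain_at[OF d\<tau> d2[OF \<tau>1]] by (simp add: o_def)
    show "((\<lambda>t. h' t $ j) has_vector_derivative (1 - (\<tau> t)\<^sup>2)\<^sup>2 * deriv (deriv (G j)) (\<tau> t)
      - 2 * \<tau> t * (1 - (\<tau> t)\<^sup>2) * deriv (G j) (\<tau> t)) (at t)"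
      unfolding h'j using has_vector_derivative_mult[OF a b]
      by (simp add: power2_eq_square algebra_simps)
  qed
  define t where "t = ln (sqrt ((1 + x) / (1 - x)))"
  have "tanh t = x" unfolding t_def using x by (rule tanh_surj)
  then have \<tau>t: "\<tau> t = of_real x" by (simp add: \<tau>_def)
  define X where "X = complex_of_real x"
  define Y where "Y = 1 - X\<^sup>2"
  have "Y = of_real (1 - x\<^sup>2)" by (simp add: X_def Y_def)
  moreover have "1 - x\<^sup>2 \<noteq> 0" using one_minus_norm_square_pos[of x] x by simp
  ultimately have Y0: "Y \<noteq> 0" by (simp only: of_real_eq_0_iff not_False_eq_True)
  define W where "W = 1 - herm_prod (h t) (h t)"
  define H where "H = herm_prod (\<chi> i. deriv (G i) X) (h t)"
  have "norm (h t) < 1" using hB by (auto simp: image_subset_iff)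
  then have W0: "W \<noteq> 0" using one_minus_herm_prod_nonzero[of "h t" "h t"] by (simp add: W_def)
  have "h' t = Y *s (\<chi> i. deriv (G i) X)"
    by (simp add: vec_eq_iff h'j \<tau>t X_def Y_def algebra_simps)
  then have "herm_prod (h' t) (h t) = Y * H" by (simp add: herm_prod_simps H_def)
  then have "h'' t = (- 2 * (Y * H) / W) *s h' t"
    using h(3)[of t] by (simp add: ball_geodesic_eq_def W_def)
  then have "h'' t $ j = (- 2 * (Y * H) / W) * h' t $ j" by simp
  then have "Y\<^sup>2 * deriv (deriv (G j)) X - 2 * X * Y * deriv (G j) X = (- 2 * (Y * H) / W) * (Y * deriv (G j) X)"
    unfolding h''j h'j \<tau>t X_def [symmetric] Y_def [symmetric] .
  then have "Y\<^sup>2 * deriv (deriv (G j)) X = Y\<^sup>2 * ((2 * X / Y - 2 * H / W) * deriv (G j) X)"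
  proof -
    assume eq: "Y\<^sup>2 * deriv (deriv (G j)) X - 2 * X * Y * deriv (G j) X = (- 2 * (Y * H) / W) * (Y * deriv (G j) X)"
    define p where "p = 2 * X / Y"
    define q where "q = 2 * H / W"
    have e1: "2 * X = Y * p" and e2: "- 2 * (Y * H) / W = - (Y * q)"
      using Y0 by (simp_all add: p_def q_def)
    have "Y\<^sup>2 * deriv (deriv (G j)) X = Y * p * Y * deriv (G j) X + - (Y * q) * (Y * deriv (G j) X)"
      using eq unfolding e1 e2 by (simp only: diff_eq_eq add.commute)
    also have "\<dots> = Y\<^sup>2 * ((p - q) * deriv (G j) X)"
      by (simp add: algebra_simps power2_eq_square)
    finally have "Y\<^sup>2 * deriv (deriv (G j)) X = Y\<^sup>2 * ((p - q) * deriv (G j) X)" .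
    then show ?thesis unfolding p_def q_def .
  qed
  then have "deriv (deriv (G j)) X = (2 * X / Y - 2 * H / W) * deriv (G j) X"
    using Y0 by simp
  moreover have "h t = g (X *s v)" by (simp add: h_def \<open>tanh t = x\<close> X_def scaleR_vec_eq)
  ultimately show ?thesis unfolding X_def Y_def H_def W_def G_def by simp
qed

lemma filterlim_of_real_at_0: "filterlim complex_of_real (at 0) (at 0)"
  by (rule filterlim_atI) (auto intro!: tendsto_eq_intros simp: eventually_at_filter)

text \<open>
  Dividing the radial equation by \<open>x\<close> and letting \<open>x\<close> tend to \<open>0\<close>: the second derivative at \<open>0\<close>
  vanishes, and \<open>g (x v) / x\<close> tends to \<open>D v\<close>.
\<close>
lemma totally_geodesic_third_derivative:
  fixes g :: "complex ^ 'n \<Rightarrow> complex ^ 'm"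
  assumes g: "holomorphic_map_on g unit_ball" "g 0 = 0"
    and tg: "totally_geodesic_map unit_ball poincare_metric unit_ball poincare_metric g"
    and D: "(g has_derivative D) (at 0)" "\<And>c v. D (c *s v) = c *s D v"
    and v: "norm v = 1"
  shows "(deriv ^^ 3) (\<lambda>\<zeta>. g (\<zeta> *s v) $ j) 0 = (2 - 2 * herm_prod (D v) (D v)) * D v $ j"
proof -
  define G where "G = (\<lambda>j \<zeta>. g (\<zeta> *s v) $ j)"
  have hol: "G j holomorphic_on ball 0 1" for j
  proof -
    have "norm (0 + \<zeta> *s v) < 1" if "\<zeta> \<in> ball 0 1" for \<zeta>
      using that v by (simp add: norm_cmult_vec)
    from holomorphic_on_slice[OF g(1) this, of "ball 0 1" j] show ?thesis by (simp add: G_def)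
  qed
  have G0: "G j 0 = 0" for j by (simp add: G_def g(2))
  have dG: "(G j has_field_derivative D v $ j) (at 0)" for j
    using has_field_derivative_slice[of g D 0 0 v j] D by (simp add: G_def)
  have dG': "deriv (G j) 0 = D v $ j" for j by (rule DERIV_imp_deriv[OF dG])
  have hol1: "deriv (G j) holomorphic_on ball 0 1" for j
    by (rule holomorphic_deriv[OF hol open_ball])
  have hol2: "deriv (deriv (G j)) holomorphic_on ball 0 1" for j
    by (rule holomorphic_deriv[OF hol1 open_ball])
  have radial: "deriv (deriv (G j)) (of_real x) = (2 * of_real x / (1 - (of_real x)\<^sup>2) -
     2 * herm_prod (\<chi> i. deriv (G i) (of_real x)) (g (of_real x *s v)) /
       (1 - herm_prod (g (of_real x *s v)) (g (of_real x *s v)))) * deriv (G j) (of_real x)"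
    if "\<bar>x\<bar> < 1" for x :: real and j
    unfolding G_def by (rule totally_geodesic_radial_eq[OF g(1) tg v that])
  have d20: "deriv (deriv (G j)) 0 = 0" for j
    using radial[of 0 j] by (simp add: g(2))
  let ?F = "at (0 :: real)"
  have lim_of_real: "((\<lambda>x. h (complex_of_real x)) \<longlongrightarrow> l) ?F" if "(h \<longlongrightarrow> l) (at 0)" for h and l :: complex
    by (rule filterlim_compose[OF that filterlim_of_real_at_0])
  have c1: "((\<lambda>x. deriv (G j) (of_real x)) \<longlongrightarrow> D v $ j) ?F" for j
  proof (rule lim_of_real)
    have "isCont (deriv (G j)) 0"
      by (rule DERIV_isCont[OF holomorphic_derivI[OF hol1 open_ball]]) simp
    then show "(deriv (G j) \<longlongrightarrow> D v $ j) (at 0)" by (simp add: isCont_def dG')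
  qed
  then have c1': "((\<lambda>x. \<chi> j. deriv (G j) (of_real x)) \<longlongrightarrow> D v) ?F"
    by (intro vec_tendstoI) simp
  have c2: "((\<lambda>x. (1 / complex_of_real x) *s g (of_real x *s v)) \<longlongrightarrow> D v) ?F"
  proof (rule vec_tendstoI)
    fix j
    have "((\<lambda>z. G j z / z) \<longlongrightarrow> D v $ j) (at 0)"
      using dG[of j] unfolding has_field_derivative_iff by (simp add: G0)
    from lim_of_real[OF this]
    show "((\<lambda>x. ((1 / complex_of_real x) *s g (of_real x *s v)) $ j) \<longlongrightarrow> D v $ j) ?F"
      by (simp add: G_def)
  qed
  have c3: "((\<lambda>x. g (of_real x *s v)) \<longlongrightarrow> 0) ?F"
  proof (rule vec_tendstoI)
    fix j
    have "(G j \<longlongrightarrow> 0) (at 0)"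
      using DERIV_isCont[OF dG[of j]] by (simp add: isCont_def G0)
    from lim_of_real[OF this] show "((\<lambda>x. g (of_real x *s v) $ j) \<longlongrightarrow> 0 $ j) ?F"
      by (simp add: G_def)
  qed
  have c4: "((\<lambda>x. herm_prod (g (complex_of_real x *s v)) (g (of_real x *s v))) \<longlongrightarrow> 0) ?F"
    using tendsto_herm_prod[OF c3 c3] by simp
  have A: "((\<lambda>x. (2 / (1 - (complex_of_real x)\<^sup>2) -
     2 * herm_prod (\<chi> i. deriv (G i) (of_real x)) ((1 / of_real x) *s g (of_real x *s v)) /
       (1 - herm_prod (g (of_real x *s v)) (g (of_real x *s v)))) * deriv (G j) (of_real x))
     \<longlongrightarrow> (2 / (1 - (of_real 0)\<^sup>2) - 2 * herm_prod (D v) (D v) / (1 - 0)) * D v $ j) ?F"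
    by (intro tendsto_intros c1 c1' c2 c4) auto
  have B: "\<forall>\<^sub>F x in ?F. (2 / (1 - (complex_of_real x)\<^sup>2) -
     2 * herm_prod (\<chi> i. deriv (G i) (of_real x)) ((1 / of_real x) *s g (of_real x *s v)) /
       (1 - herm_prod (g (of_real x *s v)) (g (of_real x *s v)))) * deriv (G j) (of_real x) =
     deriv (deriv (G j)) (of_real x) / of_real x"
  proof -
    have "\<forall>\<^sub>F x :: real in ?F. x \<noteq> 0 \<and> \<bar>x\<bar> < 1"
      unfolding eventually_at by (intro exI[of _ 1]) auto
    then show ?thesis
    proof eventually_elim
      case (elim x)
      have "(2 / Y - 2 * (1 / X * h) / W) * d = (2 * X / Y - 2 * h / W) * d / X"
        if "X \<noteq> 0" for X Y W h d :: complex
      proof -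
        have "inverse X * X = 1" using that by simp
        then have "(2 * y - 2 * (inverse X * h) * w) * d = (2 * X * y - 2 * h * w) * d * inverse X"
          for y w by algebra
        then show ?thesis by (simp add: divide_inverse)
      qed
      moreover have "complex_of_real x \<noteq> 0" using elim by simp
      moreover have "cnj (1 / complex_of_real x) = 1 / of_real x" by simp
      ultimately show ?case
        unfolding herm_prod_cmult_right by (simp only: radial[OF conjunct2[OF elim], of j])
    qed
  qed
  have l1: "((\<lambda>x. deriv (deriv (G j)) (of_real x) / of_real x) \<longlongrightarrow>
      (2 / (1 - (of_real 0)\<^sup>2) - 2 * herm_prod (D v) (D v) / (1 - 0)) * D v $ j) ?F"
    by (rule Lim_transform_eventually[OF A B])
  have "(deriv (deriv (G j)) has_field_derivative deriv (deriv (deriv (G j))) 0) (at 0)"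
    by (rule holomorphic_derivI[OF hol2 open_ball]) simp
  then have "((\<lambda>z. deriv (deriv (G j)) z / z) \<longlongrightarrow> deriv (deriv (deriv (G j))) 0) (at 0)"
    unfolding has_field_derivative_iff by (simp add: d20)
  from lim_of_real[OF this]
  have l2: "((\<lambda>x. deriv (deriv (G j)) (of_real x) / of_real x) \<longlongrightarrow> deriv (deriv (deriv (G j))) 0) ?F" .
  have "deriv (deriv (deriv (G j))) 0 =
      (2 / (1 - (of_real 0)\<^sup>2) - 2 * herm_prod (D v) (D v) / (1 - 0)) * D v $ j"
    by (rule tendsto_unique[OF _ l2 l1]) simp
  then have "deriv (deriv (deriv (G j))) 0 = (2 - 2 * herm_prod (D v) (D v)) * D v $ j"
    by simp
  then show ?thesis by (simp add: G_def numeral_3_eq_3)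
qed

text \<open>
  The third derivative is homogeneous of degree 3, whereas \<open>totally_geodesic_third_derivative\<close> shows it
  to be homogeneous of degree 1 under multiplication of \<open>v\<close> by \<open>\<i>\<close>.  Since \<open>\<i>\<^sup>3 = - \<i>\<close>, it vanishes, so
  \<open>D v\<close> has norm 0 or 1.
\<close>
lemma totally_geodesic_imp_norm_preserving:
  fixes g :: "complex ^ 'n \<Rightarrow> complex ^ 'm"
  assumes g: "holomorphic_map_on g unit_ball" "g 0 = 0" "\<And>z. norm z < 1 \<Longrightarrow> norm (g z) < 1"
    and tg: "totally_geodesic_map unit_ball poincare_metric unit_ball poincare_metric g"
    and nonconst: "\<And>v. norm v = 1 \<Longrightarrow> \<exists>x. \<bar>x\<bar> < 1 \<and> g (x *\<^sub>R v) \<noteq> 0"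
    and z: "norm z < 1"
  shows "norm (g z) = norm z"
proof (cases "z = 0")
  case True
  then show ?thesis by (simp add: g(2))
next
  case False
  obtain D where D: "(g has_derivative D) (at 0)" "\<And>c v. D (c *s v) = c *s D v"
    by (rule holomorphic_map_on_ball_derivative[OF g(1), of 0]) auto
  define v where "v = of_real (1 / norm z) *s z"
  have v: "norm v = 1" using False by (simp add: v_def norm_cmult_vec norm_divide)
  have zv: "of_real (norm z) *s v = z" using False by (simp add: v_def)
  define G where "G = (\<lambda>j \<zeta>. g (\<zeta> *s v) $ j)"
  have hol: "G j holomorphic_on ball 0 1" for j
  proof -
    have "norm (0 + \<zeta> *s v) < 1" if "\<zeta> \<in> ball 0 1" for \<zeta>
      using that v by (simp add: norm_cmult_vec)
    from holomorphic_on_slice[OF g(1) this, of "ball 0 1" j] show ?thesis by (simp add: G_def)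
  qed
  have "(2 - 2 * herm_prod (D v) (D v)) * D v $ j = 0" for j
  proof -
    let ?X = "(2 - 2 * herm_prod (D v) (D v)) * D v $ j"
    have 1: "(deriv ^^ 3) (G j) 0 = ?X"
      unfolding G_def by (rule totally_geodesic_third_derivative[OF g(1,2) tg D v])
    have "norm (\<i> *s v) = 1" by (simp add: norm_cmult_vec v)
    from totally_geodesic_third_derivative[OF g(1,2) tg D this, of j]
    have "(deriv ^^ 3) (\<lambda>\<zeta>. G j (\<i> * \<zeta>)) 0 = \<i> * ?X"
      by (simp add: D(2) herm_prod_simps G_def vector_smult_assoc mult.commute)
    moreover have "(deriv ^^ 3) (\<lambda>\<zeta>. G j (\<i> * \<zeta>)) 0 = \<i> ^ 3 * (deriv ^^ 3) (G j) (\<i> * 0)"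
      by (rule higher_deriv_compose_linear[where T = "ball 0 1" and S = "ball 0 1"])
        (auto simp: norm_mult intro: hol)
    ultimately have "- \<i> * ?X = \<i> * ?X" by (simp add: 1 power3_eq_cube)
    moreover have "x = 0" if "- \<i> * x = \<i> * x" for x
      using that by (simp add: complex_eq_iff)
    ultimately show ?thesis by blast
  qed
  then have "D v = 0 \<or> 2 - 2 * herm_prod (D v) (D v) = 0" by (auto simp: vec_eq_iff)
  moreover have "D v \<noteq> 0"
  proof
    assume "D v = 0"
    let ?c = "\<lambda>t. g (tanh t *\<^sub>R v)"
    have geo: "geodesic_in unit_ball poincare_metric UNIV ?c"
      using tg[unfolded totally_geodesic_map_def, rule_format, of UNIV "\<lambda>t. tanh t *\<^sub>R v"]
        geodesic_tanh[OF v] by (simp add: o_def)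
    have "(tanh has_real_derivative 1) (at (0 :: real))"
      by (auto intro!: derivative_eq_intros)
    then have "((\<lambda>t. tanh t *\<^sub>R v) has_vector_derivative 1 *\<^sub>R v) (at 0)"
      unfolding has_real_derivative_iff_has_vector_derivative
      by (rule bounded_linear.has_vector_derivative[OF bounded_linear_scaleR_left])
    from vector_derivative_diff_chain_within[OF this, of g D]
    have "(?c has_vector_derivative 0) (at 0)"
      using D(1) \<open>D v = 0\<close> by (simp add: o_def has_derivative_at_withinI)
    from geodesic_constant_if_velocity_zero[OF geo this] have "?c t = 0" for t by (simp add: g(2))
    moreover obtain x where x: "\<bar>x\<bar> < 1" "g (x *\<^sub>R v) \<noteq> 0" using nonconst[OF v] by blast
    moreover have "tanh (ln (sqrt ((1 + x) / (1 - x)))) = x"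
      using x(1) by (rule tanh_surj)
    ultimately show False by metis
  qed
  ultimately have hD: "herm_prod (D v) (D v) = 1" by simp
  then have "complex_of_real ((norm (D v))\<^sup>2) = of_real 1" by (simp only: herm_prod_self of_real_1)
  then have "(norm (D v))\<^sup>2 = 1\<^sup>2" by (simp only: of_real_eq_iff power_one)
  then have nD: "norm (D v) = 1" by (simp only: power2_eq_iff_nonneg norm_ge_zero zero_le_one)
  define k where "k = (\<lambda>\<zeta>. herm_prod (g (\<zeta> *s v)) (D v))"
  have k: "k holomorphic_on ball 0 1" "k 0 = 0" "\<And>\<zeta>. norm \<zeta> < 1 \<Longrightarrow> norm (k \<zeta>) < 1"
    unfolding k_def using v nD g
    by (auto intro!: holomorphic_on_herm_prod_disc herm_prod_disc_bound)
  have "(k has_field_derivative (\<Sum>i\<in>UNIV. D v $ i * cnj (D v $ i))) (at 0)"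
    unfolding k_def herm_prod_def
    using has_field_derivative_slice[of g D 0 0 v] D
    by (intro DERIV_sum DERIV_cmult_right) simp
  then have dk: "deriv k 0 = 1"
    using hD by (simp add: DERIV_imp_deriv herm_prod_def)
  have nz: "norm (complex_of_real (norm z)) < 1" using z by simp
  have "\<exists>\<alpha>. (\<forall>\<zeta>. norm \<zeta> < 1 \<longrightarrow> k \<zeta> = \<alpha> * \<zeta>) \<and> norm \<alpha> = 1"
    by (rule Schwarz_Lemma(3)[OF k(1,2) _ nz], erule k(3), rule disjI2, simp only: dk norm_one)
  then obtain \<alpha> where "\<And>\<zeta>. norm \<zeta> < 1 \<Longrightarrow> k \<zeta> = \<alpha> * \<zeta>" "norm \<alpha> = 1" by blast
  then have "norm (k (of_real (norm z))) = norm z"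
    using nz by (simp add: norm_mult)
  moreover have "norm (k (of_real (norm z))) \<le> norm (g z)"
    using herm_prod_Cauchy_Schwarz[of "g z" "D v"] by (simp add: k_def zv nD)
  moreover have "norm (g z) \<le> norm z"
    by (rule schwarz_ball[OF g(1) g(3) g(2) z])
  ultimately show ?thesis by simp
qed

section \<open>Polynomials and the polarised boundary identity\<close>

text \<open>
  The polynomial functions as the smallest class closed under sums and products, so that their
  properties follow by rule induction instead of computations with multi-indices.
\<close>
inductive polyfun :: "(complex ^ 'n \<Rightarrow> complex) \<Rightarrow> bool" where
  polyfun_const: "polyfun (\<lambda>z. c)"
| polyfun_nth: "polyfun (\<lambda>z. z $ i)"
| polyfun_add: "polyfun p \<Longrightarrow> polyfun q \<Longrightarrow> polyfun (\<lambda>z. p z + q z)"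
| polyfun_mult: "polyfun p \<Longrightarrow> polyfun q \<Longrightarrow> polyfun (\<lambda>z. p z * q z)"

lemma polyfun_sum: "(\<And>i. i \<in> I \<Longrightarrow> polyfun (p i)) \<Longrightarrow> polyfun (\<lambda>z. \<Sum>i\<in>I. p i z)"
  by (induction I rule: infinite_finite_induct) (auto intro: polyfun.intros)

lemma polyfun_prod: "(\<And>i. i \<in> I \<Longrightarrow> polyfun (p i)) \<Longrightarrow> polyfun (\<lambda>z. \<Prod>i\<in>I. p i z)"
  by (induction I rule: infinite_finite_induct) (auto intro: polyfun.intros)

lemma polyfun_power: "polyfun p \<Longrightarrow> polyfun (\<lambda>z. p z ^ k)"
  by (induction k) (auto intro: polyfun.intros)

lemma poly_function_imp_polyfun: "poly_function p \<Longrightarrow> polyfun p"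
  unfolding poly_function_def
  by (auto intro!: polyfun_sum polyfun_mult polyfun_const polyfun_prod polyfun_power polyfun_nth)

lemma continuous_on_polyfun: "polyfun p \<Longrightarrow> continuous_on S p"
  by (induction rule: polyfun.induct) (auto intro!: continuous_intros)

lemma holomorphic_on_polyfun:
  assumes "polyfun p" "\<And>i. (\<lambda>\<zeta>. u \<zeta> $ i) holomorphic_on S"
  shows "(\<lambda>\<zeta>. p (u \<zeta>)) holomorphic_on S"
  using assms(1) by induction (auto intro!: holomorphic_intros assms(2))

lemma holomorphic_on_cnj_polyfun:
  assumes "polyfun p" "\<And>i. (\<lambda>\<zeta>. cnj (u \<zeta> $ i)) holomorphic_on S"
  shows "(\<lambda>\<zeta>. cnj (p (u \<zeta>))) holomorphic_on S"
  using assms(1) by induction (auto intro!: holomorphic_intros assms(2))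

text \<open>
  The bound on the degree and the continuity of the coefficients allow uniform statements about all
  lines close to a given one.
\<close>
lemma polyfun_on_lines:
  fixes p :: "complex ^ 'n \<Rightarrow> complex"
  assumes "polyfun p"
  obtains L d where "\<And>v t. p (a + t *s v) = poly (L v) t" "\<And>v. degree (L v) \<le> d"
    "\<And>k. continuous_on UNIV (\<lambda>v. coeff (L v) k)"
proof -
  have "\<exists>L d. (\<forall>v t. p (a + t *s v) = poly (L v) t) \<and> (\<forall>v. degree (L v) \<le> d) \<and>
    (\<forall>k. continuous_on UNIV (\<lambda>v. coeff (L v) k))"
    using assms
  proof induction
    case (polyfun_const c)
    show ?case by (rule exI[of _ "\<lambda>v. [:c:]"], rule exI[of _ 0]) auto
  next
    case (polyfun_nth i)
    have "continuous_on UNIV (\<lambda>v :: complex ^ 'n. coeff [:a $ i, v $ i:] k)" for k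
    proof -
      have "coeff [:a $ i, v $ i:] k = (if k = 0 then a $ i else if k = 1 then v $ i else 0)" for v :: "complex ^ 'n"
        by (simp add: coeff_pCons split: nat.splits)
      then show ?thesis by (cases "k = 0"; cases "k = 1") (auto intro!: continuous_intros)
    qed
    then show ?case
      by (intro exI[of _ "\<lambda>v. [:a $ i, v $ i:]"] exI[of _ 1]) (auto simp: degree_pCons_eq_if)
  next
    case (polyfun_add p q)
    then obtain L d M e where
      L: "\<And>v t. p (a + t *s v) = poly (L v) t" "\<And>v. degree (L v) \<le> d"
         "\<And>k. continuous_on UNIV (\<lambda>v. coeff (L v) k)" and
      M: "\<And>v t. q (a + t *s v) = poly (M v) t" "\<And>v. degree (M v) \<le> e"
         "\<And>k. continuous_on UNIV (\<lambda>v. coeff (M v) k)" by metis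
    have "degree (L v + M v) \<le> max d e" for v
      using L(2)[of v] M(2)[of v] by (intro degree_add_le) auto
    then show ?case
      using L M by (intro exI[of _ "\<lambda>v. L v + M v"] exI[of _ "max d e"]) (auto intro!: continuous_intros)
  next
    case (polyfun_mult p q)
    then obtain L d M e where
      L: "\<And>v t. p (a + t *s v) = poly (L v) t" "\<And>v. degree (L v) \<le> d"
         "\<And>k. continuous_on UNIV (\<lambda>v. coeff (L v) k)" and
      M: "\<And>v t. q (a + t *s v) = poly (M v) t" "\<And>v. degree (M v) \<le> e"
         "\<And>k. continuous_on UNIV (\<lambda>v. coeff (M v) k)" by metis
    have "degree (L v * M v) \<le> d + e" for v
      using L(2)[of v] M(2)[of v] degree_mult_le[of "L v" "M v"] by linarith
    then show ?case
      using L M by (intro exI[of _ "\<lambda>v. L v * M v"] exI[of _ "d + e"])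
        (auto simp: coeff_mult intro!: continuous_intros)
  qed
  then show ?thesis using that by blast
qed

lemma polyfun_eq_0_on_open:
  fixes p :: "complex ^ 'n \<Rightarrow> complex"
  assumes p: "polyfun p" and U: "open U" "a \<in> U" and z: "\<And>z. z \<in> U \<Longrightarrow> p z = 0"
  shows "p w = 0"
proof -
  obtain L d where L: "\<And>v t. p (a + t *s v) = poly (L v) t"
    by (rule polyfun_on_lines[OF p, of a]) blast
  let ?l = "\<lambda>t :: complex. a + t *s (w - a)"
  have "continuous_on UNIV ?l" by (intro continuous_intros)
  then have "open (?l -` U)" using U(1) by (simp add: continuous_on_open_vimage)
  moreover have "0 \<in> ?l -` U" using U(2) by simp
  ultimately obtain r where "r > 0" "ball 0 r \<subseteq> ?l -` U" by (meson open_contains_ball)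
  then have "ball 0 r \<subseteq> {t. poly (L (w - a)) t = 0}"
    using z by (auto simp: L [symmetric])
  then have "infinite {t. poly (L (w - a)) t = 0}"
    using uncountable_ball[OF \<open>r > 0\<close>, of "0 :: complex"] countable_finite finite_subset by blast
  then have "L (w - a) = 0" using poly_roots_finite by blast
  then show ?thesis using L[of 1 "w - a"] by simp
qed

lemma polyfun_mult_nonzero:
  fixes p q :: "complex ^ 'n \<Rightarrow> complex"
  assumes p: "polyfun p" "p \<noteq> (\<lambda>z. 0)" and q: "polyfun q" "q \<noteq> (\<lambda>z. 0)"
  shows "(\<lambda>z. p z * q z) \<noteq> (\<lambda>z. 0)"
proof
  assume "(\<lambda>z. p z * q z) = (\<lambda>z. 0)"
  then have pq: "p z * q z = 0" for z by metis
  obtain a where a: "p a \<noteq> 0" using p(2) by auto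
  have "open (p -` (- {0}))"
    using continuous_on_polyfun[OF p(1), of UNIV] by (simp add: continuous_on_open_vimage open_Compl)
  then have "q w = 0" for w
    by (rule polyfun_eq_0_on_open[OF q(1), of _ a]) (use a pq in auto)
  then show False using q(2) by auto
qed

lemma polyfun_prod_nonzero:
  fixes q :: "'i \<Rightarrow> complex ^ 'n \<Rightarrow> complex"
  assumes "finite I" "\<And>i. i \<in> I \<Longrightarrow> polyfun (q i) \<and> q i \<noteq> (\<lambda>z. 0)"
  shows "(\<lambda>z. \<Prod>i\<in>I. q i z) \<noteq> (\<lambda>z. 0)"
  using assms
proof (induction I)
  case empty
  show ?case by (simp add: fun_eq_iff)
next
  case (insert i I)
  have "(\<lambda>z. q i z * (\<Prod>i\<in>I. q i z)) \<noteq> (\<lambda>z. 0)"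
    by (rule polyfun_mult_nonzero) (use insert in \<open>auto intro!: polyfun_prod\<close>)
  then show ?case using insert(1,2) by simp
qed

text \<open>
  A common denominator of the components.  The equation is stated without division, so that it also
  holds, by continuity, where the denominator vanishes.
\<close>
lemma rational_proper_map_fraction:
  fixes f :: "complex ^ 'n \<Rightarrow> complex ^ 'm"
  assumes f: "rational_proper_map f"
  obtains P Q where "polyfun Q" "Q \<noteq> (\<lambda>z. 0)" "\<And>j. polyfun (P j)"
    "\<And>z j. norm z < 1 \<Longrightarrow> Q z * f z $ j = P j z"
proof -
  have cont: "continuous_on unit_ball f"
    using f continuous_on_holomorphic_map by (auto simp: rational_proper_map_def)
  have "\<forall>j. \<exists>p q. poly_function p \<and> poly_function q \<and> q \<noteq> (\<lambda>z. 0) \<and>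
     (\<forall>z\<in>unit_ball. q z \<noteq> 0 \<longrightarrow> f z $ j = p z / q z)"
    using f unfolding rational_proper_map_def rational_function_on_def by blast
  then obtain p q where pq0: "\<forall>j. poly_function (p j) \<and> poly_function (q j) \<and> q j \<noteq> (\<lambda>z. 0) \<and>
     (\<forall>z\<in>unit_ball. q j z \<noteq> 0 \<longrightarrow> f z $ j = p j z / q j z)"
    unfolding choice_iff by blast
  have pq: "poly_function (p j)" "poly_function (q j)" "q j \<noteq> (\<lambda>z. 0)"
    "norm z < 1 \<Longrightarrow> q j z \<noteq> 0 \<Longrightarrow> f z $ j = p j z / q j z" for j z
    using pq0 by auto
  have pol: "polyfun (p j)" "polyfun (q j)" for j using pq poly_function_imp_polyfun by blast+
  have qf: "q j z * f z $ j = p j z" if z: "norm z < 1" for j z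
  proof (rule ccontr)
    assume ne: "q j z * f z $ j \<noteq> p j z"
    let ?U = "unit_ball \<inter> (\<lambda>z. q j z * f z $ j - p j z) -` (- {0})"
    have "continuous_on unit_ball (\<lambda>z. q j z * f z $ j - p j z)"
      by (intro continuous_intros continuous_on_polyfun pol cont)
    then have "open ?U" by (intro continuous_open_preimage) auto
    moreover have "z \<in> ?U" using ne z by simp
    moreover have "q j w = 0" if "w \<in> ?U" for w using that pq(4)[of w j] by (cases "q j w = 0") auto
    ultimately have "q j w = 0" for w using polyfun_eq_0_on_open[OF pol(2)] by blast
    then show False using pq(3)[of j] by auto
  qed
  show ?thesis
  proof (rule that)
    show "polyfun (\<lambda>z. \<Prod>i\<in>UNIV. q i z)" by (intro polyfun_prod pol)
    show "(\<lambda>z. \<Prod>i\<in>UNIV. q i z) \<noteq> (\<lambda>z. 0)" by (rule polyfun_prod_nonzero) (use pol pq in auto)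
    show "polyfun (\<lambda>z. p j z * (\<Prod>i\<in>UNIV - {j}. q i z))" for j
      by (intro polyfun_mult polyfun_prod pol)
    show "(\<Prod>i\<in>UNIV. q i z) * f z $ j = p j z * (\<Prod>i\<in>UNIV - {j}. q i z)" if "norm z < 1" for z j
      using qf[OF that, of j] prod.remove[of UNIV j "\<lambda>i. q i z"] by (simp add: mult_ac)
  qed
qed

lemma rational_proper_map_norm:
  "rational_proper_map f \<Longrightarrow> norm z < 1 \<Longrightarrow> norm (f z) < 1"
  by (auto simp: rational_proper_map_def image_subset_iff)

text \<open>
  Properness, as compactness of the preimage of a closed ball.
\<close>
lemma rational_proper_map_bound:
  fixes f :: "complex ^ 'n \<Rightarrow> complex ^ 'm"
  assumes f: "rational_proper_map f" and r: "r < 1"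
  obtains \<rho> where "\<rho> < 1" "\<And>z. norm z < 1 \<Longrightarrow> norm (f z) \<le> r \<Longrightarrow> norm z \<le> \<rho>"
proof -
  have "compactin (top_of_set unit_ball) (cball (0 :: complex ^ 'm) r)"
    using r by (auto simp: compactin_subtopology)
  then have "compactin (top_of_set unit_ball) {z \<in> topspace (top_of_set unit_ball). f z \<in> cball 0 r}"
    using f unfolding rational_proper_map_def by (intro compactin_proper_map_preimage) auto
  then have "compact {z \<in> unit_ball. f z \<in> cball 0 r}"
    by (simp add: compactin_subtopology)
  then obtain \<rho> where "\<rho> < 1" "\<And>z. z \<in> {z \<in> unit_ball. f z \<in> cball 0 r} \<Longrightarrow> norm z \<le> \<rho>"
    by (rule compact_subset_ball_bound) auto
  then show ?thesis by (intro that[of \<rho>]) auto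
qed

lemma rational_proper_map_boundary:
  fixes f :: "complex ^ 'n \<Rightarrow> complex ^ 'm"
  assumes f: "rational_proper_map f" and z: "\<forall>\<^sub>F x in F. norm (z x) < 1"
    and lim: "((\<lambda>x. norm (z x)) \<longlongrightarrow> 1) F"
  shows "((\<lambda>x. norm (f (z x))) \<longlongrightarrow> 1) F"
proof (rule order_tendstoI)
  fix a :: real assume "a < 1"
  obtain \<rho> where \<rho>: "\<rho> < 1" "\<And>z. norm z < 1 \<Longrightarrow> norm (f z) \<le> a \<Longrightarrow> norm z \<le> \<rho>"
    by (rule rational_proper_map_bound[OF f \<open>a < 1\<close>]) blast
  show "\<forall>\<^sub>F x in F. a < norm (f (z x))"
    using z order_tendstoD(1)[OF lim \<rho>(1)] by eventually_elim (use \<rho>(2) in \<open>force simp: not_le [symmetric]\<close>)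
next
  fix a :: real assume "1 < a"
  show "\<forall>\<^sub>F x in F. norm (f (z x)) < a"
    using z by eventually_elim (use rational_proper_map_norm[OF f] \<open>1 < a\<close> in force)
qed

text \<open>
  By properness \<open>\<bar>f\<bar>\<close> tends to 1 along the radius ending at \<open>z\<close>.
\<close>
lemma boundary_identity:
  fixes f :: "complex ^ 'n \<Rightarrow> complex ^ 'm"
  assumes f: "rational_proper_map f" and Q: "polyfun Q" and P: "\<And>j. polyfun (P j)"
    and eq: "\<And>z j. norm z < 1 \<Longrightarrow> Q z * f z $ j = P j z" and z: "norm z = 1"
  shows "(\<Sum>j\<in>UNIV. P j z * cnj (P j z)) = Q z * cnj (Q z)"
proof -
  let ?F = "at_left (1 :: real)"
  have e: "\<forall>\<^sub>F t in ?F. 0 < t \<and> t < 1"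
    unfolding eventually_at_left_field by (intro exI[of _ 0]) auto
  have tz: "((\<lambda>t. t *\<^sub>R z) \<longlongrightarrow> z) ?F" by (auto intro!: tendsto_eq_intros)
  have e1: "\<forall>\<^sub>F t in ?F. norm (t *\<^sub>R z) < 1" using e by eventually_elim (simp add: z)
  have "((\<lambda>t. norm (t *\<^sub>R z)) \<longlongrightarrow> 1) ?F" using tendsto_norm[OF tz] by (simp add: z)
  from rational_proper_map_boundary[OF f e1 this]
  have nf: "((\<lambda>t. norm (f (t *\<^sub>R z))) \<longlongrightarrow> 1) ?F" .
  have lim: "((\<lambda>t. p (t *\<^sub>R z)) \<longlongrightarrow> p z) ?F" if "polyfun p" for p
  proof -
    have "isCont p z" using continuous_on_polyfun[OF that, of UNIV] by (simp add: continuous_on_eq_continuous_at)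
    from isCont_tendsto_compose[OF this tz] show ?thesis .
  qed
  have A: "((\<lambda>t. \<Sum>j\<in>UNIV. P j (t *\<^sub>R z) * cnj (P j (t *\<^sub>R z))) \<longlongrightarrow> (\<Sum>j\<in>UNIV. P j z * cnj (P j z))) ?F"
    by (intro tendsto_intros lim P)
  have B: "((\<lambda>t. Q (t *\<^sub>R z) * cnj (Q (t *\<^sub>R z)) * of_real ((norm (f (t *\<^sub>R z)))\<^sup>2)) \<longlongrightarrow>
      Q z * cnj (Q z) * of_real (1\<^sup>2)) ?F"
    by (intro tendsto_intros lim Q nf)
  have C: "\<forall>\<^sub>F t in ?F. (\<Sum>j\<in>UNIV. P j (t *\<^sub>R z) * cnj (P j (t *\<^sub>R z))) =
      Q (t *\<^sub>R z) * cnj (Q (t *\<^sub>R z)) * of_real ((norm (f (t *\<^sub>R z)))\<^sup>2)"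
    using e1
  proof eventually_elim
    case (elim t)
    show ?case
      unfolding herm_prod_self [symmetric] herm_prod_def sum_distrib_left
      by (rule sum.cong) (simp_all add: eq[OF elim, symmetric])
  qed
  have "(\<Sum>j\<in>UNIV. P j z * cnj (P j z)) = Q z * cnj (Q z) * of_real (1\<^sup>2)"
    by (rule tendsto_unique[OF _ Lim_transform_eventually[OF A C] B]) simp
  then show ?thesis by simp
qed

text \<open>
  With \<open>X = \<alpha>\<^sup>2\<close> and \<open>Y = \<beta>\<^sup>2\<close>, the vectors have to be found in the plane of \<open>z\<close> and \<open>w\<close> such that
  \<open>w = u\<^sub>1 + v\<^sub>1\<close> and \<open>z = X u\<^sub>1 + Y v\<^sub>1\<close>.  Any sufficiently large \<open>X\<close> can be chosen, and the orthogonality of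
  \<open>u\<^sub>1\<close> and \<open>v\<^sub>1\<close> then determines \<open>Y\<close>.
\<close>
lemma polarization_splitting:
  fixes z w :: "complex ^ 'n"
  assumes zw: "herm_prod z w = 1"
  obtains \<alpha> \<beta> :: real and u v where "\<alpha> > 0" "\<beta> > 0" "herm_prod u v = 0"
    "herm_prod u u + herm_prod v v = 1"
    "z = of_real \<alpha> *s u + of_real \<beta> *s v" "w = of_real (1 / \<alpha>) *s u + of_real (1 / \<beta>) *s v"
proof -
  define a where "a = (norm z)\<^sup>2"
  define b where "b = (norm w)\<^sup>2"
  have w0: "w \<noteq> 0" and z0: "z \<noteq> 0" using zw by auto
  have b0: "b > 0" using w0 by (simp add: b_def)
  have "1 \<le> norm z * norm w" using herm_prod_Cauchy_Schwarz[of z w] zw by simp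
  then have ab: "1 \<le> a * b"
    unfolding a_def b_def power_mult_distrib [symmetric] by (simp add: one_le_power)
  \<comment> \<open>Any \<open>X\<close> with \<open>X > a\<close> and \<open>X b > 1\<close> would do; this makes \<open>Y\<close> positive.\<close>
  define X where "X = a + 1 / b + 1"
  have "a \<ge> 0" by (simp add: a_def)
  then have X: "X > a" "X * b - 1 > 0" "X > 0"
    using b0 by (simp_all add: X_def field_simps add_pos_nonneg)
  define Y where "Y = (X - a) / (X * b - 1)"
  have Y: "Y > 0" using X by (simp add: Y_def)
  have Ye: "Y * (X * b - 1) = X - a" using X by (simp add: Y_def)
  have XY: "X - Y \<noteq> 0"
  proof
    assume "X - Y = 0"
    then have "X * (X * b - 1) = X - a" using Ye by simp
    then have "b * (X * (X * b - 1) - (X - a)) = 0" by simp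
    then have "(X * b - 1)\<^sup>2 + (a * b - 1) = 0" by (simp add: power2_eq_square algebra_simps)
    moreover have "(X * b - 1)\<^sup>2 > 0" using X(2) by simp
    ultimately show False using ab by linarith
  qed
  define k where "k = complex_of_real (1 / (X - Y))"
  have "1 / (X - Y) * (X - Y) = 1" using XY by simp
  then have k: "k * (complex_of_real X - of_real Y) = 1"
    unfolding k_def by (metis of_real_1 of_real_diff of_real_mult)
  define u1 where "u1 = k *s (z - of_real Y *s w)"
  define v1 where "v1 = k *s (of_real X *s w - z)"
  have "u1 + v1 = (k * (complex_of_real X - of_real Y)) *s w"
    by (simp only: u1_def v1_def vec_eq_iff) (simp add: algebra_simps)
  then have w': "w = u1 + v1" by (simp add: k)
  have "of_real X *s u1 + of_real Y *s v1 = (k * (complex_of_real X - of_real Y)) *s z"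
    by (simp only: u1_def v1_def vec_eq_iff) (simp add: algebra_simps)
  then have z': "z = of_real X *s u1 + of_real Y *s v1" by (simp add: k)
  have wz: "herm_prod w z = 1" using arg_cong[OF zw, of cnj] by (simp add: cnj_herm_prod)
  have "herm_prod (z - of_real Y *s w) (of_real X *s w - z) = of_real (X - a - Y * (X * b - 1))"
    by (simp add: herm_prod_simps zw wz herm_prod_self a_def b_def algebra_simps)
  then have "herm_prod (z - of_real Y *s w) (of_real X *s w - z) = 0" using Ye by simp
  then have orth: "herm_prod u1 v1 = 0"
    by (simp only: u1_def v1_def herm_prod_cmult_left herm_prod_cmult_right mult_zero_right)
  define \<alpha> where "\<alpha> = sqrt X"
  define \<beta> where "\<beta> = sqrt Y"
  have ab2: "\<alpha> > 0" "\<beta> > 0" "\<alpha> * \<alpha> = X" "\<beta> * \<beta> = Y" using X Y by (simp_all add: \<alpha>_def \<beta>_def)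
  have orth': "herm_prod v1 u1 = 0" using arg_cong[OF orth, of cnj] by (simp add: cnj_herm_prod)
  have "herm_prod z w = of_real X * herm_prod u1 u1 + of_real Y * herm_prod v1 v1"
    by (subst z', subst w') (simp add: herm_prod_simps orth orth')
  then have sum1: "of_real X * herm_prod u1 u1 + of_real Y * herm_prod v1 v1 = 1" using zw by simp
  have "complex_of_real \<alpha> * of_real \<alpha> = of_real X" "complex_of_real \<beta> * of_real \<beta> = of_real Y"
    using ab2 by (simp_all flip: of_real_mult)
  then show ?thesis
    using ab2 z' w' sum1
    by (intro that[of \<alpha> \<beta> "of_real \<alpha> *s u1" "of_real \<beta> *s v1"])
      (simp_all add: herm_prod_simps orth vector_smult_assoc mult.assoc [symmetric])
qed

text \<open>
  The pair \<open>(z, w)\<close> is joined to pairs on the diagonal of the sphere by a holomorphic family: with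
  \<open>Z \<zeta> = \<alpha> powr \<zeta> u + \<beta> powr \<zeta> v\<close> and \<open>W \<zeta>\<close> defined by the powers with exponent \<open>- cnj \<zeta>\<close>,
  the two points coincide and lie on the sphere for imaginary \<open>\<zeta>\<close>, and they are \<open>z\<close> and \<open>w\<close> for
  \<open>\<zeta> = 1\<close>.  The difference of the two sides is holomorphic in \<open>\<zeta>\<close>.
\<close>
lemma polarized_identity:
  fixes P :: "'m :: finite \<Rightarrow> complex ^ 'n \<Rightarrow> complex"
  assumes Q: "polyfun Q" and P: "\<And>j. polyfun (P j)"
    and sph: "\<And>z. norm z = 1 \<Longrightarrow> (\<Sum>j\<in>UNIV. P j z * cnj (P j z)) = Q z * cnj (Q z)"
    and zw: "herm_prod z w = 1"
  shows "(\<Sum>j\<in>UNIV. P j z * cnj (P j w)) = Q z * cnj (Q w)"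
proof -
  obtain \<alpha> \<beta> :: real and u v where ab: "\<alpha> > 0" "\<beta> > 0" and uv: "herm_prod u v = 0"
    "herm_prod u u + herm_prod v v = 1"
    and z: "z = of_real \<alpha> *s u + of_real \<beta> *s v" and w: "w = of_real (1 / \<alpha>) *s u + of_real (1 / \<beta>) *s v"
    by (rule polarization_splitting[OF zw]) blast
  define A where "A = complex_of_real (ln \<alpha>)"
  define B where "B = complex_of_real (ln \<beta>)"
  have eA1: "exp A = of_real \<alpha>"
    unfolding A_def by (subst exp_of_real) (simp only: exp_ln[OF ab(1)])
  have eB1: "exp B = of_real \<beta>"
    unfolding B_def by (subst exp_of_real) (simp only: exp_ln[OF ab(2)])
  have eA2: "exp (- A) = of_real (1 / \<alpha>)"
    by (simp only: exp_minus eA1 of_real_divide of_real_1 divide_inverse mult_1 of_real_inverse)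
  have eB2: "exp (- B) = of_real (1 / \<beta>)"
    by (simp only: exp_minus eB1 of_real_divide of_real_1 divide_inverse mult_1 of_real_inverse)
  define Z where "Z = (\<lambda>\<zeta>. exp (A * \<zeta>) *s u + exp (B * \<zeta>) *s v)"
  define W where "W = (\<lambda>\<zeta>. exp (- (A * cnj \<zeta>)) *s u + exp (- (B * cnj \<zeta>)) *s v)"
  define K where "K = (\<lambda>\<zeta>. (\<Sum>j\<in>UNIV. P j (Z \<zeta>) * cnj (P j (W \<zeta>))) - Q (Z \<zeta>) * cnj (Q (W \<zeta>)))"
  have cA: "cnj A = A" "cnj B = B" by (simp_all add: A_def B_def)
  have hZ: "(\<lambda>\<zeta>. Z \<zeta> $ i) holomorphic_on UNIV" for i
    unfolding Z_def by (auto intro!: holomorphic_intros)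
  have "(\<lambda>\<zeta>. exp (- (A * \<zeta>)) * cnj (u $ i) + exp (- (B * \<zeta>)) * cnj (v $ i)) holomorphic_on UNIV" for i
    by (intro holomorphic_intros)
  then have hW: "(\<lambda>\<zeta>. cnj (W \<zeta> $ i)) holomorphic_on UNIV" for i
    by (simp add: W_def exp_cnj cA)
  have hK: "K holomorphic_on UNIV"
    unfolding K_def
    by (intro holomorphic_on_diff holomorphic_on_sum holomorphic_on_mult
        holomorphic_on_polyfun[OF P hZ] holomorphic_on_polyfun[OF Q hZ]
        holomorphic_on_cnj_polyfun[OF P hW] holomorphic_on_cnj_polyfun[OF Q hW])
  have K0: "K (\<i> * of_real y) = 0" for y
  proof -
    have WZ: "W (\<i> * of_real y) = Z (\<i> * of_real y)" by (simp add: W_def Z_def)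
    have unit: "exp (of_real x * (\<i> * of_real y)) * cnj (exp (of_real x * (\<i> * of_real y))) = 1" for x
      by (simp add: exp_cnj flip: exp_add)
    have "herm_prod v u = 0" using arg_cong[OF uv(1), of cnj] by (simp add: cnj_herm_prod)
    then have "herm_prod (Z (\<i> * of_real y)) (Z (\<i> * of_real y)) =
       (exp (A * (\<i> * of_real y)) * cnj (exp (A * (\<i> * of_real y)))) * herm_prod u u +
       (exp (B * (\<i> * of_real y)) * cnj (exp (B * (\<i> * of_real y)))) * herm_prod v v"
      by (simp only: Z_def herm_prod_simps uv(1)) (simp add: mult_ac)
    also have "\<dots> = 1" unfolding A_def B_def unit using uv(2) by simp
    finally have "complex_of_real ((norm (Z (\<i> * of_real y)))\<^sup>2) = of_real 1"
      by (simp only: herm_prod_self of_real_1)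
    then have "(norm (Z (\<i> * of_real y)))\<^sup>2 = 1\<^sup>2" by (simp only: of_real_eq_iff power_one)
    then have "norm (Z (\<i> * of_real y)) = 1"
      by (simp only: power2_eq_iff_nonneg norm_ge_zero zero_le_one)
    then show ?thesis unfolding K_def WZ by (simp add: sph)
  qed
  have "K 1 = 0"
  proof (rule analytic_continuation[OF hK open_UNIV connected_UNIV, of "range (\<lambda>y. \<i> * complex_of_real y)" 0])
    obtain x :: "nat \<Rightarrow> real" where x: "\<And>n. x n \<noteq> 0" "x \<longlonglongrightarrow> 0"
      by (rule that[OF _ LIMSEQ_inverse_real_of_nat]) simp
    have "(\<lambda>n. \<i> * complex_of_real (x n)) \<longlonglongrightarrow> \<i> * of_real 0"
      by (intro tendsto_intros x(2))
    then show "0 islimpt range (\<lambda>y. \<i> * complex_of_real y)"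
      unfolding islimpt_sequential using x(1) by (intro exI[of _ "\<lambda>n. \<i> * complex_of_real (x n)"]) auto
  qed (use K0 in auto)
  moreover have "Z 1 = z" "W 1 = w" by (simp_all add: Z_def W_def z w eA1 eA2 eB1 eB2)
  ultimately show ?thesis by (simp add: K_def)
qed

section \<open>Rigidity of the Taylor coefficients\<close>

text \<open>
  The weights \<open>w\<close> at the points \<open>x\<close> form a functional; if it kills the polynomials of degree at
  most \<open>k\<close>, it kills \<open>\<phi> k\<close>.  The proof is by induction on \<open>k\<close>.  The relations express \<open>r i (k + 1)\<close> through
  \<open>r\<close> with a smaller second index and through \<open>\<phi> (k + 1)\<close>, at the cost of multiplying the weights by
  \<open>x\<close>, so the functional also kills \<open>r i k'\<close> in either variable when the index of that variable is smaller
  than \<open>k\<close>.  Applying it in both variables to the last relation shows that the vector to which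
  it maps \<open>\<phi> k\<close> has norm \<open>0\<close>.
\<close>
lemma functional_annihilates_coefficients:
  fixes \<phi> :: "nat \<Rightarrow> complex \<Rightarrow> complex ^ 'm" and r :: "nat \<Rightarrow> nat \<Rightarrow> complex \<Rightarrow> complex \<Rightarrow> complex"
    and x :: "'i \<Rightarrow> complex"
  assumes "\<And>s \<sigma>. s \<in> D \<Longrightarrow> \<sigma> \<in> D \<Longrightarrow> herm_prod (\<phi> 0 s) (\<phi> 0 \<sigma>) = 1"
    and "\<And>k s \<sigma>. s \<in> D \<Longrightarrow> \<sigma> \<in> D \<Longrightarrow> herm_prod (\<phi> 0 s) (\<phi> (Suc k) \<sigma>) = - r 0 k s \<sigma>"
    and "\<And>k s \<sigma>. s \<in> D \<Longrightarrow> \<sigma> \<in> D \<Longrightarrow> herm_prod (\<phi> (Suc k) s) (\<phi> 0 \<sigma>) = - r k 0 s \<sigma>"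
    and "\<And>i k s \<sigma>. s \<in> D \<Longrightarrow> \<sigma> \<in> D \<Longrightarrow> herm_prod (\<phi> (Suc i) s) (\<phi> (Suc k) \<sigma>) =
       - (r i (Suc k) s \<sigma> + r (Suc i) k s \<sigma> +
          (c00 + c10 * s + c01 * cnj \<sigma> + c11 * s * cnj \<sigma>) * r i k s \<sigma>)"
    and x: "\<And>l. l \<in> I \<Longrightarrow> x l \<in> D"
    and ann: "\<And>j. j \<le> k \<Longrightarrow> (\<Sum>l\<in>I. w l * x l ^ j) = 0"
  shows "(\<Sum>l\<in>I. w l *s \<phi> k (x l)) = 0"
proof -
  note N00 = assms(1) and N0 = assms(2) and Nk = assms(3) and N = assms(4)
  define ann where "ann = (\<lambda>k w. \<forall>j\<le>k. (\<Sum>l\<in>I. w l * x l ^ j) = 0)"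
  have ann1: "ann k w" and ann2: "ann k (\<lambda>l. w l * x l)" if "ann (Suc k) w" for k w
  proof -
    show "ann k w" using that by (simp add: ann_def)
    show "ann k (\<lambda>l. w l * x l)"
      unfolding ann_def
    proof (intro allI impI)
      fix j assume "j \<le> k"
      then have "(\<Sum>l\<in>I. w l * x l ^ Suc j) = 0" using that by (auto simp: ann_def)
      then show "(\<Sum>l\<in>I. w l * x l * x l ^ j) = 0" by (simp add: mult.assoc)
    qed
  qed
  \<comment> \<open>Up to level \<open>K\<close>, the functional kills the \<open>r\<close> as functions of the second variable.\<close>
  have right: "(\<Sum>l\<in>I. cnj (w l) * r i k s (x l)) = 0"
    if IH: "\<And>k w. k < K \<Longrightarrow> ann k w \<Longrightarrow> (\<Sum>l\<in>I. w l *s \<phi> k (x l)) = 0"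
      and "k < K" "ann k w" and s: "s \<in> D" for K k w i s
    using that(2,3)
  proof (induction k arbitrary: w i)
    case 0
    have "(\<Sum>l\<in>I. cnj (w l) * r i 0 s (x l)) = - herm_prod (\<phi> (Suc i) s) (\<Sum>l\<in>I. w l *s \<phi> 0 (x l))"
      unfolding herm_prod_sum_right herm_prod_cmult_right sum_negf [symmetric]
      by (rule sum.cong) (simp_all add: Nk[OF s x])
    then show ?case using IH[OF 0] by simp
  next
    case (Suc k)
    have "(\<Sum>l\<in>I. cnj (w l) * r i (Suc k) s (x l)) =
      (\<Sum>l\<in>I. - (cnj (w l) * herm_prod (\<phi> (Suc i) s) (\<phi> (Suc k) (x l)))
         - cnj (w l) * r (Suc i) k s (x l) - (c00 + c10 * s) * (cnj (w l) * r i k s (x l))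
         - (c01 + c11 * s) * (cnj (w l * x l) * r i k s (x l)))"
      by (rule sum.cong) (simp_all add: N[OF s x] algebra_simps)
    also have "\<dots> = - herm_prod (\<phi> (Suc i) s) (\<Sum>l\<in>I. w l *s \<phi> (Suc k) (x l))
         - (\<Sum>l\<in>I. cnj (w l) * r (Suc i) k s (x l)) - (c00 + c10 * s) * (\<Sum>l\<in>I. cnj (w l) * r i k s (x l))
         - (c01 + c11 * s) * (\<Sum>l\<in>I. cnj (w l * x l) * r i k s (x l))"
      by (simp only: sum_subtractf sum_negf sum_distrib_left herm_prod_sum_right herm_prod_cmult_right)
    also have "\<dots> = 0"
      using Suc.IH[OF Suc_lessD[OF Suc.prems(1)] ann1[OF Suc.prems(2)]]
        Suc.IH[OF Suc_lessD[OF Suc.prems(1)] ann2[OF Suc.prems(2)]] IH[OF Suc.prems]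
      by simp
    finally show ?case .
  qed
  \<comment> \<open>The same in the first variable.\<close>
  have left: "(\<Sum>l\<in>I. w l * r i k (x l) \<sigma>) = 0"
    if IH: "\<And>k w. k < K \<Longrightarrow> ann k w \<Longrightarrow> (\<Sum>l\<in>I. w l *s \<phi> k (x l)) = 0"
      and "i < K" "ann i w" and s: "\<sigma> \<in> D" for K k w i \<sigma>
    using that(2,3)
  proof (induction i arbitrary: w k)
    case 0
    have "(\<Sum>l\<in>I. w l * r 0 k (x l) \<sigma>) = - herm_prod (\<Sum>l\<in>I. w l *s \<phi> 0 (x l)) (\<phi> (Suc k) \<sigma>)"
      unfolding herm_prod_sum_left herm_prod_cmult_left sum_negf [symmetric]
      by (rule sum.cong) (simp_all add: N0[OF x s])
    then show ?case using IH[OF 0] by simp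
  next
    case (Suc i)
    have "(\<Sum>l\<in>I. w l * r (Suc i) k (x l) \<sigma>) =
      (\<Sum>l\<in>I. - (w l * herm_prod (\<phi> (Suc i) (x l)) (\<phi> (Suc k) \<sigma>))
         - w l * r i (Suc k) (x l) \<sigma> - (c00 + c01 * cnj \<sigma>) * (w l * r i k (x l) \<sigma>)
         - (c10 + c11 * cnj \<sigma>) * (w l * x l * r i k (x l) \<sigma>))"
      by (rule sum.cong) (simp_all add: N[OF x s] algebra_simps)
    also have "\<dots> = - herm_prod (\<Sum>l\<in>I. w l *s \<phi> (Suc i) (x l)) (\<phi> (Suc k) \<sigma>)
         - (\<Sum>l\<in>I. w l * r i (Suc k) (x l) \<sigma>) - (c00 + c01 * cnj \<sigma>) * (\<Sum>l\<in>I. w l * r i k (x l) \<sigma>)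
         - (c10 + c11 * cnj \<sigma>) * (\<Sum>l\<in>I. w l * x l * r i k (x l) \<sigma>)"
      by (simp only: sum_subtractf sum_negf sum_distrib_left herm_prod_sum_left herm_prod_cmult_left)
    also have "\<dots> = 0"
      using Suc.IH[OF Suc_lessD[OF Suc.prems(1)] ann1[OF Suc.prems(2)]]
        Suc.IH[OF Suc_lessD[OF Suc.prems(1)] ann2[OF Suc.prems(2)]] IH[OF Suc.prems]
      by simp
    finally show ?case .
  qed
  have "(\<Sum>l\<in>I. w l *s \<phi> k (x l)) = 0" if "ann k w" for k w
    using that
  proof (induction k arbitrary: w rule: less_induct)
    case (less k)
    let ?v = "\<Sum>l\<in>I. w l *s \<phi> k (x l)"
    have v: "herm_prod ?v ?v = (\<Sum>l'\<in>I. cnj (w l') * (\<Sum>l\<in>I. w l * herm_prod (\<phi> k (x l)) (\<phi> k (x l'))))"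
      by (simp only: herm_prod_sum_left herm_prod_sum_right herm_prod_cmult_left herm_prod_cmult_right)
    have "herm_prod ?v ?v = 0"
    proof (cases k)
      case 0
      have "(\<Sum>l\<in>I. w l * herm_prod (\<phi> k (x l)) (\<phi> k (x l'))) = 0" if "l' \<in> I" for l'
      proof -
        have "(\<Sum>l\<in>I. w l * herm_prod (\<phi> k (x l)) (\<phi> k (x l'))) = (\<Sum>l\<in>I. w l * x l ^ 0)"
          by (rule sum.cong) (simp_all add: 0 N00 x that)
        also have "\<dots> = 0" using less.prems unfolding ann_def by blast
        finally show ?thesis .
      qed
      then show ?thesis unfolding v by simp
    next
      case (Suc i)
      have a: "ann i w" "ann i (\<lambda>l. w l * x l)" using less.prems Suc ann1 ann2 by auto
      have IH: "(\<Sum>l\<in>I. w l *s \<phi> k' (x l)) = 0" if "k' < Suc i" "ann k' w" for k' w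
        using less.IH[of k' w] that Suc by simp
      have in1: "(\<Sum>l\<in>I. w l * herm_prod (\<phi> k (x l)) (\<phi> k (x l'))) =
          - (\<Sum>l\<in>I. w l * r (Suc i) i (x l) (x l'))" if l': "l' \<in> I" for l'
      proof -
        have "(\<Sum>l\<in>I. w l * herm_prod (\<phi> k (x l)) (\<phi> k (x l'))) =
          (\<Sum>l\<in>I. - (w l * r (Suc i) i (x l) (x l')) - w l * r i (Suc i) (x l) (x l')
            - (c00 + c01 * cnj (x l')) * (w l * r i i (x l) (x l'))
            - (c10 + c11 * cnj (x l')) * (w l * x l * r i i (x l) (x l')))"
          by (rule sum.cong) (simp_all add: Suc N[OF x x] l' algebra_simps)
        also have "\<dots> = - (\<Sum>l\<in>I. w l * r (Suc i) i (x l) (x l')) - (\<Sum>l\<in>I. w l * r i (Suc i) (x l) (x l'))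
            - (c00 + c01 * cnj (x l')) * (\<Sum>l\<in>I. w l * r i i (x l) (x l'))
            - (c10 + c11 * cnj (x l')) * (\<Sum>l\<in>I. w l * x l * r i i (x l) (x l'))"
          by (simp only: sum_subtractf sum_negf sum_distrib_left)
        also have "\<dots> = - (\<Sum>l\<in>I. w l * r (Suc i) i (x l) (x l'))"
          using left[OF IH lessI a(1) x[OF l']] left[OF IH lessI a(2) x[OF l']] by simp
        finally show ?thesis .
      qed
      have "herm_prod ?v ?v = - (\<Sum>l'\<in>I. \<Sum>l\<in>I. w l * (cnj (w l') * r (Suc i) i (x l) (x l')))"
        unfolding v by (simp add: in1 sum_negf sum_distrib_left mult_ac)
      also have "(\<Sum>l'\<in>I. \<Sum>l\<in>I. w l * (cnj (w l') * r (Suc i) i (x l) (x l'))) =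
          (\<Sum>l\<in>I. w l * (\<Sum>l'\<in>I. cnj (w l') * r (Suc i) i (x l) (x l')))"
        by (subst sum.swap) (simp add: sum_distrib_left)
      also have "\<dots> = 0" using right[OF IH lessI a(1) x] by simp
      finally show ?thesis by simp
    qed
    then show ?case by (simp only: herm_prod_eq_0_iff)
  qed
  then show ?thesis using ann by (simp add: ann_def)
qed

lemma sum_powers_root_of_unity:
  assumes "\<eta> ^ Suc k = 1" "\<eta> \<noteq> (1 :: complex)"
  shows "(\<Sum>l\<le>k. \<eta> ^ l) = 0"
  using assms geometric_sum[of \<eta> "Suc k"] by (simp add: lessThan_Suc_atMost)

text \<open>
  Interpolation at the points \<open>\<rho> \<omega>\<^sup>l\<close>, where \<open>\<omega>\<close> is a primitive root of unity of order \<open>k + 1\<close>: the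
  functional that subtracts the interpolation polynomial from the value at \<open>s\<close> kills the polynomials of
  degree at most \<open>k\<close>.  With these nodes the coefficients satisfy Cauchy's estimates.
\<close>
lemma polynomial_if_annihilated:
  fixes \<phi> :: "complex \<Rightarrow> complex ^ 'm"
  assumes \<rho>: "\<rho> > 0" and bound: "\<And>s. cmod s \<le> \<rho> \<Longrightarrow> norm (\<phi> s) \<le> M"
    and ann: "\<And>w x. (\<And>l. l \<le> Suc k \<Longrightarrow> cmod (x l) \<le> \<rho>) \<Longrightarrow>
      (\<And>j. j \<le> k \<Longrightarrow> (\<Sum>l\<le>Suc k. w l * x l ^ j) = 0) \<Longrightarrow> (\<Sum>l\<le>Suc k. w l *s \<phi> (x l)) = 0"
  obtains b where "\<And>s. cmod s \<le> \<rho> \<Longrightarrow> \<phi> s = (\<Sum>j\<le>k. s ^ j *s b j)" "\<And>j. norm (b j) \<le> M / \<rho> ^ j"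
proof -
  define \<omega> where "\<omega> = cis (2 * pi / real (Suc k))"
  have \<omega>l: "\<omega> ^ l = cis (2 * pi * real l / real (Suc k))" for l
    unfolding \<omega>_def by (subst Complex.DeMoivre) (rule arg_cong[where f = cis], simp)
  have inj: "inj_on (\<lambda>l. \<omega> ^ l) {..<Suc k}"
    unfolding \<omega>l using bij_betw_imp_inj_on[OF Complex.bij_betw_roots_unity[of "Suc k"]] by simp
  have \<omega>1: "\<omega> ^ Suc k = 1" unfolding \<omega>l by (simp del: of_nat_Suc)
  have \<omega>0: "\<omega> \<noteq> 0" by (simp add: \<omega>_def)
  have n\<omega>: "cmod (\<omega> ^ l) = 1" for l by (simp add: \<omega>l)
  define y where "y = (\<lambda>l. of_real \<rho> * \<omega> ^ l)"
  have ny: "cmod (y l) = \<rho>" for l using \<rho> by (simp add: y_def norm_mult n\<omega>)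
  have y0: "y l \<noteq> 0" for l using ny[of l] \<rho> by auto
  have orth: "(\<Sum>l\<le>k. inverse (y l) ^ j * y l ^ i) = (if i = j then of_nat (Suc k) else 0)"
    if ij: "i \<le> k" "j \<le> k" for i j
  proof -
    let ?\<eta> = "\<omega> ^ i * inverse (\<omega> ^ j)"
    have e: "inverse (y l) ^ j * y l ^ i = (of_real \<rho> ^ i * inverse (of_real \<rho> ^ j)) * ?\<eta> ^ l" for l
      by (simp add: y_def power_mult_distrib power_inverse [symmetric] mult_ac flip: power_mult)
    have "(\<Sum>l\<le>k. inverse (y l) ^ j * y l ^ i) = (of_real \<rho> ^ i * inverse (of_real \<rho> ^ j)) * (\<Sum>l\<le>k. ?\<eta> ^ l)"
      unfolding e by (simp add: sum_distrib_left)
    moreover have "(\<Sum>l\<le>k. ?\<eta> ^ l) = 0" if "i \<noteq> j"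
    proof (rule sum_powers_root_of_unity)
      have w: "(\<omega> ^ i) ^ Suc k = 1" "(\<omega> ^ j) ^ Suc k = 1"
        by (simp_all only: power_mult [symmetric] mult.commute[of _ "Suc k"]) (simp_all only: power_mult \<omega>1 power_one)
      show "?\<eta> ^ Suc k = 1" unfolding divide_inverse [symmetric] power_divide w by simp
      have "\<omega> ^ i \<noteq> \<omega> ^ j" using inj_onD[OF inj, of i j] ij that by auto
      then show "?\<eta> \<noteq> 1" using \<omega>0 by (simp add: field_simps)
    qed
    moreover have "(of_real \<rho> ^ i * inverse (of_real \<rho> ^ j)) * (\<Sum>l\<le>k. ?\<eta> ^ l) = of_nat (Suc k)" if "i = j"
      using \<rho> \<omega>0 that by simp
    ultimately show ?thesis by auto
  qed
  define b where "b = (\<lambda>j. (1 / of_nat (Suc k)) *s (\<Sum>l\<le>k. inverse (y l) ^ j *s \<phi> (y l)))"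
  show ?thesis
  proof (rule that)
    fix s assume s: "cmod s \<le> \<rho>"
    define x where "x = (\<lambda>l. if l \<le> k then y l else s)"
    define w where "w = (\<lambda>l. if l \<le> k then - (1 / of_nat (Suc k)) * (\<Sum>j\<le>k. s ^ j * inverse (y l) ^ j) else 1)"
    have "(\<Sum>l\<le>Suc k. w l *s \<phi> (x l)) = 0"
    proof (rule ann)
      show "cmod (x l) \<le> \<rho>" for l using s ny by (simp add: x_def)
      fix i assume i: "i \<le> k"
      have "(\<Sum>l\<le>Suc k. w l * x l ^ i) = s ^ i - (1 / of_nat (Suc k)) *
          (\<Sum>l\<le>k. \<Sum>j\<le>k. s ^ j * (inverse (y l) ^ j * y l ^ i))"
        by (simp add: w_def x_def sum_distrib_left sum_distrib_right sum_negf mult_ac)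
      also have "(\<Sum>l\<le>k. \<Sum>j\<le>k. s ^ j * (inverse (y l) ^ j * y l ^ i)) =
          (\<Sum>j\<le>k. s ^ j * (\<Sum>l\<le>k. inverse (y l) ^ j * y l ^ i))"
        by (subst sum.swap) (simp add: sum_distrib_left)
      also have "\<dots> = (\<Sum>j\<le>k. s ^ j * (if i = j then of_nat (Suc k) else 0))"
        by (rule sum.cong) (simp_all add: orth i del: of_nat_Suc)
      also have "\<dots> = s ^ i * of_nat (Suc k)"
        using i by (simp add: if_distrib [of "\<lambda>c. _ * c"] sum.delta del: of_nat_Suc cong: if_cong)
      finally show "(\<Sum>l\<le>Suc k. w l * x l ^ i) = 0" by (simp del: of_nat_Suc)
    qed
    then have "\<phi> s = - (\<Sum>l\<le>k. w l *s \<phi> (x l))"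
      by (simp add: w_def x_def eq_neg_iff_add_eq_0 add.commute)
    also have "\<dots> = (\<Sum>l\<le>k. \<Sum>j\<le>k. (1 / of_nat (Suc k)) *s (s ^ j *s (inverse (y l) ^ j *s \<phi> (y l))))"
    proof -
      have "- (w l *s \<phi> (x l)) = (\<Sum>j\<le>k. (1 / of_nat (Suc k)) *s (s ^ j *s (inverse (y l) ^ j *s \<phi> (y l))))"
        if "l \<le> k" for l
        using that by (simp add: w_def x_def vec_eq_iff sum_distrib_left sum_distrib_right sum_negf mult_ac del: of_nat_Suc)
      then show ?thesis by (simp add: sum_negf [symmetric] del: of_nat_Suc)
    qed
    also have "\<dots> = (\<Sum>j\<le>k. s ^ j *s b j)"
      by (subst sum.swap)
        (simp add: b_def vec_eq_iff sum_distrib_left mult_ac del: of_nat_Suc)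
    finally show "\<phi> s = (\<Sum>j\<le>k. s ^ j *s b j)" .
  next
    fix j
    have "norm (\<Sum>l\<le>k. inverse (y l) ^ j *s \<phi> (y l)) \<le> (\<Sum>l\<le>k. M / \<rho> ^ j)"
    proof (rule sum_norm_le)
      fix l
      have "norm (\<phi> (y l)) \<le> M" using bound ny by simp
      then show "norm (inverse (y l) ^ j *s \<phi> (y l)) \<le> M / \<rho> ^ j"
        using \<rho> by (simp add: norm_cmult_vec norm_power norm_inverse ny divide_inverse power_inverse mult.commute mult_left_mono)
    qed
    then have "norm (\<Sum>l\<le>k. inverse (y l) ^ j *s \<phi> (y l)) \<le> M / \<rho> ^ j * real (Suc k)"
      by (simp add: mult.commute del: of_nat_Suc)
    then have "norm (\<Sum>l\<le>k. inverse (y l) ^ j *s \<phi> (y l)) / real (Suc k) \<le> M / \<rho> ^ j"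
      by (simp only: pos_divide_le_eq of_nat_0_less_iff zero_less_Suc)
    moreover have "cmod (1 / of_nat (Suc k)) = 1 / real (Suc k)"
      by (simp only: norm_divide norm_one norm_of_nat)
    ultimately show "norm (b j) \<le> M / \<rho> ^ j"
      unfolding b_def norm_cmult_vec by (simp only: times_divide_eq_left mult_1)
  qed
qed

definition taylor_vec :: "(complex \<Rightarrow> complex ^ 'm) \<Rightarrow> nat \<Rightarrow> complex ^ 'm"
  where "taylor_vec a k = (\<chi> j. fps_nth (fps_expansion (\<lambda>t. a t $ j) 0) k)"

lemma has_fps_expansion_cnj:
  assumes "f has_fps_expansion F"
  shows "(\<lambda>z. cnj (f (cnj z))) has_fps_expansion Abs_fps (\<lambda>k. cnj (fps_nth F k))"
proof (rule has_fps_expansionI)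
  obtain \<epsilon> where \<epsilon>: "\<epsilon> > 0" "\<And>z. cmod z < \<epsilon> \<Longrightarrow> eval_fps F z = f z \<and> ereal (cmod z) < fps_conv_radius F"
  proof -
    have 1: "\<forall>\<^sub>F z in nhds 0. eval_fps F z = f z" and 2: "0 < fps_conv_radius F"
      using assms by (auto simp: has_fps_expansion_def)
    have 3: "\<forall>\<^sub>F z in nhds (0 :: complex). z \<in> eball 0 (fps_conv_radius F)"
      using 2 by (intro eventually_nhds_in_open) (auto simp: in_eball_iff zero_ereal_def)
    have "\<forall>\<^sub>F z in nhds 0. eval_fps F z = f z \<and> ereal (cmod z) < fps_conv_radius F"
      using 1 3 by eventually_elim (simp add: in_eball_iff)
    then show ?thesis using that by (auto simp: eventually_nhds_metric dist_norm)
  qed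
  have "(\<lambda>n. fps_nth (Abs_fps (\<lambda>k. cnj (fps_nth F k))) n * u ^ n) sums cnj (f (cnj u))" if "cmod u < \<epsilon>" for u
  proof -
    have "(\<lambda>n. fps_nth F n * cnj u ^ n) sums f (cnj u)"
      using sums_eval_fps[of "cnj u" F] \<epsilon>(2)[of "cnj u"] that by simp
    then have "(\<lambda>n. cnj (fps_nth F n * cnj u ^ n)) sums cnj (f (cnj u))"
      by (simp only: sums_cnj)
    then show ?thesis by simp
  qed
  then show "\<forall>\<^sub>F u in nhds 0. (\<lambda>n. fps_nth (Abs_fps (\<lambda>k. cnj (fps_nth F k))) n * u ^ n) sums cnj (f (cnj u))"
    using \<epsilon>(1) by (auto simp: eventually_nhds_metric dist_norm)
qed

lemma has_fps_expansion_sum':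
  fixes f :: "'i \<Rightarrow> complex \<Rightarrow> complex"
  assumes "\<And>i. i \<in> I \<Longrightarrow> f i has_fps_expansion F i"
  shows "(\<lambda>z. \<Sum>i\<in>I. f i z) has_fps_expansion (\<Sum>i\<in>I. F i)"
  using assms by (induction I rule: infinite_finite_induct) (auto intro!: fps_expansion_intros)

text \<open>
  The points \<open>p + t v\<close> and \<open>p + \<tau> v'\<close> with \<open>\<langle>v, p\<rangle> = \<langle>v', p\<rangle> = 1\<close> and \<open>c = \<langle>v, v'\<rangle>\<close> have product 1
  exactly if \<open>t + \<tau>' + c t \<tau>' = 0\<close> for \<open>\<tau>' = cnj \<tau>\<close>, that is, \<open>t = - \<tau>' / (1 + c \<tau>')\<close>.  If
  \<open>1 - \<langle>a t, b \<tau>\<rangle>\<close> vanishes under this relation, it is divisible by \<open>t + \<tau>' + c t \<tau>'\<close> as a power series in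
  \<open>t\<close> and \<open>\<tau>'\<close>; the \<open>r i k\<close> are the coefficients of the quotient, and the equations compare coefficients.
\<close>
lemma reflection_coefficients:
  fixes a b :: "complex \<Rightarrow> complex ^ 'm"
  assumes \<delta>: "\<delta> > 0" and a: "\<And>j. (\<lambda>t. a t $ j) holomorphic_on ball 0 \<delta>"
    and b: "\<And>j. (\<lambda>t. b t $ j) holomorphic_on ball 0 \<delta>"
    and rel: "\<forall>\<^sub>F \<tau> in at 0. herm_prod (a (- \<tau> / (1 + c * \<tau>))) (b (cnj \<tau>)) = 1"
  obtains r :: "nat \<Rightarrow> nat \<Rightarrow> complex" where
    "herm_prod (taylor_vec a 0) (taylor_vec b 0) = 1"
    "\<And>k. herm_prod (taylor_vec a 0) (taylor_vec b (Suc k)) = - r 0 k"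
    "\<And>k. herm_prod (taylor_vec a (Suc k)) (taylor_vec b 0) = - r k 0"
    "\<And>i k. herm_prod (taylor_vec a (Suc i)) (taylor_vec b (Suc k)) = - (r i (Suc k) + r (Suc i) k + c * r i k)"
proof -
  define F where "F = (\<lambda>j. fps_expansion (\<lambda>t. a t $ j) 0)"
  define G where "G = (\<lambda>j. Abs_fps (\<lambda>k. cnj (fps_nth (fps_expansion (\<lambda>t. b t $ j) 0) k)))"
  define V where "V = 1 + fps_const c * fps_X"
  define T where "T = - fps_X * inverse V"
  have V0: "fps_nth V 0 \<noteq> 0" by (simp add: V_def)
  have VT: "V * T = - fps_X"
  proof -
    have "V * T = - fps_X * (V * inverse V)" by (simp add: T_def mult_ac)
    then show ?thesis using inverse_mult_eq_1'[OF V0] by simp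
  qed
  have T0: "fps_nth T 0 = 0" by (simp add: T_def)
  have Fe: "(\<lambda>t. a t $ j) has_fps_expansion F j" for j
    unfolding F_def by (rule has_fps_expansion_fps_expansion[OF open_ball _ a]) (use \<delta> in simp)
  have be: "(\<lambda>t. b t $ j) has_fps_expansion fps_expansion (\<lambda>t. b t $ j) 0" for j
    by (rule has_fps_expansion_fps_expansion[OF open_ball _ b]) (use \<delta> in simp)
  have Ge: "(\<lambda>t. cnj (b (cnj t) $ j)) has_fps_expansion G j" for j
    unfolding G_def by (rule has_fps_expansion_cnj[OF be])
  have "(\<lambda>t. 1 + c * t) has_fps_expansion V"
    unfolding V_def by (intro fps_expansion_intros)
  then have "(\<lambda>t. inverse (1 + c * t)) has_fps_expansion inverse V"
    using V0 by (intro has_fps_expansion_inverse)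
  then have Te: "(\<lambda>t. - t * inverse (1 + c * t)) has_fps_expansion T"
    unfolding T_def by (intro has_fps_expansion_mult has_fps_expansion_minus has_fps_expansion_fps_X)
  define h where "h = (\<lambda>\<tau>. herm_prod (a (- \<tau> * inverse (1 + c * \<tau>))) (b (cnj \<tau>)))"
  have hexp: "h has_fps_expansion (\<Sum>j\<in>UNIV. (F j oo T) * G j)"
    unfolding h_def herm_prod_def
    by (intro has_fps_expansion_sum' has_fps_expansion_mult Ge
        has_fps_expansion_compose[OF Fe Te T0, unfolded o_def])
  have h1: "\<forall>\<^sub>F \<tau> in at 0. h \<tau> = 1" using rel by (simp add: h_def divide_inverse)
  have "(h \<longlongrightarrow> h 0) (at 0)"
    using has_fps_expansion_imp_continuous[OF hexp, of UNIV] by (simp add: continuous_within)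
  moreover have "(h \<longlongrightarrow> 1) (at 0)" using h1 by (rule tendsto_eventually)
  ultimately have "h 0 = 1" using tendsto_unique trivial_limit_at by blast
  then have "\<forall>\<^sub>F \<tau> in nhds 0. h \<tau> = 1" using h1 by (simp add: eventually_nhds_conv_at)
  then have "h has_fps_expansion 1"
    using has_fps_expansion_1 has_fps_expansion_cong[of h "\<lambda>_. 1"] by simp
  then have sum1: "(\<Sum>j\<in>UNIV. (F j oo T) * G j) = 1"
    using hexp fps_expansion_unique_complex by blast
  \<comment> \<open>Long division: \<open>S i\<close> is what remains of the coefficients of index at least \<open>i\<close> in \<open>t\<close> after substituting \<open>T\<close> for \<open>t\<close>.\<close>
  define S where "S = (\<lambda>i. (if i = 0 then 1 else 0) - (\<Sum>j\<in>UNIV. (fps_shift i (F j) oo T) * G j))"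
  define N where "N = (\<lambda>i. (if i = 0 then 1 else 0) - (\<Sum>j\<in>UNIV. fps_const (fps_nth (F j) i) * G j))"
  have S0: "S 0 = 0" by (simp add: S_def sum1)
  have step: "S i = N i + T * S (Suc i)" for i
  proof -
    have "fps_shift i f = fps_const (fps_nth f i) + fps_X * fps_shift (Suc i) f" for f :: "complex fps"
      by (rule fps_ext) (auto simp: fps_X_mult_nth)
    then have "fps_shift i f oo T = fps_const (fps_nth f i) + T * (fps_shift (Suc i) f oo T)" for f
      using T0 by (simp add: fps_compose_add_distrib fps_compose_mult_distrib fps_X_fps_compose_startby0)
    then show ?thesis
      by (simp add: S_def N_def distrib_right sum.distrib sum_distrib_left mult.assoc)
  qed
  define R where "R = (\<lambda>i. S (Suc i) * inverse V)"
  have SR: "S (Suc i) = V * R i" for i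
  proof -
    have "V * R i = (V * inverse V) * S (Suc i)" by (simp only: R_def mult.commute mult.left_commute)
    then show ?thesis by (simp only: inverse_mult_eq_1'[OF V0] mult_1)
  qed
  have TS: "T * S (Suc i) = - fps_X * R i" for i
  proof -
    have "T * S (Suc i) = (V * T) * R i" unfolding SR by (simp only: mult.commute mult.left_commute)
    then show ?thesis by (simp only: VT)
  qed
  have "0 = N 0 + - fps_X * R 0" using step[of 0] unfolding TS S0 .
  then have N0: "N 0 = fps_X * R 0" by simp
  have "V * R i = N (Suc i) + - fps_X * R (Suc i)" for i
    using step[of "Suc i"] unfolding TS unfolding SR .
  then have NS: "N (Suc i) = V * R i + fps_X * R (Suc i)" for i by simp
  have Nn: "fps_nth (N i) k = (if i = 0 \<and> k = 0 then 1 else 0) - herm_prod (taylor_vec a i) (taylor_vec b k)" for i k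
    by (simp add: N_def fps_sum_nth herm_prod_def taylor_vec_def F_def G_def)
  show ?thesis
  proof (rule that)
    show "herm_prod (taylor_vec a 0) (taylor_vec b 0) = 1"
      using Nn[of 0 0] by (simp add: N0)
    show "herm_prod (taylor_vec a 0) (taylor_vec b (Suc k)) = - fps_nth (R 0) k" for k
      using Nn[of 0 "Suc k"] by (simp add: N0)
    show "herm_prod (taylor_vec a (Suc k)) (taylor_vec b 0) = - fps_nth (R k) 0" for k
      using Nn[of "Suc k" 0] by (simp add: NS V_def)
    show "herm_prod (taylor_vec a (Suc i)) (taylor_vec b (Suc k)) =
        - (fps_nth (R i) (Suc k) + fps_nth (R (Suc i)) k + c * fps_nth (R i) k)" for i k
    proof -
      have "- herm_prod (taylor_vec a (Suc i)) (taylor_vec b (Suc k)) =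
          fps_nth (R i) (Suc k) + c * fps_nth (R i) k + fps_nth (R (Suc i)) k"
        using Nn[of "Suc i" "Suc k"] by (simp add: NS V_def distrib_right mult.assoc)
      from arg_cong[OF this, of uminus] show ?thesis by (simp add: algebra_simps)
    qed
  qed
qed

section \<open>Lines through a boundary point\<close>

lemma poly_eq_power_mult_sum:
  fixes p :: "complex poly"
  assumes "\<And>k. k < m \<Longrightarrow> coeff p k = 0" "degree p \<le> d"
  shows "poly p t = t ^ m * (\<Sum>k\<le>d. coeff p (m + k) * t ^ k)"
proof -
  have "poly p t = (\<Sum>i\<le>degree p. coeff p i * t ^ i)" by (rule poly_altdef)
  also have "\<dots> = (\<Sum>i\<in>{0 + m..d + m}. coeff p i * t ^ i)"
  proof (rule sum.mono_neutral_cong)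
    show "coeff p i * t ^ i = 0" if "i \<in> {0 + m..d + m} - {..degree p}" for i
      using that coeff_eq_0[of p i] by auto
    show "coeff p i * t ^ i = 0" if "i \<in> {..degree p} - {0 + m..d + m}" for i
      using that assms(2) assms(1)[of i] by auto
  qed auto
  also have "\<dots> = (\<Sum>k\<in>{0..d}. coeff p (k + m) * t ^ (k + m))"
    by (rule sum.shift_bounds_cl_nat_ivl)
  also have "\<dots> = t ^ m * (\<Sum>k\<le>d. coeff p (m + k) * t ^ k)"
    by (simp add: sum_distrib_left power_add atLeast0AtMost algebra_simps)
  finally show ?thesis .
qed

lemma poly_low_coeffs_vanish:
  fixes p :: "complex poly"
  assumes b: "\<forall>\<^sub>F t in at_right (0 :: real). cmod (poly p (- of_real t)) \<le> C * t ^ m" and "k < m"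
  shows "coeff p k = 0"
  using \<open>k < m\<close>
proof (induction k rule: less_induct)
  case (less k)
  define S where "S = (\<lambda>t. \<Sum>i\<le>degree p. coeff p (k + i) * t ^ i)"
  have pS: "poly p t = t ^ k * S t" for t
    unfolding S_def by (rule poly_eq_power_mult_sum) (use less in auto)
  have S0: "S 0 = coeff p k"
  proof -
    have "S 0 = (\<Sum>i\<le>degree p. if i = 0 then coeff p k else 0)"
      unfolding S_def by (rule sum.cong) auto
    then show ?thesis by simp
  qed
  let ?F = "at_right (0 :: real)"
  have t0: "((\<lambda>t. - complex_of_real t) \<longlongrightarrow> 0) ?F" by (auto intro!: tendsto_eq_intros)
  have "((\<lambda>t. S (- of_real t)) \<longlongrightarrow> (\<Sum>i\<le>degree p. coeff p (k + i) * 0 ^ i)) ?F"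
    unfolding S_def by (intro tendsto_intros t0)
  then have l: "((\<lambda>t. cmod (S (- of_real t))) \<longlongrightarrow> cmod (coeff p k)) ?F"
    unfolding S0 [symmetric] S_def by (rule tendsto_norm)
  have "((\<lambda>t :: real. \<bar>C\<bar> * t) \<longlongrightarrow> 0) ?F" by (auto intro!: tendsto_eq_intros)
  moreover have "\<forall>\<^sub>F t in ?F. cmod (S (- of_real t)) \<le> \<bar>C\<bar> * t"
  proof -
    have "\<forall>\<^sub>F t in ?F. 0 < t \<and> t < (1 :: real)"
      unfolding eventually_at_right_field by (intro exI[of _ 1]) auto
    with b show ?thesis
    proof eventually_elim
      case (elim t)
      have "t ^ k * cmod (S (- of_real t)) \<le> C * t ^ m"
        using elim by (simp add: pS norm_mult norm_power)
      also have "\<dots> \<le> \<bar>C\<bar> * t ^ m" using elim by (intro mult_right_mono) auto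
      also have "t ^ m \<le> t ^ Suc k" using elim less.prems by (intro power_decreasing) auto
      then have "\<bar>C\<bar> * t ^ m \<le> \<bar>C\<bar> * t ^ Suc k" by (rule mult_left_mono) simp
      also have "\<bar>C\<bar> * t ^ Suc k = t ^ k * (\<bar>C\<bar> * t)" by simp
      finally show ?case using elim by (simp add: mult_le_cancel_left_pos)
    qed
  qed
  ultimately have "cmod (coeff p k) \<le> 0"
    using tendsto_le[OF _ _ l] trivial_limit_at_right_real by blast
  then show ?case by simp
qed

text \<open>
  The order \<open>m\<close> is the smallest order of vanishing of \<open>Q\<close> at \<open>p\<close> along any line.  It is attained along
  the lines with direction close to \<open>e\<close>, where \<open>Q\<close> is \<open>t\<^sup>m\<close> times a nowhere vanishing factor \<open>q\<close>.  The
  components of \<open>P\<close> vanish to order \<open>m\<close> as well, since they are bounded by \<open>Q\<close> on the part of the line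
  inside the ball.
\<close>
lemma line_normal_form:
  fixes P :: "'m :: finite \<Rightarrow> complex ^ 'n \<Rightarrow> complex" and p :: "complex ^ 'n"
  assumes Q: "polyfun Q" "Q \<noteq> (\<lambda>z. 0)" and P: "\<And>j. polyfun (P j)" and p: "norm p = 1"
    and le: "\<And>z j. norm z < 1 \<Longrightarrow> cmod (P j z) \<le> cmod (Q z)"
  obtains m :: nat and e :: "complex ^ 'n" and \<rho> \<delta> M :: real and
    q :: "complex ^ 'n \<Rightarrow> complex \<Rightarrow> complex" and U :: "complex ^ 'n \<Rightarrow> complex \<Rightarrow> complex ^ 'm"
  where "herm_prod e p = 1" "\<rho> > 0" "\<delta> > 0"
    "\<And>v t. v \<in> cball e \<rho> \<Longrightarrow> cmod t < \<delta> \<Longrightarrow> q v t \<noteq> 0"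
    "\<And>v t. v \<in> cball e \<rho> \<Longrightarrow> cmod t < \<delta> \<Longrightarrow> norm (U v t) \<le> M"
    "\<And>v t. v \<in> cball e \<rho> \<Longrightarrow> cmod t < \<delta> \<Longrightarrow> Q (p + t *s v) = t ^ m * q v t"
    "\<And>v t j. v \<in> cball e \<rho> \<Longrightarrow> cmod t < \<delta> \<Longrightarrow> herm_prod v p = 1 \<Longrightarrow>
       P j (p + t *s v) = t ^ m * q v t * U v t $ j"
    "\<And>v j. v \<in> cball e \<rho> \<Longrightarrow> (\<lambda>t. U v t $ j) holomorphic_on ball 0 \<delta>"
proof -
  obtain L dQ where L: "\<And>v t. Q (p + t *s v) = poly (L v) t" "\<And>v. degree (L v) \<le> dQ"
    "\<And>k. continuous_on UNIV (\<lambda>v. coeff (L v) k)"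
    by (rule polyfun_on_lines[OF Q(1), of p]) blast
  have "\<exists>K d. (\<forall>v t. P j (p + t *s v) = poly (K v) t) \<and> (\<forall>v. degree (K v) \<le> d) \<and>
     (\<forall>k. continuous_on UNIV (\<lambda>v. coeff (K v) k))" for j
    by (rule polyfun_on_lines[OF P[of j], of p]) blast
  then have "\<forall>j. \<exists>K d. (\<forall>v t. P j (p + t *s v) = poly (K v) t) \<and> (\<forall>v. degree (K v) \<le> d) \<and>
     (\<forall>k. continuous_on UNIV (\<lambda>v. coeff (K v) k))" by blast
  then obtain K dP where K0: "\<forall>j. (\<forall>v t. P j (p + t *s v) = poly (K j v) t) \<and> (\<forall>v. degree (K j v) \<le> dP j) \<and>
     (\<forall>k. continuous_on UNIV (\<lambda>v. coeff (K j v) k))"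
    unfolding choice_iff by blast
  define d where "d = dQ + (\<Sum>j\<in>UNIV. dP j)"
  have dLd: "degree (L v) \<le> d" for v using L(2)[of v] by (simp add: d_def)
  have dKd: "degree (K j v) \<le> d" for j v
  proof -
    have "dP j \<le> (\<Sum>j\<in>UNIV. dP j)" by (rule member_le_sum) auto
    moreover have "degree (K j v) \<le> dP j" using K0 by blast
    ultimately show ?thesis by (simp add: d_def)
  qed
  \<comment> \<open>Scaling the direction does not change the order, so a direction with nonzero product with \<open>p\<close> can be normalised.\<close>
  have scale: "coeff (L (c *s v)) k = c ^ k * coeff (L v) k" for c v k
  proof -
    have "poly (L (c *s v)) t = poly (pcompose (L v) [:0, c:]) t" for t
      by (simp add: L(1) [symmetric] poly_pcompose vector_smult_assoc mult.commute)
    then have "L (c *s v) = pcompose (L v) [:0, c:]" by (simp add: poly_eq_poly_eq_iff [symmetric] fun_eq_iff)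
    then show ?thesis by (simp add: coeff_pcompose_linear)
  qed
  have ex: "\<exists>k v. coeff (L v) k \<noteq> 0"
  proof -
    obtain z where "Q z \<noteq> 0" using Q(2) by auto
    then have "poly (L (z - p)) 1 \<noteq> 0" using L(1)[of 1 "z - p"] by simp
    then have "L (z - p) \<noteq> 0" by auto
    then show ?thesis using leading_coeff_0_iff by blast
  qed
  define m where "m = (LEAST k. \<exists>v. coeff (L v) k \<noteq> 0)"
  have "\<exists>v. coeff (L v) m \<noteq> 0" unfolding m_def using ex by (rule LeastI_ex)
  then obtain v1 where v1: "coeff (L v1) m \<noteq> 0" by blast
  have Llow: "coeff (L v) k = 0" if "k < m" for v k
    using not_less_Least[of k "\<lambda>k. \<exists>v. coeff (L v) k \<noteq> 0"] that unfolding m_def by blast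
  obtain v2 where v2: "coeff (L v2) m \<noteq> 0" "herm_prod v2 p \<noteq> 0"
  proof (cases "herm_prod v1 p = 0")
    case False
    then show ?thesis using that v1 by blast
  next
    case True
    have "open {v. coeff (L v) m \<noteq> 0}"
      using continuous_on_open_vimage[OF open_UNIV, of "\<lambda>v. coeff (L v) m"] L(3)[of m]
      by (auto simp: vimage_def dest!: spec[of _ "- {0 :: complex}"])
    then obtain \<epsilon> where \<epsilon>: "\<epsilon> > 0" "ball v1 \<epsilon> \<subseteq> {v. coeff (L v) m \<noteq> 0}"
      using v1 open_contains_ball by blast
    let ?v = "v1 + (\<epsilon> / 2) *\<^sub>R p"
    have "?v \<in> ball v1 \<epsilon>" using \<epsilon>(1) by (simp add: dist_norm p)
    then have 1: "coeff (L ?v) m \<noteq> 0" using \<epsilon>(2) by blast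
    have eq: "herm_prod ?v p = of_real (\<epsilon> / 2)"
      using True by (simp add: herm_prod_simps herm_prod_self p)
    have 2: "herm_prod ?v p \<noteq> 0" using \<epsilon>(1) unfolding eq of_real_eq_0_iff by simp
    show ?thesis by (rule that[OF 1 2])
  qed
  define e where "e = (1 / herm_prod v2 p) *s v2"
  have e: "coeff (L e) m \<noteq> 0" "herm_prod e p = 1"
    using v2 by (simp_all add: e_def scale herm_prod_simps)
  define qt where "qt = (\<lambda>v t. \<Sum>k\<le>d. coeff (L v) (m + k) * t ^ k)"
  define pt where "pt = (\<lambda>j v t. \<Sum>k\<le>d. coeff (K j v) (m + k) * t ^ k)"
  define U where "U = (\<lambda>v t. \<chi> j. pt j v t / qt v t)"
  have Qt: "Q (p + t *s v) = t ^ m * qt v t" for v t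
    unfolding L(1) qt_def by (rule poly_eq_power_mult_sum[OF Llow dLd])
  have Klow: "coeff (K j v) k = 0" if v: "herm_prod v p = 1" and "k < m" for j v k
  proof (rule poly_low_coeffs_vanish[OF _ \<open>k < m\<close>])
    let ?F = "at_right (0 :: real)"
    have "((\<lambda>t. cmod (qt v (- of_real t))) \<longlongrightarrow> cmod (\<Sum>k\<le>d. coeff (L v) (m + k) * (- of_real 0) ^ k)) ?F"
      unfolding qt_def by (intro tendsto_intros)
    then have "\<forall>\<^sub>F t in ?F. cmod (qt v (- of_real t)) < cmod (\<Sum>k\<le>d. coeff (L v) (m + k) * (- of_real 0) ^ k) + 1"
      by (rule order_tendstoD) simp
    moreover have "\<forall>\<^sub>F t in ?F. 0 < t \<and> t < 1 / (1 + (norm v)\<^sup>2)"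
      unfolding eventually_at_right_field
      by (intro exI[of _ "1 / (1 + (norm v)\<^sup>2)"]) (simp add: add_pos_nonneg)
    ultimately show "\<forall>\<^sub>F t in ?F. cmod (poly (K j v) (- of_real t)) \<le>
       (cmod (\<Sum>k\<le>d. coeff (L v) (m + k) * (- of_real 0) ^ k) + 1) * t ^ m"
    proof eventually_elim
      case (elim t)
      let ?z = "p + (- of_real t) *s v"
      have "(norm ?z)\<^sup>2 = 1 - 2 * t + t\<^sup>2 * (norm v)\<^sup>2"
      proof -
        have pv: "herm_prod p v = 1" using arg_cong[OF v, of cnj] by (simp add: cnj_herm_prod)
        have pp: "herm_prod p p = 1" by (simp add: herm_prod_self p)
        have vv: "herm_prod v v = of_real ((norm v)\<^sup>2)" by (rule herm_prod_self)
        have "complex_of_real ((norm ?z)\<^sup>2) = of_real (1 - 2 * t + t\<^sup>2 * (norm v)\<^sup>2)"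
          unfolding herm_prod_self [symmetric]
          by (simp add: herm_prod_simps v pv pp vv power2_eq_square algebra_simps)
        then show ?thesis by (simp only: of_real_eq_iff)
      qed
      moreover have "t * (t * (norm v)\<^sup>2) < t * 1"
      proof (rule mult_strict_left_mono)
        have "t * (1 + (norm v)\<^sup>2) < 1" using elim(2) by (simp add: pos_less_divide_eq add_pos_nonneg)
        then show "t * (norm v)\<^sup>2 < 1" using elim(2) by (simp add: distrib_left)
      qed (use elim in simp)
      ultimately have "(norm ?z)\<^sup>2 < 1" using elim(2) by (simp add: power2_eq_square mult.assoc)
      then have "norm ?z < 1" by (simp add: power_less_one_iff)
      from le[OF this, of j] have "cmod (poly (K j v) (- of_real t)) \<le> cmod ((- of_real t) ^ m * qt v (- of_real t))"
        using K0 Qt by metis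
      also have "\<dots> = t ^ m * cmod (qt v (- of_real t))" using elim by (simp add: norm_mult norm_power)
      also have "\<dots> \<le> t ^ m * (cmod (\<Sum>k\<le>d. coeff (L v) (m + k) * (- of_real 0) ^ k) + 1)"
        using elim by (intro mult_left_mono) auto
      finally show ?case by (simp add: mult.commute)
    qed
  qed
  have Pt: "P j (p + t *s v) = t ^ m * pt j v t" if "herm_prod v p = 1" for j v t
  proof -
    have "P j (p + t *s v) = poly (K j v) t" using K0 by blast
    then show ?thesis unfolding pt_def using poly_eq_power_mult_sum[OF Klow[OF that] dKd] by simp
  qed
  have cq: "continuous_on UNIV (\<lambda>x. qt (fst x) (snd x))"
    unfolding qt_def
    by (intro continuous_intros continuous_on_compose2[OF L(3)] subset_UNIV)
  have cp: "continuous_on UNIV (\<lambda>x. pt j (fst x) (snd x))" for j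
  proof -
    have "continuous_on UNIV (\<lambda>v. coeff (K j v) k)" for k using K0 by blast
    then show ?thesis unfolding pt_def
      by (intro continuous_intros continuous_on_compose2[of UNIV "\<lambda>v. coeff (K j v) _" UNIV fst] subset_UNIV)
  qed
  have q0: "qt e 0 \<noteq> 0"
  proof -
    have "qt e 0 = (\<Sum>k\<le>d. if k = 0 then coeff (L e) m else 0)"
      unfolding qt_def by (rule sum.cong) auto
    then show ?thesis using e by simp
  qed
  let ?N = "at (e, 0 :: complex)"
  have tq: "((\<lambda>x. qt (fst x) (snd x)) \<longlongrightarrow> qt e 0) (nhds (e, 0))"
    using cq tendsto_at_iff_tendsto_nhds[of "\<lambda>x. qt (fst x) (snd x)" "(e, 0)"]
    by (simp add: continuous_on_eq_continuous_at isCont_def)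
  have tp: "((\<lambda>x. pt j (fst x) (snd x)) \<longlongrightarrow> pt j e 0) (nhds (e, 0))" for j
    using cp[of j] tendsto_at_iff_tendsto_nhds[of "\<lambda>x. pt j (fst x) (snd x)" "(e, 0)"]
    by (simp add: continuous_on_eq_continuous_at isCont_def)
  have "((\<lambda>x. U (fst x) (snd x)) \<longlongrightarrow> U e 0) (nhds (e, 0))"
    unfolding U_def by (intro vec_tendstoI) (simp add: tendsto_divide[OF tp tq q0])
  from order_tendstoD(2)[OF tendsto_norm[OF this], of "norm (U e 0) + 1"]
  have "\<forall>\<^sub>F x in nhds (e, 0). norm (U (fst x) (snd x)) < norm (U e 0) + 1" by simp
  moreover have "\<forall>\<^sub>F x in nhds (e, 0). qt (fst x) (snd x) \<noteq> 0"
    by (rule tendsto_imp_eventually_ne[OF tq q0])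
  ultimately have "\<forall>\<^sub>F x in nhds (e, 0). norm (U (fst x) (snd x)) < norm (U e 0) + 1 \<and> qt (fst x) (snd x) \<noteq> 0"
    by eventually_elim simp
  then obtain \<eta> where \<eta>: "\<eta> > 0" "\<And>x. dist x (e, 0) < \<eta> \<Longrightarrow>
      norm (U (fst x) (snd x)) < norm (U e 0) + 1 \<and> qt (fst x) (snd x) \<noteq> 0"
    unfolding eventually_nhds_metric by blast
  have near: "norm (U v t) < norm (U e 0) + 1 \<and> qt v t \<noteq> 0" if "v \<in> cball e (\<eta> / 4)" "cmod t < \<eta> / 4" for v t
  proof -
    have "dist (v, t) (e, 0) \<le> dist v e + dist t 0"
      unfolding dist_Pair_Pair by (rule sqrt_sum_squares_le_sum) auto
    also have "\<dots> < \<eta>" using that \<eta>(1) by (simp add: dist_commute)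
    finally show ?thesis using \<eta>(2)[of "(v, t)"] by simp
  qed
  show ?thesis
  proof (rule that[of e "\<eta> / 4" "\<eta> / 4" qt U "norm (U e 0) + 1" m])
    show "herm_prod e p = 1" by (rule e(2))
    show "\<eta> / 4 > 0" "\<eta> / 4 > 0" using \<eta> by auto
    fix v assume v: "v \<in> cball e (\<eta> / 4)"
    show "(\<lambda>t. U v t $ j) holomorphic_on ball 0 (\<eta> / 4)" for j
      unfolding U_def qt_def pt_def
      using near[OF v] by (auto intro!: holomorphic_intros simp: qt_def dist_norm)
    fix t :: complex assume t: "cmod t < \<eta> / 4"
    show "qt v t \<noteq> 0" "norm (U v t) \<le> norm (U e 0) + 1" using near[OF v t] by auto
    show "Q (p + t *s v) = t ^ m * qt v t" by (rule Qt)
    show "P j (p + t *s v) = t ^ m * qt v t * U v t $ j" if "herm_prod v p = 1" for j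
      using Pt[OF that] near[OF v t] by (simp add: U_def)
  qed
qed

lemma quadratic_le_exponential: "real ((k + 2) * (k + 3)) \<le> 6 * 2 ^ k"
proof (induction k)
  case (Suc k)
  have "real ((Suc k + 2) * (Suc k + 3)) \<le> 2 * real ((k + 2) * (k + 3))"
    by (simp add: algebra_simps)
  then show ?case using Suc by simp
qed simp

lemma linear_le_exponential: "real (k + 2) \<le> 6 * 2 ^ k"
proof -
  have "k + 2 \<le> (k + 2) * (k + 3)" by simp
  then have "real (k + 2) \<le> real ((k + 2) * (k + 3))" by (simp only: of_nat_le_iff)
  then show ?thesis using quadratic_le_exponential[of k] by linarith
qed

text \<open>
  A power series in \<open>x\<close> and \<open>x'\<close>, grouped by total degree, with the variable \<open>x'\<close> kept fixed.  The bounds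
  on \<open>F\<close> and \<open>F'\<close> only involve the constants \<open>r\<close>, \<open>\<rho>\<close> and \<open>M\<close>; this uniformity is what the comparison of
  different slices requires.  The factor 12 is the sum of the geometric series that dominates the tail.
\<close>
lemma bihomogeneous_series:
  fixes b :: "nat \<Rightarrow> nat \<Rightarrow> complex"
  assumes r: "r > 0" and \<rho>: "\<rho> > 0" and M: "M \<ge> 0"
    and b: "\<And>k j. cmod (b k j) \<le> M / (r ^ k * \<rho> ^ j)"
    and x': "cmod x' \<le> \<rho> * (r / 4)"
  obtains F F' where
    "\<And>x. cmod x < r / 4 \<Longrightarrow> (\<lambda>k. \<Sum>j\<le>k. x ^ (k - j) * x' ^ j * b k j) sums F x"
    "\<And>x. cmod x < r / 4 \<Longrightarrow> (F has_field_derivative F' x) (at x)"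
    "\<And>x \<epsilon>. cmod x < r / 4 \<Longrightarrow> cmod x \<le> \<epsilon> \<Longrightarrow> cmod x' \<le> \<rho> * \<epsilon> \<Longrightarrow> \<epsilon> \<le> r / 4 \<Longrightarrow>
       cmod (F x - b 0 0) \<le> 12 * M / r * \<epsilon>"
    "\<And>x \<epsilon>. cmod x < r / 4 \<Longrightarrow> cmod x \<le> \<epsilon> \<Longrightarrow> cmod x' \<le> \<rho> * \<epsilon> \<Longrightarrow> \<epsilon> \<le> r / 4 \<Longrightarrow>
       cmod (F' x - b 1 0) \<le> 12 * M / r\<^sup>2 * \<epsilon>"
proof -
  define E where "E = (\<lambda>k x. \<Sum>j\<le>k. x ^ (k - j) * x' ^ j * b k j)"
  define D where "D = (\<lambda>k x. \<Sum>j\<le>k. of_nat (k - j) * x ^ (k - j - 1) * x' ^ j * b k j)"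
  have term_bound: "cmod (x ^ (i - j) * x' ^ j * b k j) \<le> M * \<epsilon> ^ i / r ^ k"
    if "j \<le> i" "cmod x \<le> \<epsilon>" "cmod x' \<le> \<rho> * \<epsilon>" for x \<epsilon> i j k
  proof -
    have \<epsilon>0: "\<epsilon> \<ge> 0" using that(2) norm_ge_zero order_trans by blast
    have "cmod (x ^ (i - j) * x' ^ j * b k j) \<le> \<epsilon> ^ (i - j) * (\<rho> * \<epsilon>) ^ j * (M / (r ^ k * \<rho> ^ j))"
      unfolding norm_mult norm_power
      using that \<epsilon>0 \<rho> b by (intro mult_mono power_mono) (auto intro!: mult_nonneg_nonneg)
    also have "\<dots> = M * (\<epsilon> ^ (i - j) * \<epsilon> ^ j) / r ^ k"
      using \<rho> by (simp add: power_mult_distrib)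
    also have "\<epsilon> ^ (i - j) * \<epsilon> ^ j = \<epsilon> ^ i"
      using that(1) by (simp flip: power_add)
    finally show ?thesis .
  qed
  have Eb: "cmod (E k x) \<le> real (k + 1) * (M * \<epsilon> ^ k / r ^ k)"
    if "cmod x \<le> \<epsilon>" "cmod x' \<le> \<rho> * \<epsilon>" for k x \<epsilon>
  proof -
    have "cmod (E k x) \<le> (\<Sum>j\<le>k. M * \<epsilon> ^ k / r ^ k)"
      unfolding E_def by (rule sum_norm_le) (use term_bound that in auto)
    then show ?thesis by simp
  qed
  have Db: "cmod (D (Suc k) x) \<le> real ((k + 1) * (k + 2)) * (M * \<epsilon> ^ k / r ^ Suc k)"
    if x: "cmod x \<le> \<epsilon>" "cmod x' \<le> \<rho> * \<epsilon>" for k x \<epsilon>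
  proof -
    have \<epsilon>0: "\<epsilon> \<ge> 0" using x(1) norm_ge_zero order_trans by blast
    have nn: "0 \<le> M * \<epsilon> ^ k / r ^ Suc k" using M \<epsilon>0 r by simp
    have "cmod (D (Suc k) x) \<le> (\<Sum>j\<le>Suc k. real (k + 1) * (M * \<epsilon> ^ k / r ^ Suc k))"
      unfolding D_def
    proof (rule sum_norm_le)
      fix j assume "j \<in> {..Suc k}"
      show "cmod (of_nat (Suc k - j) * x ^ (Suc k - j - 1) * x' ^ j * b (Suc k) j) \<le>
          real (k + 1) * (M * \<epsilon> ^ k / r ^ Suc k)"
      proof (cases "j = Suc k")
        case True
        have "0 \<le> real (k + 1) * (M * \<epsilon> ^ k / r ^ Suc k)"
          by (rule mult_nonneg_nonneg[OF of_nat_0_le_iff nn])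
        then show ?thesis using True by simp
      next
        case False
        then have j: "j \<le> k" using \<open>j \<in> {..Suc k}\<close> by simp
        have "cmod (of_nat (Suc k - j) * x ^ (Suc k - j - 1) * x' ^ j * b (Suc k) j) =
            real (Suc k - j) * cmod (x ^ (k - j) * x' ^ j * b (Suc k) j)"
          by (simp only: norm_mult norm_of_nat mult.assoc) (use j in \<open>simp add: Suc_diff_le\<close>)
        also have "\<dots> \<le> real (k + 1) * (M * \<epsilon> ^ k / r ^ Suc k)"
          using term_bound[OF j x, of "Suc k"] nn by (intro mult_mono) auto
        finally show ?thesis .
      qed
    qed
    moreover have "(\<Sum>j\<le>Suc k. real (k + 1) * X) = real ((k + 1) * (k + 2)) * X" for X :: real
      by (simp add: algebra_simps)
    ultimately show ?thesis by (simp only:)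
  qed
  have D0: "D 0 x = 0" "D 1 x = b 1 0" for x by (simp_all add: D_def)
  have E0: "E 0 x = b 0 0" for x by (simp add: E_def)
  have "summable (\<lambda>k. 6 * M * (1 / 2 :: real) ^ k)"
    by (intro summable_mult summable_geometric) simp
  moreover have "(E k has_field_derivative D k x) (at x)" for k x
    unfolding E_def D_def
    by (auto intro!: derivative_eq_intros DERIV_sum simp: mult_ac)
  moreover have "\<forall>\<^sub>F k in sequentially. \<forall>x\<in>ball 0 (r / 4). cmod (E k x) \<le> 6 * M * (1 / 2) ^ k"
  proof (intro always_eventually allI ballI)
    fix k and x :: complex assume "x \<in> ball 0 (r / 4)"
    then have "cmod (E k x) \<le> real (k + 1) * (M * (r / 4) ^ k / r ^ k)"
      by (intro Eb x') (simp add: dist_norm)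
    also have "\<dots> = M * (real (k + 1) * (1 / 4) ^ k)"
      using r by (simp add: power_divide)
    also have "\<dots> \<le> M * ((6 * 2 ^ k) * (1 / 4) ^ k)"
      using linear_le_exponential[of k] M
      by (intro mult_left_mono mult_right_mono) auto
    also have "\<dots> = 6 * M * (1 / 2) ^ k"
    proof -
      have "(2 :: real) ^ k * (1 / 4) ^ k = (1 / 2) ^ k" by (simp flip: power_mult_distrib)
      then show ?thesis by (simp add: mult_ac)
    qed
    finally show "cmod (E k x) \<le> 6 * M * (1 / 2) ^ k" .
  qed
  ultimately obtain F F' where F: "\<forall>x\<in>ball 0 (r / 4). ((\<lambda>k. E k x) sums F x) \<and> ((\<lambda>k. D k x) sums F' x) \<and>
      (F has_field_derivative F' x) (at x)"
    by (rule series_and_derivative_comparison[OF open_ball])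
  have geo: "(\<lambda>k. 6 * C * (1 / 2) ^ k) sums (12 * C)" for C :: real
    using sums_mult[OF geometric_sums[of "1 / 2 :: real"], of "6 * C"] by simp
  have pw: "\<epsilon> ^ Suc k / r ^ Suc k \<le> (\<epsilon> / r) * (1 / 4) ^ k" if "0 \<le> \<epsilon>" "\<epsilon> \<le> r / 4" for \<epsilon> k
  proof -
    have "(\<epsilon> / r) ^ k \<le> (1 / 4) ^ k" using that r by (intro power_mono) (auto simp: field_simps)
    then have "(\<epsilon> / r) * (\<epsilon> / r) ^ k \<le> (\<epsilon> / r) * (1 / 4) ^ k" using that r by (intro mult_left_mono) auto
    then show ?thesis by (simp add: power_divide)
  qed
  have half: "c * (1 / 4) ^ k \<le> 6 * (1 / 2) ^ k" if "c \<le> 6 * 2 ^ k" for c :: real and k :: nat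
  proof -
    have "c * (1 / 4) ^ k \<le> (6 * 2 ^ k) * (1 / 4) ^ k" using that by (intro mult_right_mono) auto
    also have "(2 :: real) ^ k * (1 / 4) ^ k = (1 / 2) ^ k" by (simp flip: power_mult_distrib)
    then have "(6 * 2 ^ k) * (1 / 4) ^ k = 6 * (1 / 2 :: real) ^ k" by simp
    finally show ?thesis .
  qed
  show ?thesis
  proof (rule that[of F F'])
    fix x assume x: "cmod x < r / 4"
    then have xb: "x \<in> ball 0 (r / 4)" by (simp add: dist_norm)
    have sE: "(\<lambda>k. E k x) sums F x" and sD: "(\<lambda>k. D k x) sums F' x" using F xb by blast+
    show "(\<lambda>k. \<Sum>j\<le>k. x ^ (k - j) * x' ^ j * b k j) sums F x"
      using sE by (simp add: E_def)
    show "(F has_field_derivative F' x) (at x)" using F xb by blast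
    fix \<epsilon> assume e: "cmod x \<le> \<epsilon>" "cmod x' \<le> \<rho> * \<epsilon>" "\<epsilon> \<le> r / 4"
    have \<epsilon>0: "\<epsilon> \<ge> 0" using e(1) norm_ge_zero order_trans by blast
    have "(\<lambda>k. E (Suc k) x) sums (F x - b 0 0)"
      using sE sums_Suc_iff[of "\<lambda>k. E k x" "F x - b 0 0"] by (simp add: E0)
    then have "cmod (F x - b 0 0) \<le> 12 * (M * (\<epsilon> / r))"
    proof (rule norm_sums_le[OF _ geo])
      fix k
      have "cmod (E (Suc k) x) \<le> real (k + 2) * (M * (\<epsilon> ^ Suc k / r ^ Suc k))"
        using Eb[OF e(1,2), of "Suc k"] by (simp del: power_Suc)
      also have "\<dots> \<le> real (k + 2) * (M * ((\<epsilon> / r) * (1 / 4) ^ k))"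
        using pw[OF \<epsilon>0 e(3)] M by (intro mult_left_mono) auto
      also have "\<dots> = (M * (\<epsilon> / r)) * (real (k + 2) * (1 / 4) ^ k)" by simp
      also have "\<dots> \<le> (M * (\<epsilon> / r)) * (6 * (1 / 2) ^ k)"
      proof (rule mult_left_mono[OF half])
        show "real (k + 2) \<le> 6 * 2 ^ k" by (rule linear_le_exponential)
      qed (use M \<epsilon>0 r in simp)
      finally show "cmod (E (Suc k) x) \<le> 6 * (M * (\<epsilon> / r)) * (1 / 2) ^ k" by (simp add: mult_ac)
    qed
    then show "cmod (F x - b 0 0) \<le> 12 * M / r * \<epsilon>" by simp
    have "(\<lambda>k. D (Suc k) x) sums F' x"
      using sD sums_Suc_iff[of "\<lambda>k. D k x" "F' x"] by (simp add: D0)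
    then have "(\<lambda>k. D (Suc (Suc k)) x) sums (F' x - b 1 0)"
      using D0(2)[of x] sums_Suc_iff[of "\<lambda>k. D (Suc k) x" "F' x - b 1 0"] by simp
    then have "cmod (F' x - b 1 0) \<le> 12 * (M * (\<epsilon> / r) / r)"
    proof (rule norm_sums_le[OF _ geo])
      fix k
      have "cmod (D (Suc (Suc k)) x) \<le> real ((k + 2) * (k + 3)) * (M * (\<epsilon> ^ Suc k / r ^ Suc k) / r)"
        using Db[OF e(1,2), of "Suc k"] by (simp add: numeral_3_eq_3 mult_ac)
      also have "\<dots> \<le> real ((k + 2) * (k + 3)) * (M * ((\<epsilon> / r) * (1 / 4) ^ k) / r)"
        using pw[OF \<epsilon>0 e(3)] M r by (intro mult_left_mono divide_right_mono) auto
      also have "\<dots> = (M * (\<epsilon> / r) / r) * (real ((k + 2) * (k + 3)) * (1 / 4) ^ k)" by simp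
      also have "\<dots> \<le> (M * (\<epsilon> / r) / r) * (6 * (1 / 2) ^ k)"
        by (rule mult_left_mono[OF half[OF quadratic_le_exponential]]) (use M \<epsilon>0 r in simp)
      finally show "cmod (D (Suc (Suc k)) x) \<le> 6 * (M * (\<epsilon> / r) / r) * (1 / 2) ^ k" by (simp add: mult_ac)
    qed
    then show "cmod (F' x - b 1 0) \<le> 12 * M / r\<^sup>2 * \<epsilon>" by (simp add: power2_eq_square)
  qed
qed

lemma norm_vec_le_card:
  fixes x :: "complex ^ 'm"
  assumes "\<And>j. cmod (x $ j) \<le> c"
  shows "norm x \<le> real CARD('m) * c"
proof -
  have "(\<Sum>j\<in>UNIV. cmod (x $ j)) \<le> (\<Sum>j\<in>(UNIV :: 'm set). c)" by (intro sum_mono assms)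
  then show ?thesis using L2_set_le_sum[of UNIV "\<lambda>j. cmod (x $ j)"] by (simp add: norm_vec_def)
qed

lemma taylor_vec_bound:
  fixes a :: "complex \<Rightarrow> complex ^ 'm"
  assumes \<delta>: "\<delta> > 0" and a: "\<And>j. (\<lambda>t. a t $ j) holomorphic_on ball 0 \<delta>"
    and M: "\<And>t. cmod t < \<delta> \<Longrightarrow> norm (a t) \<le> M"
  shows "norm (taylor_vec a k) \<le> real CARD('m) * M / (\<delta> / 2) ^ k"
    and "cmod t < \<delta> / 2 \<Longrightarrow> (\<lambda>k. taylor_vec a k $ j * t ^ k) sums (a t $ j)"
proof -
  have "cmod (taylor_vec a k $ j) \<le> M / (\<delta> / 2) ^ k" for j
  proof -
    have "cmod ((deriv ^^ k) (\<lambda>t. a t $ j) 0) \<le> fact k * M / (\<delta> / 2) ^ k"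
    proof (rule Cauchy_inequality)
      show "(\<lambda>t. a t $ j) holomorphic_on ball 0 (\<delta> / 2)"
        by (rule holomorphic_on_subset[OF a]) (use \<delta> in auto)
      show "continuous_on (cball 0 (\<delta> / 2)) (\<lambda>t. a t $ j)"
        by (rule continuous_on_subset[OF holomorphic_on_imp_continuous_on[OF a]]) (use \<delta> in auto)
      show "cmod (a x $ j) \<le> M" if "cmod (0 - x) = \<delta> / 2" for x
        using Finite_Cartesian_Product.norm_nth_le[of "a x" j] M[of x] that \<delta> by simp
    qed (use \<delta> in simp)
    then show ?thesis using \<delta>
      by (simp add: taylor_vec_def fps_expansion_def norm_divide field_simps)
  qed
  then have "norm (taylor_vec a k) \<le> real CARD('m) * (M / (\<delta> / 2) ^ k)" by (rule norm_vec_le_card)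
  then show "norm (taylor_vec a k) \<le> real CARD('m) * M / (\<delta> / 2) ^ k" by simp
  assume "cmod t < \<delta> / 2"
  then have "t \<in> ball 0 \<delta>" using \<delta> by (simp add: dist_norm)
  from holomorphic_power_series[OF a this, of j]
  show "(\<lambda>k. taylor_vec a k $ j * t ^ k) sums (a t $ j)"
    by (simp add: taylor_vec_def fps_expansion_def)
qed

text \<open>
  The Taylor coefficients along the lines with direction \<open>e + s y\<close> depend polynomially on \<open>s\<close>: the
  polarised identity provides the relations required by \<open>functional_annihilates_coefficients\<close>, with
  the product of two directions being affine in \<open>s\<close> and in \<open>cnj \<sigma>\<close>.
\<close>
lemma slice_coefficients:
  fixes P :: "'m :: finite \<Rightarrow> complex ^ 'n \<Rightarrow> complex"
    and U :: "complex ^ 'n \<Rightarrow> complex \<Rightarrow> complex ^ 'm" and p e y :: "complex ^ 'n"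
  assumes p: "norm p = 1" and e: "herm_prod e p = 1" and \<rho>: "\<rho> > 0" and \<delta>: "\<delta> > 0"
    and q: "\<And>v t. v \<in> cball e \<rho> \<Longrightarrow> cmod t < \<delta> \<Longrightarrow> q v t \<noteq> 0"
    and M: "\<And>v t. v \<in> cball e \<rho> \<Longrightarrow> cmod t < \<delta> \<Longrightarrow> norm (U v t) \<le> M"
    and Q: "\<And>v t. v \<in> cball e \<rho> \<Longrightarrow> cmod t < \<delta> \<Longrightarrow> Q (p + t *s v) = t ^ m * q v t"
    and P: "\<And>v t j. v \<in> cball e \<rho> \<Longrightarrow> cmod t < \<delta> \<Longrightarrow> herm_prod v p = 1 \<Longrightarrow>
       P j (p + t *s v) = t ^ m * q v t * U v t $ j"
    and U: "\<And>v j. v \<in> cball e \<rho> \<Longrightarrow> (\<lambda>t. U v t $ j) holomorphic_on ball 0 \<delta>"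
    and refl: "\<And>z w. herm_prod z w = 1 \<Longrightarrow> (\<Sum>j\<in>UNIV. P j z * cnj (P j w)) = Q z * cnj (Q w)"
    and y: "herm_prod y p = 0" "norm y \<le> 1"
  obtains b where
    "\<And>s k. cmod s \<le> \<rho> \<Longrightarrow> taylor_vec (U (e + s *s y)) k = (\<Sum>j\<le>k. s ^ j *s b k j)"
    "\<And>k j. norm (b k j) \<le> real CARD('m) * M / ((\<delta> / 2) ^ k * \<rho> ^ j)"
proof -
  define v where "v = (\<lambda>s. e + s *s y)"
  have vb: "v s \<in> cball e \<rho>" if "cmod s \<le> \<rho>" for s
    using mult_mono[of "cmod s" \<rho> "norm y" 1] that y(2) \<rho> by (simp add: v_def dist_norm norm_cmult_vec)
  have vp: "herm_prod (v s) p = 1" for s by (simp add: v_def herm_prod_simps e y(1))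
  have pv: "herm_prod p (v s) = 1" for s using arg_cong[OF vp[of s], of cnj] by (simp add: cnj_herm_prod)
  have rel: "\<forall>\<^sub>F \<tau> in at 0. herm_prod (U (v s) (- \<tau> / (1 + herm_prod (v s) (v \<sigma>) * \<tau>))) (U (v \<sigma>) (cnj \<tau>)) = 1"
    if s: "cmod s \<le> \<rho>" "cmod \<sigma> \<le> \<rho>" for s \<sigma>
  proof -
    define c where "c = herm_prod (v s) (v \<sigma>)"
    define T where "T = (\<lambda>\<tau>. - \<tau> / (1 + c * \<tau>))"
    have "(T \<longlongrightarrow> - 0 / (1 + c * 0)) (at 0)"
      unfolding T_def by (intro tendsto_intros) auto
    then have "\<forall>\<^sub>F \<tau> in at 0. cmod (T \<tau>) < \<delta>"
      using order_tendstoD(2)[OF tendsto_norm, of T "- 0 / (1 + c * 0)" "at 0" \<delta>] \<delta> by simp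
    moreover have "((\<lambda>\<tau>. 1 + c * \<tau>) \<longlongrightarrow> 1 + c * 0) (at 0)" by (intro tendsto_intros)
    then have "\<forall>\<^sub>F \<tau> in at 0. 1 + c * \<tau> \<noteq> 0" by (rule tendsto_imp_eventually_ne) simp
    moreover have "\<forall>\<^sub>F \<tau> :: complex in at 0. \<tau> \<noteq> 0 \<and> cmod \<tau> < \<delta>"
      unfolding eventually_at using \<delta> by (intro exI[of _ \<delta>]) auto
    ultimately have "\<forall>\<^sub>F \<tau> in at 0. herm_prod (U (v s) (T \<tau>)) (U (v \<sigma>) (cnj \<tau>)) = 1"
    proof eventually_elim
      case (elim \<tau>)
      have T: "T \<tau> * (1 + c * \<tau>) = - \<tau>" using elim by (simp add: T_def)
      have T0: "T \<tau> \<noteq> 0" using elim by (simp add: T_def)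
      have t2: "cmod (cnj \<tau>) < \<delta>" using elim by simp
      let ?z = "p + T \<tau> *s v s" and ?w = "p + cnj \<tau> *s v \<sigma>"
      have "herm_prod ?z ?w = 1 + (T \<tau> * (1 + c * \<tau>) + \<tau>)"
        by (simp add: herm_prod_simps vp pv herm_prod_self p c_def algebra_simps)
      then have "herm_prod ?z ?w = 1" unfolding T by simp
      from refl[OF this]
      have "(\<Sum>j\<in>UNIV. (T \<tau> ^ m * q (v s) (T \<tau>) * U (v s) (T \<tau>) $ j) *
           cnj (cnj \<tau> ^ m * q (v \<sigma>) (cnj \<tau>) * U (v \<sigma>) (cnj \<tau>) $ j)) =
         T \<tau> ^ m * q (v s) (T \<tau>) * cnj (cnj \<tau> ^ m * q (v \<sigma>) (cnj \<tau>))"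
        unfolding P[OF vb[OF s(1)] elim(1) vp]
          P[OF vb[OF s(2)] t2 vp] Q[OF vb[OF s(1)] elim(1)] Q[OF vb[OF s(2)] t2] .
      then have "(T \<tau> ^ m * q (v s) (T \<tau>) * cnj (cnj \<tau> ^ m * q (v \<sigma>) (cnj \<tau>))) *
           herm_prod (U (v s) (T \<tau>)) (U (v \<sigma>) (cnj \<tau>)) =
         (T \<tau> ^ m * q (v s) (T \<tau>) * cnj (cnj \<tau> ^ m * q (v \<sigma>) (cnj \<tau>))) * 1"
        by (simp add: herm_prod_def sum_distrib_left mult_ac)
      moreover have "T \<tau> ^ m * q (v s) (T \<tau>) * cnj (cnj \<tau> ^ m * q (v \<sigma>) (cnj \<tau>)) \<noteq> 0"
        using T0 elim q[OF vb[OF s(1)] elim(1)] q[OF vb[OF s(2)] t2] by simp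
      ultimately show ?case by (rule iffD1[OF mult_left_cancel, rotated])
    qed
    then show ?thesis by (simp add: T_def c_def)
  qed
  define \<phi> where "\<phi> = (\<lambda>k s. taylor_vec (U (v s)) k)"
  have "\<forall>s \<sigma>. \<exists>r :: nat \<Rightarrow> nat \<Rightarrow> complex. cmod s \<le> \<rho> \<longrightarrow> cmod \<sigma> \<le> \<rho> \<longrightarrow>
    herm_prod (\<phi> 0 s) (\<phi> 0 \<sigma>) = 1 \<and>
    (\<forall>k. herm_prod (\<phi> 0 s) (\<phi> (Suc k) \<sigma>) = - r 0 k) \<and>
    (\<forall>k. herm_prod (\<phi> (Suc k) s) (\<phi> 0 \<sigma>) = - r k 0) \<and>
    (\<forall>i k. herm_prod (\<phi> (Suc i) s) (\<phi> (Suc k) \<sigma>) = - (r i (Suc k) + r (Suc i) k + herm_prod (v s) (v \<sigma>) * r i k))"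
  proof (intro allI)
    fix s \<sigma>
    show "\<exists>r :: nat \<Rightarrow> nat \<Rightarrow> complex. cmod s \<le> \<rho> \<longrightarrow> cmod \<sigma> \<le> \<rho> \<longrightarrow>
      herm_prod (\<phi> 0 s) (\<phi> 0 \<sigma>) = 1 \<and>
      (\<forall>k. herm_prod (\<phi> 0 s) (\<phi> (Suc k) \<sigma>) = - r 0 k) \<and>
      (\<forall>k. herm_prod (\<phi> (Suc k) s) (\<phi> 0 \<sigma>) = - r k 0) \<and>
      (\<forall>i k. herm_prod (\<phi> (Suc i) s) (\<phi> (Suc k) \<sigma>) = - (r i (Suc k) + r (Suc i) k + herm_prod (v s) (v \<sigma>) * r i k))"
    proof (cases "cmod s \<le> \<rho> \<and> cmod \<sigma> \<le> \<rho>")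
      case True
      then have s: "cmod s \<le> \<rho>" "cmod \<sigma> \<le> \<rho>" by auto
      obtain r :: "nat \<Rightarrow> nat \<Rightarrow> complex" where
        "herm_prod (\<phi> 0 s) (\<phi> 0 \<sigma>) = 1"
        "\<And>k. herm_prod (\<phi> 0 s) (\<phi> (Suc k) \<sigma>) = - r 0 k"
        "\<And>k. herm_prod (\<phi> (Suc k) s) (\<phi> 0 \<sigma>) = - r k 0"
        "\<And>i k. herm_prod (\<phi> (Suc i) s) (\<phi> (Suc k) \<sigma>) = - (r i (Suc k) + r (Suc i) k + herm_prod (v s) (v \<sigma>) * r i k)"
        unfolding \<phi>_def
        by (rule reflection_coefficients[OF \<delta> U[OF vb[OF s(1)]] U[OF vb[OF s(2)]] rel[OF s]]) blast
      then show ?thesis by (intro exI[of _ r]) blast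
    next
      case False
      then show ?thesis by auto
    qed
  qed
  then obtain r :: "complex \<Rightarrow> complex \<Rightarrow> nat \<Rightarrow> nat \<Rightarrow> complex" where
    r: "\<forall>s \<sigma>. cmod s \<le> \<rho> \<longrightarrow> cmod \<sigma> \<le> \<rho> \<longrightarrow>
    herm_prod (\<phi> 0 s) (\<phi> 0 \<sigma>) = 1 \<and>
    (\<forall>k. herm_prod (\<phi> 0 s) (\<phi> (Suc k) \<sigma>) = - r s \<sigma> 0 k) \<and>
    (\<forall>k. herm_prod (\<phi> (Suc k) s) (\<phi> 0 \<sigma>) = - r s \<sigma> k 0) \<and>
    (\<forall>i k. herm_prod (\<phi> (Suc i) s) (\<phi> (Suc k) \<sigma>) =
       - (r s \<sigma> i (Suc k) + r s \<sigma> (Suc i) k + herm_prod (v s) (v \<sigma>) * r s \<sigma> i k))"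
    unfolding choice_iff by blast
  have vv: "herm_prod (v s) (v \<sigma>) = herm_prod e e + herm_prod y e * s + herm_prod e y * cnj \<sigma> + herm_prod y y * s * cnj \<sigma>" for s \<sigma>
    by (simp add: v_def herm_prod_simps algebra_simps)
  have ann: "(\<Sum>l\<le>Suc k. w l *s \<phi> k (x l)) = 0"
    if x: "\<And>l. l \<le> Suc k \<Longrightarrow> cmod (x l) \<le> \<rho>" and w: "\<And>j. j \<le> k \<Longrightarrow> (\<Sum>l\<le>Suc k. w l * x l ^ j) = 0"
    for w x :: "nat \<Rightarrow> complex" and k
  proof (rule functional_annihilates_coefficients[where D = "{s. cmod s \<le> \<rho>}" and r = "\<lambda>i k s \<sigma>. r s \<sigma> i k"
        and ?c00.0 = "herm_prod e e" and ?c10.0 = "herm_prod y e" and ?c01.0 = "herm_prod e y" and ?c11.0 = "herm_prod y y"])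
    fix s \<sigma> assume "s \<in> {s. cmod s \<le> \<rho>}" "\<sigma> \<in> {s. cmod s \<le> \<rho>}"
    then have *: "herm_prod (\<phi> 0 s) (\<phi> 0 \<sigma>) = 1 \<and>
    (\<forall>k. herm_prod (\<phi> 0 s) (\<phi> (Suc k) \<sigma>) = - r s \<sigma> 0 k) \<and>
    (\<forall>k. herm_prod (\<phi> (Suc k) s) (\<phi> 0 \<sigma>) = - r s \<sigma> k 0) \<and>
    (\<forall>i k. herm_prod (\<phi> (Suc i) s) (\<phi> (Suc k) \<sigma>) =
       - (r s \<sigma> i (Suc k) + r s \<sigma> (Suc i) k + herm_prod (v s) (v \<sigma>) * r s \<sigma> i k))"
      using r by blast
    show "herm_prod (\<phi> 0 s) (\<phi> 0 \<sigma>) = 1" using * by blast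
    show "herm_prod (\<phi> 0 s) (\<phi> (Suc k) \<sigma>) = - r s \<sigma> 0 k" for k using * by blast
    show "herm_prod (\<phi> (Suc k) s) (\<phi> 0 \<sigma>) = - r s \<sigma> k 0" for k using * by blast
    show "herm_prod (\<phi> (Suc i) s) (\<phi> (Suc k) \<sigma>) = - (r s \<sigma> i (Suc k) + r s \<sigma> (Suc i) k +
        (herm_prod e e + herm_prod y e * s + herm_prod e y * cnj \<sigma> + herm_prod y y * s * cnj \<sigma>) * r s \<sigma> i k)" for i k
      unfolding vv [symmetric] using * by blast
  qed (use x w in auto)
  have "\<forall>k. \<exists>b. (\<forall>s. cmod s \<le> \<rho> \<longrightarrow> \<phi> k s = (\<Sum>j\<le>k. s ^ j *s b j)) \<and>
      (\<forall>j. norm (b j) \<le> real CARD('m) * M / (\<delta> / 2) ^ k / \<rho> ^ j)"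
  proof
    fix k
    have bd: "norm (\<phi> k s) \<le> real CARD('m) * M / (\<delta> / 2) ^ k" if "cmod s \<le> \<rho>" for s
      unfolding \<phi>_def by (rule taylor_vec_bound(1)[OF \<delta> U[OF vb[OF that]] M[OF vb[OF that]]])
    obtain b where "\<And>s. cmod s \<le> \<rho> \<Longrightarrow> \<phi> k s = (\<Sum>j\<le>k. s ^ j *s b j)"
      "\<And>j. norm (b j) \<le> real CARD('m) * M / (\<delta> / 2) ^ k / \<rho> ^ j"
      by (rule polynomial_if_annihilated[where \<phi> = "\<phi> k", OF \<rho> bd ann]) (assumption+, rule that)
    then show "\<exists>b. (\<forall>s. cmod s \<le> \<rho> \<longrightarrow> \<phi> k s = (\<Sum>j\<le>k. s ^ j *s b j)) \<and>
      (\<forall>j. norm (b j) \<le> real CARD('m) * M / (\<delta> / 2) ^ k / \<rho> ^ j)" by blast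
  qed
  then obtain b where b: "\<forall>k. (\<forall>s. cmod s \<le> \<rho> \<longrightarrow> \<phi> k s = (\<Sum>j\<le>k. s ^ j *s b k j)) \<and>
      (\<forall>j. norm (b k j) \<le> real CARD('m) * M / (\<delta> / 2) ^ k / \<rho> ^ j)"
    unfolding choice_iff by blast
  show ?thesis
  proof (rule that[of b])
    show "taylor_vec (U (e + s *s y)) k = (\<Sum>j\<le>k. s ^ j *s b k j)" if "cmod s \<le> \<rho>" for s k
      using b that by (simp add: \<phi>_def v_def)
    show "norm (b k j) \<le> real CARD('m) * M / ((\<delta> / 2) ^ k * \<rho> ^ j)" for k j
      using b by (simp add: divide_divide_eq_left)
  qed
qed

section \<open>Boundary regularity\<close>

text \<open>
  The point \<open>p + x e + x' y\<close> lies on the line with direction \<open>e + s y\<close> for \<open>s = x' / x\<close>, and there the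
  Taylor series turns into a power series \<open>F\<close> in \<open>x\<close> and \<open>x'\<close>.  So \<open>Q F = P\<close> holds when \<open>\<bar>s\<bar> \<le> \<rho>\<close>, and then on
  the whole disc by analytic continuation in \<open>x\<close>.  The constants do not depend on the slice.
\<close>
lemma boundary_slice_extension:
  fixes f :: "complex ^ 'n \<Rightarrow> complex ^ 'm" and p :: "complex ^ 'n"
  assumes f: "rational_proper_map f" and p: "norm p = 1"
  obtains e :: "complex ^ 'n" and E0 B :: "complex ^ 'm" and r \<rho> K :: real
  where "herm_prod e p = 1" "r > 0" "\<rho> > 0" "K \<ge> 0"
    "\<And>y x'. herm_prod y p = 0 \<Longrightarrow> norm y \<le> 1 \<Longrightarrow> cmod x' < \<rho> * r \<Longrightarrow>
      \<exists>F F'. (\<forall>x j. cmod x < r \<longrightarrow> ((\<lambda>x. F x $ j) has_field_derivative F' x $ j) (at x)) \<and>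
        (\<forall>x. cmod x < r \<longrightarrow> norm (p + x *s e + x' *s y) < 1 \<longrightarrow> f (p + x *s e + x' *s y) = F x) \<and>
        (\<forall>x \<epsilon>. cmod x < r \<longrightarrow> cmod x \<le> \<epsilon> \<longrightarrow> cmod x' \<le> \<rho> * \<epsilon> \<longrightarrow> \<epsilon> \<le> r \<longrightarrow>
          norm (F x - E0) \<le> K * \<epsilon> \<and> (\<forall>j. cmod (F' x $ j - B $ j) \<le> K * \<epsilon>))"
proof -
  obtain P Q where Q: "polyfun Q" "Q \<noteq> (\<lambda>z. 0)" and P: "\<And>j. polyfun (P j)"
    and QP: "\<And>z j. norm z < 1 \<Longrightarrow> Q z * f z $ j = P j z"
    by (rule rational_proper_map_fraction[OF f]) blast
  have le: "cmod (P j z) \<le> cmod (Q z)" if z: "norm z < 1" for z j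
  proof -
    have "cmod (f z $ j) \<le> 1"
      using Finite_Cartesian_Product.norm_nth_le[of "f z" j] rational_proper_map_norm[OF f z] by simp
    then have "cmod (Q z) * cmod (f z $ j) \<le> cmod (Q z) * 1" by (intro mult_left_mono) auto
    then show ?thesis using QP[OF z, of j] by (metis mult.right_neutral norm_mult)
  qed
  obtain m :: nat and e :: "complex ^ 'n" and \<rho> \<delta> M :: real and
    q :: "complex ^ 'n \<Rightarrow> complex \<Rightarrow> complex" and U :: "complex ^ 'n \<Rightarrow> complex \<Rightarrow> complex ^ 'm"
  where e: "herm_prod e p = 1" and \<rho>: "\<rho> > 0" and \<delta>: "\<delta> > 0"
    and q: "\<And>v t. v \<in> cball e \<rho> \<Longrightarrow> cmod t < \<delta> \<Longrightarrow> q v t \<noteq> 0"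
    and M: "\<And>v t. v \<in> cball e \<rho> \<Longrightarrow> cmod t < \<delta> \<Longrightarrow> norm (U v t) \<le> M"
    and Qt: "\<And>v t. v \<in> cball e \<rho> \<Longrightarrow> cmod t < \<delta> \<Longrightarrow> Q (p + t *s v) = t ^ m * q v t"
    and Pt: "\<And>v t j. v \<in> cball e \<rho> \<Longrightarrow> cmod t < \<delta> \<Longrightarrow> herm_prod v p = 1 \<Longrightarrow>
       P j (p + t *s v) = t ^ m * q v t * U v t $ j"
    and U: "\<And>v j. v \<in> cball e \<rho> \<Longrightarrow> (\<lambda>t. U v t $ j) holomorphic_on ball 0 \<delta>"
    by (rule line_normal_form[where P = P, OF Q P p le]) (assumption | rule that)+
  have refl: "(\<Sum>j\<in>UNIV. P j z * cnj (P j w)) = Q z * cnj (Q w)" if "herm_prod z w = 1" for z w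
    by (rule polarized_identity[where P = P, OF Q(1) P boundary_identity[where P = P, OF f Q(1) P QP] that])
  have M0: "M \<ge> 0" using order_trans[OF norm_ge_zero M[of e 0]] \<rho> \<delta> by auto
  define N where "N = real CARD('m) * M"
  have N0: "N \<ge> 0" using M0 by (simp add: N_def)
  define r0 where "r0 = \<delta> / 2"
  have r0: "r0 > 0" using \<delta> by (simp add: r0_def)
  define E0 where "E0 = taylor_vec (U e) 0"
  define B where "B = taylor_vec (U e) 1"
  define K where "K = real CARD('m) * (12 * N / r0) + 12 * N / r0\<^sup>2"
  have K1: "real CARD('m) * (12 * N / r0) \<le> K" "12 * N / r0\<^sup>2 \<le> K" "K \<ge> 0"
    using N0 r0 by (simp_all add: K_def)
  show ?thesis
  proof (rule that[of e "r0 / 4" \<rho> K E0 B])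
    fix y :: "complex ^ 'n" and x' assume y: "herm_prod y p = 0" "norm y \<le> 1" and x': "cmod x' < \<rho> * (r0 / 4)"
    obtain b where b: "\<And>s k. cmod s \<le> \<rho> \<Longrightarrow> taylor_vec (U (e + s *s y)) k = (\<Sum>j\<le>k. s ^ j *s b k j)"
      "\<And>k j. norm (b k j) \<le> real CARD('m) * M / ((\<delta> / 2) ^ k * \<rho> ^ j)"
      by (rule slice_coefficients[where P = P and q = q and U = U, OF p e \<rho> \<delta> q M Qt Pt U refl y]) (assumption | rule that)+
    have b00: "b 0 0 = E0" using b(1)[of 0 0] \<rho> by (simp add: E0_def)
    have b10: "b 1 0 = B" using b(1)[of 0 1] \<rho> by (simp add: B_def)
    have "\<forall>i. \<exists>F F'. (\<forall>x. cmod x < r0 / 4 \<longrightarrow> (\<lambda>k. \<Sum>j\<le>k. x ^ (k - j) * x' ^ j * b k j $ i) sums F x) \<and>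
      (\<forall>x. cmod x < r0 / 4 \<longrightarrow> (F has_field_derivative F' x) (at x)) \<and>
      (\<forall>x \<epsilon>. cmod x < r0 / 4 \<longrightarrow> cmod x \<le> \<epsilon> \<longrightarrow> cmod x' \<le> \<rho> * \<epsilon> \<longrightarrow> \<epsilon> \<le> r0 / 4 \<longrightarrow>
       cmod (F x - E0 $ i) \<le> 12 * N / r0 * \<epsilon> \<and> cmod (F' x - B $ i) \<le> 12 * N / r0\<^sup>2 * \<epsilon>)"
    proof
      fix i
      have bi: "cmod (b k j $ i) \<le> N / (r0 ^ k * \<rho> ^ j)" for k j
        using Finite_Cartesian_Product.norm_nth_le[of "b k j" i] b(2)[of k j] by (simp add: N_def r0_def)
      obtain F F' where
        "\<And>x. cmod x < r0 / 4 \<Longrightarrow> (\<lambda>k. \<Sum>j\<le>k. x ^ (k - j) * x' ^ j * b k j $ i) sums F x"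
        "\<And>x. cmod x < r0 / 4 \<Longrightarrow> (F has_field_derivative F' x) (at x)"
        "\<And>x \<epsilon>. cmod x < r0 / 4 \<Longrightarrow> cmod x \<le> \<epsilon> \<Longrightarrow> cmod x' \<le> \<rho> * \<epsilon> \<Longrightarrow> \<epsilon> \<le> r0 / 4 \<Longrightarrow>
           cmod (F x - b 0 0 $ i) \<le> 12 * N / r0 * \<epsilon>"
        "\<And>x \<epsilon>. cmod x < r0 / 4 \<Longrightarrow> cmod x \<le> \<epsilon> \<Longrightarrow> cmod x' \<le> \<rho> * \<epsilon> \<Longrightarrow> \<epsilon> \<le> r0 / 4 \<Longrightarrow>
           cmod (F' x - b 1 0 $ i) \<le> 12 * N / r0\<^sup>2 * \<epsilon>"
        by (rule bihomogeneous_series[where b = "\<lambda>k j. b k j $ i", OF r0 \<rho> N0 bi less_imp_le[OF x']]) (assumption | rule that)+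
      then show "\<exists>F F'. (\<forall>x. cmod x < r0 / 4 \<longrightarrow> (\<lambda>k. \<Sum>j\<le>k. x ^ (k - j) * x' ^ j * b k j $ i) sums F x) \<and>
        (\<forall>x. cmod x < r0 / 4 \<longrightarrow> (F has_field_derivative F' x) (at x)) \<and>
        (\<forall>x \<epsilon>. cmod x < r0 / 4 \<longrightarrow> cmod x \<le> \<epsilon> \<longrightarrow> cmod x' \<le> \<rho> * \<epsilon> \<longrightarrow> \<epsilon> \<le> r0 / 4 \<longrightarrow>
         cmod (F x - E0 $ i) \<le> 12 * N / r0 * \<epsilon> \<and> cmod (F' x - B $ i) \<le> 12 * N / r0\<^sup>2 * \<epsilon>)"
        unfolding b00 b10 by blast
    qed
    then obtain F F' where F: "\<forall>i. (\<forall>x. cmod x < r0 / 4 \<longrightarrow> (\<lambda>k. \<Sum>j\<le>k. x ^ (k - j) * x' ^ j * b k j $ i) sums F i x) \<and>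
      (\<forall>x. cmod x < r0 / 4 \<longrightarrow> (F i has_field_derivative F' i x) (at x)) \<and>
      (\<forall>x \<epsilon>. cmod x < r0 / 4 \<longrightarrow> cmod x \<le> \<epsilon> \<longrightarrow> cmod x' \<le> \<rho> * \<epsilon> \<longrightarrow> \<epsilon> \<le> r0 / 4 \<longrightarrow>
       cmod (F i x - E0 $ i) \<le> 12 * N / r0 * \<epsilon> \<and> cmod (F' i x - B $ i) \<le> 12 * N / r0\<^sup>2 * \<epsilon>)"
      unfolding choice_iff by blast
    define z where "z = (\<lambda>x. p + x *s e + x' *s y)"
    define A where "A = {x. cmod x' < \<rho> * cmod x} \<inter> ball 0 (r0 / 4)"
    have "open A" unfolding A_def by (intro open_Int open_Collect_less continuous_intros open_ball)
    have "A \<noteq> {}"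
    proof -
      obtain t where t: "cmod x' / \<rho> < t" "t < r0 / 4"
        using dense[of "cmod x' / \<rho>" "r0 / 4"] x' \<rho> by (auto simp: pos_divide_less_eq mult.commute)
      have "t \<ge> 0" using t(1) \<rho> by (meson divide_nonneg_pos norm_ge_zero order_trans less_imp_le)
      then have "of_real t \<in> A" using t \<rho> by (simp add: A_def pos_divide_less_eq mult.commute)
      then show ?thesis by blast
    qed
    \<comment> \<open>On \<open>A\<close> the slope \<open>s = x' / x\<close> is admissible for the line expansion.\<close>
    have on_A: "Q (z x) \<noteq> 0" "Q (z x) * F j x = P j (z x)" if x: "x \<in> A" for x j
    proof -
      have x0: "x \<noteq> 0" using x by (auto simp: A_def)
      define s where "s = x' / x"
      have s: "cmod s \<le> \<rho>" using x x0 by (simp add: s_def A_def norm_divide pos_divide_le_eq less_imp_le)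
      define v where "v = e + s *s y"
      have vb: "v \<in> cball e \<rho>"
        using mult_mono[of "cmod s" \<rho> "norm y" 1] s y(2) \<rho> by (simp add: v_def dist_norm norm_cmult_vec)
      have vp: "herm_prod v p = 1" by (simp add: v_def herm_prod_simps e y(1))
      have xr: "cmod x < r0 / 4" using x by (simp add: A_def)
      then have xd: "cmod x < \<delta>" "cmod x < \<delta> / 2" using \<delta> by (simp_all add: r0_def)
      have zx: "z x = p + x *s v" using x0 by (simp add: z_def v_def s_def vec_eq_iff algebra_simps)
      show "Q (z x) \<noteq> 0" unfolding zx Qt[OF vb xd(1)] using x0 q[OF vb xd(1)] by simp
      have "(\<lambda>k. taylor_vec (U v) k $ j * x ^ k) sums (U v x $ j)"
        by (rule taylor_vec_bound(2)[OF \<delta> U[OF vb] M[OF vb] xd(2)])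
      moreover have "taylor_vec (U v) k $ j * x ^ k = (\<Sum>i\<le>k. x ^ (k - i) * x' ^ i * b k i $ j)" for k
      proof -
        have "s ^ i * b k i $ j * x ^ k = x ^ (k - i) * x' ^ i * b k i $ j" if "i \<le> k" for i
        proof -
          have "x ^ k = x ^ (k - i) * x ^ i" using that by (simp flip: power_add)
          moreover have "s ^ i * x ^ i = x' ^ i" using x0 by (simp add: s_def flip: power_mult_distrib)
          ultimately show ?thesis by (metis (no_types, opaque_lifting) mult.assoc mult.commute)
        qed
        then show ?thesis
          unfolding v_def b(1)[OF s] sum_component vector_smult_component sum_distrib_right
            by (intro sum.cong) auto
      qed
      ultimately have "U v x $ j = F j x" using F xr by (metis (no_types, lifting) sums_cong sums_unique2)
      then show "Q (z x) * F j x = P j (z x)"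
        unfolding zx Qt[OF vb xd(1)] Pt[OF vb xd(1) vp] by simp
    qed
    have zl: "z x = (p + x' *s y) + x *s e" for x by (simp add: z_def add_ac)
    obtain L d where L: "\<And>v t. Q ((p + x' *s y) + t *s v) = poly (L v) t"
      by (rule polyfun_on_lines[OF Q(1), of "p + x' *s y"]) blast
    have Qz: "Q (z x) = poly (L e) x" for x unfolding zl by (rule L)
    have holP: "(\<lambda>x. P j (z x)) holomorphic_on ball 0 (r0 / 4)" for j
    proof -
      obtain L' d' where "\<And>v t. P j ((p + x' *s y) + t *s v) = poly (L' v) t"
        by (rule polyfun_on_lines[OF P[of j], of "p + x' *s y"]) blast
      then have "(\<lambda>x. P j (z x)) = poly (L' e)" unfolding zl by blast
      then show ?thesis by (simp add: holomorphic_intros)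
    qed
    have holF: "F j holomorphic_on ball 0 (r0 / 4)" for j
      using F by (intro holomorphic_onI) (auto simp: field_differentiable_def intro: has_field_derivative_at_within)
    have ext: "Q (z x) * F j x = P j (z x)" if x: "cmod x < r0 / 4" for x j
    proof -
      have "(\<lambda>x. Q (z x) * F j x) holomorphic_on ball 0 (r0 / 4)"
        unfolding Qz by (intro holomorphic_intros holF)
      from analytic_continuation_open[OF \<open>open A\<close> open_ball \<open>A \<noteq> {}\<close> connected_ball _ this holP on_A(2), of x]
      show ?thesis using x by (auto simp: A_def)
    qed
    \<comment> \<open>So \<open>Q\<close> has isolated zeros on the slice and \<open>f = F\<close> extends over them by continuity.\<close>
    have L0: "L e \<noteq> 0" using \<open>A \<noteq> {}\<close> on_A(1) Qz by force
    have fF: "f (z x) $ j = F j x" if x: "cmod x < r0 / 4" "norm (z x) < 1" for x j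
    proof -
      have "\<forall>\<^sub>F t in at x. t \<notin> {t. poly (L e) t = 0}"
        using islimpt_finite[OF poly_roots_finite[OF L0], of x] unfolding islimpt_iff_eventually by blast
      moreover have cz: "((\<lambda>t. z t) \<longlongrightarrow> z x) (at x)"
        unfolding z_def by (intro tendsto_intros)
      then have "\<forall>\<^sub>F t in at x. norm (z t) < 1"
        using order_tendstoD(2)[OF tendsto_norm[OF cz] x(2)] by simp
      moreover have "((\<lambda>t. cmod t) \<longlongrightarrow> cmod x) (at x)" by (intro tendsto_intros)
      then have "\<forall>\<^sub>F t in at x. cmod t < r0 / 4" using order_tendstoD(2) x(1) by blast
      ultimately have ev: "\<forall>\<^sub>F t in at x. F j t = f (z t) $ j"
      proof eventually_elim
        case (elim t)
        have "Q (z t) \<noteq> 0" using elim(1) Qz by simp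
        moreover have "Q (z t) * F j t = Q (z t) * f (z t) $ j"
          using ext[OF elim(3), of j] QP[OF elim(2), of j] by simp
        ultimately show ?case by simp
      qed
      have "continuous_on unit_ball f"
        using f continuous_on_holomorphic_map by (auto simp: rational_proper_map_def)
      then have "isCont f (z x)" using x(2) by (simp add: continuous_on_eq_continuous_at)
      then have "((\<lambda>t. f (z t)) \<longlongrightarrow> f (z x)) (at x)" by (rule isCont_tendsto_compose[OF _ cz])
      then have l1: "((\<lambda>t. f (z t) $ j) \<longlongrightarrow> f (z x) $ j) (at x)" by (rule tendsto_vec_nth)
      have "isCont (F j) x" using F x(1) DERIV_isCont by blast
      then have "(F j \<longlongrightarrow> F j x) (at x)" by (simp add: isCont_def)
      then have "((\<lambda>t. f (z t) $ j) \<longlongrightarrow> F j x) (at x)" using ev by (rule Lim_transform_eventually)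
      then show ?thesis using l1 tendsto_unique[OF trivial_limit_at] by blast
    qed
    define G where "G = (\<lambda>x. \<chi> j. F j x)"
    define G' where "G' = (\<lambda>x. \<chi> j. F' j x)"
    have "\<forall>x j. cmod x < r0 / 4 \<longrightarrow> ((\<lambda>x. G x $ j) has_field_derivative G' x $ j) (at x)"
      using F by (simp add: G_def G'_def)
    moreover have "\<forall>x. cmod x < r0 / 4 \<longrightarrow> norm (p + x *s e + x' *s y) < 1 \<longrightarrow> f (p + x *s e + x' *s y) = G x"
      using fF by (simp add: G_def vec_eq_iff z_def)
    moreover have "norm (G x - E0) \<le> K * \<epsilon> \<and> (\<forall>j. cmod (G' x $ j - B $ j) \<le> K * \<epsilon>)"
      if x: "cmod x < r0 / 4" "cmod x \<le> \<epsilon>" "cmod x' \<le> \<rho> * \<epsilon>" "\<epsilon> \<le> r0 / 4" for x \<epsilon>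
    proof -
      have \<epsilon>0: "\<epsilon> \<ge> 0" using x(2) norm_ge_zero order_trans by blast
      have b1: "cmod (F j x - E0 $ j) \<le> 12 * N / r0 * \<epsilon>" "cmod (F' j x - B $ j) \<le> 12 * N / r0\<^sup>2 * \<epsilon>" for j
        using F x by blast+
      have "norm (G x - E0) \<le> real CARD('m) * (12 * N / r0 * \<epsilon>)"
        by (rule norm_vec_le_card) (use b1(1) in \<open>simp add: G_def\<close>)
      also have "\<dots> = (real CARD('m) * (12 * N / r0)) * \<epsilon>" by simp
      also have "\<dots> \<le> K * \<epsilon>" by (rule mult_right_mono[OF K1(1) \<epsilon>0])
      finally have "norm (G x - E0) \<le> K * \<epsilon>" .
      moreover have "cmod (G' x $ j - B $ j) \<le> K * \<epsilon>" for j
        using order_trans[OF b1(2)[of j] mult_right_mono[OF K1(2) \<epsilon>0]] by (simp add: G'_def)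
      ultimately show ?thesis by blast
    qed
    ultimately show "\<exists>F F'. (\<forall>x j. cmod x < r0 / 4 \<longrightarrow> ((\<lambda>x. F x $ j) has_field_derivative F' x $ j) (at x)) \<and>
        (\<forall>x. cmod x < r0 / 4 \<longrightarrow> norm (p + x *s e + x' *s y) < 1 \<longrightarrow> f (p + x *s e + x' *s y) = F x) \<and>
        (\<forall>x \<epsilon>. cmod x < r0 / 4 \<longrightarrow> cmod x \<le> \<epsilon> \<longrightarrow> cmod x' \<le> \<rho> * \<epsilon> \<longrightarrow> \<epsilon> \<le> r0 / 4 \<longrightarrow>
          norm (F x - E0) \<le> K * \<epsilon> \<and> (\<forall>j. cmod (F' x $ j - B $ j) \<le> K * \<epsilon>))"
      by blast
  qed (use e r0 \<rho> K1(3) in auto)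
qed

text \<open>
  The intermediate value theorem for \<open>\<bar>z + t e\<bar>\<^sup>2\<close>.  The condition on \<open>e\<close> says that \<open>e\<close> points outwards
  at \<open>z\<close>, so the sphere is reached within a time comparable to \<open>1 - \<bar>z\<bar>\<^sup>2\<close>.
\<close>
lemma push_to_sphere:
  fixes z e :: "complex ^ 'n"
  assumes z: "norm z < 1" and e: "inner z e \<ge> 1 / 2"
  obtains \<tau> where "0 < \<tau>" "\<tau> \<le> 1 - (norm z)\<^sup>2" "norm (z + \<tau> *\<^sub>R e) = 1"
    "1 - (norm z)\<^sup>2 = \<tau> * (2 * inner z e + \<tau> * (norm e)\<^sup>2)"
    "\<And>t. 0 \<le> t \<Longrightarrow> t < \<tau> \<Longrightarrow> norm (z + t *\<^sub>R e) < 1"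
proof -
  define D where "D = 1 - (norm z)\<^sup>2"
  have D0: "D > 0" using one_minus_norm_square_pos[OF z] by (simp add: D_def)
  have sq: "(norm (z + t *\<^sub>R e))\<^sup>2 = (norm z)\<^sup>2 + t * (2 * inner z e + t * (norm e)\<^sup>2)" for t
    by (simp add: power2_norm_eq_inner inner_add_left inner_add_right inner_commute algebra_simps)
  have "D * 1 \<le> D * (2 * inner z e + D * (norm e)\<^sup>2)"
    using e D0 by (intro mult_left_mono add_increasing2) auto
  then have "1 \<le> (norm (z + D *\<^sub>R e))\<^sup>2" by (simp add: sq D_def)
  then have "1 \<le> norm (z + D *\<^sub>R e)" by (meson norm_ge_zero not_le power_less_one_iff zero_less_numeral)
  moreover have "continuous_on {0..D} (\<lambda>t. norm (z + t *\<^sub>R e))" by (intro continuous_intros)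
  ultimately obtain \<tau> where \<tau>: "0 \<le> \<tau>" "\<tau> \<le> D" "norm (z + \<tau> *\<^sub>R e) = 1"
    using IVT'[of "\<lambda>t. norm (z + t *\<^sub>R e)" 0 1 D] z D0 by auto
  have "\<tau> \<noteq> 0" using \<tau>(3) z by auto
  then have pos: "\<tau> > 0" using \<tau>(1) by simp
  show ?thesis
  proof (rule that[OF pos])
    show "1 - (norm z)\<^sup>2 = \<tau> * (2 * inner z e + \<tau> * (norm e)\<^sup>2)" using sq[of \<tau>] \<tau>(3) by simp
    fix t assume t: "0 \<le> t" "t < \<tau>"
    define u where "u = t / \<tau>"
    have u: "0 \<le> u" "u < 1" using t pos by (simp_all add: u_def)
    have "z + t *\<^sub>R e = (1 - u) *\<^sub>R z + u *\<^sub>R (z + \<tau> *\<^sub>R e)"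
      using pos by (simp add: u_def algebra_simps)
    then have "norm (z + t *\<^sub>R e) \<le> (1 - u) * norm z + u * norm (z + \<tau> *\<^sub>R e)"
      using u norm_triangle_ineq[of "(1 - u) *\<^sub>R z" "u *\<^sub>R (z + \<tau> *\<^sub>R e)"] by simp
    also have "\<dots> < (1 - u) * 1 + u * 1"
      unfolding \<tau>(3) using u z by (intro add_less_le_mono mult_strict_left_mono) auto
    finally show "norm (z + t *\<^sub>R e) < 1" by simp
  qed (use \<tau> in \<open>auto simp: D_def\<close>)
qed

text \<open>
  Here \<open>\<tau>\<close> is the time at which the path from \<open>z\<close> in direction \<open>e\<close> reaches the sphere, and \<open>w\<close> is the
  limit of \<open>f\<close> there, which has norm 1 by properness.  The vectors \<open>E0\<close> and \<open>B\<close> are the value and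
  the derivative in direction \<open>e\<close> at \<open>p\<close> of the extensions of \<open>f\<close> along the slices.
\<close>
lemma boundary_chord:
  fixes f :: "complex ^ 'n \<Rightarrow> complex ^ 'm" and p :: "complex ^ 'n"
  assumes f: "rational_proper_map f" and p: "norm p = 1"
  obtains e :: "complex ^ 'n" and E0 B :: "complex ^ 'm" and d K :: real
  where "herm_prod e p = 1" "d > 0"
    "\<And>z. norm z < 1 \<Longrightarrow> dist z p < d \<Longrightarrow> \<exists>\<tau> w. 0 < \<tau> \<and> \<tau> \<le> 2 * dist z p \<and>
      1 - (norm z)\<^sup>2 = \<tau> * (2 * inner z e + \<tau> * (norm e)\<^sup>2) \<and> norm w = 1 \<and>
      norm (f z - E0) \<le> K * dist z p \<and> norm (w - E0) \<le> K * dist z p \<and>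
      norm (w - f z - \<tau> *\<^sub>R B) \<le> K * dist z p * \<tau>"
proof -
  obtain e :: "complex ^ 'n" and E0 B :: "complex ^ 'm" and r \<rho> K :: real
  where e: "herm_prod e p = 1" and r: "r > 0" and \<rho>: "\<rho> > 0" and K: "K \<ge> 0"
    and ext: "\<And>y x'. herm_prod y p = 0 \<Longrightarrow> norm y \<le> 1 \<Longrightarrow> cmod x' < \<rho> * r \<Longrightarrow>
      \<exists>F F'. (\<forall>x j. cmod x < r \<longrightarrow> ((\<lambda>x. F x $ j) has_field_derivative F' x $ j) (at x)) \<and>
        (\<forall>x. cmod x < r \<longrightarrow> norm (p + x *s e + x' *s y) < 1 \<longrightarrow> f (p + x *s e + x' *s y) = F x) \<and>
        (\<forall>x \<epsilon>. cmod x < r \<longrightarrow> cmod x \<le> \<epsilon> \<longrightarrow> cmod x' \<le> \<rho> * \<epsilon> \<longrightarrow> \<epsilon> \<le> r \<longrightarrow>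
          norm (F x - E0) \<le> K * \<epsilon> \<and> (\<forall>j. cmod (F' x $ j - B $ j) \<le> K * \<epsilon>))"
    by (rule boundary_slice_extension[OF f p]) (assumption | rule that)+
  \<comment> \<open>Chosen such that \<open>\<bar>x\<bar> + \<tau>\<close> and \<open>\<bar>x'\<bar> / \<rho>\<close> below are at most \<open>\<kappa>\<close> times the distance of \<open>z\<close> from \<open>p\<close>.\<close>
  define \<kappa> where "\<kappa> = 3 + (1 + norm e) / \<rho>"
  have \<kappa>: "\<kappa> \<ge> 3" "\<rho> * \<kappa> \<ge> 1 + norm e" "\<kappa> > 0"
  proof -
    have "(1 + norm e) / \<rho> \<ge> 0" using \<rho> by simp
    then show "\<kappa> \<ge> 3" "\<kappa> > 0" by (simp_all add: \<kappa>_def)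
    have "\<rho> * ((1 + norm e) / \<rho>) = 1 + norm e" using \<rho> by simp
    then show "\<rho> * \<kappa> \<ge> 1 + norm e" using \<rho> by (simp add: \<kappa>_def distrib_left del: times_divide_eq_right)
  qed
  define d where "d = min (r / (2 * \<kappa>)) (1 / (2 * (1 + norm e)))"
  define K2 where "K2 = real CARD('m) * (K * \<kappa>) + K * \<kappa>"
  have d0: "d > 0" using r \<kappa> by (simp add: d_def add_pos_nonneg)
  have ep: "inner p e = 1" using arg_cong[OF e, of Re] by (simp add: Re_herm_prod inner_commute)
  show ?thesis
  proof (rule that[of e d E0 K2 B])
    fix z :: "complex ^ 'n" assume z: "norm z < 1" and zd: "dist z p < d"
    have zp0: "dist z p \<ge> 0" by simp
    have zn: "norm (z - p) = dist z p" by (simp add: dist_norm)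
    have k1: "\<kappa> * dist z p < r"
    proof -
      have "dist z p < r / (2 * \<kappa>)" using zd by (simp add: d_def)
      then have "\<kappa> * dist z p \<le> r / 2" using \<kappa>(3) by (simp add: field_simps)
      then show ?thesis using r by simp
    qed
    have "\<bar>inner (z - p) e\<bar> \<le> 1 / 2"
    proof -
      have "\<bar>inner (z - p) e\<bar> \<le> dist z p * norm e" using Cauchy_Schwarz_ineq2[of "z - p" e] zn by simp
      also have "\<dots> \<le> dist z p * (1 + norm e)" by (intro mult_left_mono) auto
      also have "\<dots> \<le> 1 / 2"
      proof -
        have "dist z p < 1 / (2 * (1 + norm e))" using zd by (simp add: d_def)
        moreover have "1 + norm e > 0" by (simp add: add_pos_nonneg)
        ultimately show ?thesis by (simp add: field_simps)
      qed
      finally show ?thesis .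
    qed
    then have ze: "inner z e \<ge> 1 / 2" using ep unfolding inner_diff_left by linarith
    obtain \<tau> where \<tau>: "0 < \<tau>" "\<tau> \<le> 1 - (norm z)\<^sup>2" "norm (z + \<tau> *\<^sub>R e) = 1"
      "1 - (norm z)\<^sup>2 = \<tau> * (2 * inner z e + \<tau> * (norm e)\<^sup>2)"
      "\<And>t. 0 \<le> t \<Longrightarrow> t < \<tau> \<Longrightarrow> norm (z + t *\<^sub>R e) < 1"
      by (rule push_to_sphere[OF z ze]) (assumption | rule that)+
    have \<tau>d: "\<tau> \<le> 2 * dist z p"
    proof -
      have "1 - norm z \<le> dist z p" using norm_triangle_ineq3[of z p] p zn by simp
      then have "2 * (1 - norm z) \<le> 2 * dist z p" by simp
      moreover have "1 - (norm z)\<^sup>2 \<le> 2 * (1 - norm z)"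
        using zero_le_power2[of "1 - norm z"] by (simp add: power2_eq_square algebra_simps)
      ultimately show ?thesis using order_trans[OF \<tau>(2)] order_trans by blast
    qed
    \<comment> \<open>The point \<open>z\<close> is written as \<open>p + x *s e + x' *s y\<close> with \<open>y\<close> tangential.\<close>
    define x where "x = herm_prod (z - p) p"
    define w where "w = z - p - x *s e"
    define y where "y = (1 / norm w) *\<^sub>R w"
    define x' where "x' = complex_of_real (norm w)"
    have xn: "cmod x \<le> dist z p" using herm_prod_Cauchy_Schwarz[of "z - p" p] p zn by (simp add: x_def)
    have wn: "norm w \<le> (1 + norm e) * dist z p"
    proof -
      have "norm w \<le> dist z p + cmod x * norm e"
        using norm_triangle_ineq4[of "z - p" "x *s e"] zn by (simp add: w_def norm_cmult_vec)
      also have "\<dots> \<le> dist z p + dist z p * norm e" using xn by (intro add_left_mono mult_right_mono) auto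
      finally show ?thesis by (simp add: algebra_simps)
    qed
    have wp: "herm_prod w p = 0" by (simp add: w_def x_def herm_prod_diff_left herm_prod_cmult_left e)
    have xy: "x' *s y = w" by (cases "w = 0") (simp_all add: x'_def y_def flip: scaleR_vec_eq)
    have y: "herm_prod y p = 0" "norm y \<le> 1" by (simp_all add: y_def herm_prod_scaleR_left wp)
    have x'n: "cmod x' \<le> \<rho> * (\<kappa> * dist z p)"
    proof -
      have "(1 + norm e) * dist z p \<le> (\<rho> * \<kappa>) * dist z p" using \<kappa>(2) by (intro mult_right_mono) auto
      then show ?thesis using wn by (simp add: x'_def mult.assoc)
    qed
    have "\<rho> * (\<kappa> * dist z p) < \<rho> * r" using k1 \<rho> by simp
    then have x'r: "cmod x' < \<rho> * r" using x'n by linarith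
    have zt: "z + t *\<^sub>R e = p + (x + of_real t) *s e + x' *s y" for t
      unfolding xy by (simp add: w_def scaleR_vec_eq vec_eq_iff algebra_simps)
    obtain F F' where F: "\<And>x j. cmod x < r \<Longrightarrow> ((\<lambda>x. F x $ j) has_field_derivative F' x $ j) (at x)"
      "\<And>x. cmod x < r \<Longrightarrow> norm (p + x *s e + x' *s y) < 1 \<Longrightarrow> f (p + x *s e + x' *s y) = F x"
      "\<And>x \<epsilon>. cmod x < r \<Longrightarrow> cmod x \<le> \<epsilon> \<Longrightarrow> cmod x' \<le> \<rho> * \<epsilon> \<Longrightarrow> \<epsilon> \<le> r \<Longrightarrow>
          norm (F x - E0) \<le> K * \<epsilon> \<and> (\<forall>j. cmod (F' x $ j - B $ j) \<le> K * \<epsilon>)"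
      using ext[OF y x'r] by blast
    have xt: "cmod (x + of_real t) \<le> \<kappa> * dist z p" if "0 \<le> t" "t \<le> \<tau>" for t
    proof -
      have "cmod (x + of_real t) \<le> dist z p + 2 * dist z p"
        using norm_triangle_ineq[of x "of_real t"] xn that \<tau>d by simp
      also have "\<dots> \<le> \<kappa> * dist z p" using mult_right_mono[OF \<kappa>(1) zp0] by simp
      finally show ?thesis .
    qed
    have xtr: "cmod (x + of_real t) < r" if "0 \<le> t" "t \<le> \<tau>" for t
      using xt[OF that] k1 by linarith
    have fF: "f (z + t *\<^sub>R e) = F (x + of_real t)" if "0 \<le> t" "t < \<tau>" for t
      unfolding zt using F(2)[OF xtr, of t] \<tau>(5)[OF that] that by (simp add: zt)
    have Fb: "norm (F (x + of_real t) - E0) \<le> K * (\<kappa> * dist z p)"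
        "cmod (F' (x + of_real t) $ j - B $ j) \<le> K * (\<kappa> * dist z p)" if "0 \<le> t" "t \<le> \<tau>" for t j
      using F(3)[OF xtr[OF that] xt[OF that] x'n] k1 by auto
    have fz: "f z = F x" using fF[of 0] \<tau>(1) by simp
    define W where "W = F (x + of_real \<tau>)"
    have "norm W = 1"
    proof -
      let ?A = "at_left \<tau>"
      have ev: "\<forall>\<^sub>F t in ?A. 0 < t \<and> t < \<tau>" using eventually_at_left_real[OF \<tau>(1)] by simp
      have "((\<lambda>t. z + t *\<^sub>R e) \<longlongrightarrow> z + \<tau> *\<^sub>R e) ?A" by (intro tendsto_intros)
      from tendsto_norm[OF this] have "((\<lambda>t. norm (z + t *\<^sub>R e)) \<longlongrightarrow> 1) ?A" by (simp add: \<tau>(3))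
      moreover have "\<forall>\<^sub>F t in ?A. norm (z + t *\<^sub>R e) < 1" using ev by eventually_elim (simp add: \<tau>(5))
      ultimately have l1: "((\<lambda>t. norm (f (z + t *\<^sub>R e))) \<longlongrightarrow> 1) ?A"
        by (rule rational_proper_map_boundary[OF f, rotated])
      have "((\<lambda>t. F (x + of_real t)) \<longlongrightarrow> W) ?A"
      proof (rule vec_tendstoI)
        fix j
        have "isCont (\<lambda>x. F x $ j) (x + of_real \<tau>)"
          using DERIV_isCont[OF F(1)[OF xtr]] \<tau>(1) by simp
        moreover have "((\<lambda>t. x + of_real t) \<longlongrightarrow> x + of_real \<tau>) ?A" by (intro tendsto_intros)
        ultimately show "((\<lambda>t. F (x + of_real t) $ j) \<longlongrightarrow> W $ j) ?A"
          unfolding W_def by (rule isCont_tendsto_compose)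
      qed
      then have "((\<lambda>t. norm (F (x + of_real t))) \<longlongrightarrow> norm W) ?A" by (rule tendsto_norm)
      moreover have "\<forall>\<^sub>F t in ?A. norm (F (x + of_real t)) = norm (f (z + t *\<^sub>R e))"
        using ev by eventually_elim (simp add: fF)
      ultimately have "((\<lambda>t. norm (f (z + t *\<^sub>R e))) \<longlongrightarrow> norm W) ?A" by (rule Lim_transform_eventually)
      then show ?thesis using l1 tendsto_unique[OF trivial_limit_at_left_real] by blast
    qed
    moreover have "norm (W - f z - \<tau> *\<^sub>R B) \<le> K2 * dist z p * \<tau>"
    proof -
      have "cmod ((W - f z - \<tau> *\<^sub>R B) $ j) \<le> K * (\<kappa> * dist z p) * \<tau>" for j
      proof -
        let ?S = "closed_segment x (x + of_real \<tau>)"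
        have seg: "\<exists>t. 0 \<le> t \<and> t \<le> \<tau> \<and> \<xi> = x + of_real t" if \<xi>: "\<xi> \<in> ?S" for \<xi>
        proof -
          obtain u where u: "0 \<le> u" "u \<le> 1" "\<xi> = (1 - u) *\<^sub>R x + u *\<^sub>R (x + of_real \<tau>)"
            using \<xi> by (auto simp: in_segment)
          have "\<xi> = x + of_real (u * \<tau>)" unfolding u(3) by (simp add: scaleR_conv_of_real algebra_simps)
          moreover have "0 \<le> u * \<tau>" "u * \<tau> \<le> \<tau>" using u \<tau>(1) by (auto intro: mult_left_le_one_le)
          ultimately show ?thesis by blast
        qed
        have "cmod ((F (x + of_real \<tau>) $ j - (x + of_real \<tau>) * B $ j) - (F x $ j - x * B $ j)) \<le>
            K * (\<kappa> * dist z p) * cmod ((x + of_real \<tau>) - x)"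
        proof (rule field_differentiable_bound[of ?S])
          fix \<xi> assume "\<xi> \<in> ?S"
          then obtain t where t: "0 \<le> t" "t \<le> \<tau>" "\<xi> = x + of_real t" using seg by blast
          have "((\<lambda>x. F x $ j - x * B $ j) has_field_derivative F' \<xi> $ j - B $ j) (at \<xi>)"
            unfolding t(3) by (rule DERIV_diff[OF F(1)[OF xtr[OF t(1,2)]]]) (auto intro!: derivative_eq_intros)
          then show "((\<lambda>x. F x $ j - x * B $ j) has_field_derivative F' \<xi> $ j - B $ j) (at \<xi> within ?S)"
            by (rule has_field_derivative_at_within)
          show "cmod (F' \<xi> $ j - B $ j) \<le> K * (\<kappa> * dist z p)" unfolding t(3) by (rule Fb(2)[OF t(1,2)])
        qed auto
        then show ?thesis using \<tau>(1) by (simp add: W_def fz scaleR_conv_of_real[of \<tau> "B $ j"] algebra_simps)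
      qed
      then have "norm (W - f z - \<tau> *\<^sub>R B) \<le> real CARD('m) * (K * (\<kappa> * dist z p) * \<tau>)" by (rule norm_vec_le_card)
      also have "\<dots> = (real CARD('m) * (K * \<kappa>)) * (dist z p * \<tau>)" by simp
      also have "\<dots> \<le> K2 * (dist z p * \<tau>)"
        using K \<kappa>(3) \<tau>(1) by (intro mult_right_mono) (auto simp: K2_def)
      finally show ?thesis by simp
    qed
    moreover have K2: "K * (\<kappa> * dist z p) \<le> K2 * dist z p"
    proof -
      have "(K * \<kappa>) * dist z p \<le> K2 * dist z p"
        using K \<kappa>(3) by (intro mult_right_mono) (auto simp: K2_def)
      then show ?thesis by simp
    qed
    moreover have "norm (f z - E0) \<le> K2 * dist z p"
      using Fb(1)[of 0] \<tau>(1) K2 by (simp add: fz)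
    moreover have "norm (W - E0) \<le> K2 * dist z p"
      using Fb(1)[of \<tau>] \<tau>(1) K2 by (simp add: W_def)
    ultimately show "\<exists>\<tau> w. 0 < \<tau> \<and> \<tau> \<le> 2 * dist z p \<and>
      1 - (norm z)\<^sup>2 = \<tau> * (2 * inner z e + \<tau> * (norm e)\<^sup>2) \<and> norm w = 1 \<and>
      norm (f z - E0) \<le> K2 * dist z p \<and> norm (w - E0) \<le> K2 * dist z p \<and>
      norm (w - f z - \<tau> *\<^sub>R B) \<le> K2 * dist z p * \<tau>"
      using \<tau>(1,4) \<tau>d by blast
  qed (use e d0 in auto)
qed

text \<open>
  Both \<open>1 - \<bar>z\<bar>\<^sup>2\<close> and \<open>1 - \<bar>f z\<bar>\<^sup>2 = \<bar>w\<bar>\<^sup>2 - \<bar>f z\<bar>\<^sup>2\<close> are expanded to first order in \<open>\<tau>\<close>; the quotient tends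
  to the real part of \<open>\<langle>B, E0\<rangle>\<close>.
\<close>
theorem boundary_regularity:
  fixes f :: "complex ^ 'n \<Rightarrow> complex ^ 'm" and p :: "complex ^ 'n"
  assumes f: "rational_proper_map f" and p: "norm p = 1"
  obtains E0 L where "(f \<longlongrightarrow> E0) (at p within unit_ball)"
    "((\<lambda>z. (1 - (norm (f z))\<^sup>2) / (1 - (norm z)\<^sup>2)) \<longlongrightarrow> L) (at p within unit_ball)"
proof -
  obtain e :: "complex ^ 'n" and E0 B :: "complex ^ 'm" and d K :: real
  where e: "herm_prod e p = 1" and d: "d > 0"
    and ch0: "\<And>z. norm z < 1 \<Longrightarrow> dist z p < d \<Longrightarrow> \<exists>\<tau> w. 0 < \<tau> \<and> \<tau> \<le> 2 * dist z p \<and>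
      1 - (norm z)\<^sup>2 = \<tau> * (2 * inner z e + \<tau> * (norm e)\<^sup>2) \<and> norm w = 1 \<and>
      norm (f z - E0) \<le> K * dist z p \<and> norm (w - E0) \<le> K * dist z p \<and>
      norm (w - f z - \<tau> *\<^sub>R B) \<le> K * dist z p * \<tau>"
    by (rule boundary_chord[OF f p]) (assumption | rule that)+
  have "\<forall>z. \<exists>\<tau> w. norm z < 1 \<longrightarrow> dist z p < d \<longrightarrow> 0 < \<tau> \<and> \<tau> \<le> 2 * dist z p \<and>
      1 - (norm z)\<^sup>2 = \<tau> * (2 * inner z e + \<tau> * (norm e)\<^sup>2) \<and> norm w = 1 \<and>
      norm (f z - E0) \<le> K * dist z p \<and> norm (w - E0) \<le> K * dist z p \<and>
      norm (w - f z - \<tau> *\<^sub>R B) \<le> K * dist z p * \<tau>"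
    using ch0 by blast
  then obtain \<tau> w where ch: "\<forall>z. norm z < 1 \<longrightarrow> dist z p < d \<longrightarrow> 0 < \<tau> z \<and> \<tau> z \<le> 2 * dist z p \<and>
      1 - (norm z)\<^sup>2 = \<tau> z * (2 * inner z e + \<tau> z * (norm e)\<^sup>2) \<and> norm (w z) = 1 \<and>
      norm (f z - E0) \<le> K * dist z p \<and> norm (w z - E0) \<le> K * dist z p \<and>
      norm (w z - f z - \<tau> z *\<^sub>R B) \<le> K * dist z p * \<tau> z"
    unfolding choice_iff by blast
  let ?A = "at p within unit_ball"
  have ep: "inner p e = 1" using arg_cong[OF e, of Re] by (simp add: Re_herm_prod inner_commute)
  have ev: "\<forall>\<^sub>F z in ?A. norm z < 1 \<and> dist z p < d"
    unfolding eventually_at using d by (intro exI[of _ d]) auto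
  have "((\<lambda>z. dist z p) \<longlongrightarrow> dist p p) ?A" by (intro tendsto_intros)
  then have dz: "((\<lambda>z. dist z p) \<longlongrightarrow> 0) ?A" by simp
  from tendsto_mult_right_zero[OF dz] have Kd: "((\<lambda>z. K * dist z p) \<longlongrightarrow> 0) ?A" .
  have fE: "(f \<longlongrightarrow> E0) ?A"
  proof (rule Lim_null[THEN iffD2], rule Lim_null_comparison[OF _ Kd])
    show "\<forall>\<^sub>F z in ?A. norm (f z - E0) \<le> K * dist z p" using ev by eventually_elim (use ch in blast)
  qed
  have wE: "(w \<longlongrightarrow> E0) ?A"
  proof (rule Lim_null[THEN iffD2], rule Lim_null_comparison[OF _ Kd])
    show "\<forall>\<^sub>F z in ?A. norm (w z - E0) \<le> K * dist z p" using ev by eventually_elim (use ch in blast)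
  qed
  have \<tau>0: "(\<tau> \<longlongrightarrow> 0) ?A"
  proof (rule Lim_null_comparison[OF _ tendsto_mult_right_zero[OF dz]])
    show "\<forall>\<^sub>F z in ?A. norm (\<tau> z) \<le> 2 * dist z p"
      using ev by eventually_elim (use ch in \<open>simp add: abs_of_pos\<close>)
  qed
  define q where "q = (\<lambda>z. (1 / \<tau> z) *\<^sub>R (w z - f z))"
  have qB: "(q \<longlongrightarrow> B) ?A"
  proof (rule Lim_null[THEN iffD2], rule Lim_null_comparison[OF _ Kd])
    show "\<forall>\<^sub>F z in ?A. norm (q z - B) \<le> K * dist z p"
      using ev
    proof eventually_elim
      case (elim z)
      have t: "0 < \<tau> z" and b: "norm (w z - f z - \<tau> z *\<^sub>R B) \<le> K * dist z p * \<tau> z" using ch elim by blast+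
      have "q z - B = (1 / \<tau> z) *\<^sub>R (w z - f z - \<tau> z *\<^sub>R B)"
        using t by (simp add: q_def algebra_simps)
      then have "norm (q z - B) = norm (w z - f z - \<tau> z *\<^sub>R B) / \<tau> z" using t by simp
      then show ?case using b t by (simp add: pos_divide_le_eq)
    qed
  qed
  have den: "((\<lambda>z. 2 * inner z e + \<tau> z * (norm e)\<^sup>2) \<longlongrightarrow> 2 * inner p e + 0 * (norm e)\<^sup>2) ?A"
    by (intro tendsto_intros \<tau>0)
  have num: "((\<lambda>z. 2 * inner (q z) (w z) - \<tau> z * (norm (q z))\<^sup>2) \<longlongrightarrow> 2 * inner B E0 - 0 * (norm B)\<^sup>2) ?A"
    by (intro tendsto_intros \<tau>0 qB wE)
  have "((\<lambda>z. (2 * inner (q z) (w z) - \<tau> z * (norm (q z))\<^sup>2) / (2 * inner z e + \<tau> z * (norm e)\<^sup>2)) \<longlongrightarrow>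
      (2 * inner B E0 - 0 * (norm B)\<^sup>2) / (2 * inner p e + 0 * (norm e)\<^sup>2)) ?A"
    by (rule tendsto_divide[OF num den]) (simp add: ep)
  moreover have "\<forall>\<^sub>F z in ?A. (2 * inner (q z) (w z) - \<tau> z * (norm (q z))\<^sup>2) / (2 * inner z e + \<tau> z * (norm e)\<^sup>2) =
      (1 - (norm (f z))\<^sup>2) / (1 - (norm z)\<^sup>2)"
    using ev
  proof eventually_elim
    case (elim z)
    have t: "0 < \<tau> z" and D: "1 - (norm z)\<^sup>2 = \<tau> z * (2 * inner z e + \<tau> z * (norm e)\<^sup>2)" and w: "norm (w z) = 1"
      using ch elim by blast+
    have fq: "f z = w z - \<tau> z *\<^sub>R q z" using t by (simp add: q_def)
    have "(norm (f z))\<^sup>2 = (norm (w z))\<^sup>2 - \<tau> z * (2 * inner (q z) (w z) - \<tau> z * (norm (q z))\<^sup>2)"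
      unfolding fq by (simp add: power2_norm_eq_inner inner_diff_left inner_diff_right inner_commute algebra_simps)
    then have "1 - (norm (f z))\<^sup>2 = \<tau> z * (2 * inner (q z) (w z) - \<tau> z * (norm (q z))\<^sup>2)" using w by simp
    then show ?case unfolding D using t by simp
  qed
  ultimately show ?thesis by (intro that[OF fE]) (rule Lim_transform_eventually)
qed

section \<open>The Hermitian invariant group\<close>

text \<open>
  The involution of the target centred at \<open>f 0\<close> moves \<open>f 0\<close> to \<open>0\<close>.
\<close>
definition recentre :: "(complex ^ 'n \<Rightarrow> complex ^ 'm) \<Rightarrow> complex ^ 'n \<Rightarrow> complex ^ 'm"
  where "recentre f z = mob (f 0) (f z)"

lemma recentre_properties:
  fixes f :: "complex ^ 'n \<Rightarrow> complex ^ 'm"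
  assumes f: "rational_proper_map f"
  shows recentre_holomorphic: "holomorphic_map_on (recentre f) unit_ball"
    and recentre_0: "recentre f 0 = 0"
    and recentre_norm: "norm z < 1 \<Longrightarrow> norm (recentre f z) < 1"
    and mob_recentre: "norm z < 1 \<Longrightarrow> mob (f 0) (recentre f z) = f z"
proof -
  have f0: "norm (f 0) < 1" by (rule rational_proper_map_norm[OF f]) simp
  have fh: "holomorphic_map_on f unit_ball" "f ` unit_ball \<subseteq> unit_ball"
    using f by (auto simp: rational_proper_map_def)
  show "holomorphic_map_on (recentre f) unit_ball"
    unfolding recentre_def [abs_def] by (rule holomorphic_map_on_compose[OF fh(1) holomorphic_mob[OF f0] fh(2)])
  show "recentre f 0 = 0" by (simp add: recentre_def mob_self[OF f0])
  show "norm (recentre f z) < 1" if "norm z < 1"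
    unfolding recentre_def by (rule mob_in_ball[OF f0 rational_proper_map_norm[OF f that]])
  show "mob (f 0) (recentre f z) = f z" if "norm z < 1"
    unfolding recentre_def by (rule mob_mob[OF f0 rational_proper_map_norm[OF f that]])
qed

lemma subgroup_hermitian_invariant_group:
  fixes f :: "complex ^ 'n \<Rightarrow> complex ^ 'm"
  assumes f: "\<And>z. norm z < 1 \<Longrightarrow> norm (f z) < 1"
  shows "subgroup (hermitian_invariant_group f) ball_aut_group"
proof -
  let ?\<Gamma> = "hermitian_invariant_group f"
  let ?G = "ball_aut_group :: (complex ^ 'n \<Rightarrow> complex ^ 'n) monoid"
  let ?H = "ball_aut_group :: (complex ^ 'm \<Rightarrow> complex ^ 'm) monoid"
  interpret G: group ?G by (rule group_ball_aut_group)
  interpret H: group ?H by (rule group_ball_aut_group)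
  have oneG: "\<one>\<^bsub>?G\<^esub> \<in> ball_aut" using G.one_closed by (simp add: carrier_ball_aut_group)
  have oneH: "\<one>\<^bsub>?H\<^esub> \<in> ball_aut" using H.one_closed by (simp add: carrier_ball_aut_group)
  show ?thesis
  proof (rule G.subgroupI)
    show "?\<Gamma> \<subseteq> carrier ?G" by (auto simp: hermitian_invariant_group_def carrier_ball_aut_group)
    have "\<forall>z\<in>unit_ball. f (\<one>\<^bsub>?G\<^esub> z) = \<one>\<^bsub>?H\<^esub> (f z)"
      using f by (simp add: one_ball_aut_apply)
    then have "\<one>\<^bsub>?G\<^esub> \<in> ?\<Gamma>" using oneG oneH unfolding hermitian_invariant_group_def by blast
    then show "?\<Gamma> \<noteq> {}" by blast
  next
    fix \<gamma> assume "\<gamma> \<in> ?\<Gamma>"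
    then obtain \<psi> where \<gamma>: "\<gamma> \<in> ball_aut" and \<psi>: "\<psi> \<in> ball_aut" and eq: "\<And>z. norm z < 1 \<Longrightarrow> f (\<gamma> z) = \<psi> (f z)"
      unfolding hermitian_invariant_group_def by auto
    have "f ((inv\<^bsub>?G\<^esub> \<gamma>) z) = (inv\<^bsub>?H\<^esub> \<psi>) (f z)" if z: "norm z < 1" for z
    proof -
      have w: "norm ((inv\<^bsub>?G\<^esub> \<gamma>) z) < 1" by (rule ball_aut_norm[OF inv_ball_aut(1)[OF \<gamma>] z])
      have "f z = \<psi> (f ((inv\<^bsub>?G\<^esub> \<gamma>) z))" using eq[OF w] inv_ball_aut(3)[OF \<gamma> z] by simp
      then show ?thesis using inv_ball_aut(2)[OF \<psi> f[OF w]] by simp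
    qed
    then show "inv\<^bsub>?G\<^esub> \<gamma> \<in> ?\<Gamma>"
      using inv_ball_aut(1)[OF \<gamma>] inv_ball_aut(1)[OF \<psi>] unfolding hermitian_invariant_group_def by auto
  next
    fix \<gamma> \<gamma>' assume "\<gamma> \<in> ?\<Gamma>" "\<gamma>' \<in> ?\<Gamma>"
    then obtain \<psi> \<psi>' where \<gamma>: "\<gamma> \<in> ball_aut" "\<gamma>' \<in> ball_aut" and \<psi>: "\<psi> \<in> ball_aut" "\<psi>' \<in> ball_aut"
      and eq: "\<And>z. norm z < 1 \<Longrightarrow> f (\<gamma> z) = \<psi> (f z)" "\<And>z. norm z < 1 \<Longrightarrow> f (\<gamma>' z) = \<psi>' (f z)"
      unfolding hermitian_invariant_group_def by auto
    have "f ((\<gamma> \<otimes>\<^bsub>?G\<^esub> \<gamma>') z) = (\<psi> \<otimes>\<^bsub>?H\<^esub> \<psi>') (f z)" if z: "norm z < 1" for z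
      using z f ball_aut_norm[OF \<gamma>(2) z] by (simp add: mult_ball_aut_apply[OF \<gamma>] mult_ball_aut_apply[OF \<psi>] eq)
    then show "\<gamma> \<otimes>\<^bsub>?G\<^esub> \<gamma>' \<in> ?\<Gamma>"
      using mult_ball_aut_closed[OF \<gamma>] mult_ball_aut_closed[OF \<psi>] unfolding hermitian_invariant_group_def by auto
  qed
qed

lemma conjugate_by_mob:
  fixes \<psi> :: "complex ^ 'n \<Rightarrow> complex ^ 'n"
  assumes b: "norm b < 1" and \<psi>: "\<psi> \<in> ball_aut"
  obtains \<psi>' where "\<psi>' \<in> ball_aut" "\<And>x. norm x < 1 \<Longrightarrow> \<psi>' x = mob b (\<psi> (mob b x))"
proof -
  let ?\<beta> = "restrict (mob b) unit_ball"
  let ?G = "ball_aut_group :: (complex ^ 'n \<Rightarrow> complex ^ 'n) monoid"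
  have \<beta>: "?\<beta> \<in> ball_aut" by (rule mob_in_ball_aut[OF b])
  have \<psi>\<beta>: "\<psi> \<otimes>\<^bsub>?G\<^esub> ?\<beta> \<in> ball_aut" by (rule mult_ball_aut_closed[OF \<psi> \<beta>])
  show ?thesis
  proof (rule that)
    show "?\<beta> \<otimes>\<^bsub>?G\<^esub> (\<psi> \<otimes>\<^bsub>?G\<^esub> ?\<beta>) \<in> ball_aut" by (rule mult_ball_aut_closed[OF \<beta> \<psi>\<beta>])
    fix x :: "complex ^ 'n" assume x: "norm x < 1"
    have "norm (\<psi> (mob b x)) < 1" by (rule ball_aut_norm[OF \<psi> mob_in_ball[OF b x]])
    then show "(?\<beta> \<otimes>\<^bsub>?G\<^esub> (\<psi> \<otimes>\<^bsub>?G\<^esub> ?\<beta>)) x = mob b (\<psi> (mob b x))"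
      by (simp add: mult_ball_aut_apply[OF \<beta> \<psi>\<beta> x] mult_ball_aut_apply[OF \<psi> \<beta> x] x)
  qed
qed

text \<open>
  After recentring, the automorphism of the target maps \<open>0 = recentre f 0\<close> to \<open>recentre f (\<gamma> 0)\<close>, so its
  coordinates consist of this point and a unitary matrix.
\<close>
lemma hermitian_invariant_groupE:
  fixes f :: "complex ^ 'n \<Rightarrow> complex ^ 'm"
  assumes f: "rational_proper_map f" and \<gamma>: "\<gamma> \<in> hermitian_invariant_group f"
  obtains A V where "unitary_matrix A" "unitary_matrix V" "norm (\<gamma> 0) < 1" "\<gamma> = mobu (\<gamma> 0) A"
    "\<And>z. norm z < 1 \<Longrightarrow>
      recentre f (mob (\<gamma> 0) (A *v z)) = mob (recentre f (\<gamma> 0)) (V *v recentre f z)"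
proof -
  have f0: "norm (f 0) < 1" by (rule rational_proper_map_norm[OF f]) simp
  obtain \<psi> where \<gamma>B: "\<gamma> \<in> ball_aut" and \<psi>: "\<psi> \<in> ball_aut" and eq: "\<And>z. norm z < 1 \<Longrightarrow> f (\<gamma> z) = \<psi> (f z)"
    using \<gamma> unfolding hermitian_invariant_group_def by auto
  obtain \<psi>' where \<psi>': "\<psi>' \<in> ball_aut" "\<And>x. norm x < 1 \<Longrightarrow> \<psi>' x = mob (f 0) (\<psi> (mob (f 0) x))"
    by (rule conjugate_by_mob[OF f0 \<psi>]) (assumption | rule that)+
  have rel: "recentre f (\<gamma> z) = \<psi>' (recentre f z)" if z: "norm z < 1" for z
    using \<psi>'(2)[OF recentre_norm[OF f z]] unfolding mob_recentre[OF f z]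
    by (simp add: recentre_def[of f "\<gamma> z"] eq[OF z])
  have \<gamma>0: "norm (\<gamma> 0) < 1" by (rule ball_aut_norm[OF \<gamma>B]) simp
  obtain A where A: "unitary_matrix A" "\<gamma> = mobu (\<gamma> 0) A" by (rule ball_aut_decomp[OF \<gamma>B])
  obtain V where V: "unitary_matrix V" "\<psi>' = mobu (\<psi>' 0) V" by (rule ball_aut_decomp[OF \<psi>'(1)])
  have \<psi>0: "\<psi>' 0 = recentre f (\<gamma> 0)" using rel[of 0] by (simp add: recentre_0[OF f])
  show ?thesis
  proof (rule that[OF A(1) V(1) \<gamma>0 A(2)])
    fix z :: "complex ^ 'n" assume z: "norm z < 1"
    have "\<gamma> z = mob (\<gamma> 0) (A *v z)" using fun_cong[OF A(2), of z] mobu_apply[OF z] by (rule trans)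
    moreover have "\<psi>' (recentre f z) = mob (recentre f (\<gamma> 0)) (V *v recentre f z)"
      using fun_cong[OF V(2), of "recentre f z"] mobu_apply[OF recentre_norm[OF f z]] unfolding \<psi>0 by (rule trans)
    ultimately show "recentre f (mob (\<gamma> 0) (A *v z)) = mob (recentre f (\<gamma> 0)) (V *v recentre f z)"
      using rel[OF z] by simp
  qed
qed

lemma hermitian_invariant_groupI:
  fixes f :: "complex ^ 'n \<Rightarrow> complex ^ 'm"
  assumes f: "rational_proper_map f" and a: "norm a < 1" and A: "unitary_matrix A" and V: "unitary_matrix V"
    and rel: "\<And>z. norm z < 1 \<Longrightarrow> recentre f (mob a (A *v z)) = mob (recentre f a) (V *v recentre f z)"
  shows "mobu a A \<in> hermitian_invariant_group f"
proof -
  have f0: "norm (f 0) < 1" by (rule rational_proper_map_norm[OF f]) simp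
  have \<psi>: "mobu (recentre f a) V \<in> ball_aut" by (rule mobu_in_ball_aut[OF recentre_norm[OF f a] V])
  obtain \<psi>' where \<psi>': "\<psi>' \<in> ball_aut"
      "\<And>x. norm x < 1 \<Longrightarrow> \<psi>' x = mob (f 0) (mobu (recentre f a) V (mob (f 0) x))"
    by (rule conjugate_by_mob[OF f0 \<psi>]) (assumption | rule that)+
  have "f (mobu a A z) = \<psi>' (f z)" if z: "norm z < 1" for z
  proof -
    have w: "norm (mob a (A *v z)) < 1" by (rule mob_in_ball[OF a]) (simp add: unitary_norm[OF A] z)
    have "\<psi>' (f z) = mob (f 0) (mobu (recentre f a) V (recentre f z))"
      using \<psi>'(2)[OF rational_proper_map_norm[OF f z]] by (simp add: recentre_def)
    also have "\<dots> = mob (f 0) (recentre f (mob a (A *v z)))"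
      by (simp add: mobu_apply[OF recentre_norm[OF f z]] rel[OF z])
    also have "\<dots> = f (mobu a A z)" by (simp add: mob_recentre[OF f w] mobu_apply[OF z])
    finally show ?thesis by simp
  qed
  then show ?thesis
    using mobu_in_ball_aut[OF a A] \<psi>'(1) unfolding hermitian_invariant_group_def by auto
qed

text \<open>
  The group is the image of a closed set of triples \<open>(a, A, V)\<close> in a product of a closed ball of radius \<open>r\<close>
  with two unitary groups.
\<close>
lemma compactin_hermitian_invariant_group:
  fixes f :: "complex ^ 'n \<Rightarrow> complex ^ 'm"
  assumes f: "rational_proper_map f" and r: "r < 1"
    and bd: "\<And>\<gamma>. \<gamma> \<in> hermitian_invariant_group f \<Longrightarrow> norm (\<gamma> 0) \<le> r"
  shows "compactin ball_aut_topology (hermitian_invariant_group f)"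
proof -
  let ?g = "recentre f"
  define C :: "((complex ^ 'n) \<times> (complex ^ 'n ^ 'n) \<times> (complex ^ 'm ^ 'm)) set"
    where "C = cball 0 r \<times> {A. unitary_matrix A} \<times> {V. unitary_matrix V}"
  define Y where "Y = {y \<in> C. \<forall>z. norm z < 1 \<longrightarrow>
    ?g (mob (fst y) (fst (snd y) *v z)) = mob (?g (fst y)) (snd (snd y) *v ?g z)}"
  have "compact C" unfolding C_def by (intro compact_Times compact_cball compact_unitary)
  have Cfst: "norm (fst y) < 1" and CA: "unitary_matrix (fst (snd y))" and CV: "unitary_matrix (snd (snd y))"
    if "y \<in> C" for y using that r by (auto simp: C_def)
  have cg: "continuous_on unit_ball ?g" by (rule continuous_on_holomorphic_map[OF recentre_holomorphic[OF f]])
  have "closed {y \<in> C. ?g (mob (fst y) (fst (snd y) *v z)) - mob (?g (fst y)) (snd (snd y) *v ?g z) = 0}"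
    if z: "norm z < 1" for z
  proof (rule continuous_closed_preimage_constant[OF _ compact_imp_closed[OF \<open>compact C\<close>]])
    have Az: "norm (fst (snd y) *v z) < 1" if "y \<in> C" for y using z by (simp add: unitary_norm[OF CA[OF that]])
    have Vz: "norm (snd (snd y) *v ?g z) < 1" if "y \<in> C" for y
      using recentre_norm[OF f z] by (simp add: unitary_norm[OF CV[OF that]])
    have c1: "continuous_on C (\<lambda>y. mob (fst y) (fst (snd y) *v z))"
      by (rule continuous_on_mob) (use Cfst Az in \<open>auto intro!: continuous_intros\<close>)
    have c2: "continuous_on C (\<lambda>y. ?g (mob (fst y) (fst (snd y) *v z)))"
    proof (rule continuous_on_compose2[OF cg c1], rule image_subsetI)
      fix y assume "y \<in> C"
      then show "mob (fst y) (fst (snd y) *v z) \<in> unit_ball" using mob_in_ball[OF Cfst Az] by simp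
    qed
    have c3: "continuous_on C (\<lambda>y. ?g (fst y))"
      by (rule continuous_on_compose2[OF cg continuous_on_fst[OF continuous_on_id]]) (use Cfst in auto)
    have c4: "continuous_on C (\<lambda>y. mob (?g (fst y)) (snd (snd y) *v ?g z))"
      by (rule continuous_on_mob[OF c3]) (use recentre_norm[OF f Cfst] Vz in \<open>auto intro!: continuous_intros\<close>)
    show "continuous_on C (\<lambda>y. ?g (mob (fst y) (fst (snd y) *v z)) - mob (?g (fst y)) (snd (snd y) *v ?g z))"
      by (rule continuous_on_diff[OF c2 c4])
  qed
  then have "closed (\<Inter>z\<in>unit_ball. {y \<in> C. ?g (mob (fst y) (fst (snd y) *v z)) - mob (?g (fst y)) (snd (snd y) *v ?g z) = 0})"
    by (intro closed_INT ballI) simp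
  then have "compact (C \<inter> (\<Inter>z\<in>unit_ball. {y \<in> C. ?g (mob (fst y) (fst (snd y) *v z)) - mob (?g (fst y)) (snd (snd y) *v ?g z) = 0}))"
    by (rule compact_Int_closed[OF \<open>compact C\<close>])
  also have "C \<inter> (\<Inter>z\<in>unit_ball. {y \<in> C. ?g (mob (fst y) (fst (snd y) *v z)) - mob (?g (fst y)) (snd (snd y) *v ?g z) = 0}) = Y"
    by (auto simp: Y_def)
  finally have "compact ((\<lambda>y. (fst y, fst (snd y))) ` Y)"
    by (rule compact_continuous_image[rotated]) (intro continuous_intros)
  then have "compactin ball_aut_topology ((\<lambda>x. mobu (fst x) (snd x)) ` (\<lambda>y. (fst y, fst (snd y))) ` Y)"
    by (rule compactin_mobu_image) (use Cfst CA in \<open>auto simp: Y_def\<close>)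
  also have "(\<lambda>x. mobu (fst x) (snd x)) ` (\<lambda>y. (fst y, fst (snd y))) ` Y = hermitian_invariant_group f"
  proof (intro equalityI subsetI)
    fix \<gamma> assume "\<gamma> \<in> (\<lambda>x. mobu (fst x) (snd x)) ` (\<lambda>y. (fst y, fst (snd y))) ` Y"
    then obtain y where y: "y \<in> Y" "\<gamma> = mobu (fst y) (fst (snd y))" by auto
    then have yC: "y \<in> C" by (simp add: Y_def)
    show "\<gamma> \<in> hermitian_invariant_group f"
      unfolding y(2) by (rule hermitian_invariant_groupI[OF f Cfst[OF yC] CA[OF yC] CV[OF yC]])
        (use y(1) in \<open>simp add: Y_def\<close>)
  next
    fix \<gamma> assume \<gamma>: "\<gamma> \<in> hermitian_invariant_group f"
    obtain A V where AV: "unitary_matrix A" "unitary_matrix V" "norm (\<gamma> 0) < 1" "\<gamma> = mobu (\<gamma> 0) A"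
      "\<And>z. norm z < 1 \<Longrightarrow> ?g (mob (\<gamma> 0) (A *v z)) = mob (?g (\<gamma> 0)) (V *v ?g z)"
      by (rule hermitian_invariant_groupE[OF f \<gamma>]) (assumption | rule that)+
    have "(\<gamma> 0, A, V) \<in> Y" using AV bd[OF \<gamma>] by (simp add: Y_def C_def)
    then have "mobu (\<gamma> 0) A \<in> (\<lambda>x. mobu (fst x) (snd x)) ` (\<lambda>y. (fst y, fst (snd y))) ` Y"
      by (force simp: image_iff)
    then show "\<gamma> \<in> (\<lambda>x. mobu (fst x) (snd x)) ` (\<lambda>y. (fst y, fst (snd y))) ` Y"
      using AV(4) by (rule ssubst[rotated])
  qed
  finally show ?thesis .
qed

lemma geodesic_in_cong:
  assumes "open I" "\<And>t. t \<in> I \<Longrightarrow> c t = d t" "geodesic_in S g I c"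
  shows "geodesic_in S g I d"
proof -
  obtain c' c'' where c: "c ` I \<subseteq> S" "\<And>t. t \<in> I \<Longrightarrow> (c has_vector_derivative c' t) (at t)"
    "\<And>t. t \<in> I \<Longrightarrow> (c' has_vector_derivative c'' t) (at t)"
    "\<And>t w. t \<in> I \<Longrightarrow> g (c t) (c'' t) w + christoffel g (c t) (c' t) (c' t) w = 0"
    using assms(3) unfolding geodesic_in_def by blast
  have "(d has_vector_derivative c' t) (at t)" if "t \<in> I" for t
    by (rule has_vector_derivative_transform_within_open[OF c(2)[OF that] assms(1) that assms(2)])
  moreover have "d ` I \<subseteq> S" using c(1) assms(2) by auto
  moreover have "g (d t) (c'' t) w + christoffel g (d t) (c' t) (c' t) w = 0" if "t \<in> I" for t w
    using c(4)[OF that] assms(2)[OF that] by simp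
  ultimately show ?thesis unfolding geodesic_in_def using c(3) by blast
qed

lemma norm_preserving_imp_totally_geodesic:
  fixes f :: "complex ^ 'n \<Rightarrow> complex ^ 'm"
  assumes f: "rational_proper_map f" and n: "\<And>z. norm z < 1 \<Longrightarrow> norm (recentre f z) = norm z"
  shows "totally_geodesic_map unit_ball poincare_metric unit_ball poincare_metric f"
  unfolding totally_geodesic_map_def
proof (intro allI impI, elim conjE)
  fix I :: "real set" and c :: "real \<Rightarrow> complex ^ 'n" assume I: "open I" and c: "geodesic_in unit_ball poincare_metric I c"
  have f0: "norm (f 0) < 1" by (rule rational_proper_map_norm[OF f]) simp
  obtain D where D: "\<And>u v. D (u + v) = D u + D v" "\<And>c v. D (c *s v) = c *s D v"
    "\<And>v w. herm_prod (D v) (D w) = herm_prod v w" "\<And>z. norm z < 1 \<Longrightarrow> recentre f z = D z"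
    by (rule holomorphic_norm_preserving_imp_linear[OF recentre_holomorphic[OF f] n]) (assumption | rule that)+
  have "geodesic_in unit_ball poincare_metric I (\<lambda>t. mob (f 0) (D (c t)))"
    by (rule geodesic_mob[OF f0 I geodesic_linear_isometry[OF D(1,2,3) c]])
  moreover have "mob (f 0) (D (c t)) = (f \<circ> c) t" if "t \<in> I" for t
  proof -
    have "norm (c t) < 1" using c that by (auto simp: geodesic_in_def image_subset_iff)
    then show ?thesis using mob_recentre[OF f] D(4) by simp
  qed
  ultimately show "geodesic_in unit_ball poincare_metric I (f \<circ> c)" by (rule geodesic_in_cong[OF I, rotated])
qed

text \<open>
  Properness prevents the map from being constant on a diameter.
\<close>
lemma totally_geodesic_imp_recentre_norm:
  fixes f :: "complex ^ 'n \<Rightarrow> complex ^ 'm"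
  assumes f: "rational_proper_map f"
    and tg: "totally_geodesic_map unit_ball poincare_metric unit_ball poincare_metric f"
    and z: "norm z < 1"
  shows "norm (recentre f z) = norm z"
proof (rule totally_geodesic_imp_norm_preserving[OF recentre_holomorphic[OF f] recentre_0[OF f] recentre_norm[OF f] _ _ z])
  have f0: "norm (f 0) < 1" by (rule rational_proper_map_norm[OF f]) simp
  show "totally_geodesic_map unit_ball poincare_metric unit_ball poincare_metric (recentre f)"
    unfolding recentre_def [abs_def] by (rule totally_geodesic_mob_compose[OF f0 tg])
  fix v :: "complex ^ 'n" assume v: "norm v = 1"
  obtain \<rho> where \<rho>: "\<rho> < 1" "\<And>z. norm z < 1 \<Longrightarrow> norm (f z) \<le> norm (f 0) \<Longrightarrow> norm z \<le> \<rho>"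
    by (rule rational_proper_map_bound[OF f f0]) (assumption | rule that)+
  obtain x where x: "max \<rho> 0 < x" "x < 1" using dense[of "max \<rho> 0" 1] \<rho>(1) by auto
  show "\<exists>x. \<bar>x\<bar> < 1 \<and> recentre f (x *\<^sub>R v) \<noteq> 0"
  proof (intro exI conjI notI)
    show "\<bar>x\<bar> < 1" using x by simp
    assume g0: "recentre f (x *\<^sub>R v) = 0"
    have xv: "norm (x *\<^sub>R v) < 1" using x v by simp
    have "f (x *\<^sub>R v) = f 0" using mob_recentre[OF f xv] by (simp add: g0 mob_0)
    then have "norm (x *\<^sub>R v) \<le> \<rho>" using \<rho>(2)[OF xv] by simp
    then show False using x v by simp
  qed
qed

text \<open>
  A linear isometry \<open>D\<close> satisfies \<open>D (mob a z) = mob (D a) (D z)\<close>, so every involution belongs to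
  the group and the orbit of \<open>0\<close> is the whole ball.
\<close>
lemma norm_preserving_imp_not_compactin:
  fixes f :: "complex ^ 'n \<Rightarrow> complex ^ 'm"
  assumes f: "rational_proper_map f" and n: "\<And>z. norm z < 1 \<Longrightarrow> norm (recentre f z) = norm z"
  shows "\<not> compactin ball_aut_topology (hermitian_invariant_group f)"
proof
  assume "compactin ball_aut_topology (hermitian_invariant_group f)"
  then obtain r where r: "0 \<le> r" "r < 1" "\<And>\<gamma>. \<gamma> \<in> hermitian_invariant_group f \<Longrightarrow> norm (\<gamma> 0) \<le> r"
    by (rule compactin_ball_aut_bounded) (assumption | rule that)+
  obtain D where D: "\<And>u v. D (u + v) = D u + D v" "\<And>c v. D (c *s v) = c *s D v"
    "\<And>v w. herm_prod (D v) (D w) = herm_prod v w" "\<And>z. norm z < 1 \<Longrightarrow> recentre f z = D z"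
    by (rule holomorphic_norm_preserving_imp_linear[OF recentre_holomorphic[OF f] n]) (assumption | rule that)+
  have Dd: "D (u - v) = D u - D v" for u v using D(1)[of "u - v" v] by simp
  obtain a :: "complex ^ 'n" where a: "norm a = (1 + r) / 2"
    using vector_choose_size[of "(1 + r) / 2"] r(1) by auto
  have a1: "norm a < 1" using a r(2) by simp
  have nD: "norm (D a) = norm a" using n[OF a1] D(4)[OF a1] by simp
  have I: "unitary_matrix (mat 1 :: complex ^ 'k ^ 'k)" 
  proof -
    have "ctranspose (mat 1 :: complex ^ 'k ^ 'k) = mat 1" by (auto simp: ctranspose_def mat_def vec_eq_iff)
    then show ?thesis by (simp add: unitary_matrix_iff)
  qed
  have "mobu a (mat 1) \<in> hermitian_invariant_group f"
  proof (rule hermitian_invariant_groupI[OF f a1 I I])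
    fix z :: "complex ^ 'n" assume z: "norm z < 1"
    have "D (mob a z) = mob (D a) (D z)"
      unfolding mob_def by (simp add: D Dd nD)
    then show "recentre f (mob a (mat 1 *v z)) = mob (recentre f a) (mat 1 *v recentre f z)"
      using D(4)[OF z] D(4)[OF a1] D(4)[OF mob_in_ball[OF a1 z]] by simp
  qed
  from r(3)[OF this] have "norm a \<le> r" by (simp add: mobu_apply mob_0)
  then show False using a r(2) by simp
qed

section \<open>Unbounded orbits\<close>

lemma mob_boundary_centre:
  assumes "norm p = 1" "1 - herm_prod w p \<noteq> 0"
  shows "mob p w = p"
proof -
  have "mob p w = (1 / (1 - herm_prod w p)) *s ((1 - herm_prod w p) *s p)"
    using assms(1) by (simp add: mob_def vec_eq_iff algebra_simps)
  also have "\<dots> = p" using assms(2) by (simp only: vector_smult_assoc) simp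
  finally show ?thesis .
qed

lemma recentre_ratio_ge_1:
  assumes f: "rational_proper_map f" and z: "norm z < 1"
  shows "1 \<le> (1 - (norm (recentre f z))\<^sup>2) / (1 - (norm z)\<^sup>2)"
proof -
  have "norm (recentre f z) \<le> norm z"
    by (rule schwarz_ball[OF recentre_holomorphic[OF f] recentre_norm[OF f] recentre_0[OF f] z])
  then have "(norm (recentre f z))\<^sup>2 \<le> (norm z)\<^sup>2" by (intro power_mono) auto
  then show ?thesis using one_minus_norm_square_pos[OF z] by (simp add: pos_le_divide_eq)
qed

text \<open>
  The quotient for the recentred map differs from the one for \<open>f\<close> by a factor that is continuous up to
  the boundary.
\<close>
lemma recentre_boundary_regularity:
  fixes f :: "complex ^ 'n \<Rightarrow> complex ^ 'm" and p :: "complex ^ 'n"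
  assumes f: "rational_proper_map f" and p: "norm p = 1"
  obtains b L where "norm b = 1" "L \<ge> 1" "(recentre f \<longlongrightarrow> b) (at p within unit_ball)"
    "((\<lambda>z. (1 - (norm (recentre f z))\<^sup>2) / (1 - (norm z)\<^sup>2)) \<longlongrightarrow> L) (at p within unit_ball)"
proof -
  let ?A = "at p within unit_ball"
  have f0: "norm (f 0) < 1" by (rule rational_proper_map_norm[OF f]) simp
  obtain E0 L where E0: "(f \<longlongrightarrow> E0) ?A" and L: "((\<lambda>z. (1 - (norm (f z))\<^sup>2) / (1 - (norm z)\<^sup>2)) \<longlongrightarrow> L) ?A"
    by (rule boundary_regularity[OF f p])
  have nt: "?A \<noteq> bot" using p by (simp add: trivial_limit_within islimpt_ball)
  have ev: "\<forall>\<^sub>F z in ?A. norm z < 1" unfolding eventually_at by (intro exI[of _ 1]) auto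
  have "((\<lambda>z. norm z) \<longlongrightarrow> norm p) ?A" by (intro tendsto_intros)
  then have "((\<lambda>z. norm (f z)) \<longlongrightarrow> 1) ?A" using rational_proper_map_boundary[OF f ev] p by simp
  then have nE: "norm E0 = 1" using tendsto_unique[OF nt tendsto_norm[OF E0]] by simp
  have ne: "1 - herm_prod E0 (f 0) \<noteq> 0"
    using one_minus_herm_prod_nonzero[OF f0, of E0] nE cnj_herm_prod[of "f 0" E0] by (metis complex_cnj_one complex_cnj_diff complex_cnj_zero_iff order_refl)
  let ?L = "L * (1 - (norm (f 0))\<^sup>2) / (cmod (1 - herm_prod E0 (f 0)))\<^sup>2"
  have gb: "(recentre f \<longlongrightarrow> mob (f 0) E0) ?A"
    unfolding recentre_def [abs_def] by (rule tendsto_mob[OF tendsto_const E0 less_imp_le[OF f0] ne])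
  have "((\<lambda>z. (1 - (norm (f z))\<^sup>2) / (1 - (norm z)\<^sup>2) * (1 - (norm (f 0))\<^sup>2) / (cmod (1 - herm_prod (f z) (f 0)))\<^sup>2)
      \<longlongrightarrow> ?L) ?A"
    by (intro tendsto_intros L E0) (use ne in simp)
  moreover have "\<forall>\<^sub>F z in ?A. (1 - (norm (f z))\<^sup>2) / (1 - (norm z)\<^sup>2) * (1 - (norm (f 0))\<^sup>2) / (cmod (1 - herm_prod (f z) (f 0)))\<^sup>2 =
      (1 - (norm (recentre f z))\<^sup>2) / (1 - (norm z)\<^sup>2)"
    using ev
  proof eventually_elim
    case (elim z)
    have "1 - herm_prod (f z) (f 0) \<noteq> 0"
      by (rule one_minus_herm_prod_nonzero[OF rational_proper_map_norm[OF f elim] less_imp_le[OF f0]])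
    then show ?case unfolding recentre_def by (simp add: one_minus_norm_mob[OF f0] mult_ac)
  qed
  ultimately have Rg: "((\<lambda>z. (1 - (norm (recentre f z))\<^sup>2) / (1 - (norm z)\<^sup>2)) \<longlongrightarrow> ?L) ?A"
    by (rule Lim_transform_eventually)
  have "\<forall>\<^sub>F z in ?A. 1 \<le> (1 - (norm (recentre f z))\<^sup>2) / (1 - (norm z)\<^sup>2)"
    using ev by eventually_elim (rule recentre_ratio_ge_1[OF f])
  then have "1 \<le> ?L" using tendsto_lowerbound[OF Rg _ nt] by blast
  moreover have "norm (mob (f 0) E0) = 1"
  proof -
    have "1 - (norm (mob (f 0) E0))\<^sup>2 = 0" by (simp add: one_minus_norm_mob[OF f0 ne] nE)
    then have "(norm (mob (f 0) E0))\<^sup>2 = 1" by linarith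
    then show ?thesis by (simp add: power2_eq_1_iff) (use norm_ge_zero[of "mob (f 0) E0"] in linarith)
  qed
  ultimately show ?thesis using gb Rg by (intro that)
qed

text \<open>
  The sequences of points and unitary matrices are made convergent by passing to a subsequence.  The
  images of \<open>z\<close> converge to the same boundary point \<open>p\<close> as the images of \<open>0\<close>, so the boundary limit
  \<open>L\<close> cancels in the identity \<open>ratio\<close>.
\<close>
lemma unbounded_imp_norm_preserving:
  fixes f :: "complex ^ 'n \<Rightarrow> complex ^ 'm"
  assumes f: "rational_proper_map f"
    and ub: "\<And>r. r < 1 \<Longrightarrow> \<exists>\<gamma>\<in>hermitian_invariant_group f. r < norm (\<gamma> 0)"
    and z: "norm z < 1"
  shows "norm (recentre f z) = norm z"
proof -
  let ?g = "recentre f"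
  let ?R = "\<lambda>z. (1 - (norm (?g z))\<^sup>2) / (1 - (norm z)\<^sup>2)"
  have "\<forall>k. \<exists>a A V. unitary_matrix A \<and> unitary_matrix V \<and> norm a < 1 \<and> 1 - inverse (real (Suc k)) < norm a \<and>
     (\<forall>z. norm z < 1 \<longrightarrow> ?g (mob a (A *v z)) = mob (?g a) (V *v ?g z))"
  proof
    fix k
    obtain \<gamma> where \<gamma>: "\<gamma> \<in> hermitian_invariant_group f" "1 - inverse (real (Suc k)) < norm (\<gamma> 0)"
      using ub[of "1 - inverse (real (Suc k))"] by auto
    obtain A V where "unitary_matrix A" "unitary_matrix V" "norm (\<gamma> 0) < 1" "\<gamma> = mobu (\<gamma> 0) A"
      "\<And>z. norm z < 1 \<Longrightarrow> ?g (mob (\<gamma> 0) (A *v z)) = mob (?g (\<gamma> 0)) (V *v ?g z)"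
      by (rule hermitian_invariant_groupE[OF f \<gamma>(1)]) (assumption | rule that)+
    then show "\<exists>a A V. unitary_matrix A \<and> unitary_matrix V \<and> norm a < 1 \<and> 1 - inverse (real (Suc k)) < norm a \<and>
     (\<forall>z. norm z < 1 \<longrightarrow> ?g (mob a (A *v z)) = mob (?g a) (V *v ?g z))" using \<gamma>(2) by blast
  qed
  then obtain a A V where seq0: "\<forall>k. unitary_matrix (A k) \<and> unitary_matrix (V k) \<and> norm (a k) < 1 \<and>
     1 - inverse (real (Suc k)) < norm (a k) \<and>
     (\<forall>z. norm z < 1 \<longrightarrow> ?g (mob (a k) (A k *v z)) = mob (?g (a k)) (V k *v ?g z))"
    unfolding choice_iff by blast
  have "compact (cball (0 :: complex ^ 'n) 1 \<times> {A :: complex ^ 'n ^ 'n. unitary_matrix A} \<times> {V :: complex ^ 'm ^ 'm. unitary_matrix V})"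
    by (intro compact_Times compact_cball compact_unitary)
  moreover have "\<forall>k. (a k, A k, V k) \<in> cball 0 1 \<times> {A. unitary_matrix A} \<times> {V. unitary_matrix V}"
    using seq0 by (simp add: less_imp_le)
  ultimately obtain l s where l: "l \<in> cball 0 1 \<times> {A. unitary_matrix A} \<times> {V. unitary_matrix V}"
    "strict_mono (s :: nat \<Rightarrow> nat)" "((\<lambda>k. (a k, A k, V k)) \<circ> s) \<longlonglongrightarrow> l"
    unfolding compact_def by meson
  obtain p A0 V0 where l_eq: "l = (p, A0, V0)" by (cases l) auto
  define a' where "a' = a \<circ> s"
  define A' where "A' = A \<circ> s"
  define V' where "V' = V \<circ> s"
  have lim: "a' \<longlonglongrightarrow> p" "A' \<longlonglongrightarrow> A0" "V' \<longlonglongrightarrow> V0"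
    using tendsto_fst[OF l(3)] tendsto_fst[OF tendsto_snd[OF l(3)]] tendsto_snd[OF tendsto_snd[OF l(3)]]
    by (simp_all add: l_eq a'_def A'_def V'_def o_def)
  have A0: "unitary_matrix A0" and V0: "unitary_matrix V0" using l(1) by (simp_all add: l_eq)
  have A': "unitary_matrix (A' k)" and V': "unitary_matrix (V' k)" and a': "norm (a' k) < 1"
    and rel: "norm z < 1 \<Longrightarrow> ?g (mob (a' k) (A' k *v z)) = mob (?g (a' k)) (V' k *v ?g z)" for k z
    using seq0 by (simp_all add: a'_def A'_def V'_def)
  have p: "norm p = 1"
  proof -
    have "(\<lambda>k. norm (a k)) \<longlonglongrightarrow> 1"
    proof (rule tendsto_sandwich[of "\<lambda>k. 1 - inverse (real (Suc k))" _ _ "\<lambda>k. 1"])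
      show "(\<lambda>k. 1 - inverse (real (Suc k))) \<longlonglongrightarrow> 1"
        using tendsto_diff[OF tendsto_const LIMSEQ_inverse_real_of_nat, of 1] by simp
    qed (use seq0 in \<open>auto intro!: always_eventually less_imp_le\<close>)
    then have "((\<lambda>k. norm (a k)) \<circ> s) \<longlonglongrightarrow> 1" by (rule LIMSEQ_subseq_LIMSEQ[OF _ l(2)])
    then have "(\<lambda>k. norm (a' k)) \<longlonglongrightarrow> 1" by (simp add: a'_def o_def)
    then show ?thesis using LIMSEQ_unique[OF tendsto_norm[OF lim(1)]] by blast
  qed
  obtain b L where b: "norm b = 1" and L1: "L \<ge> 1" and gb: "(?g \<longlongrightarrow> b) (at p within unit_ball)"
    and RL: "(?R \<longlongrightarrow> L) (at p within unit_ball)"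
    by (rule recentre_boundary_regularity[OF f p])
  have within: "filterlim x (at p within unit_ball) sequentially"
    if "x \<longlonglongrightarrow> p" "\<And>k. norm (x k) < 1" for x
  proof -
    have "x k \<in> unit_ball \<and> x k \<noteq> p" for k using that(2)[of k] p by auto
    then show ?thesis unfolding filterlim_at using that(1) by simp
  qed
  have bk: "(\<lambda>k. ?g (a' k)) \<longlonglongrightarrow> b" by (rule filterlim_compose[OF gb within[OF lim(1) a']])
  have Rk: "(\<lambda>k. ?R (a' k)) \<longlonglongrightarrow> L" by (rule filterlim_compose[OF RL within[OF lim(1) a']])
  have ratio: "?R z * (cmod (1 - herm_prod (A0 *v z) p))\<^sup>2 = (cmod (1 - herm_prod (V0 *v ?g z) b))\<^sup>2"
    if z: "norm z < 1" for z
  proof -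
    have gz: "norm (?g z) < 1" by (rule recentre_norm[OF f z])
    have n1: "1 - herm_prod (A0 *v z) p \<noteq> 0"
      by (rule one_minus_herm_prod_nonzero) (simp_all add: unitary_norm[OF A0] z p)
    have n2: "1 - herm_prod (V0 *v ?g z) b \<noteq> 0"
      by (rule one_minus_herm_prod_nonzero) (simp_all add: unitary_norm[OF V0] gz b)
    have Az: "norm (A' k *v z) < 1" for k by (simp add: unitary_norm[OF A'] z)
    have Vz: "norm (V' k *v ?g z) < 1" for k by (simp add: unitary_norm[OF V'] gz)
    have "(\<lambda>k. mob (a' k) (A' k *v z)) \<longlonglongrightarrow> mob p (A0 *v z)"
      by (rule tendsto_mob[OF lim(1) tendsto_matrix_vector_mult[OF lim(2) tendsto_const]]) (use p n1 in auto)
    then have mp: "(\<lambda>k. mob (a' k) (A' k *v z)) \<longlonglongrightarrow> p" by (simp add: mob_boundary_centre[OF p n1])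
    have l1: "(\<lambda>k. ?R (mob (a' k) (A' k *v z))) \<longlonglongrightarrow> L"
      by (rule filterlim_compose[OF RL within[OF mp mob_in_ball[OF a' Az]]])
    have "(\<lambda>k. ?R (a' k) * ?R z * (cmod (1 - herm_prod (A' k *v z) (a' k)))\<^sup>2 /
        (cmod (1 - herm_prod (V' k *v ?g z) (?g (a' k))))\<^sup>2) \<longlonglongrightarrow>
      L * ?R z * (cmod (1 - herm_prod (A0 *v z) p))\<^sup>2 / (cmod (1 - herm_prod (V0 *v ?g z) b))\<^sup>2"
      by (intro tendsto_divide tendsto_mult tendsto_power tendsto_norm tendsto_diff tendsto_const Rk
          tendsto_herm_prod tendsto_matrix_vector_mult lim bk) (use n2 in simp)
    moreover have "?R (a' k) * ?R z * (cmod (1 - herm_prod (A' k *v z) (a' k)))\<^sup>2 /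
        (cmod (1 - herm_prod (V' k *v ?g z) (?g (a' k))))\<^sup>2 = ?R (mob (a' k) (A' k *v z))" for k
    proof -
      have m1: "1 - herm_prod (A' k *v z) (a' k) \<noteq> 0"
        by (rule one_minus_herm_prod_nonzero[OF Az less_imp_le[OF a']])
      have m2: "1 - herm_prod (V' k *v ?g z) (?g (a' k)) \<noteq> 0"
        by (rule one_minus_herm_prod_nonzero[OF Vz less_imp_le[OF recentre_norm[OF f a']]])
      have pos: "1 - (norm (a' k))\<^sup>2 \<noteq> 0" "1 - (norm z)\<^sup>2 \<noteq> 0"
        using one_minus_norm_square_pos[OF a', of k] one_minus_norm_square_pos[OF z] by auto
      show ?thesis
        unfolding rel[OF z] one_minus_norm_mob[OF a' m1] one_minus_norm_mob[OF recentre_norm[OF f a'] m2]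
          unitary_norm[OF A'] unitary_norm[OF V']
        using m1 m2 pos by (simp add: field_simps)
    qed
    ultimately have "(\<lambda>k. ?R (mob (a' k) (A' k *v z))) \<longlonglongrightarrow>
      L * ?R z * (cmod (1 - herm_prod (A0 *v z) p))\<^sup>2 / (cmod (1 - herm_prod (V0 *v ?g z) b))\<^sup>2" by simp
    from LIMSEQ_unique[OF this l1]
    have "L * (?R z * (cmod (1 - herm_prod (A0 *v z) p))\<^sup>2) = L * (cmod (1 - herm_prod (V0 *v ?g z) b))\<^sup>2"
      using n2 by (simp add: divide_eq_eq mult.assoc)
    moreover have "L \<noteq> 0" using L1 by simp
    ultimately show ?thesis by (rule iffD1[OF mult_left_cancel, rotated])
  qed
  show ?thesis
  proof (cases "z = 0")
    case True
    then show ?thesis by (simp add: recentre_0[OF f])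
  next
    case False
    define v where "v = (1 / norm z) *\<^sub>R z"
    have v: "norm v = 1" using False by (simp add: v_def)
    have zv: "of_real (norm z) *s v = z" using False by (simp add: v_def flip: scaleR_vec_eq)
    \<comment> \<open>The holomorphic quotient on the disc through \<open>z\<close> whose squared modulus is \<open>1 / ?R\<close>.\<close>
    define F where "F = (\<lambda>\<zeta>. (1 - \<zeta> * herm_prod (A0 *v v) p) / (1 - herm_prod (?g (\<zeta> *s v)) (ctranspose V0 *v b)))"
    have F_eq: "F \<zeta> = (1 - herm_prod (A0 *v (\<zeta> *s v)) p) / (1 - herm_prod (V0 *v ?g (\<zeta> *s v)) b)" for \<zeta>
      by (simp add: F_def herm_prod_matrix_left herm_prod_cmult_left vector_scalar_commute)
    have nz: "norm (\<zeta> *s v) < 1" if "\<zeta> \<in> ball 0 1" for \<zeta> using that v by (simp add: norm_cmult_vec)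
    have d0: "1 - herm_prod (V0 *v ?g (\<zeta> *s v)) b \<noteq> 0" if "\<zeta> \<in> ball 0 1" for \<zeta>
      by (rule one_minus_herm_prod_nonzero) (simp_all add: unitary_norm[OF V0] recentre_norm[OF f nz[OF that]] b)
    have hol: "F holomorphic_on ball 0 1"
      unfolding F_def
    proof (intro holomorphic_on_divide holomorphic_intros)
      show "(\<lambda>\<zeta>. herm_prod (?g (\<zeta> *s v)) (ctranspose V0 *v b)) holomorphic_on ball 0 1"
        by (rule holomorphic_on_herm_prod_disc[OF recentre_holomorphic[OF f]]) (simp add: v)
    qed (use d0 in \<open>simp add: herm_prod_matrix_left\<close>)
    have F0: "F 0 = 1" by (simp add: F_def recentre_0[OF f])
    have key: "?R (\<zeta> *s v) * (cmod (F \<zeta>))\<^sup>2 = 1" if "\<zeta> \<in> ball 0 1" for \<zeta>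
      using ratio[OF nz[OF that]] d0[OF that] by (simp add: F_eq norm_divide power_divide)
    have F1: "cmod (F \<zeta>) \<le> 1" if "\<zeta> \<in> ball 0 1" for \<zeta>
    proof -
      have "1 * (cmod (F \<zeta>))\<^sup>2 \<le> ?R (\<zeta> *s v) * (cmod (F \<zeta>))\<^sup>2"
        by (rule mult_right_mono[OF recentre_ratio_ge_1[OF f nz[OF that]]]) simp
      then have "(cmod (F \<zeta>))\<^sup>2 \<le> 1\<^sup>2" unfolding key[OF that] by simp
      then show ?thesis by (rule power2_le_imp_le) simp
    qed
    have "F constant_on ball 0 1"
      by (rule maximum_modulus_principle[OF hol open_ball connected_ball open_ball subset_refl, of 0]) (use F1 F0 in auto)
    moreover have zin: "of_real (norm z) \<in> ball (0 :: complex) 1" using z by simp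
    ultimately have Fz: "F (of_real (norm z)) = 1" using F0 unfolding constant_on_def by (metis centre_in_ball zero_less_one)
    have "?R z = 1" using key[OF zin] unfolding zv Fz by (simp only: norm_one power_one mult_1_right)
    then have "(norm (?g z))\<^sup>2 = (norm z)\<^sup>2" using one_minus_norm_square_pos[OF z] by (simp add: divide_eq_eq)
    then show ?thesis by (simp only: power2_eq_iff_nonneg norm_ge_zero)
  qed
qed

section \<open>Non-compact invariant groups and totally geodesic maps\<close>

theorem corollary3p2:
  fixes f :: "complex ^ 'n \<Rightarrow> complex ^ 'm"
  assumes "rational_proper_map f"
  shows "(\<not> compactin ball_aut_topology (hermitian_invariant_group f) \<longleftrightarrow>
            totally_geodesic_map unit_ball poincare_metric unit_ball poincare_metric f) \<and>
         (compactin ball_aut_topology (hermitian_invariant_group f) \<longrightarrow>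
            (\<exists>K. maximal_compact_subgroup K \<and> hermitian_invariant_group f \<subseteq> K \<and>
                 (\<exists>\<phi>\<in>carrier ball_aut_group.
                    K = (\<phi> <#\<^bsub>ball_aut_group\<^esub> unitary_group)
                          #>\<^bsub>ball_aut_group\<^esub> (inv\<^bsub>ball_aut_group\<^esub> \<phi>))))"
proof (intro conjI iffI impI)
  let ?\<Gamma> = "hermitian_invariant_group f"
  assume nc: "\<not> compactin ball_aut_topology ?\<Gamma>"
  have "\<exists>\<gamma>\<in>?\<Gamma>. r < norm (\<gamma> 0)" if "r < 1" for r
    using compactin_hermitian_invariant_group[OF assms that] nc by (meson not_le)
  then show "totally_geodesic_map unit_ball poincare_metric unit_ball poincare_metric f"
    using norm_preserving_imp_totally_geodesic[OF assms] unbounded_imp_norm_preserving[OF assms] by blast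
next
  assume "totally_geodesic_map unit_ball poincare_metric unit_ball poincare_metric f"
  then show "\<not> compactin ball_aut_topology (hermitian_invariant_group f)"
    using norm_preserving_imp_not_compactin[OF assms] totally_geodesic_imp_recentre_norm[OF assms] by blast
next
  let ?\<Gamma> = "hermitian_invariant_group f"
  assume c: "compactin ball_aut_topology ?\<Gamma>"
  have "subgroup ?\<Gamma> ball_aut_group"
    by (rule subgroup_hermitian_invariant_group) (rule rational_proper_map_norm[OF assms])
  then obtain p where p: "norm p < 1" "\<And>\<gamma>. \<gamma> \<in> ?\<Gamma> \<Longrightarrow> \<gamma> p = p"
    using compact_subgroup_fixes_point[OF _ c] by blast
  have "?\<Gamma> \<subseteq> ball_stabilizer p"
    using p(2) by (auto simp: ball_stabilizer_def hermitian_invariant_group_def)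
  moreover obtain \<phi> where "\<phi> \<in> carrier ball_aut_group"
    "ball_stabilizer p = (\<phi> <#\<^bsub>ball_aut_group\<^esub> unitary_group) #>\<^bsub>ball_aut_group\<^esub> (inv\<^bsub>ball_aut_group\<^esub> \<phi>)"
    by (rule ball_stabilizer_conjugate[OF p(1)])
  ultimately show "\<exists>K. maximal_compact_subgroup K \<and> ?\<Gamma> \<subseteq> K \<and> (\<exists>\<phi>\<in>carrier ball_aut_group.
      K = (\<phi> <#\<^bsub>ball_aut_group\<^esub> unitary_group) #>\<^bsub>ball_aut_group\<^esub> (inv\<^bsub>ball_aut_group\<^esub> \<phi>))"
    using maximal_compact_ball_stabilizer[OF p(1)] by blast
qed

end
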